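(* Let $\bar\chi:=D(A^* )\hat\otimes_\pi D(A^* )$. Let $F\colon[s,T]\times H\to\mathbb{R}$ be of class $C^{1,2}$ with $\partial_xF\in UC([s,T]\times H;D(A^* ))$. Let $\mathbb{X}$ be an $H$-valued process admitting a $\bar\chi$-finite quadratic variation. Suppose the following. (i) There exists a (c\`adl\`ag) bounded variation process $C\colon[s,T]\times\Omega\to H\hat\otimes_\pi H$ such that, for all $t\in[s,T]$ and $\phi\in\bar\chi$, $$C(t,\cdot)(\phi)=[\mathbb{X},\mathbb{X}]_{\bar\chi}(\phi)(t,\cdot)\qquad\text{a.s.}$$ (ii) For every continuous function $\Gamma\colon[s,T]\times H\to D(A^* )$ the forward integral $\int_s^t\langle\Gamma(r,\mathbb{X}(r)),d^-\mathbb{X}(r)\rangle$, $t\in[s,T]$, exists. Then $$F(t,\mathbb{X}(t))=F(s,\mathbb{X}(s))+\int_s^t\langle\partial_xF(r,\mathbb{X}(r)),d^-\mathbb{X}(r)\rangle+\frac12\int_s^t{}_{(H\hat\otimes_\pi H)^*}\langle\partial^2_{xx}F(r,\mathbb{X}(r)),dC(r)\rangle_{H\hat\otimes_\pi H}+\int_s^t\partial_rF(r,\mathbb{X}(r))\,dr .$$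
   Context: $(\Omega,\mathscr{F},\mathbb{P})$ is a complete probability space, $T>0$, $s\in[0,T)$. Processes are $\mathscr{B}([s,T])\otimes\mathscr{F}$-measurable maps; continuous processes and functions are extended by their value at $s$ for $t\le s$ and at $T$ for $t\ge T$. Ucp convergence is uniform convergence on $[s,T]$ in probability; $\mathscr{C}([s,T])$ is the space of real continuous processes with the ucp topology. $H$ is a real separable Hilbert space, $A\colon D(A)\subseteq H\to H$ the generator of a $C_0$-semigroup on $H$, $A^*$ its adjoint; $D(A^* )$ carries the graph norm and, via the Riesz identification $H\cong H^*$, is continuously embedded in $H^*$. $UC([s,T]\times H;D(A^* ))$ is the $F$-space of functions $G\colon[s,T]\times H\to D(A^* )$ that are uniformly continuous on each closed ball, with the topology of uniform convergence on closed balls. $F\in C^{1,2}([s,T]\times H)$ means that $F$ is continuously Fr\'echet differentiable and the second Fr\'echet derivative $\partial^2_{xx}F$ in $x$ exists everywhere and is continuous with values in the bounded bilinear forms on $H\times H$, which are identified with $(H\hat\otimes_\pi H)^*$; $\partial_rF$ is the time derivative. $H\hat\otimes_\pi H$ is the projective tensor product. A Chi-subspace of $(H\hat\otimes_\pi H)^*$ is a Banach space continuously embedded in it; $\bar\chi$ is a Chi-subspace via $a^*\otimes b^*\mapsto[(x,y)\mapsto\langle a^*,x\rangle\langle b^*,y\rangle]$. Elements of $H\hat\otimes_\pi H$ act on $\phi\in\bar\chi\subset(H\hat\otimes_\pi H)^*$ by duality; this is the meaning of $C(t,\cdot)(\phi)$. $\bar\chi$-quadratic variation. Let $J\colon H\hat\otimes_\pi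 H\to(H\hat\otimes_\pi H)^{**}$ be the canonical injection; $J(u)$ is viewed in $\bar\chi^*$ by restriction. $\mathbb{X}$ admits a $\bar\chi$-(finite) quadratic variation if: (H1) for every sequence $\epsilon_n\searrow0$ there is a subsequence $\epsilon_{n_k}$ with $\sup_k\int_s^T\frac{1}{\epsilon_{n_k}}|J((\mathbb{X}(r+\epsilon_{n_k})-\mathbb{X}(r))\otimes(\mathbb{X}(r+\epsilon_{n_k})-\mathbb{X}(r)))|_{\bar\chi^*}dr<\infty$ a.s.; (H2) with $[\mathbb{X},\mathbb{X}]^\epsilon_{\bar\chi}(\phi):=\int_s^\cdot\frac1\epsilon\,{}_{\bar\chi}\langle\phi,J((\mathbb{X}(r+\epsilon)-\mathbb{X}(r))\otimes(\mathbb{X}(r+\epsilon)-\mathbb{X}(r)))\rangle_{\bar\chi^*}dr$, (i) there is a map $[\mathbb{X},\mathbb{X}]_{\bar\chi}\colon\bar\chi\to\mathscr{C}([s,T])$ with $[\mathbb{X},\mathbb{X}]^\epsilon_{\bar\chi}(\phi)\to[\mathbb{X},\mathbb{X}]_{\bar\chi}(\phi)$ ucp as $\epsilon\to0^+$ for every $\phi\in\bar\chi$; (ii) there is a strongly measurable process $\widetilde{[\mathbb{X},\mathbb{X}]}_{\bar\chi}\colon\Omega\times[s,T]\to\bar\chi^*$ which a.s. is a (c\`adl\`ag) bounded variation process and satisfies $\widetilde{[\mathbb{X},\mathbb{X}]}_{\bar\chi}(\cdot,t)(\phi)=[\mathbb{X},\mathbb{X}]_{\bar\chi}(\phi)(\cdot,t)$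 a.s. for all $\phi\in\bar\chi$, $t\in[s,T]$. Forward integral: the integrator $\mathbb{X}$ being a continuous $H$-valued process and $\mathbb{Y}$ a Bochner integrable $H^*$-valued process, if for almost every $t\in[s,T]$ the limit $\int_s^t\langle\mathbb{Y}(r),d^-\mathbb{X}(r)\rangle:=\lim_{\epsilon\to0^+}\int_s^t\langle\mathbb{Y}(r),\frac{\mathbb{X}(r+\epsilon)-\mathbb{X}(r)}{\epsilon}\rangle dr$ exists in probability and the resulting process has a continuous version, this version is the forward integral. (In particular, $\mathbb{X}$ is continuous in the claim, as required for forward integrals with respect to it.) *)

theory Defs
  imports "HOL-Probability.Probability"
begin

section \<open>The projective tensor product\<close>

text \<open>
  A list \<open>[(a\<^sub>1, b\<^sub>1), \<dots>, (a\<^sub>n, b\<^sub>n)]\<close> stands for the formal sum of the pairs. The algebraic tensor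
  product is the quotient by the congruence generated by the bilinearity relations (scalar
  coefficients are absorbed in the first component).
\<close>

inductive tensor_eq ::
  "('a::real_vector \<times> 'b::real_vector) list \<Rightarrow> ('a \<times> 'b) list \<Rightarrow> bool" where
  refl: "tensor_eq u u"
| sym: "tensor_eq u v \<Longrightarrow> tensor_eq v u"
| trans: "tensor_eq u v \<Longrightarrow> tensor_eq v w \<Longrightarrow> tensor_eq u w"
| append: "tensor_eq u u' \<Longrightarrow> tensor_eq v v' \<Longrightarrow> tensor_eq (u @ v) (u' @ v')"
| commute: "tensor_eq (u @ v) (v @ u)"
| zero: "tensor_eq [(0, b)] []"
| add_left: "tensor_eq [(a + a', b)] [(a, b), (a', b)]"
| add_right: "tensor_eq [(a, b + b')] [(a, b), (a, b')]"
| scale: "tensor_eq [(c *\<^sub>R a, b)] [(a, c *\<^sub>R b)]"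

quotient_type (overloaded) ('a, 'b) alg_tensor =
  "('a::real_vector \<times> 'b::real_vector) list" / tensor_eq
  by (intro equivpI reflpI sympI transpI) (auto intro: tensor_eq.intros)

definition scale_list :: "real \<Rightarrow> ('a::real_vector \<times> 'b) list \<Rightarrow> ('a \<times> 'b) list" where
  "scale_list c = map (\<lambda>(a, b). (c *\<^sub>R a, b))"

lemma scale_list_simps [simp]:
  "scale_list c [] = []" "scale_list c ((a, b) # u) = (c *\<^sub>R a, b) # scale_list c u"
  "scale_list c (u @ v) = scale_list c u @ scale_list c v"
  by (auto simp: scale_list_def)

lemma tensor_eq_scale_list: "tensor_eq u v \<Longrightarrow> tensor_eq (scale_list c u) (scale_list c v)"
proof (induction rule: tensor_eq.induct)
  case (scale d a b)
  then show ?case using tensor_eq.scale[of d "c *\<^sub>R a" b] by (simp add: mult.commute)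
qed (auto intro: tensor_eq.intros simp: scaleR_add_right)

lemma tensor_eq_scale_add:
  "tensor_eq (scale_list (c + d) u) (scale_list c u @ scale_list d u)"
proof (induction u)
  case (Cons p u)
  obtain a b where p: "p = (a, b)" by (cases p)
  let ?C = "scale_list c u" and ?D = "scale_list d u"
  have "tensor_eq ([((c + d) *\<^sub>R a, b)] @ scale_list (c + d) u)
          (([(c *\<^sub>R a, b)] @ [(d *\<^sub>R a, b)]) @ (?C @ ?D))"
    using Cons tensor_eq.add_left[of "c *\<^sub>R a" "d *\<^sub>R a" b]
    by (intro tensor_eq.append) (auto simp: scaleR_add_left)
  moreover have "tensor_eq ([(c *\<^sub>R a, b)] @ (([(d *\<^sub>R a, b)] @ ?C) @ ?D))
      ([(c *\<^sub>R a, b)] @ ((?C @ [(d *\<^sub>R a, b)]) @ ?D))"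
    by (intro tensor_eq.append tensor_eq.refl tensor_eq.commute)
  ultimately show ?case by (auto simp: p intro: tensor_eq.trans)
qed (auto intro: tensor_eq.intros)

lemma tensor_eq_scale_0: "tensor_eq (scale_list 0 u) []"
proof (induction u)
  case (Cons p u)
  then show ?case using tensor_eq.append[OF tensor_eq.zero Cons] by (cases p) auto
qed (auto intro: tensor_eq.intros)

instantiation alg_tensor :: (real_vector, real_vector) real_vector
begin

lift_definition zero_alg_tensor :: "('a, 'b) alg_tensor" is "[]" .
lift_definition plus_alg_tensor ::
  "('a, 'b) alg_tensor \<Rightarrow> ('a, 'b) alg_tensor \<Rightarrow> ('a, 'b) alg_tensor" is "(@)"
  by (rule tensor_eq.append)
lift_definition scaleR_alg_tensor ::
  "real \<Rightarrow> ('a, 'b) alg_tensor \<Rightarrow> ('a, 'b) alg_tensor" is scale_list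
  by (rule tensor_eq_scale_list)
definition uminus_alg_tensor :: "('a, 'b) alg_tensor \<Rightarrow> ('a, 'b) alg_tensor" where
  "uminus_alg_tensor u = (-1) *\<^sub>R u"
definition minus_alg_tensor ::
  "('a, 'b) alg_tensor \<Rightarrow> ('a, 'b) alg_tensor \<Rightarrow> ('a, 'b) alg_tensor" where
  "minus_alg_tensor u v = u + (- v)"

instance
proof
  fix u v w :: "('a, 'b) alg_tensor" and c d :: real
  show "(u + v) + w = u + (v + w)" by transfer (simp add: tensor_eq.refl)
  show "u + v = v + u" by transfer (rule tensor_eq.commute)
  show "0 + u = u" by transfer (simp add: tensor_eq.refl)
  show scale_add: "(c + d) *\<^sub>R u = c *\<^sub>R u + d *\<^sub>R u" for c d by transfer (rule tensor_eq_scale_add)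
  show "c *\<^sub>R (u + v) = c *\<^sub>R u + c *\<^sub>R v" by transfer (simp add: tensor_eq.refl)
  show "c *\<^sub>R d *\<^sub>R u = (c * d) *\<^sub>R u"
    by transfer (auto simp: scale_list_def o_def case_prod_unfold intro: tensor_eq.refl)
  show one: "1 *\<^sub>R u = u" by transfer (auto simp: scale_list_def intro: tensor_eq.refl)
  show "- u + u = 0"
  proof -
    have "- u + u = (-1 + 1) *\<^sub>R u" unfolding uminus_alg_tensor_def scale_add by (simp add: one)
    also have "\<dots> = 0" by simp (transfer, rule tensor_eq_scale_0)
    finally show ?thesis .
  qed
  show "u - v = u + - v" by (rule minus_alg_tensor_def)
qed

end

lift_definition alg_elem :: "'a::real_vector \<Rightarrow> 'b::real_vector \<Rightarrow> ('a, 'b) alg_tensor"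
  is "\<lambda>a b. [(a, b)]" .

lemma alg_tensor_of_list: "abs_alg_tensor xs = (\<Sum>(a, b)\<leftarrow>xs. alg_elem a b)"
proof (induction xs)
  case Nil then show ?case by (simp add: zero_alg_tensor_def)
next
  case (Cons p xs)
  have "abs_alg_tensor (p # xs) = abs_alg_tensor [p] + abs_alg_tensor xs"
    by (simp add: plus_alg_tensor.abs_eq)
  then show ?case using Cons by (cases p) (simp add: alg_elem.abs_eq)
qed

lemma alg_tensor_list_exhaust:
  obtains xs where "u = (\<Sum>(a, b)\<leftarrow>xs. alg_elem a b)"
  by (metis alg_tensor_of_list Quotient3_abs_rep Quotient3_alg_tensor)

lemma alg_elem_add_left: "alg_elem (a + a') b = alg_elem a b + alg_elem a' b"
  by transfer (simp add: tensor_eq.add_left)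
lemma alg_elem_add_right: "alg_elem a (b + b') = alg_elem a b + alg_elem a b'"
  by transfer (simp add: tensor_eq.add_right)
lemma alg_elem_scale_left: "alg_elem (c *\<^sub>R a) b = c *\<^sub>R alg_elem a b"
  by transfer (simp add: tensor_eq.refl)
lemma alg_elem_scale_right: "alg_elem a (c *\<^sub>R b) = c *\<^sub>R alg_elem a b"
  by transfer (simp add: tensor_eq.sym tensor_eq.scale)

lemma alg_tensor_lift_ex:
  fixes f :: "'a::real_vector \<Rightarrow> 'b::real_vector \<Rightarrow> 'c::real_vector"
  assumes "\<And>b. linear (\<lambda>a. f a b)" "\<And>a. linear (f a)"
  shows "\<exists>g. linear g \<and> (\<forall>a b. g (alg_elem a b) = f a b)"
proof -
  interpret l: linear "\<lambda>a. f a b" for b by fact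
  interpret r: linear "f a" for a by fact
  define h where "h xs = (\<Sum>(a, b)\<leftarrow>xs. f a b)" for xs
  have h: "h xs = h ys" if "tensor_eq xs ys" for xs ys
    using that
    by induction (auto simp: h_def l.add r.add l.scaleR r.scaleR l.zero add.commute)
  define g where "g u = h (rep_alg_tensor u)" for u
  have g: "g (abs_alg_tensor xs) = h xs" for xs
    unfolding g_def by (rule h) (simp add: Quotient3_rep_abs[OF Quotient3_alg_tensor] tensor_eq.refl)
  have "g (u + v) = g u + g v" for u v
    by (induction u; induction v) (simp add: plus_alg_tensor.abs_eq g h_def)
  moreover have "g (c *\<^sub>R u) = c *\<^sub>R g u" for c u
  proof -
    obtain xs where u: "u = abs_alg_tensor xs"
      by (metis Quotient3_abs_rep Quotient3_alg_tensor)
    have "h (scale_list c xs) = c *\<^sub>R h xs"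
      by (induction xs) (auto simp: h_def l.scaleR scaleR_add_right)
    then show ?thesis by (simp add: u scaleR_alg_tensor.abs_eq g)
  qed
  ultimately have "linear g" by (intro linearI)
  moreover have "g (alg_elem a b) = f a b" for a b by (simp add: alg_elem.abs_eq g h_def)
  ultimately show ?thesis by blast
qed

definition proj_norm :: "('a::real_normed_vector, 'b::real_normed_vector) alg_tensor \<Rightarrow> real" where
  "proj_norm u = Inf {\<Sum>(a, b)\<leftarrow>xs. norm a * norm b | xs. u = (\<Sum>(a, b)\<leftarrow>xs. alg_elem a b)}"

lemma list_norm_nonneg: "0 \<le> (\<Sum>(a, b)\<leftarrow>xs. norm a * norm b)"
  by (induction xs) auto

lemma proj_norm_le:
  "u = (\<Sum>(a, b)\<leftarrow>xs. alg_elem a b) \<Longrightarrow> proj_norm u \<le> (\<Sum>(a, b)\<leftarrow>xs. norm a * norm b)"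
  unfolding proj_norm_def
  by (intro cInf_lower bdd_belowI[of _ 0]) (auto simp: list_norm_nonneg)

lemma proj_norm_less:
  assumes "proj_norm u < c"
  obtains xs where "u = (\<Sum>(a, b)\<leftarrow>xs. alg_elem a b)" "(\<Sum>(a, b)\<leftarrow>xs. norm a * norm b) < c"
proof -
  have "{\<Sum>(a, b)\<leftarrow>xs. norm a * norm b | xs. u = (\<Sum>(a, b)\<leftarrow>xs. alg_elem a b)} \<noteq> {}"
    using alg_tensor_list_exhaust[of u] by auto
  from cInf_lessD[OF this] show ?thesis using assms that unfolding proj_norm_def by auto
qed

lemma proj_norm_nonneg [simp]: "0 \<le> proj_norm u"
proof -
  have "\<not> proj_norm u < 0"
  proof
    assume "proj_norm u < 0"
    then obtain xs where "(\<Sum>(a, b)\<leftarrow>xs. norm (a::'a) * norm (b::'b)) < 0"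
      using proj_norm_less by metis
    then show False using list_norm_nonneg[of xs] by simp
  qed
  then show ?thesis by simp
qed

lemma proj_norm_0 [simp]: "proj_norm 0 = 0"
  by (rule order_antisym[OF _ proj_norm_nonneg]) (use proj_norm_le[of 0 "[]"] in simp)

lemma proj_norm_triangle: "proj_norm (u + v) \<le> proj_norm u + proj_norm v"
proof (rule field_le_epsilon)
  fix e :: real assume e: "e > 0"
  obtain xs where xs: "u = (\<Sum>(a, b)\<leftarrow>xs. alg_elem a b)"
    "(\<Sum>(a, b)\<leftarrow>xs. norm a * norm b) < proj_norm u + e / 2"
    using e by (metis half_gt_zero less_add_same_cancel1 proj_norm_less)
  obtain ys where ys: "v = (\<Sum>(a, b)\<leftarrow>ys. alg_elem a b)"
    "(\<Sum>(a, b)\<leftarrow>ys. norm a * norm b) < proj_norm v + e / 2"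
    using e by (metis half_gt_zero less_add_same_cancel1 proj_norm_less)
  have "proj_norm (u + v) \<le> (\<Sum>(a, b)\<leftarrow>xs @ ys. norm a * norm b)"
    by (rule proj_norm_le) (simp add: xs ys)
  then show "proj_norm (u + v) \<le> proj_norm u + proj_norm v + e" using xs ys by simp
qed

lemma proj_norm_scaleR_le: "proj_norm (c *\<^sub>R u) \<le> \<bar>c\<bar> * proj_norm u"
proof (rule field_le_epsilon)
  fix e :: real assume e: "e > 0"
  have "proj_norm u < proj_norm u + e / (\<bar>c\<bar> + 1)" using e by simp
  then obtain xs where xs: "u = (\<Sum>(a, b)\<leftarrow>xs. alg_elem a b)"
    "(\<Sum>(a, b)\<leftarrow>xs. norm a * norm b) < proj_norm u + e / (\<bar>c\<bar> + 1)"
    by (rule proj_norm_less)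
  have 1: "c *\<^sub>R (\<Sum>(a, b)\<leftarrow>xs. alg_elem a b) = (\<Sum>(a, b)\<leftarrow>scale_list c xs. alg_elem a b)" for xs
    by (induction xs) (auto simp: scaleR_add_right alg_elem_scale_left)
  have 2: "(\<Sum>(a, b)\<leftarrow>scale_list c xs. norm a * norm b) = \<bar>c\<bar> * (\<Sum>(a, b)\<leftarrow>xs. norm a * norm b)"
    for xs :: "('a \<times> 'b) list"
    by (induction xs) (auto simp: algebra_simps)
  have "proj_norm (c *\<^sub>R u) \<le> \<bar>c\<bar> * (\<Sum>(a, b)\<leftarrow>xs. norm a * norm b)"
    using proj_norm_le[of "c *\<^sub>R u" "scale_list c xs"] by (simp add: 1 2 xs(1))
  also have "\<dots> \<le> \<bar>c\<bar> * (proj_norm u + e / (\<bar>c\<bar> + 1))"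
    using xs by (intro mult_left_mono) auto
  also have "\<dots> \<le> \<bar>c\<bar> * proj_norm u + e"
    using e by (simp add: field_simps)
  finally show "proj_norm (c *\<^sub>R u) \<le> \<bar>c\<bar> * proj_norm u + e" .
qed

lemma proj_norm_scaleR [simp]: "proj_norm (c *\<^sub>R u) = \<bar>c\<bar> * proj_norm u"
proof (cases "c = 0")
  case False
  have "\<bar>c\<bar> * proj_norm u = \<bar>c\<bar> * proj_norm (inverse c *\<^sub>R (c *\<^sub>R u))" using False by simp
  also have "\<dots> \<le> \<bar>c\<bar> * (\<bar>inverse c\<bar> * proj_norm (c *\<^sub>R u))"
    by (intro mult_left_mono proj_norm_scaleR_le) auto
  also have "\<dots> = proj_norm (c *\<^sub>R u)" using False by (simp add: abs_inverse)
  finally show ?thesis using proj_norm_scaleR_le[of c u] by simp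
qed simp

lemma proj_norm_minus [simp]: "proj_norm (- u) = proj_norm u"
  using proj_norm_scaleR[of "-1" u] by simp

lemma proj_norm_minus_commute: "proj_norm (u - v) = proj_norm (v - u)"
  using proj_norm_minus[of "u - v"] by simp

lemma proj_norm_diff_triangle: "proj_norm (u - w) \<le> proj_norm (u - v) + proj_norm (v - w)"
  using proj_norm_triangle[of "u - v" "v - w"] by simp

lemma proj_norm_triangle2: "\<bar>proj_norm u - proj_norm v\<bar> \<le> proj_norm (u - v)"
  using proj_norm_triangle[of "u - v" v] proj_norm_triangle[of "v - u" u]
    proj_norm_minus_commute[of u v] by simp

lemma proj_norm_lift_le:
  fixes g :: "('a::real_normed_vector, 'b::real_normed_vector) alg_tensor \<Rightarrow> 'c::real_normed_vector"
  assumes "linear g" "\<And>a b. norm (g (alg_elem a b)) \<le> K * (norm a * norm b)" "0 \<le> K"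
  shows "norm (g u) \<le> K * proj_norm u"
proof (rule field_le_epsilon)
  fix e :: real assume e: "e > 0"
  have "proj_norm u < proj_norm u + e / (K + 1)" using e assms(3) by simp
  then obtain xs where xs: "u = (\<Sum>(a, b)\<leftarrow>xs. alg_elem a b)"
    "(\<Sum>(a, b)\<leftarrow>xs. norm a * norm b) < proj_norm u + e / (K + 1)"
    by (rule proj_norm_less)
  have "norm (g (\<Sum>(a, b)\<leftarrow>xs. alg_elem a b)) \<le> K * (\<Sum>(a, b)\<leftarrow>xs. norm a * norm b)" for xs
  proof (induction xs)
    case (Cons p xs)
    obtain a b where p: "p = (a, b)" by (cases p)
    have "norm (g (\<Sum>(a, b)\<leftarrow>p # xs. alg_elem a b)) \<le>
      norm (g (alg_elem a b)) + norm (g (\<Sum>(a, b)\<leftarrow>xs. alg_elem a b))"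
      by (simp add: p linear_add[OF assms(1)] norm_triangle_ineq)
    also have "\<dots> \<le> K * (norm a * norm b) + K * (\<Sum>(a, b)\<leftarrow>xs. norm a * norm b)"
      by (intro add_mono assms Cons)
    finally show ?case by (simp add: p distrib_left)
  qed (simp add: linear_0[OF assms(1)])
  also have "K * (\<Sum>(a, b)\<leftarrow>xs. norm a * norm b) \<le> K * (proj_norm u + e / (K + 1))"
    using xs assms by (intro mult_left_mono) auto
  also have "\<dots> \<le> K * proj_norm u + e"
    using e assms(3) by (simp add: field_simps)
  finally show "norm (g u) \<le> K * proj_norm u + e" by (simp add: xs(1))
qed


lemma LIMSEQ_proj_norm_diff_0_trans:
  assumes "(\<lambda>n. proj_norm (X n - Y n)) \<longlonglongrightarrow> 0" "(\<lambda>n. proj_norm (Y n - Z n)) \<longlonglongrightarrow> 0"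
  shows "(\<lambda>n. proj_norm (X n - Z n)) \<longlonglongrightarrow> 0"
proof (rule tendsto_sandwich[of "\<lambda>_. 0"])
  show "(\<lambda>n. proj_norm (X n - Y n) + proj_norm (Y n - Z n)) \<longlonglongrightarrow> 0"
    using tendsto_add[OF assms] by simp
qed (auto intro: always_eventually proj_norm_diff_triangle)

text \<open>
  The projective tensor product is the completion of \<^typ>\<open>('a, 'b) alg_tensor\<close> under \<^const>\<open>proj_norm\<close>:
  Cauchy sequences modulo null sequences.
\<close>

definition proj_Cauchy :: "(nat \<Rightarrow> ('a::real_normed_vector, 'b::real_normed_vector) alg_tensor) \<Rightarrow> bool"
  where "proj_Cauchy X \<longleftrightarrow> (\<forall>e>0. \<exists>N. \<forall>m\<ge>N. \<forall>n\<ge>N. proj_norm (X m - X n) < e)"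

definition proj_equiv ::
  "(nat \<Rightarrow> ('a::real_normed_vector, 'b::real_normed_vector) alg_tensor) \<Rightarrow> (nat \<Rightarrow> ('a, 'b) alg_tensor) \<Rightarrow> bool"
  where "proj_equiv X Y \<longleftrightarrow>
    proj_Cauchy X \<and> proj_Cauchy Y \<and> (\<lambda>n. proj_norm (X n - Y n)) \<longlonglongrightarrow> 0"

lemma proj_Cauchy_const [simp]: "proj_Cauchy (\<lambda>_. u)"
  by (auto simp: proj_Cauchy_def)

lemma proj_equiv_refl [simp]: "proj_equiv X X \<longleftrightarrow> proj_Cauchy X"
  by (simp add: proj_equiv_def)

quotient_type (overloaded) ('a, 'b) ptensor =
  "nat \<Rightarrow> ('a::real_normed_vector, 'b::real_normed_vector) alg_tensor" / partial: proj_equiv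
proof (rule part_equivpI)
  show "\<exists>X. proj_equiv X (X :: nat \<Rightarrow> ('a, 'b) alg_tensor)" by (rule exI[of _ "\<lambda>_. 0"]) simp
  show "symp (proj_equiv :: (nat \<Rightarrow> ('a, 'b) alg_tensor) \<Rightarrow> _)"
    by (auto intro!: sympI simp: proj_equiv_def proj_norm_minus_commute)
  show "transp (proj_equiv :: (nat \<Rightarrow> ('a, 'b) alg_tensor) \<Rightarrow> _)"
    by (intro transpI) (auto simp: proj_equiv_def intro: LIMSEQ_proj_norm_diff_0_trans)
qed

lemma proj_Cauchy_add:
  assumes "proj_Cauchy X" "proj_Cauchy Y"
  shows "proj_Cauchy (\<lambda>n. X n + Y n)"
  unfolding proj_Cauchy_def
proof (intro allI impI)
  fix e :: real assume "e > 0"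
  then have "e / 2 > 0" by simp
  then obtain N M where "\<forall>m\<ge>N. \<forall>n\<ge>N. proj_norm (X m - X n) < e / 2"
    "\<forall>m\<ge>M. \<forall>n\<ge>M. proj_norm (Y m - Y n) < e / 2"
    using assms unfolding proj_Cauchy_def by metis
  moreover have "proj_norm (X m + Y m - (X n + Y n)) \<le> proj_norm (X m - X n) + proj_norm (Y m - Y n)" for m n
    using proj_norm_triangle[of "X m - X n" "Y m - Y n"] by (simp add: algebra_simps)
  ultimately have "\<forall>m\<ge>max M N. \<forall>n\<ge>max M N. proj_norm (X m + Y m - (X n + Y n)) < e"
    by (smt (verit, best) field_sum_of_halves max.bounded_iff)
  then show "\<exists>N. \<forall>m\<ge>N. \<forall>n\<ge>N. proj_norm (X m + Y m - (X n + Y n)) < e" by blast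
qed

lemma proj_Cauchy_scaleR:
  assumes "proj_Cauchy X"
  shows "proj_Cauchy (\<lambda>n. c *\<^sub>R X n)"
proof (cases "c = 0")
  case False
  show ?thesis unfolding proj_Cauchy_def
  proof (intro allI impI)
    fix e :: real assume "e > 0"
    then have "e / \<bar>c\<bar> > 0" using False by simp
    then obtain N where "\<forall>m\<ge>N. \<forall>n\<ge>N. proj_norm (X m - X n) < e / \<bar>c\<bar>"
      using assms unfolding proj_Cauchy_def by metis
    moreover have "proj_norm (c *\<^sub>R X m - c *\<^sub>R X n) = \<bar>c\<bar> * proj_norm (X m - X n)" for m n
      by (simp flip: scaleR_diff_right)
    ultimately have "\<forall>m\<ge>N. \<forall>n\<ge>N. proj_norm (c *\<^sub>R X m - c *\<^sub>R X n) < e"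
      using False by (simp add: field_simps)
    then show "\<exists>N. \<forall>m\<ge>N. \<forall>n\<ge>N. proj_norm (c *\<^sub>R X m - c *\<^sub>R X n) < e" by blast
  qed
qed simp

lemma proj_equiv_add:
  assumes "proj_equiv X X'" "proj_equiv Y Y'"
  shows "proj_equiv (\<lambda>n. X n + Y n) (\<lambda>n. X' n + Y' n)"
  unfolding proj_equiv_def
proof (intro conjI proj_Cauchy_add[of X Y] proj_Cauchy_add[of X' Y'])
  show "(\<lambda>n. proj_norm (X n + Y n - (X' n + Y' n))) \<longlonglongrightarrow> 0"
  proof (rule tendsto_sandwich[of "\<lambda>_. 0"])
    show "(\<lambda>n. proj_norm (X n - X' n) + proj_norm (Y n - Y' n)) \<longlonglongrightarrow> 0"
      using tendsto_add[of "\<lambda>n. proj_norm (X n - X' n)" 0 sequentially "\<lambda>n. proj_norm (Y n - Y' n)" 0]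
        assms by (simp add: proj_equiv_def)
    have "proj_norm (X n + Y n - (X' n + Y' n)) \<le> proj_norm (X n - X' n) + proj_norm (Y n - Y' n)" for n
      using proj_norm_triangle[of "X n - X' n" "Y n - Y' n"] by (simp add: algebra_simps)
    then show "\<forall>\<^sub>F n in sequentially. proj_norm (X n + Y n - (X' n + Y' n))
        \<le> proj_norm (X n - X' n) + proj_norm (Y n - Y' n)" by simp
  qed auto
qed (use assms in \<open>simp_all add: proj_equiv_def\<close>)

lemma proj_equiv_scaleR:
  assumes "proj_equiv X X'"
  shows "proj_equiv (\<lambda>n. c *\<^sub>R X n) (\<lambda>n. c *\<^sub>R X' n)"
  using assms tendsto_mult_left[of "\<lambda>n. proj_norm (X n - X' n)" 0 sequentially "\<bar>c\<bar>"]
  by (auto simp: proj_equiv_def proj_Cauchy_scaleR simp flip: scaleR_diff_right)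

lemma proj_norm_LIMSEQ:
  assumes "proj_Cauchy X"
  shows "(\<lambda>n. proj_norm (X n)) \<longlonglongrightarrow> lim (\<lambda>n. proj_norm (X n))"
proof -
  have "Cauchy (\<lambda>n. proj_norm (X n))"
    unfolding Cauchy_def dist_real_def
  proof (intro allI impI)
    fix e :: real assume "e > 0"
    then obtain N where "\<forall>m\<ge>N. \<forall>n\<ge>N. proj_norm (X m - X n) < e"
      using assms unfolding proj_Cauchy_def by blast
    then have "\<forall>m\<ge>N. \<forall>n\<ge>N. \<bar>proj_norm (X m) - proj_norm (X n)\<bar> < e"
      by (blast intro: le_less_trans[OF proj_norm_triangle2])
    then show "\<exists>M. \<forall>m\<ge>M. \<forall>n\<ge>M. \<bar>proj_norm (X m) - proj_norm (X n)\<bar> < e" by blast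
  qed
  then show ?thesis using Cauchy_convergent convergent_LIMSEQ_iff by blast
qed

lemma lim_proj_norm_cong:
  assumes "proj_equiv X Y"
  shows "lim (\<lambda>n. proj_norm (X n)) = lim (\<lambda>n. proj_norm (Y n))"
proof -
  have "proj_Cauchy X" "proj_Cauchy Y" using assms by (auto simp: proj_equiv_def)
  note X = proj_norm_LIMSEQ[OF this(1)] and Y = proj_norm_LIMSEQ[OF this(2)]
  have "(\<lambda>n. proj_norm (X n) - proj_norm (Y n)) \<longlonglongrightarrow> 0"
    by (rule tendsto_0_le[where K = 1 and f = "\<lambda>n. proj_norm (X n - Y n)"])
       (use assms in \<open>simp_all add: proj_equiv_def proj_norm_triangle2\<close>)
  from LIMSEQ_unique[OF tendsto_diff[OF X Y] this] show ?thesis by simp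
qed

instantiation ptensor :: (real_normed_vector, real_normed_vector) real_normed_vector
begin

lift_definition zero_ptensor :: "('a, 'b) ptensor" is "\<lambda>_. 0" by simp
lift_definition plus_ptensor :: "('a, 'b) ptensor \<Rightarrow> ('a, 'b) ptensor \<Rightarrow> ('a, 'b) ptensor"
  is "\<lambda>X Y n. X n + Y n" by (rule proj_equiv_add)
lift_definition scaleR_ptensor :: "real \<Rightarrow> ('a, 'b) ptensor \<Rightarrow> ('a, 'b) ptensor"
  is "\<lambda>c X n. c *\<^sub>R X n" by (rule proj_equiv_scaleR)
lift_definition norm_ptensor :: "('a, 'b) ptensor \<Rightarrow> real"
  is "\<lambda>X. lim (\<lambda>n. proj_norm (X n))" by (rule lim_proj_norm_cong)
definition uminus_ptensor :: "('a, 'b) ptensor \<Rightarrow> ('a, 'b) ptensor" where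
  "uminus_ptensor u = (-1) *\<^sub>R u"
definition minus_ptensor :: "('a, 'b) ptensor \<Rightarrow> ('a, 'b) ptensor \<Rightarrow> ('a, 'b) ptensor" where
  "minus_ptensor u v = u + (- v)"
definition dist_ptensor :: "('a, 'b) ptensor \<Rightarrow> ('a, 'b) ptensor \<Rightarrow> real" where
  "dist_ptensor u v = norm (u - v)"
definition sgn_ptensor :: "('a, 'b) ptensor \<Rightarrow> ('a, 'b) ptensor" where
  "sgn_ptensor u = scaleR (inverse (norm u)) u"
definition [code del]: "(uniformity :: (('a, 'b) ptensor \<times> ('a, 'b) ptensor) filter) =
  (INF e\<in>{0 <..}. principal {(x, y). dist x y < e})"
definition open_ptensor :: "('a, 'b) ptensor set \<Rightarrow> bool" where
  "open_ptensor S = (\<forall>x\<in>S. \<forall>\<^sub>F (x', y) in uniformity. x' = x \<longrightarrow> y \<in> S)"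

instance
proof
  fix u v w :: "('a, 'b) ptensor" and c d :: real
  note * = proj_Cauchy_add proj_Cauchy_scaleR
  show "(u + v) + w = u + (v + w)" by transfer (simp add: add.assoc *)
  show "u + v = v + u" by transfer (simp add: add.commute *)
  show "0 + u = u" by transfer simp
  show scale_add: "(c + d) *\<^sub>R u = c *\<^sub>R u + d *\<^sub>R u" for c d by transfer (simp add: scaleR_add_left *)
  show "c *\<^sub>R (u + v) = c *\<^sub>R u + c *\<^sub>R v" by transfer (simp add: scaleR_add_right *)
  show "c *\<^sub>R d *\<^sub>R u = (c * d) *\<^sub>R u" by transfer (simp add: *)
  show "1 *\<^sub>R u = u" by transfer simp
  show "- u + u = 0" unfolding uminus_ptensor_def by transfer simp
  show "u - v = u + - v" by (rule minus_ptensor_def)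
  show "dist u v = norm (u - v)" by (rule dist_ptensor_def)
  show "sgn u = scaleR (inverse (norm u)) u" by (rule sgn_ptensor_def)
  show "(uniformity :: (('a, 'b) ptensor \<times> ('a, 'b) ptensor) filter) =
    (INF e\<in>{0 <..}. principal {(x, y). dist x y < e})" by (rule uniformity_ptensor_def)
  show "open S = (\<forall>x\<in>S. \<forall>\<^sub>F (x', y) in uniformity. x' = x \<longrightarrow> y \<in> S)" for S :: "('a, 'b) ptensor set"
    by (rule open_ptensor_def)
  show "norm u = 0 \<longleftrightarrow> u = 0"
  proof transfer
    fix X :: "nat \<Rightarrow> ('a, 'b) alg_tensor" assume "proj_equiv X X"
    then have X: "proj_Cauchy X" by simp
    then have "lim (\<lambda>n. proj_norm (X n)) = 0 \<longleftrightarrow> (\<lambda>n. proj_norm (X n)) \<longlonglongrightarrow> 0"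
      using limI[of "\<lambda>n. proj_norm (X n)" 0] proj_norm_LIMSEQ[OF X] by (intro iffI) simp_all
    then show "lim (\<lambda>n. proj_norm (X n)) = 0 \<longleftrightarrow> proj_equiv X (\<lambda>_. 0)"
      using X by (simp add: proj_equiv_def)
  qed
  show "norm (u + v) \<le> norm u + norm v"
  proof transfer
    fix X Y :: "nat \<Rightarrow> ('a, 'b) alg_tensor" assume "proj_equiv X X" "proj_equiv Y Y"
    then have "proj_Cauchy X" "proj_Cauchy Y" by simp_all
    note C = this
    show "lim (\<lambda>n. proj_norm (X n + Y n)) \<le> lim (\<lambda>n. proj_norm (X n)) + lim (\<lambda>n. proj_norm (Y n))"
      by (rule LIMSEQ_le[OF proj_norm_LIMSEQ[OF proj_Cauchy_add[OF C]]
            tendsto_add[OF proj_norm_LIMSEQ[OF C(1)] proj_norm_LIMSEQ[OF C(2)]]])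
        (simp add: proj_norm_triangle)
  qed
  show "norm (c *\<^sub>R u) = \<bar>c\<bar> * norm u"
  proof transfer
    fix c and X :: "nat \<Rightarrow> ('a, 'b) alg_tensor" assume "proj_equiv X X"
    then have "proj_Cauchy X" by simp
    from limI[OF tendsto_mult_left[OF proj_norm_LIMSEQ[OF this]]]
    show "lim (\<lambda>n. proj_norm (c *\<^sub>R X n)) = \<bar>c\<bar> * lim (\<lambda>n. proj_norm (X n))" by simp
  qed
qed

end

definition to_ptensor ::
  "('a::real_normed_vector, 'b::real_normed_vector) alg_tensor \<Rightarrow> ('a, 'b) ptensor"
  where "to_ptensor u = abs_ptensor (\<lambda>_. u)"

lemma linear_to_ptensor: "linear to_ptensor"
  by (rule linearI)
    (simp_all add: to_ptensor_def plus_ptensor.abs_eq scaleR_ptensor.abs_eq)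

lemma norm_to_ptensor: "norm (to_ptensor u) = proj_norm u"
  by (simp add: to_ptensor_def norm_ptensor.abs_eq)

lemma norm_ptensor_Cauchy:
  assumes "proj_Cauchy X"
  shows "(\<lambda>n. proj_norm (X n)) \<longlonglongrightarrow> norm (abs_ptensor X)"
  using proj_norm_LIMSEQ[OF assms] assms by (simp add: norm_ptensor.abs_eq)

lemma ptensor_obtain:
  obtains X where "proj_Cauchy X" "u = abs_ptensor X"
proof
  show "proj_Cauchy (rep_ptensor u)"
    using Quotient3_rep_reflp[OF Quotient3_ptensor, of u] by simp
  show "u = abs_ptensor (rep_ptensor u)"
    using Quotient3_abs_rep[OF Quotient3_ptensor, of u] by simp
qed

lemma abs_ptensor_diff:
  assumes "proj_Cauchy X"
  shows "abs_ptensor X - to_ptensor v = abs_ptensor (\<lambda>n. X n + (-1) *\<^sub>R v)"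
proof -
  have "abs_ptensor X - to_ptensor v = abs_ptensor X + to_ptensor ((-1) *\<^sub>R v)"
    by (simp add: linear_neg[OF linear_to_ptensor])
  also have "\<dots> = abs_ptensor (\<lambda>n. X n + (-1) *\<^sub>R v)"
    unfolding to_ptensor_def by (rule plus_ptensor.abs_eq) (simp_all add: assms)
  finally show ?thesis .
qed

lemma to_ptensor_dense:
  assumes "e > 0"
  shows "\<exists>v. dist u (to_ptensor v) < e"
proof -
  obtain X where X: "proj_Cauchy X" "u = abs_ptensor X" by (rule ptensor_obtain)
  obtain N where N: "\<forall>m\<ge>N. \<forall>n\<ge>N. proj_norm (X m - X n) < e / 2"
    using X(1) assms unfolding proj_Cauchy_def by (meson half_gt_zero)
  have C: "proj_Cauchy (\<lambda>n. X n + (-1) *\<^sub>R X N)"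
    by (rule proj_Cauchy_add[OF X(1) proj_Cauchy_const])
  have "u - to_ptensor (X N) = abs_ptensor (\<lambda>n. X n + (-1) *\<^sub>R X N)"
    unfolding X(2) by (rule abs_ptensor_diff[OF X(1)])
  then have "(\<lambda>n. proj_norm (X n - X N)) \<longlonglongrightarrow> norm (u - to_ptensor (X N))"
    using norm_ptensor_Cauchy[OF C] by simp
  then have "norm (u - to_ptensor (X N)) \<le> e / 2"
    using N by (intro Lim_bounded[where M = N]) (auto intro: less_imp_le)
  then show ?thesis using assms by (intro exI[of _ "X N"]) (simp add: dist_norm)
qed

instance ptensor :: (real_normed_vector, real_normed_vector) banach
proof
  fix U :: "nat \<Rightarrow> ('a, 'b) ptensor" assume U: "Cauchy U"
  have "\<exists>v. dist (U n) (to_ptensor v) < 1 / Suc n" for n by (rule to_ptensor_dense) simp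
  then obtain V where V: "\<And>n. dist (U n) (to_ptensor (V n)) < 1 / Suc n" by metis
  have d0: "(\<lambda>n. dist (U n) (to_ptensor (V n))) \<longlonglongrightarrow> 0"
  proof (rule tendsto_sandwich[OF _ _ tendsto_const LIMSEQ_inverse_real_of_nat])
    show "\<forall>\<^sub>F n in sequentially. dist (U n) (to_ptensor (V n)) \<le> inverse (real (Suc n))"
      using less_imp_le[OF V] unfolding inverse_eq_divide by (intro always_eventually allI)
  qed simp
  have UV: "(\<lambda>n. U n - to_ptensor (V n)) \<longlonglongrightarrow> 0"
    using d0 by (simp add: dist_norm tendsto_norm_zero_iff)
  have "Cauchy (\<lambda>n. to_ptensor (V n))"
  proof (rule metric_CauchyI)
    fix e :: real assume e: "e > 0"
    then have e4: "e / 4 > 0" by simp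
    obtain N1 where N1: "\<forall>m\<ge>N1. \<forall>n\<ge>N1. dist (U m) (U n) < e / 4"
      using metric_CauchyD[OF U e4] by blast
    obtain N2 where N2: "\<forall>n\<ge>N2. dist (U n) (to_ptensor (V n)) < e / 4"
      using LIMSEQ_D[OF d0 e4] by (simp only: diff_0_right real_norm_def abs_of_nonneg zero_le_dist) blast
    have "dist (to_ptensor (V m)) (to_ptensor (V n)) < e" if "m \<ge> max N1 N2" "n \<ge> max N1 N2" for m n
    proof -
      have "dist (to_ptensor (V m)) (to_ptensor (V n))
          \<le> dist (to_ptensor (V m)) (U m) + dist (U m) (U n) + dist (U n) (to_ptensor (V n))"
        by (meson add_mono_thms_linordered_semiring(3) dist_triangle order_trans)
      moreover have "dist (to_ptensor (V m)) (U m) < e / 4"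
        using N2 that by (simp add: dist_commute)
      moreover have "dist (U m) (U n) < e / 4" using N1 that by simp
      moreover have "dist (U n) (to_ptensor (V n)) < e / 4" using N2 that by simp
      ultimately show ?thesis using e by linarith
    qed
    then show "\<exists>M. \<forall>m\<ge>M. \<forall>n\<ge>M. dist (to_ptensor (V m)) (to_ptensor (V n)) < e" by blast
  qed
  then have V_C: "proj_Cauchy V"
    by (simp add: Cauchy_def proj_Cauchy_def dist_norm norm_to_ptensor
      flip: linear_diff[OF linear_to_ptensor])
  define u where "u = abs_ptensor V"
  have "(\<lambda>n. to_ptensor (V n)) \<longlonglongrightarrow> u"
  proof (rule LIMSEQ_I)
    fix e :: real assume e: "e > 0"
    obtain N where N: "\<forall>m\<ge>N. \<forall>n\<ge>N. proj_norm (V m - V n) < e / 2"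
      using V_C e unfolding proj_Cauchy_def by (meson half_gt_zero)
    have "norm (to_ptensor (V m) - u) < e" if "m \<ge> N" for m
    proof -
      have C: "proj_Cauchy (\<lambda>n. V n + (-1) *\<^sub>R V m)"
        by (rule proj_Cauchy_add[OF V_C proj_Cauchy_const])
      have "u - to_ptensor (V m) = abs_ptensor (\<lambda>n. V n + (-1) *\<^sub>R V m)"
        unfolding u_def by (rule abs_ptensor_diff[OF V_C])
      then have "(\<lambda>n. proj_norm (V n - V m)) \<longlonglongrightarrow> norm (u - to_ptensor (V m))"
        using norm_ptensor_Cauchy[OF C] by simp
      then have "norm (u - to_ptensor (V m)) \<le> e / 2"
        using N that by (intro Lim_bounded[where M = N]) (auto intro: less_imp_le)
      then show ?thesis using e by (simp add: norm_minus_commute)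
    qed
    then show "\<exists>no. \<forall>n\<ge>no. norm (to_ptensor (V n) - u) < e" by blast
  qed
  from tendsto_add[OF UV this] have "U \<longlonglongrightarrow> u" by simp
  then show "convergent U" by (rule convergentI)
qed

subsection \<open>Elementary tensors and the universal property\<close>

definition elem_tensor ::
  "'a::real_normed_vector \<Rightarrow> 'b::real_normed_vector \<Rightarrow> ('a, 'b) ptensor" (infixr "\<otimes>" 70)
  where "a \<otimes> b = to_ptensor (alg_elem a b)"

lemma bounded_bilinear_elem_tensor: "bounded_bilinear (\<otimes>)"
proof
  fix a a' :: "'a" and b b' :: "'b" and r :: real
  show "(a + a') \<otimes> b = a \<otimes> b + a' \<otimes> b" "a \<otimes> (b + b') = a \<otimes> b + a \<otimes> b'"
    by (simp_all add: elem_tensor_def alg_elem_add_left alg_elem_add_right linear_add[OF linear_to_ptensor])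
  show "(r *\<^sub>R a) \<otimes> b = r *\<^sub>R (a \<otimes> b)" "a \<otimes> (r *\<^sub>R b) = r *\<^sub>R (a \<otimes> b)"
    by (simp_all add: elem_tensor_def alg_elem_scale_left alg_elem_scale_right linear_cmul[OF linear_to_ptensor])
  show "\<exists>K. \<forall>a b. norm ((a :: 'a) \<otimes> (b :: 'b)) \<le> norm a * norm b * K"
    using proj_norm_le[of "alg_elem a b" "[(a, b)]" for a :: 'a and b :: 'b]
    by (intro exI[of _ 1]) (simp add: elem_tensor_def norm_to_ptensor)
qed

lemma to_ptensor_LIMSEQ:
  obtains V where "(\<lambda>n. to_ptensor (V n)) \<longlonglongrightarrow> u"
proof -
  have "\<exists>v. dist u (to_ptensor v) < inverse (Suc n)" for n by (rule to_ptensor_dense) simp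
  then obtain V where V: "\<And>n. dist u (to_ptensor (V n)) < inverse (Suc n)" by metis
  have "(\<lambda>n. to_ptensor (V n)) \<longlonglongrightarrow> u"
  proof (subst tendsto_dist_iff, rule tendsto_sandwich[OF _ _ tendsto_const LIMSEQ_inverse_real_of_nat])
    show "\<forall>\<^sub>F n in sequentially. dist (to_ptensor (V n)) u \<le> inverse (real (Suc n))"
      using less_imp_le[OF V] by (intro always_eventually allI) (simp add: dist_commute)
  qed simp
  then show ?thesis by (rule that)
qed

lemma blinfun_ptensor_eqI:
  fixes L L' :: "('a::real_normed_vector, 'b::real_normed_vector) ptensor \<Rightarrow>\<^sub>L 'c::real_normed_vector"
  assumes "\<And>a b. L (a \<otimes> b) = L' (a \<otimes> b)"
  shows "L = L'"
proof (rule blinfun_eqI)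
  fix u :: "('a, 'b) ptensor"
  have 1: "L (to_ptensor (\<Sum>(a, b)\<leftarrow>xs. alg_elem a b)) = L' (to_ptensor (\<Sum>(a, b)\<leftarrow>xs. alg_elem a b))" for xs
    by (induction xs) (auto simp: linear_0[OF linear_to_ptensor] linear_add[OF linear_to_ptensor]
        blinfun.add_right assms[unfolded elem_tensor_def])
  have 2: "L (to_ptensor v) = L' (to_ptensor v)" for v
    by (rule alg_tensor_list_exhaust[of v]) (simp add: 1)
  obtain V where "(\<lambda>n. to_ptensor (V n)) \<longlonglongrightarrow> u" by (rule to_ptensor_LIMSEQ)
  then have "(\<lambda>n. L (to_ptensor (V n))) \<longlonglongrightarrow> L u" "(\<lambda>n. L' (to_ptensor (V n))) \<longlonglongrightarrow> L' u"
    by (auto intro: blinfun.tendsto tendsto_const)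
  then show "L u = L' u" unfolding 2 by (rule LIMSEQ_unique)
qed

lemma ptensor_lift_ex:
  fixes f :: "'a::real_normed_vector \<Rightarrow> 'b::real_normed_vector \<Rightarrow> 'c::banach"
  assumes "bounded_bilinear f"
  shows "\<exists>L :: ('a, 'b) ptensor \<Rightarrow>\<^sub>L 'c. \<forall>a b. L (a \<otimes> b) = f a b"
proof -
  interpret f: bounded_bilinear f by fact
  obtain g where g: "linear g" "\<And>a b. g (alg_elem a b) = f a b"
    using alg_tensor_lift_ex[of f] f.bounded_linear_left f.bounded_linear_right
    by (metis bounded_linear.linear)
  obtain K where K: "0 < K" "\<And>a b. norm (f a b) \<le> norm a * norm b * K"
    using f.pos_bounded by blast
  have gK: "norm (g u) \<le> K * proj_norm u" for u
    by (rule proj_norm_lift_le[OF g(1)]) (use K in \<open>auto simp: g(2) mult_ac\<close>)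
  have conv: "(\<lambda>n. g (X n)) \<longlonglongrightarrow> lim (\<lambda>n. g (X n))" if X: "proj_Cauchy X" for X
  proof -
    have "Cauchy (\<lambda>n. g (X n))"
    proof (rule metric_CauchyI)
      fix e :: real assume "e > 0"
      then have "e / K > 0" using K by simp
      then obtain N where N: "\<forall>m\<ge>N. \<forall>n\<ge>N. proj_norm (X m - X n) < e / K"
        using X unfolding proj_Cauchy_def by blast
      have "dist (g (X m)) (g (X n)) < e" if "m \<ge> N" "n \<ge> N" for m n
      proof -
        have "dist (g (X m)) (g (X n)) \<le> K * proj_norm (X m - X n)"
          using gK[of "X m - X n"] by (simp add: dist_norm linear_diff[OF g(1)])
        also have "\<dots> < K * (e / K)" using N that K by (intro mult_strict_left_mono) auto
        finally show ?thesis using K by simp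
      qed
      then show "\<exists>M. \<forall>m\<ge>M. \<forall>n\<ge>M. dist (g (X m)) (g (X n)) < e" by blast
    qed
    then show ?thesis using Cauchy_convergent convergent_LIMSEQ_iff by blast
  qed
  define h where "h u = lim (\<lambda>n. g (rep_ptensor u n))" for u
  have h: "h (abs_ptensor X) = l" if X: "proj_Cauchy X" and l: "(\<lambda>n. g (X n)) \<longlonglongrightarrow> l" for X l
  proof -
    let ?Y = "rep_ptensor (abs_ptensor X)"
    have Y: "proj_equiv ?Y X"
      by (rule Quotient3_rep_abs[OF Quotient3_ptensor]) (simp add: X)
    then have "(\<lambda>n. K * proj_norm (?Y n - X n)) \<longlonglongrightarrow> K * 0"
      by (intro tendsto_mult_left) (simp add: proj_equiv_def)
    then have "(\<lambda>n. K * proj_norm (?Y n - X n)) \<longlonglongrightarrow> 0" by simp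
    then have "(\<lambda>n. g (?Y n) - g (X n)) \<longlonglongrightarrow> 0"
      by (rule tendsto_0_le[where K = 1])
        (use gK K in \<open>auto intro!: always_eventually simp flip: linear_diff[OF g(1)]\<close>)
    from tendsto_add[OF this l] show ?thesis by (simp add: h_def limI)
  qed
  have h_add: "h (u + v) = h u + h v" for u v
  proof -
    obtain X Y where X: "proj_Cauchy X" "u = abs_ptensor X" and Y: "proj_Cauchy Y" "v = abs_ptensor Y"
      using ptensor_obtain by metis
    have "u + v = abs_ptensor (\<lambda>n. X n + Y n)"
      unfolding X(2) Y(2) by (rule plus_ptensor.abs_eq) (simp_all add: X Y)
    moreover have "(\<lambda>n. g (X n + Y n)) \<longlonglongrightarrow> lim (\<lambda>n. g (X n)) + lim (\<lambda>n. g (Y n))"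
      unfolding linear_add[OF g(1)] by (rule tendsto_add[OF conv[OF X(1)] conv[OF Y(1)]])
    ultimately show ?thesis
      using h[OF proj_Cauchy_add[OF X(1) Y(1)]] h[OF X(1) conv[OF X(1)]] h[OF Y(1) conv[OF Y(1)]]
      by (simp add: X(2) Y(2))
  qed
  have h_scale: "h (c *\<^sub>R u) = c *\<^sub>R h u" for c u
  proof -
    obtain X where X: "proj_Cauchy X" "u = abs_ptensor X" by (rule ptensor_obtain)
    have "c *\<^sub>R u = abs_ptensor (\<lambda>n. c *\<^sub>R X n)"
      unfolding X(2) by (rule scaleR_ptensor.abs_eq) (simp add: X)
    moreover have "(\<lambda>n. g (c *\<^sub>R X n)) \<longlonglongrightarrow> c *\<^sub>R lim (\<lambda>n. g (X n))"
      unfolding linear_cmul[OF g(1)] by (intro tendsto_intros conv X)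
    ultimately show ?thesis
      using h[OF proj_Cauchy_scaleR[OF X(1)]] h[OF X(1) conv[OF X(1)]] by (simp add: X(2))
  qed
  have h_norm: "norm (h u) \<le> norm u * K" for u
  proof -
    obtain X where X: "proj_Cauchy X" "u = abs_ptensor X" by (rule ptensor_obtain)
    have "norm (lim (\<lambda>n. g (X n))) \<le> K * norm u"
      unfolding X(2)
      by (rule LIMSEQ_le[OF tendsto_norm[OF conv[OF X(1)]] tendsto_mult_left[OF norm_ptensor_Cauchy[OF X(1)]]])
        (use gK in blast)
    then show ?thesis using h[OF X(1) conv[OF X(1)]] by (simp add: X(2) mult.commute)
  qed
  have "bounded_linear h" by (rule bounded_linear_intro[OF h_add h_scale h_norm])
  moreover have "h (a \<otimes> b) = f a b" for a b
    unfolding elem_tensor_def to_ptensor_def by (rule h) (simp_all add: g(2))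
  ultimately show ?thesis by (intro exI[of _ "Blinfun h"]) (simp add: bounded_linear_Blinfun_apply)
qed

text \<open>
  The bounded linear map on the projective tensor product induced by a bounded bilinear map
  (meaningful only for \<^const>\<open>bounded_bilinear\<close> arguments). With scalar values, this is the identification of bounded
  bilinear forms on \<open>'a \<times> 'b\<close> with the dual of \<^typ>\<open>('a, 'b) ptensor\<close>.
\<close>

definition ptensor_lift ::
  "('a::real_normed_vector \<Rightarrow> 'b::real_normed_vector \<Rightarrow> 'c::banach) \<Rightarrow> ('a, 'b) ptensor \<Rightarrow>\<^sub>L 'c"
  where "ptensor_lift f = (THE L. \<forall>a b. blinfun_apply L (a \<otimes> b) = f a b)"

lemma ptensor_lift_elem:
  assumes "bounded_bilinear f"
  shows "ptensor_lift f (a \<otimes> b) = f a b"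
proof -
  have "\<exists>!L :: ('a, 'b) ptensor \<Rightarrow>\<^sub>L 'c. \<forall>a b. L (a \<otimes> b) = f a b"
    using ptensor_lift_ex[OF assms] by (metis blinfun_ptensor_eqI)
  from theI'[OF this] show ?thesis by (simp add: ptensor_lift_def)
qed

lemma norm_ptensor_lift_le:
  fixes f :: "'a::real_normed_vector \<Rightarrow> 'b::real_normed_vector \<Rightarrow> 'c::banach"
  assumes "bounded_bilinear f" "\<And>a b. norm (f a b) \<le> K * (norm a * norm b)" "0 \<le> K"
  shows "norm (ptensor_lift f) \<le> K"
proof (rule norm_blinfun_bound[OF assms(3)])
  fix u :: "('a, 'b) ptensor"
  let ?L = "blinfun_apply (ptensor_lift f)"
  have lin: "linear (\<lambda>v. ?L (to_ptensor v))"
    by (rule linearI) (simp_all add: linear_add[OF linear_to_ptensor]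
        linear_cmul[OF linear_to_ptensor] blinfun.add_right blinfun.scaleR_right)
  have le: "norm (?L (to_ptensor v)) \<le> K * norm (to_ptensor v :: ('a, 'b) ptensor)" for v
    unfolding norm_to_ptensor
    by (rule proj_norm_lift_le[OF lin _ assms(3)])
      (simp add: ptensor_lift_elem[OF assms(1), unfolded elem_tensor_def] assms(2))
  obtain V where V: "(\<lambda>n. to_ptensor (V n)) \<longlonglongrightarrow> u" by (rule to_ptensor_LIMSEQ)
  show "norm (?L u) \<le> K * norm u"
    by (rule LIMSEQ_le[OF tendsto_norm[OF blinfun.tendsto[OF tendsto_const V]]
          tendsto_mult_left[OF tendsto_norm[OF V]]]) (use le in auto)
qed

subsection \<open>The Chi-subspace\<close>

text \<open>
  Below, \<^typ>\<open>'d\<close> represents \<open>D(A\<^sup>*)\<close> and \<open>j\<close> its inclusion into \<open>H\<close>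
  (see \<open>adjoint_domain_space\<close>); thus \<^typ>\<open>('d, 'd) ptensor\<close> is \<open>\<chi>\<close>-bar, and \<open>chi_embed j\<close> is its
  embedding into the dual of \<^typ>\<open>('h, 'h) ptensor\<close>, where \<open>H\<close> is identified with its dual by Riesz.
\<close>

definition chi_embed ::
  "('d::real_normed_vector \<Rightarrow> 'h::real_inner) \<Rightarrow> ('d, 'd) ptensor \<Rightarrow>\<^sub>L ('h, 'h) ptensor \<Rightarrow>\<^sub>L real"
  where "chi_embed j =
    ptensor_lift (\<lambda>a b. ptensor_lift (\<lambda>x y. inner (j a) x * inner (j b) y))"

lemma bounded_bilinear_inner_mult:
  "bounded_bilinear (\<lambda>(x::'h::real_inner) (y::'h). inner a x * inner b y)"
  by (rule bounded_bilinear.comp[OF bounded_bilinear_mult bounded_linear_inner_right bounded_linear_inner_right])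

lemma norm_inner_mult_le:
  "norm (inner a x * inner b y) \<le> (norm a * norm b) * (norm x * norm (y::'h::real_inner))"
  using mult_mono[OF Cauchy_Schwarz_ineq2[of a x] Cauchy_Schwarz_ineq2[of b y]]
  by (simp add: abs_mult mult_ac)

lemma chi_embed_elem:
  assumes "bounded_linear j"
  shows "chi_embed j (a \<otimes> b) (x \<otimes> y) = inner (j a) x * inner (j b) y"
proof -
  interpret j: bounded_linear j by fact
  note lift = ptensor_lift_elem[OF bounded_bilinear_inner_mult]
  obtain K where K: "K > 0" "\<And>a. norm (j a) \<le> norm a * K" using j.pos_bounded by blast
  have "bounded_bilinear (\<lambda>a b. ptensor_lift (\<lambda>x y. inner (j a) x * inner (j b) y))"
  proof
    show "\<exists>C. \<forall>a b. norm (ptensor_lift (\<lambda>x y. inner (j a) x * inner (j b) y)) \<le> norm a * norm b * C"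
    proof (intro exI allI)
      fix a b
      have "norm (ptensor_lift (\<lambda>x y. inner (j a) x * inner (j b) y)) \<le> norm (j a) * norm (j b)"
        by (rule norm_ptensor_lift_le[OF bounded_bilinear_inner_mult norm_inner_mult_le]) simp
      also have "\<dots> \<le> (norm a * K) * (norm b * K)" using K by (intro mult_mono) auto
      finally show "norm (ptensor_lift (\<lambda>x y. inner (j a) x * inner (j b) y)) \<le> norm a * norm b * (K * K)"
        by (simp add: mult_ac)
    qed
  qed (rule blinfun_ptensor_eqI, simp only: lift blinfun.add_left blinfun.scaleR_left,
      simp add: j.add j.scaleR inner_add_left algebra_simps)+
  then show ?thesis by (simp add: chi_embed_def ptensor_lift_elem lift)
qed

text \<open>
  \<open>chi_dual j u\<close> is the canonical image of \<open>u\<close> in the bidual, restricted to \<open>\<chi>\<close>-bar.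
\<close>

definition chi_dual ::
  "('d::real_normed_vector \<Rightarrow> 'h::real_inner) \<Rightarrow> ('h, 'h) ptensor \<Rightarrow> ('d, 'd) ptensor \<Rightarrow>\<^sub>L real"
  where "chi_dual j u = Blinfun (\<lambda>\<phi>. blinfun_apply (chi_embed j \<phi>) u)"

lemma chi_dual_apply: "chi_dual j u \<phi> = chi_embed j \<phi> u"
proof -
  have "bounded_linear (\<lambda>\<phi>. blinfun_apply (chi_embed j \<phi>) u)"
    by (rule bounded_linear_compose[OF blinfun.bounded_linear_left blinfun.bounded_linear_right])
  then show ?thesis by (simp add: chi_dual_def bounded_linear_Blinfun_apply)
qed

section \<open>Semigroup generators and the adjoint\<close>

definition C0_semigroup :: "(real \<Rightarrow> 'h::real_normed_vector \<Rightarrow>\<^sub>L 'h) \<Rightarrow> bool" where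
  "C0_semigroup S \<longleftrightarrow> S 0 = id_blinfun \<and>
    (\<forall>t\<ge>0. \<forall>r\<ge>0. S (t + r) = S t o\<^sub>L S r) \<and>
    (\<forall>x. ((\<lambda>t. blinfun_apply (S t) x) \<longlongrightarrow> x) (at_right 0))"

definition semigroup_generator ::
  "(real \<Rightarrow> 'h::real_normed_vector \<Rightarrow>\<^sub>L 'h) \<Rightarrow> 'h set \<Rightarrow> ('h \<Rightarrow> 'h) \<Rightarrow> bool" where
  "semigroup_generator S DA A \<longleftrightarrow>
    DA = {x. \<exists>y. ((\<lambda>t. (S t x - x) /\<^sub>R t) \<longlongrightarrow> y) (at_right 0)} \<and>
    (\<forall>x\<in>DA. ((\<lambda>t. (S t x - x) /\<^sub>R t) \<longlongrightarrow> A x) (at_right 0))"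

definition adjoint_dom :: "'h::real_inner set \<Rightarrow> ('h \<Rightarrow> 'h) \<Rightarrow> 'h set" where
  "adjoint_dom DA A = {y. \<exists>z. \<forall>x\<in>DA. inner (A x) y = inner x z}"

definition adjoint_op :: "'h::real_inner set \<Rightarrow> ('h \<Rightarrow> 'h) \<Rightarrow> 'h \<Rightarrow> 'h" where
  "adjoint_op DA A y = (THE z. \<forall>x\<in>DA. inner (A x) y = inner x z)"

text \<open>
  The domain of the adjoint depends on \<open>A\<close> and so is not itself a type. The space \<open>D(A\<^sup>*)\<close> with its
  graph norm is represented by a Banach space type \<^typ>\<open>'d\<close> together with a linear bijection \<open>j\<close> onto the set
  \<open>adjoint_dom DA A\<close> under which the norm of \<^typ>\<open>'d\<close> is the graph norm.
\<close>

definition adjoint_domain_space ::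
  "'h::real_inner set \<Rightarrow> ('h \<Rightarrow> 'h) \<Rightarrow> ('d::banach \<Rightarrow> 'h) \<Rightarrow> bool" where
  "adjoint_domain_space DA A j \<longleftrightarrow> linear j \<and> bij_betw j UNIV (adjoint_dom DA A) \<and>
    (\<forall>y. norm y = sqrt ((norm (j y))\<^sup>2 + (norm (adjoint_op DA A (j y)))\<^sup>2))"

section \<open>Function spaces\<close>

definition UC :: "real \<Rightarrow> real \<Rightarrow> (real \<times> 'h::real_normed_vector \<Rightarrow> 'd::real_normed_vector) set" where
  "UC s T = {G. \<forall>c\<in>{s..T} \<times> UNIV. \<forall>R.
    uniformly_continuous_on (({s..T} \<times> UNIV) \<inter> cball c R) G}"

text \<open>
  \<open>F\<close> is of class \<open>C\<^sup>1\<^sup>,\<^sup>2\<close> with time derivative \<open>Fr\<close> and space derivatives \<open>Fx\<close>, \<open>Fxx\<close>; at the endpoints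
  of the time interval the derivatives are one-sided.
\<close>

definition C12_with ::
  "real \<Rightarrow> real \<Rightarrow> (real \<Rightarrow> 'h::real_normed_vector \<Rightarrow> real) \<Rightarrow> (real \<Rightarrow> 'h \<Rightarrow> real) \<Rightarrow>
    (real \<Rightarrow> 'h \<Rightarrow> 'h \<Rightarrow>\<^sub>L real) \<Rightarrow> (real \<Rightarrow> 'h \<Rightarrow> 'h \<Rightarrow>\<^sub>L 'h \<Rightarrow>\<^sub>L real) \<Rightarrow> bool" where
  "C12_with s T F Fr Fx Fxx \<longleftrightarrow>
    (\<forall>t\<in>{s..T}. \<forall>x. ((\<lambda>(r, y). F r y) has_derivative (\<lambda>(h, k). h * Fr t x + Fx t x k))
      (at (t, x) within {s..T} \<times> UNIV)) \<and>
    continuous_on ({s..T} \<times> UNIV) (\<lambda>(t, x). Fr t x) \<and>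
    continuous_on ({s..T} \<times> UNIV) (\<lambda>(t, x). Fx t x) \<and>
    (\<forall>t\<in>{s..T}. \<forall>x. (Fx t has_derivative blinfun_apply (Fxx t x)) (at x)) \<and>
    continuous_on ({s..T} \<times> UNIV) (\<lambda>(t, x). Fxx t x)"

definition bounded_variation_on :: "real \<Rightarrow> real \<Rightarrow> (real \<Rightarrow> 'b::real_normed_vector) \<Rightarrow> bool" where
  "bounded_variation_on s T f \<longleftrightarrow> (\<exists>K. \<forall>n p.
    (\<forall>i\<le>n. p i \<in> {s..T}) \<and> (\<forall>i<n. p i \<le> p (Suc i)) \<longrightarrow>
    (\<Sum>i<n. norm (f (p (Suc i)) - f (p i))) \<le> K)"

definition cadlag_on :: "real \<Rightarrow> real \<Rightarrow> (real \<Rightarrow> 'b::topological_space) \<Rightarrow> bool" where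
  "cadlag_on s T f \<longleftrightarrow> (\<forall>t\<in>{s..<T}. (f \<longlongrightarrow> f t) (at_right t)) \<and>
    (\<forall>t\<in>{s<..T}. \<exists>l. (f \<longlongrightarrow> l) (at_left t))"

text \<open>
  The Stieltjes integral of the dual pairing of a function \<open>g\<close> with values in the dual against \<open>C\<close>, as
  the limit of tagged sums along partitions of \<open>[a, b]\<close> of vanishing mesh. For \<open>g\<close> continuous and \<open>C\<close>
  cadlag of bounded variation it exists and equals the integral over \<open>(a, b]\<close> against the vector
  measure \<open>dC\<close>.
\<close>

definition has_stieltjes_integral ::
  "(real \<Rightarrow> 'b::real_normed_vector \<Rightarrow>\<^sub>L real) \<Rightarrow> (real \<Rightarrow> 'b) \<Rightarrow> real \<Rightarrow> real \<Rightarrow> real \<Rightarrow> bool" where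
  "has_stieltjes_integral g C a b I \<longleftrightarrow> (\<forall>e>0. \<exists>d>0. \<forall>n p q.
    p 0 = a \<and> p n = b \<and> (\<forall>i<n. p i \<le> q i \<and> q i \<le> p (Suc i) \<and> p (Suc i) - p i < d) \<longrightarrow>
    \<bar>(\<Sum>i<n. g (q i) (C (p (Suc i)) - C (p i))) - I\<bar> < e)"

section \<open>Processes\<close>

definition process ::
  "'w measure \<Rightarrow> real \<Rightarrow> real \<Rightarrow> (real \<Rightarrow> 'w \<Rightarrow> 'b::topological_space) \<Rightarrow> bool" where
  "process M s T X \<longleftrightarrow>
    (\<lambda>(t, \<omega>). X t \<omega>) \<in> borel_measurable (restrict_space borel {s..T} \<Otimes>\<^sub>M M)"

definition continuous_process ::
  "'w measure \<Rightarrow> real \<Rightarrow> real \<Rightarrow> (real \<Rightarrow> 'w \<Rightarrow> 'b::topological_space) \<Rightarrow> bool" where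
  "continuous_process M s T X \<longleftrightarrow>
    process M s T X \<and> (AE \<omega> in M. continuous_on {s..T} (\<lambda>t. X t \<omega>))"

definition extend :: "real \<Rightarrow> real \<Rightarrow> (real \<Rightarrow> 'b) \<Rightarrow> real \<Rightarrow> 'b" where
  "extend s T f t = f (max s (min T t))"

definition strongly_measurable :: "'a measure \<Rightarrow> ('a \<Rightarrow> 'b::topological_space) \<Rightarrow> bool" where
  "strongly_measurable N f \<longleftrightarrow>
    (\<exists>S. (\<forall>n::nat. simple_function N (S n)) \<and> (\<forall>x\<in>space N. (\<lambda>n. S n x) \<longlonglongrightarrow> f x))"

text \<open>
  These are used only where \<open>Z \<epsilon>\<close> and \<open>L\<close> are measurable; for the ucp limit, the event is measurable because
  both processes are continuous and the probability space is complete.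
\<close>

definition tendsto_in_prob ::
  "'w measure \<Rightarrow> (real \<Rightarrow> 'w \<Rightarrow> real) \<Rightarrow> ('w \<Rightarrow> real) \<Rightarrow> real filter \<Rightarrow> bool" where
  "tendsto_in_prob M Z L Fl \<longleftrightarrow> (\<forall>\<delta>>0.
    ((\<lambda>\<epsilon>. measure M {\<omega>\<in>space M. \<delta> < \<bar>Z \<epsilon> \<omega> - L \<omega>\<bar>}) \<longlongrightarrow> 0) Fl)"

definition tendsto_ucp ::
  "'w measure \<Rightarrow> real \<Rightarrow> real \<Rightarrow> (real \<Rightarrow> real \<Rightarrow> 'w \<Rightarrow> real) \<Rightarrow> (real \<Rightarrow> 'w \<Rightarrow> real) \<Rightarrow>
    real filter \<Rightarrow> bool" where
  "tendsto_ucp M s T Z L Fl \<longleftrightarrow> (\<forall>\<delta>>0.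
    ((\<lambda>\<epsilon>. measure M {\<omega>\<in>space M. \<exists>t\<in>{s..T}. \<delta> < \<bar>Z \<epsilon> t \<omega> - L t \<omega>\<bar>}) \<longlongrightarrow> 0) Fl)"

section \<open>Quadratic variation\<close>

definition increment ::
  "real \<Rightarrow> real \<Rightarrow> (real \<Rightarrow> 'w \<Rightarrow> 'h::real_vector) \<Rightarrow> real \<Rightarrow> real \<Rightarrow> 'w \<Rightarrow> 'h" where
  "increment s T X \<epsilon> r \<omega> =
    extend s T (\<lambda>t. X t \<omega>) (r + \<epsilon>) - extend s T (\<lambda>t. X t \<omega>) r"

definition chi_qv_approx ::
  "real \<Rightarrow> real \<Rightarrow> ('d::real_normed_vector \<Rightarrow> 'h::real_inner) \<Rightarrow> (real \<Rightarrow> 'w \<Rightarrow> 'h) \<Rightarrow> real \<Rightarrow>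
    ('d, 'd) ptensor \<Rightarrow> real \<Rightarrow> 'w \<Rightarrow> real" where
  "chi_qv_approx s T j X \<epsilon> \<phi> t \<omega> = (LINT r:{s..t}|lborel.
    1 / \<epsilon> * chi_dual j (increment s T X \<epsilon> r \<omega> \<otimes> increment s T X \<epsilon> r \<omega>) \<phi>)"

text \<open>
  \<open>X\<close> admits a \<open>\<chi>\<close>-bar quadratic variation, and \<open>QV\<close> is the map \<open>\<phi> \<mapsto> [X, X](\<phi>)\<close> of condition (H2)(i),
  which is unique up to indistinguishability.
\<close>

definition has_chi_quadratic_variation ::
  "'w measure \<Rightarrow> real \<Rightarrow> real \<Rightarrow> ('d::real_normed_vector \<Rightarrow> 'h::real_inner) \<Rightarrow>
    (real \<Rightarrow> 'w \<Rightarrow> 'h) \<Rightarrow> (('d, 'd) ptensor \<Rightarrow> real \<Rightarrow> 'w \<Rightarrow> real) \<Rightarrow> bool" where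
  "has_chi_quadratic_variation M s T j X QV \<longleftrightarrow>
    (\<forall>\<epsilon>::nat \<Rightarrow> real. (\<forall>n. 0 < \<epsilon> n) \<and> decseq \<epsilon> \<and> \<epsilon> \<longlonglongrightarrow> 0 \<longrightarrow>
      (\<exists>k::nat \<Rightarrow> nat. strict_mono k \<and> (AE \<omega> in M.
        (SUP i. \<integral>\<^sup>+r\<in>{s..T}. ennreal (1 / \<epsilon> (k i) *
          norm (chi_dual j (increment s T X (\<epsilon> (k i)) r \<omega> \<otimes> increment s T X (\<epsilon> (k i)) r \<omega>)))
          \<partial>lborel) < \<infinity>))) \<and>
    (\<forall>\<phi>. continuous_process M s T (QV \<phi>) \<and>
      tendsto_ucp M s T (\<lambda>\<epsilon>. chi_qv_approx s T j X \<epsilon> \<phi>) (QV \<phi>) (at_right 0)) \<and>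
    (\<exists>Q :: 'w \<Rightarrow> real \<Rightarrow> ('d, 'd) ptensor \<Rightarrow>\<^sub>L real.
      strongly_measurable (M \<Otimes>\<^sub>M restrict_space borel {s..T}) (\<lambda>(\<omega>, t). Q \<omega> t) \<and>
      (AE \<omega> in M. cadlag_on s T (Q \<omega>) \<and> bounded_variation_on s T (Q \<omega>)) \<and>
      (\<forall>\<phi>. \<forall>t\<in>{s..T}. AE \<omega> in M. blinfun_apply (Q \<omega> t) \<phi> = QV \<phi> t \<omega>))"

section \<open>Forward integrals\<close>

definition forward_approx ::
  "real \<Rightarrow> real \<Rightarrow> (real \<Rightarrow> 'w \<Rightarrow> 'h::real_normed_vector \<Rightarrow>\<^sub>L real) \<Rightarrow> (real \<Rightarrow> 'w \<Rightarrow> 'h) \<Rightarrow>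
    real \<Rightarrow> real \<Rightarrow> 'w \<Rightarrow> real" where
  "forward_approx s T Y X \<epsilon> t \<omega> = (LINT r:{s..t}|lborel.
    Y r \<omega> (increment s T X \<epsilon> r \<omega> /\<^sub>R \<epsilon>))"

text \<open>
  \<open>I\<close> is (a version of) the forward integral of \<open>Y\<close> with respect to \<open>X\<close>. Bochner integrability is spelled
  out as measurability plus integrability of the norm, because the dual of the separable Hilbert space \<open>H\<close> is
  separable but its type \<^typ>\<open>'h \<Rightarrow>\<^sub>L real\<close> is not in the class required by \<^const>\<open>integrable\<close>.
\<close>

definition has_forward_integral ::
  "'w measure \<Rightarrow> real \<Rightarrow> real \<Rightarrow>
    (real \<Rightarrow> 'w \<Rightarrow> 'h::{real_inner, complete_space, second_countable_topology} \<Rightarrow>\<^sub>L real) \<Rightarrow>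
    (real \<Rightarrow> 'w \<Rightarrow> 'h) \<Rightarrow> (real \<Rightarrow> 'w \<Rightarrow> real) \<Rightarrow> bool" where
  "has_forward_integral M s T Y X I \<longleftrightarrow>
    continuous_process M s T X \<and> process M s T Y \<and>
    (AE \<omega> in M. set_integrable lborel {s..T} (\<lambda>r. norm (Y r \<omega>))) \<and>
    continuous_process M s T I \<and>
    (AE t in lborel. t \<in> {s..T} \<longrightarrow>
      tendsto_in_prob M (\<lambda>\<epsilon>. forward_approx s T Y X \<epsilon> t) (I t) (at_right 0))"

end

theory Submission
  imports Defs
begin

text \<open>
  Write \<open>\<partial>\<^sub>xF = j \<circ> G\<close>. If \<open>Q\<close> is an operator on \<open>H\<close> of finite
  rank, built from functionals in \<open>D(A\<^sup>*)\<close>, then the quadratic variation hypothesis controls all products of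
  increments of \<open>Q X\<close>, and a Taylor expansion of \<open>F(\<cdot>, Q X)\<close> along a subsequence of \<open>\<epsilon>\<close> on which everything
  converges almost surely yields the formula for \<open>Q X\<close> at almost every time.

  There are such \<open>Q\<close>, paired with operators \<open>Q'\<close> on \<open>D(A\<^sup>*)\<close> by \<open>\<langle>j z, Q x\<rangle> = \<langle>j (Q' z), x\<rangle>\<close>, which in two
  successive limits converge strongly to \<open>(P, 1)\<close>, where \<open>P\<close> is the projection onto the closure of the range
  of \<open>j\<close>. The forward integrals of \<open>Q' G(r, Q X\<^sub>r)\<close> converge as well: all of them exist, so by
  Baire's theorem \<open>\<Gamma> \<mapsto> \<integral>\<langle>\<Gamma>, d\<^sup>-X\<rangle>\<close> is continuous from the bounded continuous functions to convergence in
  measure. The other terms converge by dominated variation of \<open>C\<close>. Since \<open>\<partial>\<^sub>xF\<close> takes values in the range of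
  \<open>j\<close>, replacing \<open>x\<close> by \<open>P x\<close> changes neither \<open>F\<close> nor its derivatives, so the limit is the formula for \<open>X\<close>.

  It extends to all times by right continuity. At \<open>t = T\<close>, where no later times are available, one uses that
  a jump of \<open>C\<close> is annihilated by \<open>D(A\<^sup>*) \<otimes> D(A\<^sup>*)\<close> because the quadratic variation is continuous.
\<close>

section \<open>Semigroups and Hilbert space preliminaries\<close>

text \<open>The norms of the increments of \<open>X\<close> in \<open>H\<close> are not bounded by
  it, so the Taylor remainder of \<open>F\<close> along \<open>X\<close> itself is out of reach; a
  finite rank operator built from such functionals reduces it to finitely many scalar squares.

  Once the truncation has been removed, the bound 2 holds for all indices.

  The formula is carried as the statement that the Stieltjes integral of the second derivative has
  the value \<open>2 (F_t - F_s - I - \<integral> F_r)\<close>. The integral of the limiting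
  integrand exists by continuity and domination alone, so that a limit passage only has to identify
  its value.

  Forward integrals are limits in probability at almost every time. Measuring them jointly in
  \<open>(t, \<omega>)\<close> by the integral of \<open>min 1 \<bar>Z\<bar>\<close> gives Baire's
  theorem one sequence of functionals to act on, instead of one for each time.\<close>

lemma Baire_closed_cover:
  fixes E :: "nat \<Rightarrow> 'a::complete_space set"
  assumes "\<And>m. closed (E m)" "(\<Union>m. E m) = UNIV"
  obtains m x r where "0 < r" "ball x r \<subseteq> E m"
proof -
  have compl: "Met_TC.mcomplete TYPE('a)"
    unfolding Met_TC.mcomplete_def using Cauchy_convergent by (auto simp: convergent_def)
  have "\<exists>m. interior (E m) \<noteq> {}"
  proof (rule ccontr)
    assume "\<not> ?thesis"
    then have "Met_TC.mtopology interior_of (\<Union>(range E)) = {}"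
      using assms by (intro Met_TC.metric_Baire_category_alt[OF compl]) auto
    then show False using assms(2) by simp
  qed
  then obtain m x where "x \<in> interior (E m)" by blast
  then show ?thesis using that unfolding mem_interior by blast
qed

text \<open>Banach-Steinhaus: the closed sets where all \<open>f n\<close> are bounded by
  \<open>m\<close> cover the space, so one of them contains a ball. Differences move this ball to
  the origin and double the bound.\<close>

lemma blinfun_uniform_boundedness:
  fixes f :: "nat \<Rightarrow> 'a::{real_normed_vector, complete_space} \<Rightarrow>\<^sub>L 'b::real_normed_vector"
  assumes "\<And>x. Bseq (\<lambda>n. f n x)"
  obtains B where "\<And>n. norm (f n) \<le> B"
proof -
  define E where "E m = {x. \<forall>n. norm (f n x) \<le> real m}" for m :: nat
  have closedE: "closed (E m)" for m
    unfolding E_def by (intro closed_Collect_all closed_Collect_le continuous_intros)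
  have "x \<in> (\<Union>m. E m)" for x
  proof -
    obtain K where "\<And>n. norm (f n x) \<le> K" using assms[of x] by (auto simp: Bseq_def)
    then have "x \<in> E (nat \<lceil>K\<rceil>)" using order_trans[OF _ real_nat_ceiling_ge[of K]] by (simp add: E_def)
    then show ?thesis by blast
  qed
  then have cover: "(\<Union>m. E m) = UNIV" by blast
  obtain m x r where r: "0 < r" "ball x r \<subseteq> E m"
    by (rule Baire_closed_cover[OF closedE cover])
  have bnd: "norm (f n u) \<le> 2 * real m" if "norm u < r" for n u
  proof -
    have "x + u \<in> E m" "x \<in> E m" using r that by (auto simp: dist_norm)
    then have "norm (f n (x + u)) \<le> m" "norm (f n x) \<le> m" by (auto simp: E_def)
    then show ?thesis using norm_triangle_ineq4[of "f n (x + u)" "f n x"]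
      by (simp add: blinfun.add_right)
  qed
  have "norm (f n) \<le> 4 * real m / r" for n
  proof (rule norm_blinfun_bound)
    fix v
    show "norm (f n v) \<le> 4 * real m / r * norm v"
    proof (cases "v = 0")
      case False
      have "norm (f n ((r / 2 / norm v) *\<^sub>R v)) \<le> 2 * real m" using r False by (intro bnd) simp
      then show ?thesis using r False by (simp add: blinfun.scaleR_right field_simps)
    qed simp
  qed (use r in simp)
  then show ?thesis by (rule that)
qed

lemma C0_semigroup_near_0:
  assumes "C0_semigroup S" "0 < e"
  shows "\<exists>b>0. \<forall>r. 0 \<le> r \<and> r < b \<longrightarrow> norm (S r x - x) < e"
proof -
  have "((\<lambda>t. S t x) \<longlongrightarrow> x) (at_right 0)" and S0: "S 0 = id_blinfun"
    using assms(1) by (auto simp: C0_semigroup_def)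
  from tendstoD[OF this(1) assms(2)] obtain b where b: "b > 0" "\<And>r. 0 < r \<Longrightarrow> r < b \<Longrightarrow> norm (S r x - x) < e"
    unfolding eventually_at_right_field dist_norm by blast
  have "norm (S r x - x) < e" if "0 \<le> r" "r < b" for r
    using b(2)[of r] that S0 assms(2) by (cases "r = 0") auto
  then show ?thesis using b(1) by blast
qed

text \<open>Otherwise there are times \<open>t n\<close> tending to 0 with
  \<open>norm (S (t n)) > n\<close>. Strong continuity at 0 makes every orbit
  \<open>S (t n) x\<close> convergent, against uniform boundedness.\<close>

lemma C0_semigroup_locally_bounded:
  fixes S :: "real \<Rightarrow> 'h::{real_inner, complete_space} \<Rightarrow>\<^sub>L 'h"
  assumes "C0_semigroup S"
  obtains d K where "0 < d" "\<And>t. 0 \<le> t \<Longrightarrow> t \<le> d \<Longrightarrow> norm (S t) \<le> K"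
proof (rule ccontr)
  assume "\<not> thesis"
  then have "\<exists>t. 0 \<le> t \<and> t \<le> 1 / Suc n \<and> norm (S t) > n" for n :: nat
    using that[of "1 / Suc n" n] by (meson not_le zero_less_divide_1_iff of_nat_0_less_iff zero_less_Suc)
  then obtain t where t: "\<And>n. 0 \<le> t n" "\<And>n. t n \<le> 1 / Suc n" "\<And>n. norm (S (t n)) > real n" by metis
  have t0: "t \<longlonglongrightarrow> 0"
    by (rule tendsto_sandwich[OF _ _ tendsto_const LIMSEQ_Suc[OF lim_1_over_n]])
       (use t(1,2) in \<open>auto intro!: always_eventually\<close>)
  obtain B where "\<And>n. norm (S (t n)) \<le> B"
  proof (rule blinfun_uniform_boundedness[of "\<lambda>n. S (t n)"])
    fix x
    have "(\<lambda>n. S (t n) x) \<longlonglongrightarrow> x"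
    proof (rule LIMSEQ_I)
      fix e :: real assume "e > 0"
      then obtain b where b: "b > 0" "\<forall>r. 0 \<le> r \<and> r < b \<longrightarrow> norm (S r x - x) < e"
        using C0_semigroup_near_0[OF assms] by blast
      obtain N where "\<forall>n\<ge>N. t n < b"
        using order_tendstoD(2)[OF t0 b(1)] by (auto simp: eventually_sequentially)
      then show "\<exists>N. \<forall>n\<ge>N. norm (S (t n) x - x) < e" using b t(1) by blast
    qed
    then show "Bseq (\<lambda>n. S (t n) x)" using convergent_imp_Bseq convergentI by blast
  qed blast
  note B = this
  obtain n :: nat where "B < n" using reals_Archimedean2 by blast
  then show False using t(3)[of n] B[of n] by linarith
qed

text \<open>Hilbert space arguments on a Banach space are carried out through an isometric embedding \<open>\<iota>\<close> into an
  inner product space, because the norm of \<open>D(A\<^sup>*)\<close> comes without an inner product on its type.\<close>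

lemma quadratic_nonneg_imp_0:
  fixes a b :: real
  assumes "\<And>t. 0 \<le> t\<^sup>2 * a + 2 * t * b" "0 \<le> a"
  shows "b = 0"
proof (rule ccontr)
  assume b: "b \<noteq> 0"
  define t where "t = - b / (a + 1)"
  have "t * (a + 1) = - b" using assms(2) by (simp add: t_def)
  then have "t\<^sup>2 * a + 2 * t * b = t\<^sup>2 * a - 2 * t * (t * (a + 1))" by simp
  also have "\<dots> = - t\<^sup>2 * (a + 2)" by (simp add: power2_eq_square algebra_simps)
  finally have "t\<^sup>2 * a + 2 * t * b = - t\<^sup>2 * (a + 2)" .
  moreover have "t \<noteq> 0" using b assms(2) by (simp add: t_def)
  then have "t\<^sup>2 * (a + 2) > 0" using assms(2) by simp
  ultimately show False using assms(1)[of t] by simp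
qed

text \<open>Variational proof: the minimiser \<open>u\<close> of
  \<open>\<Phi> v = (norm v)^2 - 2 f v\<close> represents \<open>f\<close>, which is the first order
  condition at \<open>u\<close>. Only completeness of the domain of \<iota> enters; the inner
  product space that contains the image may be incomplete.\<close>

lemma isometric_Riesz_representation:
  fixes \<iota> :: "'v::{real_normed_vector, complete_space} \<Rightarrow> 'e::real_inner" and f :: "'v \<Rightarrow> real"
  assumes \<iota>: "linear \<iota>" "\<And>v. norm (\<iota> v) = norm v" and f: "bounded_linear f"
  shows "\<exists>u. \<forall>v. inner (\<iota> u) (\<iota> v) = f v"
proof -
  interpret \<iota>: linear \<iota> by fact
  interpret f: bounded_linear f by fact
  obtain K where K: "K > 0" "\<And>v. norm (f v) \<le> norm v * K" using f.pos_bounded by blast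
  define \<Phi> where "\<Phi> v = (norm v)\<^sup>2 - 2 * f v" for v
  have \<Phi>_inner: "\<Phi> v = inner (\<iota> v) (\<iota> v) - 2 * f v" for v
    by (simp add: \<Phi>_def \<iota>(2) flip: power2_norm_eq_inner)
  have lower: "- K\<^sup>2 \<le> \<Phi> v" for v
  proof -
    have "2 * f v \<le> 2 * (norm v * K)" using K(2)[of v] by simp
    moreover have "0 \<le> (norm v - K)\<^sup>2" by simp
    ultimately show ?thesis by (simp add: \<Phi>_def power2_diff)
  qed
  define m where "m = Inf (range \<Phi>)"
  have m: "m \<le> \<Phi> v" for v
    unfolding m_def using lower by (intro cInf_lower bdd_belowI[of _ "- K\<^sup>2"]) auto
  have "\<exists>v. \<Phi> v < m + 1 / Suc n" for n
    using cInf_lessD[of "range \<Phi>" "m + 1 / Suc n"] unfolding m_def by auto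
  then obtain v where v: "\<And>n. \<Phi> (v n) < m + 1 / Suc n" by metis
  \<comment> \<open>Parallelogram law: the midpoint of \<open>a\<close> and \<open>b\<close> has
    value at least \<open>m\<close>, so two almost minimal points are close to each other. This
    makes a minimising sequence Cauchy.\<close>
  have par: "(norm (a - b))\<^sup>2 \<le> 2 * (\<Phi> a + \<Phi> b - 2 * m)" for a b
  proof -
    have "\<Phi> ((1/2) *\<^sub>R (a + b)) = \<Phi> a / 2 + \<Phi> b / 2 - (norm (a - b))\<^sup>2 / 4"
      unfolding \<Phi>_inner
      by (simp add: \<iota>.add \<iota>.diff \<iota>.scale f.add f.scaleR inner_add_left inner_add_right inner_diff_left
          inner_diff_right inner_commute field_simps power2_norm_eq_inner flip: \<iota>(2)[of "a - b"])
    with m[of "(1/2) *\<^sub>R (a + b)"] have "m \<le> \<Phi> a / 2 + \<Phi> b / 2 - (norm (a - b))\<^sup>2 / 4" by (simp only:)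
    then show ?thesis by argo
  qed
  have "Cauchy v"
  proof (rule metric_CauchyI)
    fix e :: real assume e: "e > 0"
    obtain N :: nat where N: "4 / e\<^sup>2 < N" using reals_Archimedean2 by blast
    have "dist (v p) (v q) < e" if "p \<ge> N" "q \<ge> N" for p q
    proof -
      have "1 / Suc p \<le> 1 / Suc N" "1 / Suc q \<le> 1 / Suc N" using that by (simp_all add: field_simps)
      then have "(norm (v p - v q))\<^sup>2 < 4 / Suc N" using par[of "v p" "v q"] v[of p] v[of q] by simp
      also have "\<dots> < e\<^sup>2"
      proof -
        have "4 < e\<^sup>2 * N" using N e by (simp add: field_simps)
        also have "\<dots> \<le> e\<^sup>2 * Suc N" by (intro mult_left_mono) auto
        finally show ?thesis by (simp add: field_simps)
      qed
      finally show ?thesis using e by (simp add: dist_norm power_less_imp_less_base)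
    qed
    then show "\<exists>M. \<forall>p\<ge>M. \<forall>q\<ge>M. dist (v p) (v q) < e" by blast
  qed
  then obtain u where u: "v \<longlonglongrightarrow> u" using Cauchy_convergent_iff convergent_def by blast
  have "(\<lambda>n. \<Phi> (v n)) \<longlonglongrightarrow> \<Phi> u" unfolding \<Phi>_def by (intro tendsto_intros f.tendsto u)
  moreover have "(\<lambda>n. m + 1 / real (Suc n)) \<longlonglongrightarrow> m + 0"
    by (intro tendsto_intros LIMSEQ_Suc[OF lim_1_over_n])
  ultimately have "\<Phi> u \<le> m + 0"
    by (rule LIMSEQ_le) (use v in \<open>auto intro: less_imp_le\<close>)
  then have min: "\<Phi> u \<le> \<Phi> w" for w using m[of w] by simp
  have "inner (\<iota> u) (\<iota> w) - f w = 0" for w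
  proof (rule quadratic_nonneg_imp_0[of "(norm w)\<^sup>2"])
    fix t
    have "\<Phi> (u + t *\<^sub>R w) = \<Phi> u + t\<^sup>2 * (norm w)\<^sup>2 + 2 * t * (inner (\<iota> u) (\<iota> w) - f w)"
      unfolding \<Phi>_inner
      by (simp add: \<iota>.add \<iota>.scale f.add f.scaleR inner_add_left inner_add_right
          inner_commute algebra_simps power2_eq_square flip: \<iota>(2)[of w])
         (simp add: dot_square_norm power2_eq_square)
    then show "0 \<le> t\<^sup>2 * (norm w)\<^sup>2 + 2 * t * (inner (\<iota> u) (\<iota> w) - f w)" using min[of "u + t *\<^sub>R w"] by simp
  qed simp
  then show ?thesis by auto
qed

text \<open>The averages \<open>(1/h) \<integral> S t x dt\<close> over \<open>[0, h]\<close> lie in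
  the domain and tend to \<open>x\<close>. The integral is taken weakly: \<open>X h\<close> is the
  Riesz representative of \<open>y \<mapsto> \<integral> inner (S t x) y dt\<close>, so that only
  real integrals occur, and norm bounds are recovered from bounds tested against every
  \<open>y\<close> (\<open>norm_leI\<close>). Density is what makes the adjoint of \<open>A\<close>
  single-valued.\<close>

lemma semigroup_generator_domain_dense:
  fixes S :: "real \<Rightarrow> 'h::{real_inner, complete_space} \<Rightarrow>\<^sub>L 'h"
  assumes S: "C0_semigroup S" and gen: "semigroup_generator S DA A"
  shows "closure DA = UNIV"
proof -
  obtain d K0 where d: "0 < d" and K0: "\<And>t. 0 \<le> t \<Longrightarrow> t \<le> d \<Longrightarrow> norm (S t) \<le> K0"
    using C0_semigroup_locally_bounded[OF S] by metis
  define K where "K = max K0 1"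
  have K: "norm (S t) \<le> K" if "0 \<le> t" "t \<le> d" for t using K0[OF that] by (simp add: K_def)
  have K1: "K \<ge> 1" by (simp add: K_def)
  have add: "S (t + r) x = S t (S r x)" if "0 \<le> t" "0 \<le> r" for t r x
    using S that by (simp add: C0_semigroup_def)
  have "x \<in> closure DA" for x
  proof -
    have cont: "continuous_on {0..d} (\<lambda>t. S t x)"
      unfolding continuous_on_iff
    proof (intro ballI allI impI)
      fix t e :: real assume t: "t \<in> {0..d}" and e: "0 < e"
      then obtain b where b: "b > 0" "\<And>r. 0 \<le> r \<Longrightarrow> r < b \<Longrightarrow> norm (S r x - x) < e / K"
        using C0_semigroup_near_0[OF S, of "e / K" x] K1 by auto
      have main: "norm (S u x - S v x) < e" if "0 \<le> v" "v \<le> u" "u \<le> d" "u - v < b" for u v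
      proof -
        have "S u x - S v x = S v (S (u - v) x - x)"
          using add[of v "u - v"] that by (simp add: blinfun.diff_right)
        then have "norm (S u x - S v x) \<le> norm (S v) * norm (S (u - v) x - x)"
          by (simp add: norm_blinfun)
        also have "\<dots> \<le> K * norm (S (u - v) x - x)"
          using K[of v] that by (intro mult_right_mono) auto
        also have "\<dots> < K * (e / K)"
          using b(2)[of "u - v"] that K1 by (intro mult_strict_left_mono) auto
        finally show ?thesis using K1 by simp
      qed
      have "dist (S u x) (S t x) < e" if "u \<in> {0..d}" "dist u t < b" for u
        using main[of t u] main[of u t] t that
        by (cases "t \<le> u") (auto simp: dist_norm norm_minus_commute)
      then show "\<exists>b>0. \<forall>u\<in>{0..d}. dist u t < b \<longrightarrow> dist (S u x) (S t x) < e" using b(1) by blast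
    qed
    have int: "(\<lambda>t. inner (S t x) y) integrable_on {a..b}" if "0 \<le> a" "b \<le> d" for a b y
      by (intro integrable_continuous_interval continuous_intros continuous_on_subset[OF cont]) (use that in auto)
    define \<phi> where "\<phi> y u = integral {0..u} (\<lambda>t. inner (S t x) y)" for y u
    have \<phi>_diff: "\<phi> y b - \<phi> y a = integral {a..b} (\<lambda>t. inner (S t x) y)" if "0 \<le> a" "a \<le> b" "b \<le> d" for a b y
      unfolding \<phi>_def using Henstock_Kurzweil_Integration.integral_combine[OF _ _ int[of 0 b y], of a] that by simp
    have est: "\<bar>\<phi> y (u + r) - \<phi> y u - r * inner (S u x) y\<bar> \<le> r * e * norm y"
      if u: "0 \<le> u" "0 \<le> r" "u + r \<le> d" and e: "\<And>t. u \<le> t \<Longrightarrow> t \<le> u + r \<Longrightarrow> norm (S t x - S u x) \<le> e"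
      for u r e y
    proof -
      have "((\<lambda>t. inner (S t x) y - inner (S u x) y) has_integral (\<phi> y (u + r) - \<phi> y u - r * inner (S u x) y)) {u..u + r}"
        using has_integral_diff[OF integrable_integral[OF int[of u "u + r" y]]
            has_integral_const_real[of "inner (S u x) y" u "u + r"]] u by (simp add: \<phi>_diff)
      moreover have "norm (inner (S t x) y - inner (S u x) y) \<le> e * norm y" if "t \<in> {u..u + r}" for t
        using Cauchy_Schwarz_ineq2[of "S t x - S u x" y] mult_right_mono[OF e norm_ge_zero[of y], of t] that
        by (simp add: inner_diff_left)
      moreover have "0 \<le> e" using e[of u] u by simp
      ultimately have "norm (\<phi> y (u + r) - \<phi> y u - r * inner (S u x) y) \<le> (e * norm y) * measure lborel {u..u + r}"
        by (intro has_integral_bound_real[where S = "{}"]) auto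
      then show ?thesis using u by (simp add: mult_ac)
    qed
    have near: "\<exists>b>0. \<forall>t. u \<le> t \<and> t \<le> u + b \<and> t \<le> d \<longrightarrow> norm (S t x - S u x) \<le> e"
      if u: "0 \<le> u" "u \<le> d" and "0 < e" for u e
    proof -
      obtain b where b: "b > 0" "\<And>t. t \<in> {0..d} \<Longrightarrow> dist t u < b \<Longrightarrow> dist (S t x) (S u x) < e"
        using cont u \<open>0 < e\<close> unfolding continuous_on_iff by (meson atLeastAtMost_iff)
      have "norm (S t x - S u x) \<le> e" if "u \<le> t" "t \<le> u + b / 2" "t \<le> d" for t
        using b(2)[of t] b(1) that u by (simp add: dist_norm)
      then show ?thesis using b(1) by (intro exI[of _ "b / 2"]) auto
    qed
    have "\<exists>xh. \<forall>y. inner xh y = \<phi> y h" if h: "0 \<le> h" "h \<le> d" for h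
    proof (rule isometric_Riesz_representation[where \<iota> = "\<lambda>x. x"])
      show "bounded_linear (\<lambda>y. \<phi> y h)"
      proof (rule bounded_linear_intro[where K = "h * (K * norm x)"])
        show "\<phi> (y + z) h = \<phi> y h + \<phi> z h" for y z
          unfolding \<phi>_def inner_add_right using h by (intro integral_add int) auto
        show "\<phi> (r *\<^sub>R y) h = r *\<^sub>R \<phi> y h" for r y by (simp add: \<phi>_def)
        fix y
        have le: "norm (S t x) \<le> K * norm x" if "0 \<le> t" "t \<le> d" for t
          using norm_blinfun[of "S t" x] mult_right_mono[OF K[OF that] norm_ge_zero[of x]] by linarith
        have "norm (\<phi> y h) \<le> (K * norm x * norm y) * measure lborel {0..h}"
          unfolding \<phi>_def
        proof (rule has_integral_bound_real[where S = "{}"])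
          show "((\<lambda>t. inner (S t x) y) has_integral integral {0..h} (\<lambda>t. inner (S t x) y)) {0..h}"
            using int[of 0 h y] h by (intro integrable_integral) auto
          show "norm (inner (S t x) y) \<le> K * norm x * norm y" if "t \<in> {0..h} - {}" for t
            using Cauchy_Schwarz_ineq2[of "S t x" y] mult_right_mono[OF le norm_ge_zero[of y], of t] that h by simp
        qed (use K1 in auto)
        then show "norm (\<phi> y h) \<le> norm y * (h * (K * norm x))" using h by (simp add: mult_ac)
      qed
    qed (auto intro: linear_ident)
    then obtain X where X: "\<And>h y. 0 \<le> h \<Longrightarrow> h \<le> d \<Longrightarrow> inner (X h) y = \<phi> y h" by metis
    \<comment> \<open>The adjoint of \<open>S r\<close>, needed because a weak integral commutes
      with \<open>S r\<close> only after \<open>S r\<close> has been moved onto the test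
      vector.\<close>
    have Ad_ex: "\<exists>u. \<forall>v. inner u v = inner y (S r v)" for y r
      by (rule isometric_Riesz_representation[where \<iota> = "\<lambda>x. x"])
        (auto intro: linear_ident bounded_linear_compose[OF bounded_linear_inner_right blinfun.bounded_linear_right])
    define Ad where "Ad r y = (SOME u. \<forall>v. inner u v = inner y (S r v))" for r y
    have Ad: "inner (Ad r y) v = inner y (S r v)" for r y v
      using someI_ex[OF Ad_ex[of y r]] by (simp add: Ad_def)
    have S0: "S 0 x = x" using S by (simp add: C0_semigroup_def)
    have norm_leI: "norm v \<le> c" if "\<And>y. \<bar>inner v y\<bar> \<le> c * norm y" "0 \<le> c" for v :: 'h and c
      using that(1)[of v] that(2)
      by (cases "v = 0") (simp_all add: power2_eq_square mult_le_cancel_right flip: power2_norm_eq_inner)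
    have dom: "X h /\<^sub>R h \<in> DA" if h: "0 < h" "h < d" for h
    proof -
      have shift: "inner (S r (X h)) y = \<phi> y (h + r) - \<phi> y r" if r: "0 \<le> r" "h + r \<le> d" for r y
      proof -
        have "inner (S r (X h)) y = \<phi> (Ad r y) h" using X[of h "Ad r y"] h Ad[of r y "X h"] by (simp add: inner_commute)
        also have "\<dots> = integral {0..h} (\<lambda>t. inner (S (t + r) x) y)"
          unfolding \<phi>_def
        proof (rule integral_cong)
          fix t assume "t \<in> {0..h}"
          then have "S (t + r) x = S r (S t x)" using add[of r t x] r by (simp add: add.commute)
          then show "inner (S t x) (Ad r y) = inner (S (t + r) x) y"
            using Ad[of r y "S t x"] by (simp add: inner_commute)
        qed
        also have "\<dots> = integral {0 + r..h + r} (\<lambda>t. inner (S t x) y)"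
          using integral_shift_Icc_real[of 0 h "\<lambda>t. inner (S t x) y" r] by (simp add: o_def add.commute)
        also have "\<dots> = \<phi> y (h + r) - \<phi> y r" using \<phi>_diff[of r "h + r" y] r h by simp
        finally show ?thesis .
      qed
      \<comment> \<open>Tested against \<open>y\<close>, the quotient is the average of
        \<open>inner (S t x) y\<close> over \<open>[h, h + r]\<close> minus its average over
        \<open>[0, r]\<close>, by \<open>shift\<close>. Both averages converge with an error
        proportional to \<open>norm y\<close>.\<close>
      have "((\<lambda>r. (S r (X h) - X h) /\<^sub>R r) \<longlongrightarrow> S h x - x) (at_right 0)"
      proof (rule tendstoI)
        fix e :: real assume e: "e > 0"
        then have e4: "e / 4 > 0" by simp
        obtain b where b: "b > 0" "\<And>t. h \<le> t \<Longrightarrow> t \<le> h + b \<Longrightarrow> t \<le> d \<Longrightarrow> norm (S t x - S h x) \<le> e / 4"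
          using near[of h, OF _ _ e4] h by auto
        obtain c where c: "c > 0" "\<And>t. 0 \<le> t \<Longrightarrow> t \<le> 0 + c \<Longrightarrow> t \<le> d \<Longrightarrow> norm (S t x - S 0 x) \<le> e / 4"
          using near[of 0, OF _ _ e4] d by auto
        have "dist ((S r (X h) - X h) /\<^sub>R r) (S h x - x) < e" if r: "0 < r" "r < Min {b, c, d - h}" for r
        proof -
          have r': "r < b" "r < c" "h + r < d" using r by auto
          have "norm (S r (X h) - X h - r *\<^sub>R (S h x - x)) \<le> r * (e / 4) + r * (e / 4)"
          proof (rule norm_leI)
            fix y
            have "inner (S r (X h) - X h - r *\<^sub>R (S h x - x)) y =
              (\<phi> y (h + r) - \<phi> y h - r * inner (S h x) y) - (\<phi> y (0 + r) - \<phi> y 0 - r * inner (S 0 x) y)"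
              using shift[of r y] X[of h y] h r r'
              by (simp add: inner_diff_left S0 algebra_simps) (simp add: \<phi>_def)
            moreover have "\<bar>\<phi> y (h + r) - \<phi> y h - r * inner (S h x) y\<bar> \<le> r * (e / 4) * norm y"
              using r r' h by (intro est b(2)) auto
            moreover have "\<bar>\<phi> y (0 + r) - \<phi> y 0 - r * inner (S 0 x) y\<bar> \<le> r * (e / 4) * norm y"
              using r r' h by (intro est c(2)) auto
            ultimately show "\<bar>inner (S r (X h) - X h - r *\<^sub>R (S h x - x)) y\<bar> \<le> (r * (e / 4) + r * (e / 4)) * norm y"
              unfolding distrib_right by linarith
          qed (use e r in simp)
          moreover have "(S r (X h) - X h) /\<^sub>R r - (S h x - x) = (S r (X h) - X h - r *\<^sub>R (S h x - x)) /\<^sub>R r"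
            using r by (simp add: scaleR_diff_right)
          then have "dist ((S r (X h) - X h) /\<^sub>R r) (S h x - x) = norm (S r (X h) - X h - r *\<^sub>R (S h x - x)) / r"
            using r by (simp add: dist_norm divide_inverse mult.commute)
          ultimately have "dist ((S r (X h) - X h) /\<^sub>R r) (S h x - x) \<le> (r * (e / 4) + r * (e / 4)) / r"
            using r by (simp only: divide_right_mono)
          also have "\<dots> < e" using r e by (simp add: field_simps)
          finally show ?thesis .
        qed
        then show "\<forall>\<^sub>F r in at_right 0. dist ((S r (X h) - X h) /\<^sub>R r) (S h x - x) < e"
          unfolding eventually_at_right_field using b(1) c(1) h by (intro exI[of _ "Min {b, c, d - h}"]) auto
      qed
      then have "((\<lambda>r. (1 / h) *\<^sub>R ((S r (X h) - X h) /\<^sub>R r)) \<longlongrightarrow> (1 / h) *\<^sub>R (S h x - x)) (at_right 0)"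
        by (intro tendsto_intros)
      then have "((\<lambda>r. (S r (X h /\<^sub>R h) - X h /\<^sub>R h) /\<^sub>R r) \<longlongrightarrow> (1 / h) *\<^sub>R (S h x - x)) (at_right 0)"
        by (simp add: blinfun.scaleR_right scaleR_diff_right mult.commute divide_inverse)
      then show ?thesis using gen unfolding semigroup_generator_def by blast
    qed
    show ?thesis
      unfolding closure_approachable
    proof (intro allI impI)
      fix e :: real assume e: "e > 0"
      obtain c where c: "c > 0" "\<And>t. 0 \<le> t \<Longrightarrow> t \<le> 0 + c \<Longrightarrow> t \<le> d \<Longrightarrow> norm (S t x - S 0 x) \<le> e / 2"
        using near[of 0 "e / 2"] d e by auto
      define h where "h = min c d / 2"
      have h: "0 < h" "h < d" "h \<le> c" using c d by (auto simp: h_def)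
      have "norm (X h - h *\<^sub>R x) \<le> h * (e / 2)"
      proof (rule norm_leI)
        fix y
        have "\<bar>\<phi> y (0 + h) - \<phi> y 0 - h * inner (S 0 x) y\<bar> \<le> h * (e / 2) * norm y"
          using h by (intro est c(2)) auto
        then show "\<bar>inner (X h - h *\<^sub>R x) y\<bar> \<le> h * (e / 2) * norm y"
          using X[of h y] h by (simp add: inner_diff_left S0) (simp add: \<phi>_def)
      qed (use e h in simp)
      moreover have "X h /\<^sub>R h - x = (X h - h *\<^sub>R x) /\<^sub>R h" using h by (simp add: scaleR_diff_right)
      then have "dist (X h /\<^sub>R h) x = norm (X h - h *\<^sub>R x) / h" using h by (simp add: dist_norm divide_inverse mult.commute)
      ultimately have "dist (X h /\<^sub>R h) x \<le> (h * (e / 2)) / h" using h by (simp only: divide_right_mono)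
      also have "\<dots> < e" using h e by simp
      finally show "\<exists>y\<in>DA. dist y x < e" using dom h by blast
    qed
  qed
  then show ?thesis by blast
qed

section \<open>Finite rank approximations of the identity\<close>

text \<open>With \<open>b\<^sub>k = \<parallel>B\<^sup>k x\<parallel>\<^sup>2\<close>, self-adjointness gives \<open>\<parallel>B\<^sup>2\<^sup>n x - B\<^sup>2\<^sup>m x\<parallel>\<^sup>2 = b\<^sub>2\<^sub>n + b\<^sub>2\<^sub>m - 2 b\<^sub>n\<^sub>+\<^sub>m\<close>, and \<open>b\<close>
  decreases, so the even powers of \<open>B = 1 - T\<close> converge strongly to a vector in the kernel of \<open>T\<close>.\<close>

lemma isometric_even_iterates:
  fixes \<iota> :: "'v::{real_normed_vector, complete_space} \<Rightarrow> 'e::real_inner" and T :: "'v \<Rightarrow> 'v"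
  assumes \<iota>: "linear \<iota>" "\<And>v. norm (\<iota> v) = norm v" and T: "linear T"
    and sym: "\<And>x y. inner (\<iota> (T x)) (\<iota> y) = inner (\<iota> x) (\<iota> (T y))"
    and pos: "\<And>x. (norm (T x))\<^sup>2 \<le> inner (\<iota> (T x)) (\<iota> x)"
  defines "B \<equiv> \<lambda>x. x - T x"
  shows "norm ((B ^^ k) x) \<le> norm x"
    and "inner (\<iota> ((B ^^ k) x)) (\<iota> y) = inner (\<iota> x) (\<iota> ((B ^^ k) y))"
    and "\<exists>y. (\<lambda>n. (B ^^ (2 * n)) x) \<longlonglongrightarrow> y \<and> T y = 0"
proof -
  interpret \<iota>: linear \<iota> by fact
  interpret T: linear T by fact
  have sq: "(norm v)\<^sup>2 = inner (\<iota> v) (\<iota> v)" for v by (simp add: \<iota>(2) flip: power2_norm_eq_inner)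
  have symB: "inner (\<iota> (B x)) (\<iota> y) = inner (\<iota> x) (\<iota> (B y))" for x y
    by (simp add: B_def \<iota>.diff inner_diff_left inner_diff_right sym)
  show symBk: "inner (\<iota> ((B ^^ k) x)) (\<iota> y) = inner (\<iota> x) (\<iota> ((B ^^ k) y))" for k x y
    by (induction k arbitrary: y) (simp_all add: symB, simp add: funpow_swap1)
  have contr: "norm (B x) \<le> norm x" for x
  proof -
    have "(norm (B x))\<^sup>2 = (norm x)\<^sup>2 - 2 * inner (\<iota> (T x)) (\<iota> x) + (norm (T x))\<^sup>2"
      by (simp add: sq B_def \<iota>.diff inner_diff_left inner_diff_right inner_commute)
    also have "\<dots> \<le> (norm x)\<^sup>2"
    proof -
      have "0 \<le> (norm (T x))\<^sup>2" by simp
      then show ?thesis using pos[of x] by argo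
    qed
    finally show ?thesis by (rule power2_le_imp_le) simp
  qed
  show contrk: "norm ((B ^^ k) x) \<le> norm x" for k x
    by (induction k) (auto intro: order_trans[OF contr])
  define a where "a k = (norm ((B ^^ k) x))\<^sup>2" for k
  have "decseq a" unfolding a_def decseq_Suc_iff by (simp add: contr power_mono)
  then obtain L where L: "a \<longlonglongrightarrow> L" using decseq_convergent[of a 0] by (auto simp: a_def)
  have diff: "(norm ((B ^^ (2 * n)) x - (B ^^ (2 * m)) x))\<^sup>2 = a (2 * n) + a (2 * m) - 2 * a (n + m)" for n m
  proof -
    have "inner (\<iota> ((B ^^ (2 * n)) x)) (\<iota> ((B ^^ (2 * m)) x)) = inner (\<iota> x) (\<iota> ((B ^^ (2 * n + 2 * m)) x))"
      by (simp add: symBk funpow_add)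
    also have "2 * n + 2 * m = (n + m) + (n + m)" by simp
    also have "inner (\<iota> x) (\<iota> ((B ^^ ((n + m) + (n + m))) x)) = a (n + m)"
      unfolding funpow_add[of "n + m"] o_apply by (simp add: a_def sq symBk)
    finally show ?thesis
      by (simp add: sq a_def \<iota>.diff inner_diff_left inner_diff_right inner_commute)
  qed
  have "Cauchy (\<lambda>n. (B ^^ (2 * n)) x)"
  proof (rule metric_CauchyI)
    fix e :: real assume e: "e > 0"
    then have e4: "e\<^sup>2 / 4 > 0" by simp
    obtain N where N: "\<And>n. n \<ge> N \<Longrightarrow> \<bar>a n - L\<bar> < e\<^sup>2 / 4"
      using LIMSEQ_D[OF L e4] by auto
    have "dist ((B ^^ (2 * p)) x) ((B ^^ (2 * q)) x) < e" if "p \<ge> N" "q \<ge> N" for p q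
    proof -
      have "(norm ((B ^^ (2 * p)) x - (B ^^ (2 * q)) x))\<^sup>2 < e\<^sup>2"
      proof -
        have "\<bar>a (2 * p) - L\<bar> < e\<^sup>2 / 4" "\<bar>a (2 * q) - L\<bar> < e\<^sup>2 / 4" "\<bar>a (p + q) - L\<bar> < e\<^sup>2 / 4"
          by (rule N, use that in simp)+
        then show ?thesis unfolding diff abs_less_iff by argo
      qed
      then show ?thesis using e by (simp add: dist_norm power_less_imp_less_base)
    qed
    then show "\<exists>M. \<forall>p\<ge>M. \<forall>q\<ge>M. dist ((B ^^ (2 * p)) x) ((B ^^ (2 * q)) x) < e" by blast
  qed
  then obtain y where y: "(\<lambda>n. (B ^^ (2 * n)) x) \<longlonglongrightarrow> y" using Cauchy_convergent_iff convergent_def by blast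
  have blB: "bounded_linear B"
  proof (rule bounded_linear_intro[where K = 1])
    show "B (x + y) = B x + B y" for x y unfolding B_def T.add by simp
    show "B (r *\<^sub>R x) = r *\<^sub>R B x" for r x unfolding B_def T.scale by (rule scaleR_diff_right[symmetric])
    show "norm (B x) \<le> norm x * 1" for x using contr[of x] by simp
  qed
  have "(\<lambda>n. B (B ((B ^^ (2 * n)) x))) \<longlonglongrightarrow> B (B y)"
    by (rule bounded_linear.tendsto[OF blB bounded_linear.tendsto[OF blB y]])
  moreover have "(\<lambda>n. B (B ((B ^^ (2 * n)) x))) \<longlonglongrightarrow> y"
    using LIMSEQ_Suc[OF y] by (simp only: mult_Suc_right add_2_eq_Suc funpow.simps o_apply)
  ultimately have "B (B y) = y" by (rule LIMSEQ_unique)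
  \<comment> \<open>The limit of even powers is only known to be fixed by the square of
    \<open>B\<close>. Pairing the resulting \<open>T (T y) = 2 T y\<close> with \<open>y\<close>
    gives \<open>(norm (T y))^2 = 2 inner (T y) y\<close> inside the embedding, and this is at least
    \<open>2 (norm (T y))^2\<close> by \<open>pos\<close>.\<close>
  then have "T (T y) = 2 *\<^sub>R T y" by (simp add: B_def T.diff scaleR_2 algebra_simps)
  then have "inner (\<iota> (T y)) (\<iota> (T y)) = 2 * inner (\<iota> (T y)) (\<iota> y)"
    using sym[of "T y" y] by (simp add: \<iota>.scale)
  then have "(norm (T y))\<^sup>2 \<le> 0" using pos[of y] sq[of "T y"] by simp
  then have "T y = 0" by simp
  with y show "\<exists>y. (\<lambda>n. (B ^^ (2 * n)) x) \<longlonglongrightarrow> y \<and> T y = 0" by blast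
qed

text \<open>For a finite set \<open>C\<close> of pairwise orthogonal vectors this is the orthogonal
  projection onto \<open>span C\<close>. The vectors are not normalised, and a zero vector in
  \<open>C\<close> contributes nothing.\<close>

definition orth_sum_proj :: "'h::real_inner set \<Rightarrow> 'h \<Rightarrow> 'h" where
  "orth_sum_proj C x = (\<Sum>c\<in>C. (inner c x / inner c c) *\<^sub>R c)"

lemma orth_sum_proj:
  assumes "finite C" "pairwise orthogonal C"
  shows "linear (orth_sum_proj C)" "norm (orth_sum_proj C x) \<le> norm x"
    and "v \<in> span C \<Longrightarrow> orth_sum_proj C v = v"
    and "inner (orth_sum_proj C x) y = inner x (orth_sum_proj C y)"
proof -
  let ?P = "orth_sum_proj C"
  show lin: "linear ?P"
    unfolding orth_sum_proj_def
    by (intro linear_compose_sum linearI ballI)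
       (simp_all add: inner_add_right add_divide_distrib scaleR_add_left)
  show sym: "inner (?P x) y = inner x (?P y)" for x y
    unfolding orth_sum_proj_def inner_sum_left inner_sum_right
    by (rule sum.cong) (auto simp: inner_commute)
  have Pc: "?P c = c" if "c \<in> C" for c
  proof -
    have "?P c = (\<Sum>c'\<in>C. if c' = c then c else 0)"
      unfolding orth_sum_proj_def
      by (rule sum.cong) (use assms(2) that in \<open>auto simp: pairwise_def orthogonal_def\<close>)
    then show ?thesis using assms(1) that by simp
  qed
  show Pv: "?P v = v" if "v \<in> span C" for v
    using that
  proof (induction rule: span_induct_alt)
    case base show ?case using linear_0[OF lin] .
  next
    case (step c x y) then show ?case by (simp add: linear_add[OF lin] linear_cmul[OF lin] Pc)
  qed
  have "?P x \<in> span C" for x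
    unfolding orth_sum_proj_def by (intro span_sum span_scale span_base)
  then have idem: "?P (?P x) = ?P x" for x by (rule Pv)
  have "(norm (?P x))\<^sup>2 = inner (?P x) x" using sym[of "?P x" x] by (simp add: power2_norm_eq_inner idem)
  also have "\<dots> \<le> norm (?P x) * norm x" by (rule norm_cauchy_schwarz)
  finally show "norm (?P x) \<le> norm x"
    by (cases "?P x = 0") (simp_all add: power2_eq_square mult_le_cancel_left)
qed

text \<open>Gram-Schmidt applied to the first \<open>N\<close> points of a countable dense set. The
  projections are contractions, and each dense point is eventually fixed by them, which gives strong
  convergence on the whole space.\<close>

lemma finite_orth_projections:
  obtains C :: "nat \<Rightarrow> 'h::{real_inner, second_countable_topology} set"
  where "\<And>N. finite (C N)" "\<And>N. pairwise orthogonal (C N)" "\<And>x. (\<lambda>N. orth_sum_proj (C N) x) \<longlonglongrightarrow> x"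
proof -
  obtain D :: "'h set" where D: "countable D" "\<And>X. open X \<Longrightarrow> X \<noteq> {} \<Longrightarrow> \<exists>d\<in>D. d \<in> X"
    using countable_dense_setE by metis
  have "D \<noteq> {}" using D(2)[of UNIV] by auto
  define d where "d = from_nat_into D"
  have "\<exists>C. finite C \<and> span C = span (d ` {..<N}) \<and> pairwise orthogonal C" for N
    using basis_orthogonal[of "d ` {..<N}"] by auto
  then obtain C where C: "\<And>N. finite (C N)" "\<And>N. span (C N) = span (d ` {..<N})" "\<And>N. pairwise orthogonal (C N)"
    by metis
  note P = orth_sum_proj[OF C(1) C(3)]
  have "(\<lambda>N. orth_sum_proj (C N) x) \<longlonglongrightarrow> x" for x
  proof (rule metric_LIMSEQ_I)
    fix e :: real assume e: "e > 0"
    then obtain y where "y \<in> D" "y \<in> ball x (e / 2)" using D(2)[of "ball x (e / 2)"] by auto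
    then obtain i where i: "dist (d i) x < e / 2"
      unfolding d_def using D(1) by (metis dist_commute from_nat_into_surj mem_ball)
    have "dist (orth_sum_proj (C N) x) x < e" if "N \<ge> Suc i" for N
    proof -
      have "d i \<in> span (C N)" unfolding C(2) using that by (intro span_base) auto
      then have eq: "orth_sum_proj (C N) x - x = orth_sum_proj (C N) (x - d i) - (x - d i)"
        using P(3)[of "d i" N] by (simp add: linear_diff[OF P(1)])
      have "dist (orth_sum_proj (C N) x) x \<le> norm (orth_sum_proj (C N) (x - d i)) + norm (x - d i)"
        unfolding dist_norm eq by (rule norm_triangle_ineq4)
      also have "\<dots> \<le> norm (x - d i) + norm (x - d i)" by (intro add_right_mono P(2))
      also have "\<dots> < e" using i by (simp add: dist_norm norm_minus_commute)
      finally show ?thesis .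
    qed
    then show "\<exists>no. \<forall>n\<ge>no. dist (orth_sum_proj (C n) x) x < e" by blast
  qed
  with C show ?thesis by (intro that)
qed

definition finite_rank_through ::
  "('d \<Rightarrow> 'h::real_inner) \<Rightarrow> ('h \<Rightarrow>\<^sub>L 'h) \<Rightarrow> bool" where
  "finite_rank_through j Q \<longleftrightarrow> (\<exists>C d. finite C \<and> (\<forall>x. Q x = (\<Sum>c\<in>C. inner (j (d c)) x *\<^sub>R c)))"

definition dual_pair :: "('d::real_normed_vector \<Rightarrow> 'h::real_inner) \<Rightarrow> ('h \<Rightarrow>\<^sub>L 'h) \<Rightarrow> ('d \<Rightarrow>\<^sub>L 'd) \<Rightarrow> bool" where
  "dual_pair j Q Q' \<longleftrightarrow> (\<forall>z x. inner (j z) (Q x) = inner (j (Q' z)) x)"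

text \<open>The operators \<open>U n\<close> are the Landweber iterates \<open>(\<Sum>k<n. js (1 - j js)\<^sup>k)\<close> for the equation \<open>j u = x\<close>,
  where \<open>js\<close> is the adjoint of \<open>j\<close>.\<close>

lemma finite_rank_approximation:
  fixes j :: "'d::banach \<Rightarrow> 'h::{real_inner, complete_space, second_countable_topology}"
    and \<iota> :: "'d \<Rightarrow> 'e::real_inner"
  assumes j: "linear j" "inj j" "\<And>v. norm (j v) \<le> norm v" and \<iota>: "linear \<iota>" "\<And>v. norm (\<iota> v) = norm v"
  obtains P :: "'h \<Rightarrow>\<^sub>L 'h" and S S' Q Q' and K :: "nat \<Rightarrow> real" where
    "\<And>z x. inner (j z) (P x) = inner (j z) x"
    "\<And>n. dual_pair j (S n) (S' n)" "\<And>n. norm (S n) \<le> 2" "\<And>n. norm (S' n) \<le> 2"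
    "\<And>x. (\<lambda>n. S n x) \<longlonglongrightarrow> P x" "\<And>z. (\<lambda>n. S' n z) \<longlonglongrightarrow> z"
    "\<And>n N. dual_pair j (Q n N) (Q' n N)" "\<And>n N. norm (Q n N) \<le> K n" "\<And>n N. norm (Q' n N) \<le> K n"
    "\<And>n x. (\<lambda>N. Q n N x) \<longlonglongrightarrow> S n x" "\<And>n z. (\<lambda>N. Q' n N z) \<longlonglongrightarrow> S' n z"
    "\<And>n N. finite_rank_through j (Q n N)"
proof -
  interpret j: linear j by fact
  interpret \<iota>: linear \<iota> by fact
  have blj: "bounded_linear j" by (rule bounded_linear_intro[where K = 1]) (auto simp: j.add j.scale j(3))
  have "\<exists>u. \<forall>v. inner (\<iota> u) (\<iota> v) = inner x (j v)" for x
    by (rule isometric_Riesz_representation[OF \<iota>])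
      (rule bounded_linear_compose[OF bounded_linear_inner_right blj])
  then obtain js where js: "\<And>x v. inner (\<iota> (js x)) (\<iota> v) = inner x (j v)" by metis
  have \<iota>_eqI: "a = b" if "\<And>v. inner (\<iota> a) (\<iota> v) = inner (\<iota> b) (\<iota> v)" for a b
  proof -
    have "inner (\<iota> (a - b)) (\<iota> (a - b)) = 0" using that[of "a - b"] by (simp add: \<iota>.diff inner_diff_left)
    then show ?thesis using \<iota>(2)[of "a - b"] by simp
  qed
  have js_norm: "norm (js x) \<le> norm x" for x
  proof -
    have "(norm (js x))\<^sup>2 = inner (\<iota> (js x)) (\<iota> (js x))" by (simp add: \<iota>(2) flip: power2_norm_eq_inner)
    also have "\<dots> \<le> norm x * norm (j (js x))" unfolding js by (rule norm_cauchy_schwarz)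
    also have "\<dots> \<le> norm x * norm (js x)" by (intro mult_left_mono j) auto
    finally show ?thesis by (cases "js x = 0") (simp_all add: power2_eq_square mult_le_cancel_right)
  qed
  have bljs: "bounded_linear js"
    by (rule bounded_linear_intro[where K = 1], (rule \<iota>_eqI, simp add: \<iota>.add \<iota>.scale inner_add_left js)+)
      (simp add: js_norm)
  interpret js: bounded_linear js by fact
  define J where "J = Blinfun j"
  define JS where "JS = Blinfun js"
  have [simp]: "blinfun_apply J = j" "blinfun_apply JS = js"
    using blj bljs by (simp_all add: J_def JS_def bounded_linear_Blinfun_apply)
  define TH where "TH x = j (js x)" for x
  define TV where "TV z = js (j z)" for z
  define BH where "BH x = x - TH x" for x
  define BV where "BV z = z - TV z" for z
  have linT: "linear TH" "linear TV"
    by (auto intro!: linearI simp: TH_def TV_def j.add j.scale js.add js.scaleR)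
  have symH: "inner (TH x) y = inner x (TH y)" for x y
    using js[of x "js y"] js[of y "js x"] by (simp add: TH_def inner_commute)
  have posH: "(norm (TH x))\<^sup>2 \<le> inner (TH x) x" for x
  proof -
    have "(norm (TH x))\<^sup>2 \<le> (norm (js x))\<^sup>2" unfolding TH_def by (intro power_mono j) auto
    also have "\<dots> = inner (TH x) x" using js[of x "js x"]
      by (simp add: TH_def inner_commute \<iota>(2) flip: power2_norm_eq_inner)
    finally show ?thesis .
  qed
  have symV: "inner (\<iota> (TV x)) (\<iota> y) = inner (\<iota> x) (\<iota> (TV y))" for x y
    using js[of "j x" y] js[of "j y" x] by (simp add: TV_def inner_commute)
  have posV: "(norm (TV x))\<^sup>2 \<le> inner (\<iota> (TV x)) (\<iota> x)" for x
    using power_mono[OF js_norm[of "j x"], of 2] by (simp add: TV_def js power2_norm_eq_inner)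
  have BH_eq: "(\<lambda>x. x - TH x) = BH" and BV_eq: "(\<lambda>x. x - TV x) = BV" by (simp_all add: BH_def BV_def fun_eq_iff)
  note itH = isometric_even_iterates[where \<iota> = "\<lambda>x. x" and T = TH, OF linear_ident HOL.refl linT(1) symH posH, unfolded BH_eq]
  note itV = isometric_even_iterates[where \<iota> = \<iota> and T = TV, OF \<iota> linT(2) symV posV, unfolded BV_eq]
  define U where "U = rec_nat (0 :: 'h \<Rightarrow>\<^sub>L 'd) (\<lambda>n u. u + (JS o\<^sub>L (id_blinfun - (J o\<^sub>L u))))"
  have U0: "U 0 = 0" and USuc: "U (Suc n) = U n + (JS o\<^sub>L (id_blinfun - (J o\<^sub>L U n)))" for n by (simp_all add: U_def)
  have UH: "j (U n x) = x - (BH ^^ n) x" for n x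
    by (induction n) (simp_all add: U0 USuc blinfun.add_left blinfun.diff_left j.zero j.add BH_def TH_def)
  have BVz: "BV z = z - js (j z)" for z by (simp add: BV_def TV_def)
  have UV: "U n (j z) = z - (BV ^^ n) z" for n z
  proof (induction n)
    case (Suc n)
    then have "U (Suc n) (j z) = z - (BV ^^ n) z + js (j z - j (z - (BV ^^ n) z))"
      by (simp add: USuc blinfun.add_left blinfun.diff_left)
    also have "j z - j (z - (BV ^^ n) z) = j ((BV ^^ n) z)" by (simp add: j.diff)
    also have "z - (BV ^^ n) z + js (j ((BV ^^ n) z)) = z - BV ((BV ^^ n) z)" by (simp only: BVz) simp
    finally show ?case by (simp only: funpow.simps o_apply)
  next
    case 0
    show ?case by (simp only: U0 zero_blinfun.rep_eq funpow.simps id_apply) simp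
  qed
  \<comment> \<open>The index is doubled because only even powers of \<open>BH\<close> and
    \<open>BV\<close> are known to converge. The two operators are the same iterate composed with
    \<open>j\<close> on either side, so \<open>S n (j z) = j (S' n z)\<close>; with the symmetry of
    \<open>S n\<close> this is the duality of the pair.\<close>
  define S where "S n = J o\<^sub>L U (2 * n)" for n
  define S' where "S' n = U (2 * n) o\<^sub>L J" for n
  have S: "S n x = x - (BH ^^ (2 * n)) x" for n x by (simp add: S_def UH)
  have S': "S' n x = x - (BV ^^ (2 * n)) x" for n x by (simp add: S'_def UV)
  have symS: "inner (S n x) y = inner x (S n y)" for n x y
    by (simp add: S inner_diff_left inner_diff_right itH(2))
  have normS: "norm (S n) \<le> 2" for n
  proof (rule norm_blinfun_bound)
    show "norm (S n x) \<le> 2 * norm x" for x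
      using norm_triangle_ineq4[of x "(BH ^^ (2 * n)) x"] itH(1)[of "2 * n" x] by (simp add: S)
  qed simp
  have normS': "norm (S' n) \<le> 2" for n
  proof (rule norm_blinfun_bound)
    show "norm (S' n x) \<le> 2 * norm x" for x
      using norm_triangle_ineq4[of x "(BV ^^ (2 * n)) x"] itV(1)[of "2 * n" x] by (simp add: S')
  qed simp
  obtain R where R: "\<And>x. (\<lambda>n. (BH ^^ (2 * n)) x) \<longlonglongrightarrow> R x" "\<And>x. TH (R x) = 0"
    using itH(3) by metis
  have SR: "(\<lambda>n. S n x) \<longlonglongrightarrow> x - R x" for x unfolding S by (intro tendsto_intros R)
  have "bounded_linear (\<lambda>x. x - R x)"
  proof (rule bounded_linear_intro[where K = 2])
    fix x y and r :: real
    show "x + y - R (x + y) = x - R x + (y - R y)"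
      by (rule LIMSEQ_unique[OF SR[of "x + y"]]) (simp only: blinfun.add_right, intro tendsto_add SR)
    show "r *\<^sub>R x - R (r *\<^sub>R x) = r *\<^sub>R (x - R x)"
      by (rule LIMSEQ_unique[OF SR[of "r *\<^sub>R x"]]) (simp only: blinfun.scaleR_right, intro tendsto_intros SR)
    have le: "norm (S n x) \<le> norm x * 2" for n
      using order_trans[OF norm_blinfun[of "S n" x] mult_right_mono[OF normS norm_ge_zero]] by (simp add: mult.commute)
    show "norm (x - R x) \<le> norm x * 2"
      by (rule LIMSEQ_le_const2[OF tendsto_norm[OF SR]]) (use le in blast)
  qed
  then have P: "blinfun_apply (Blinfun (\<lambda>x. x - R x)) = (\<lambda>x. x - R x)" by (rule bounded_linear_Blinfun_apply)
  \<comment> \<open>The vector removed by the limit operator lies in the kernel of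
    \<open>j js\<close>, hence of \<open>js\<close>, and is therefore orthogonal to the range of
    \<open>j\<close>.\<close>
  have jsR: "js (R x) = 0" for x
  proof -
    have "inner (\<iota> (js (R x))) (\<iota> (js (R x))) = 0" using R(2)[of x] by (simp add: js TH_def)
    then show ?thesis using \<iota>(2)[of "js (R x)"] by simp
  qed
  have jR: "inner (j z) (R x) = 0" for z x
    using js[of "R x" z] by (simp add: jsR \<iota>.zero inner_commute)
  have S'lim: "(\<lambda>n. S' n z) \<longlonglongrightarrow> z" for z
  proof -
    obtain y where y: "(\<lambda>n. (BV ^^ (2 * n)) z) \<longlonglongrightarrow> y" "TV y = 0" using itV(3) by blast
    have "inner (j y) (j y) = 0" using js[of "j y" y] y(2) by (simp add: TV_def \<iota>.zero)
    then have "y = 0" using j(2) j.zero by (metis inner_eq_zero_iff injD)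
    then show ?thesis unfolding S' using tendsto_diff[OF tendsto_const y(1), of z] by simp
  qed
  obtain C :: "nat \<Rightarrow> 'h set" where C: "\<And>N. finite (C N)" "\<And>N. pairwise orthogonal (C N)"
    "\<And>x. (\<lambda>N. orth_sum_proj (C N) x) \<longlonglongrightarrow> x" using finite_orth_projections[where ?'h = 'h] by metis
  note pr = orth_sum_proj[OF C(1,2)]
  define E where "E N = Blinfun (orth_sum_proj (C N))" for N
  have E: "blinfun_apply (E N) = orth_sum_proj (C N)" for N
    unfolding E_def
    by (intro bounded_linear_Blinfun_apply bounded_linear_intro[where K = 1])
       (simp_all add: linear_add[OF pr(1)] linear_cmul[OF pr(1)] pr(2))
  have normE: "norm (E N) \<le> 1" for N by (rule norm_blinfun_bound) (simp_all add: E pr(2))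
  define Q where "Q n N = E N o\<^sub>L S n" for n N
  define Q' where "Q' n N = U (2 * n) o\<^sub>L E N o\<^sub>L J" for n N
  have "norm J \<le> 1" by (rule norm_blinfun_bound) (simp_all add: j(3))
  have normQ: "norm (Q n N) \<le> max 2 (norm (U (2 * n)))" for n N
  proof -
    have "norm (Q n N) \<le> norm (E N) * norm (S n)" unfolding Q_def by (rule norm_blinfun_compose)
    also have "\<dots> \<le> 1 * 2" by (intro mult_mono normE normS) auto
    finally show ?thesis by simp
  qed
  have normQ': "norm (Q' n N) \<le> max 2 (norm (U (2 * n)))" for n N
  proof -
    have "norm (Q' n N) \<le> norm (U (2 * n) o\<^sub>L E N) * norm J" unfolding Q'_def by (rule norm_blinfun_compose)
    also have "\<dots> \<le> (norm (U (2 * n)) * norm (E N)) * 1"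
      by (intro mult_mono norm_blinfun_compose \<open>norm J \<le> 1\<close>) auto
    also have "\<dots> \<le> norm (U (2 * n)) * 1"
      using mult_left_mono[OF normE, of "norm (U (2 * n))" N] by simp
    finally show ?thesis by simp
  qed
  show ?thesis
  proof (rule that[where P = "Blinfun (\<lambda>x. x - R x)" and S = S and S' = S' and Q = Q and Q' = Q'
        and K = "\<lambda>n. max 2 (norm (U (2 * n)))"])
    show "inner (j z) (Blinfun (\<lambda>x. x - R x) x) = inner (j z) x" for z x
      by (simp add: P inner_diff_right jR)
    have S_j: "S n (j z) = j (S' n z)" for n z by (simp add: S_def S'_def)
    show "dual_pair j (S n) (S' n)" for n
      unfolding dual_pair_def S_j[symmetric] by (simp only: symS) simp
    show "(\<lambda>n. S n x) \<longlonglongrightarrow> Blinfun (\<lambda>x. x - R x) x" for x using SR by (simp add: P)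
    show "dual_pair j (Q n N) (Q' n N)" for n N
    proof -
      have "inner (j z) (Q n N x) = inner (S n (orth_sum_proj (C N) (j z))) x" for z x
        by (simp add: Q_def E symS flip: pr(4))
      then show ?thesis by (simp add: dual_pair_def Q'_def S_def E)
    qed
    show "(\<lambda>N. Q n N x) \<longlonglongrightarrow> S n x" for n x by (simp add: Q_def E C)
    show "(\<lambda>N. Q' n N z) \<longlonglongrightarrow> S' n z" for n z
      by (simp add: Q'_def S'_def E) (intro blinfun.tendsto tendsto_const C)
    show "finite_rank_through j (Q n N)" for n N
      unfolding finite_rank_through_def
    proof (intro exI conjI allI)
      fix x
      \<comment> \<open>Symmetry moves \<open>S n = j U\<close> from \<open>x\<close> onto
        \<open>c\<close>, which exhibits each coefficient of the projection as a functional from the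
        range of \<open>j\<close>.\<close>
      have "inner c (S n x) = inner (j (U (2 * n) c)) x" for c
        using symS[of n c x] by (simp add: S_def)
      then have "inner c (S n x) / inner c c = inner (j ((1 / inner c c) *\<^sub>R U (2 * n) c)) x" for c
        by (simp only: j.scale inner_scaleR_left) simp
      then show "Q n N x = (\<Sum>c\<in>C N. inner (j ((1 / inner c c) *\<^sub>R U (2 * n) c)) x *\<^sub>R c)"
        by (simp only: Q_def blinfun_apply_blinfun_compose E orth_sum_proj_def)
    qed (rule C)
  qed (fact normS normS' S'lim normQ normQ')+
qed

text \<open>The graph norm is the norm of the pair \<open>(j v, A^* (j v))\<close> in the product of
  \<open>H\<close> with itself, so the graph map is an isometry into an inner product space. Its
  linearity rests on uniqueness of the adjoint value: a vector orthogonal to a dense set is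
  zero.\<close>

lemma adjoint_domain_space_embedding:
  assumes "closure DA = UNIV" "adjoint_domain_space DA A j"
  defines "\<iota> \<equiv> \<lambda>v. (j v, adjoint_op DA A (j v))"
  shows "linear j" "inj j" "norm (j v) \<le> norm v" "linear \<iota>" "norm (\<iota> v) = norm v"
proof -
  have lin: "linear j" and bij: "bij_betw j UNIV (adjoint_dom DA A)"
    and nrm: "norm v = sqrt ((norm (j v))\<^sup>2 + (norm (adjoint_op DA A (j v)))\<^sup>2)" for v
    using assms(2) by (auto simp: adjoint_domain_space_def)
  show "linear j" by fact
  show "inj j" using bij by (simp add: bij_betw_def)
  show "norm (j v) \<le> norm v" unfolding nrm[of v] by (simp add: real_le_rsqrt)
  show "norm (\<iota> v) = norm v" unfolding nrm[of v] by (simp add: \<iota>_def norm_Pair)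
  have uniq: "z = z'" if "\<forall>x\<in>DA. inner x z = inner x z'" for z z'
  proof -
    have "closed {x. inner x (z - z') = 0}" by (intro closed_Collect_eq continuous_intros)
    moreover have "DA \<subseteq> {x. inner x (z - z') = 0}" using that by (auto simp: inner_diff_right)
    ultimately have "closure DA \<subseteq> {x. inner x (z - z') = 0}" by (rule closure_minimal[rotated])
    then have "inner (z - z') (z - z') = 0" using assms(1) by blast
    then show ?thesis by simp
  qed
  have op: "\<forall>x\<in>DA. inner (A x) (j v) = inner x (adjoint_op DA A (j v))" for v
  proof -
    have "j v \<in> adjoint_dom DA A" using bij by (auto simp: bij_betw_def)
    then obtain z where z: "\<forall>x\<in>DA. inner (A x) (j v) = inner x z" by (auto simp: adjoint_dom_def)
    show ?thesis unfolding adjoint_op_def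
      by (rule theI[where a = z and P = "\<lambda>z. \<forall>x\<in>DA. inner (A x) (j v) = inner x z", OF z]) (metis uniq z)
  qed
  have op': "x \<in> DA \<Longrightarrow> inner x (adjoint_op DA A (j v)) = inner (A x) (j v)" for x v using op[of v] by simp
  have "adjoint_op DA A (j (v + w)) = adjoint_op DA A (j v) + adjoint_op DA A (j w)" for v w
    by (rule uniq, rule ballI) (simp only: op' inner_add_right linear_add[OF lin, of v w, symmetric], simp only: linear_add[OF lin] inner_add_right)
  moreover have "adjoint_op DA A (j (r *\<^sub>R v)) = r *\<^sub>R adjoint_op DA A (j v)" for r v
    by (rule uniq, rule ballI) (simp only: op' inner_scaleR_right, simp only: linear_cmul[OF lin] inner_scaleR_right)
  ultimately show "linear \<iota>"
    by (intro linearI) (simp_all add: \<iota>_def linear_add[OF lin] linear_cmul[OF lin])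
qed

section \<open>Stieltjes integrals\<close>

text \<open>A majorant of the variation instead of the variation itself. It is automatically
  nondecreasing, it needs no regularity, and under a bounded operator it is merely multiplied by a
  constant.\<close>

definition dominated_on :: "real \<Rightarrow> real \<Rightarrow> (real \<Rightarrow> real) \<Rightarrow> (real \<Rightarrow> 'b::real_normed_vector) \<Rightarrow> bool" where
  "dominated_on a b v C \<longleftrightarrow> (\<forall>x y. a \<le> x \<and> x \<le> y \<and> y \<le> b \<longrightarrow> norm (C y - C x) \<le> v y - v x)"

lemma dominated_onD: "dominated_on a b v C \<Longrightarrow> a \<le> x \<Longrightarrow> x \<le> y \<Longrightarrow> y \<le> b \<Longrightarrow> norm (C y - C x) \<le> v y - v x"
  by (simp add: dominated_on_def)

lemma dominated_on_mono: "dominated_on a b v C \<Longrightarrow> a \<le> x \<Longrightarrow> x \<le> y \<Longrightarrow> y \<le> b \<Longrightarrow> v x \<le> v y"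
  using dominated_onD[of a b v C x y] norm_ge_zero[of "C y - C x"] by linarith

lemma dominated_on_subset: "dominated_on a b v C \<Longrightarrow> a \<le> a' \<Longrightarrow> b' \<le> b \<Longrightarrow> dominated_on a' b' v C"
  by (auto simp: dominated_on_def)

text \<open>The supremum over chains in \<open>[s, u]\<close> serves as majorant: a chain in
  \<open>[s, x]\<close>, prolonged by \<open>x\<close> and then \<open>y\<close>, is a chain in
  \<open>[s, y]\<close> whose sum is larger by at least \<open>norm (C y - C x)\<close>.\<close>

lemma bounded_variation_on_dominated:
  assumes "bounded_variation_on s T C"
  obtains v where "dominated_on s T v C"
proof -
  define V where "V u = {\<Sum>i<n. norm (C (p (Suc i)) - C (p i)) | n p.
     (\<forall>i\<le>n. p i \<in> {s..u}) \<and> (\<forall>i<n. p i \<le> p (Suc i))}" for u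
  obtain K where K: "\<And>n p. (\<forall>i\<le>n. p i \<in> {s..T}) \<Longrightarrow> (\<forall>i<n. p i \<le> p (Suc i)) \<Longrightarrow>
    (\<Sum>i<n. norm (C (p (Suc i)) - C (p i))) \<le> K"
    using assms unfolding bounded_variation_on_def by blast
  have bdd: "bdd_above (V u)" if "u \<le> T" for u
    unfolding V_def using that by (intro bdd_aboveI[of _ K]) (fastforce intro!: K)
  have ne: "V u \<noteq> {}" if "s \<le> u" for u
  proof -
    have "0 \<in> V u" unfolding V_def
      by (rule CollectI, rule exI[of _ 0], rule exI[of _ "\<lambda>_. s"]) (use that in auto)
    then show ?thesis by blast
  qed
  have "dominated_on s T (\<lambda>u. Sup (V u)) C"
    unfolding dominated_on_def
  proof (intro allI impI)
    fix x y assume xy: "s \<le> x \<and> x \<le> y \<and> y \<le> T"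
    have "Sup (V x) \<le> Sup (V y) - norm (C y - C x)"
    proof (rule cSup_least[OF ne])
      fix S assume "S \<in> V x"
      then obtain n p where S: "S = (\<Sum>i<n. norm (C (p (Suc i)) - C (p i)))"
        and p: "\<forall>i\<le>n. p i \<in> {s..x}" "\<forall>i<n. p i \<le> p (Suc i)" unfolding V_def by blast
      define p' where "p' i = (if i \<le> n then p i else if i = Suc n then x else y)" for i
      have "(\<Sum>i<n. norm (C (p' (Suc i)) - C (p' i))) = S" unfolding S by (rule sum.cong) (auto simp: p'_def)
      then have sum: "(\<Sum>i<Suc (Suc n). norm (C (p' (Suc i)) - C (p' i))) = S + norm (C x - C (p n)) + norm (C y - C x)"
        by (simp add: p'_def)
      have "(\<Sum>i<Suc (Suc n). norm (C (p' (Suc i)) - C (p' i))) \<in> V y"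
        unfolding V_def
      proof (intro CollectI exI conjI)
        show "\<forall>i\<le>Suc (Suc n). p' i \<in> {s..y}" using p xy by (fastforce simp: p'_def)
        show "\<forall>i<Suc (Suc n). p' i \<le> p' (Suc i)"
          using p xy by (auto simp: p'_def not_le less_Suc_eq)
      qed simp
      then have "S + norm (C x - C (p n)) + norm (C y - C x) \<le> Sup (V y)"
        unfolding sum by (rule cSup_upper) (use bdd xy in auto)
      then show "S \<le> Sup (V y) - norm (C y - C x)" using norm_ge_zero[of "C x - C (p n)"] by linarith
    qed (use xy in auto)
    then show "norm (C y - C x) \<le> Sup (V y) - Sup (V x)" by linarith
  qed
  then show ?thesis by (rule that)
qed

section \<open>Riemann-Stieltjes sums and their limits\<close>

definition RS_sum :: "(real \<Rightarrow> 'b::real_normed_vector \<Rightarrow>\<^sub>L real) \<Rightarrow> (real \<Rightarrow> 'b) \<Rightarrow> nat \<Rightarrow> (nat \<Rightarrow> real) \<Rightarrow> (nat \<Rightarrow> real) \<Rightarrow> real"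
  where "RS_sum g C n p q = (\<Sum>i<n. g (q i) (C (p (Suc i)) - C (p i)))"

definition RS_partition :: "real \<Rightarrow> real \<Rightarrow> real \<Rightarrow> nat \<Rightarrow> (nat \<Rightarrow> real) \<Rightarrow> (nat \<Rightarrow> real) \<Rightarrow> bool" where
  "RS_partition a b d n p q \<longleftrightarrow> p 0 = a \<and> p n = b \<and> (\<forall>i<n. p i \<le> q i \<and> q i \<le> p (Suc i) \<and> p (Suc i) - p i < d)"

lemma has_stieltjes_integral_iff:
  "has_stieltjes_integral g C a b I \<longleftrightarrow>
    (\<forall>e>0. \<exists>d>0. \<forall>n p q. RS_partition a b d n p q \<longrightarrow> \<bar>RS_sum g C n p q - I\<bar> < e)"
  by (simp add: has_stieltjes_integral_def RS_sum_def RS_partition_def)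

lemma RS_partition_mono:
  assumes "RS_partition a b d n p q" "i \<le> k" "k \<le> n"
  shows "p i \<le> p k"
  using assms(2,3)
proof (induction k rule: dec_induct)
  case (step k)
  then show ?case using assms(1) unfolding RS_partition_def by (meson Suc_le_eq less_imp_le order_trans)
qed simp

lemma RS_partition_mem:
  assumes "RS_partition a b d n p q"
  shows "i \<le> n \<Longrightarrow> a \<le> p i" "i \<le> n \<Longrightarrow> p i \<le> b" "i < n \<Longrightarrow> a \<le> q i" "i < n \<Longrightarrow> q i \<le> b"
proof -
  have p: "a \<le> p i \<and> p i \<le> b" if "i \<le> n" for i
    using RS_partition_mono[OF assms, of 0 i] RS_partition_mono[OF assms, of i n] assms that
    by (auto simp: RS_partition_def)
  have "p i \<le> q i \<and> q i \<le> p (Suc i)" if "i < n" for i using assms that by (auto simp: RS_partition_def)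
  then show "i \<le> n \<Longrightarrow> a \<le> p i" "i \<le> n \<Longrightarrow> p i \<le> b" "i < n \<Longrightarrow> a \<le> q i" "i < n \<Longrightarrow> q i \<le> b"
    using p[of i] p[of "Suc i"] by (force)+
qed

text \<open>Both sides are the increment of \<open>C\<close> over the intersection of the two
  intervals, and zero if they do not overlap.\<close>

lemma clamp_increment_swap:
  fixes C :: "real \<Rightarrow> 'b::real_normed_vector"
  assumes "l \<le> r" "l' \<le> r'"
  shows "C (max l (min r r')) - C (max l (min r l')) = C (max l' (min r' r)) - C (max l' (min r' l))"
proof -
  consider "r' \<le> l" | "r \<le> l'" | "l < r'" "l' < r" by linarith
  then show ?thesis
    using assms by cases (auto simp: max_def min_def intro: arg_cong[of _ _ C])
qed

text \<open>Both sums are rewritten over the cells of the common refinement: clamping the points of one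
  partition to a cell of the other one gives the same increments from both sides.\<close>

lemma RS_sum_diff:
  assumes P: "RS_partition a b d n p q" and P': "RS_partition a b d m p' q'"
    and dom: "dominated_on a b v C" and e: "0 \<le> e"
    and osc: "\<And>x y. x \<in> {a..b} \<Longrightarrow> y \<in> {a..b} \<Longrightarrow> \<bar>x - y\<bar> < 2 * d \<Longrightarrow> norm (g x - g y) \<le> e"
  shows "\<bar>RS_sum g C n p q - RS_sum g C m p' q'\<bar> \<le> e * (v b - v a)"
proof -
  define cl where "cl i x = max (p i) (min (p (Suc i)) x)" for i and x :: real
  define cl' where "cl' k x = max (p' k) (min (p' (Suc k)) x)" for k and x :: real
  define D where "D i k = C (cl i (p' (Suc k))) - C (cl i (p' k))" for i k
  define w where "w i k = v (cl i (p' (Suc k))) - v (cl i (p' k))" for i k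
  note mem = RS_partition_mem[OF P] and mem' = RS_partition_mem[OF P']
  have st: "p i \<le> q i" "q i \<le> p (Suc i)" "p i \<le> p (Suc i)" "p (Suc i) - p i < d" if "i < n" for i
    using P that by (auto simp: RS_partition_def intro: order_trans)
  have st': "p' i \<le> q' i" "q' i \<le> p' (Suc i)" "p' i \<le> p' (Suc i)" "p' (Suc i) - p' i < d" if "i < m" for i
    using P' that by (auto simp: RS_partition_def intro: order_trans)
  have ends: "p 0 = a" "p n = b" "p' 0 = a" "p' m = b" using P P' by (auto simp: RS_partition_def)
  have tel: "(\<Sum>k<m. h (cl i (p' (Suc k))) - h (cl i (p' k))) = h (p (Suc i)) - h (p i)" if "i < n"
    for i and h :: "real \<Rightarrow> 'c::real_normed_vector"
    using st[OF that] mem(1)[of i] mem(2)[of "Suc i"] that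
    by (simp add: sum_lessThan_telescope[of "\<lambda>k. h (cl i (p' k))"] ends) (auto simp: cl_def max_def min_def intro: arg_cong[of _ _ h])
  have tel': "(\<Sum>i<n. h (cl' k (p (Suc i))) - h (cl' k (p i))) = h (p' (Suc k)) - h (p' k)" if "k < m"
    for k and h :: "real \<Rightarrow> 'c::real_normed_vector"
    using st'[OF that] mem'(1)[of k] mem'(2)[of "Suc k"] that
    by (simp add: sum_lessThan_telescope[of "\<lambda>i. h (cl' k (p i))"] ends) (auto simp: cl'_def max_def min_def intro: arg_cong[of _ _ h])
  have DE: "D i k = C (cl' k (p (Suc i))) - C (cl' k (p i))" if "i < n" "k < m" for i k
    unfolding D_def cl_def cl'_def using st(3)[OF that(1)] st'(3)[OF that(2)] by (rule clamp_increment_swap)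
  have s1: "RS_sum g C n p q = (\<Sum>i<n. \<Sum>k<m. g (q i) (D i k))"
    unfolding RS_sum_def
    by (rule sum.cong) (simp_all add: D_def tel flip: blinfun.sum_right)
  have "RS_sum g C m p' q' = (\<Sum>k<m. \<Sum>i<n. g (q' k) (C (cl' k (p (Suc i))) - C (cl' k (p i))))"
    unfolding RS_sum_def
    by (rule sum.cong) (simp_all add: tel' flip: blinfun.sum_right)
  also have "\<dots> = (\<Sum>k<m. \<Sum>i<n. g (q' k) (D i k))" by (intro sum.cong) (auto simp: DE)
  also have "\<dots> = (\<Sum>i<n. \<Sum>k<m. g (q' k) (D i k))" by (rule sum.swap)
  finally have "RS_sum g C n p q - RS_sum g C m p' q' = (\<Sum>i<n. \<Sum>k<m. (g (q i) - g (q' k)) (D i k))"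
    unfolding s1 by (simp add: sum_subtractf blinfun.diff_left)
  also have "\<bar>\<dots>\<bar> \<le> (\<Sum>i<n. \<Sum>k<m. e * w i k)"
  proof (intro order_trans[OF sum_abs] sum_mono)
    fix i k assume "i \<in> {..<n}" "k \<in> {..<m}"
    then have ik: "i < n" "k < m" by auto
    note S = st[OF ik(1)] st'[OF ik(2)]
    have wD: "norm (D i k) \<le> w i k"
      unfolding w_def D_def
      by (rule dominated_onD[OF dom])
        (use S ik mem[of i] mem[of "Suc i"] in \<open>auto simp: cl_def max_def min_def\<close>)
    have "norm (g (q i) - g (q' k)) \<le> e" if "D i k \<noteq> 0"
    proof (rule osc)
      \<comment> \<open>Cells that do not overlap give no increment. Tags of overlapping cells of
        length below \<open>d\<close> differ by less than \<open>2 * d\<close>, which is where the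
        factor 2 in the oscillation hypothesis comes from.\<close>
      have "p i < p' (Suc k) \<and> p' k < p (Suc i)"
      proof (rule ccontr)
        assume "\<not> ?thesis"
        then have "cl i (p' (Suc k)) = cl i (p' k)" using S by (auto simp: cl_def)
        then show False using that by (simp add: D_def)
      qed
      then show "\<bar>q i - q' k\<bar> < 2 * d" using S by linarith
    qed (use mem(3,4)[OF ik(1)] mem'(3,4)[OF ik(2)] in auto)
    then have "norm ((g (q i) - g (q' k)) (D i k)) \<le> e * norm (D i k)"
      using order_trans[OF norm_blinfun mult_right_mono[OF _ norm_ge_zero]]
      by (cases "D i k = 0") (simp, blast)
    also have "\<dots> \<le> e * w i k" using wD e by (rule mult_left_mono)
    finally show "\<bar>(g (q i) - g (q' k)) (D i k)\<bar> \<le> e * w i k" by simp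
  qed
  also have "\<dots> = e * (\<Sum>i<n. v (p (Suc i)) - v (p i))"
    by (simp add: w_def tel flip: sum_distrib_left)
  also have "\<dots> = e * (v b - v a)" by (simp add: sum_lessThan_telescope[of "\<lambda>i. v (p i)"] ends)
  finally show ?thesis .
qed

definition upart :: "real \<Rightarrow> real \<Rightarrow> nat \<Rightarrow> nat \<Rightarrow> real" where
  "upart a b m i = a + (b - a) * i / m"

lemma RS_partition_upart:
  assumes "a \<le> b" "0 < m" "(b - a) / m < d"
  shows "RS_partition a b d m (upart a b m) (upart a b m)"
proof -
  have "upart a b m (Suc i) - upart a b m i = (b - a) / m" for i
    by (simp add: upart_def add_divide_distrib distrib_left)
  moreover have "0 \<le> (b - a) / m" using assms(1) by simp
  moreover have "upart a b m 0 = a" "upart a b m m = b" using assms(2) by (simp_all add: upart_def)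
  ultimately show ?thesis using assms(3) unfolding RS_partition_def by (smt (verit))
qed

lemma upart_mem:
  assumes "a \<le> b" "i \<le> m"
  shows "upart a b m i \<in> {a..b}"
proof (cases "m = 0")
  case False
  then have "(b - a) * (real i / real m) \<le> (b - a) * 1" "0 \<le> (b - a) * (real i / real m)"
    using assms by (intro mult_left_mono mult_nonneg_nonneg; simp)+
  then show ?thesis by (simp add: upart_def)
qed (use assms in \<open>simp add: upart_def\<close>)

lemma eventually_upart_mesh:
  assumes "0 < d"
  shows "\<forall>\<^sub>F m in sequentially. 0 < m \<and> (b - a) / real m < d"
proof -
  have "(\<lambda>m. (b - a) / real m) \<longlonglongrightarrow> 0" by (rule lim_const_over_n)
  from order_tendstoD(2)[OF this assms] show ?thesis
    using eventually_gt_at_top[of 0] by eventually_elim auto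
qed

lemma continuous_on_Icc_modulus:
  fixes g :: "real \<Rightarrow> 'c::real_normed_vector"
  assumes "continuous_on {a..b} g" "0 < e"
  obtains d where "0 < d" "\<And>x y. x \<in> {a..b} \<Longrightarrow> y \<in> {a..b} \<Longrightarrow> \<bar>x - y\<bar> < 2 * d \<Longrightarrow> norm (g x - g y) \<le> e"
proof -
  have "uniformly_continuous_on {a..b} g" using assms(1) by (rule compact_uniformly_continuous) simp
  then obtain d where d: "0 < d" "\<And>x y. x \<in> {a..b} \<Longrightarrow> y \<in> {a..b} \<Longrightarrow> dist y x < d \<Longrightarrow> dist (g y) (g x) < e"
    using assms(2) unfolding uniformly_continuous_on_def by metis
  have "norm (g x - g y) \<le> e" if "x \<in> {a..b}" "y \<in> {a..b}" "\<bar>x - y\<bar> < 2 * (d / 2)" for x y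
    using d(2)[of y x] that by (simp add: dist_norm)
  then show ?thesis using d(1) by (intro that[of "d / 2"]) auto
qed

lemma has_stieltjes_integral_upart:
  assumes "has_stieltjes_integral g C a b I" "a \<le> b"
  shows "(\<lambda>m. RS_sum g C m (upart a b m) (upart a b m)) \<longlonglongrightarrow> I"
proof (rule LIMSEQ_I)
  fix e :: real assume "e > 0"
  then obtain d where d: "d > 0" "\<And>n p q. RS_partition a b d n p q \<Longrightarrow> \<bar>RS_sum g C n p q - I\<bar> < e"
    using assms(1) unfolding has_stieltjes_integral_iff by blast
  have "\<forall>\<^sub>F m in sequentially. norm (RS_sum g C m (upart a b m) (upart a b m) - I) < e"
    using eventually_upart_mesh[OF d(1), of b a]
    by eventually_elim (use d(2) RS_partition_upart[OF assms(2)] in auto)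
  then show "\<exists>N. \<forall>m\<ge>N. norm (RS_sum g C m (upart a b m) (upart a b m) - I) < e"
    by (simp add: eventually_sequentially)
qed

lemma has_stieltjes_integral_unique:
  "has_stieltjes_integral g C a b I \<Longrightarrow> has_stieltjes_integral g C a b J \<Longrightarrow> a \<le> b \<Longrightarrow> I = J"
  by (meson LIMSEQ_unique has_stieltjes_integral_upart)

text \<open>\<open>RS_sum_diff\<close> with the second partition refined to the limit. The error
  depends on the integrator only through the mass of its majorant, so one mesh serves a whole family
  of integrators.\<close>

lemma has_stieltjes_integral_estimate:
  assumes I: "has_stieltjes_integral g C a b I" and P: "RS_partition a b d n p q" and d: "0 < d" and "a \<le> b"
    and dom: "dominated_on a b v C" and e: "0 \<le> e"
    and osc: "\<And>x y. x \<in> {a..b} \<Longrightarrow> y \<in> {a..b} \<Longrightarrow> \<bar>x - y\<bar> < 2 * d \<Longrightarrow> norm (g x - g y) \<le> e"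
  shows "\<bar>RS_sum g C n p q - I\<bar> \<le> e * (v b - v a)"
proof (rule tendsto_upperbound)
  show "(\<lambda>m. \<bar>RS_sum g C n p q - RS_sum g C m (upart a b m) (upart a b m)\<bar>) \<longlonglongrightarrow> \<bar>RS_sum g C n p q - I\<bar>"
    by (intro tendsto_intros has_stieltjes_integral_upart[OF I \<open>a \<le> b\<close>])
  show "\<forall>\<^sub>F m in sequentially. \<bar>RS_sum g C n p q - RS_sum g C m (upart a b m) (upart a b m)\<bar> \<le> e * (v b - v a)"
    using eventually_upart_mesh[OF d, of b a]
    by eventually_elim (intro RS_sum_diff[OF P _ dom e osc] RS_partition_upart \<open>a \<le> b\<close>, auto)
qed simp

lemma has_stieltjes_integral_exists:
  assumes g: "continuous_on {a..b} g" and dom: "dominated_on a b v C" and "a \<le> b"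
  shows "\<exists>I. has_stieltjes_integral g C a b I"
proof -
  let ?S = "\<lambda>m. RS_sum g C m (upart a b m) (upart a b m)"
  define V where "V = v b - v a"
  have V: "V \<ge> 0" using dominated_on_mono[OF dom, of a b] \<open>a \<le> b\<close> by (simp add: V_def)
  have mod: "\<exists>d>0. \<forall>n p q m p' q'. RS_partition a b d n p q \<and> RS_partition a b d m p' q' \<longrightarrow>
      \<bar>RS_sum g C n p q - RS_sum g C m p' q'\<bar> < e" if "e > 0" for e
  proof -
    have e': "e / (V + 1) > 0" using that V by simp
    obtain d where d: "0 < d" "\<And>x y. x \<in> {a..b} \<Longrightarrow> y \<in> {a..b} \<Longrightarrow> \<bar>x - y\<bar> < 2 * d \<Longrightarrow> norm (g x - g y) \<le> e / (V + 1)"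
      using continuous_on_Icc_modulus[OF g e'] by blast
    have "e / (V + 1) * V < e" using that V by (simp add: field_simps)
    then have "\<bar>RS_sum g C n p q - RS_sum g C m p' q'\<bar> < e"
      if "RS_partition a b d n p q" "RS_partition a b d m p' q'" for n p q m p' q'
      using RS_sum_diff[where g = g, OF that dom less_imp_le[OF e'] d(2)] unfolding V_def by linarith
    then show ?thesis using d(1) by blast
  qed
  have "Cauchy ?S"
  proof (rule metric_CauchyI)
    fix e :: real assume "e > 0"
    from mod[OF this] obtain d where d: "d > 0" "\<And>n p q m p' q'. RS_partition a b d n p q \<Longrightarrow>
      RS_partition a b d m p' q' \<Longrightarrow> \<bar>RS_sum g C n p q - RS_sum g C m p' q'\<bar> < e" by blast
    obtain N where "\<forall>m\<ge>N. 0 < m \<and> (b - a) / real m < d"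
      using eventually_upart_mesh[OF d(1), of b a] by (auto simp: eventually_sequentially)
    then show "\<exists>N. \<forall>m\<ge>N. \<forall>n\<ge>N. dist (?S m) (?S n) < e"
      by (intro exI[of _ N]) (auto simp: dist_real_def intro!: d(2) RS_partition_upart \<open>a \<le> b\<close>)
  qed
  then obtain I where I: "?S \<longlonglongrightarrow> I" using Cauchy_convergent_iff convergent_def by blast
  have "has_stieltjes_integral g C a b I"
    unfolding has_stieltjes_integral_iff
  proof (intro allI impI)
    fix e :: real assume "e > 0"
    from mod[OF half_gt_zero[OF this]] obtain d where d: "d > 0" "\<And>n p q m p' q'. RS_partition a b d n p q \<Longrightarrow>
      RS_partition a b d m p' q' \<Longrightarrow> \<bar>RS_sum g C n p q - RS_sum g C m p' q'\<bar> < e / 2" by blast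
    have "\<bar>RS_sum g C n p q - I\<bar> \<le> e / 2" if "RS_partition a b d n p q" for n p q
    proof (rule tendsto_upperbound)
      show "(\<lambda>m. \<bar>RS_sum g C n p q - ?S m\<bar>) \<longlonglongrightarrow> \<bar>RS_sum g C n p q - I\<bar>" by (intro tendsto_intros I)
      show "\<forall>\<^sub>F m in sequentially. \<bar>RS_sum g C n p q - ?S m\<bar> \<le> e / 2"
        using eventually_upart_mesh[OF d(1), of b a]
        by eventually_elim (intro less_imp_le d(2) that RS_partition_upart \<open>a \<le> b\<close>, auto)
    qed simp
    then show "\<exists>d>0. \<forall>n p q. RS_partition a b d n p q \<longrightarrow> \<bar>RS_sum g C n p q - I\<bar> < e"
      using d(1) \<open>e > 0\<close> by (intro exI[of _ d]) fastforce
  qed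
  then show ?thesis by blast
qed

text \<open>A Helly-Bray argument: one fixed partition approximates all the integrals at once,
  because the majorants have masses at most \<open>V\<close> and the integrands eventually share the
  modulus of continuity of \<open>g\<close>. On a fixed partition pointwise convergence of the
  integrators is enough.\<close>

lemma has_stieltjes_integral_converges:
  assumes K: "\<And>N. has_stieltjes_integral (gN N) (CN N) a b (KN N)" "has_stieltjes_integral g C a b K"
    and "a \<le> b" and g: "continuous_on {a..b} g" and unif: "uniform_limit {a..b} gN g sequentially"
    and domN: "\<And>N. dominated_on a b (vN N) (CN N)" and VN: "\<And>N. vN N b - vN N a \<le> V"
    and dom: "dominated_on a b v C"
    and C: "\<And>r. r \<in> {a..b} \<Longrightarrow> (\<lambda>N. CN N r) \<longlonglongrightarrow> C r"
  shows "KN \<longlonglongrightarrow> K"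
proof (rule metric_LIMSEQ_I)
  fix e0 :: real assume e0: "e0 > 0"
  define W where "W = v b - v a"
  have W: "W \<ge> 0" using dominated_on_mono[OF dom, of a b] \<open>a \<le> b\<close> by (simp add: W_def)
  have V0: "0 \<le> vN N b - vN N a" for N using dominated_on_mono[OF domN, of a b N] \<open>a \<le> b\<close> by simp
  then have V: "V \<ge> 0" using VN[of 0] order_trans by blast
  \<comment> \<open>The errors to come are \<open>3 e V\<close> for the partition in the integral
    with index \<open>N\<close>, \<open>e V\<close> for replacing \<open>gN N\<close> by
    \<open>g\<close>, \<open>e W\<close> for the partition in the limit integral, and
    \<open>e\<close> for the finite sums.\<close>
  define Z where "Z = 4 * V + W + 1"
  define e where "e = e0 / (2 * Z)"
  have Z: "Z > 0" using V W by (simp add: Z_def)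
  then have e: "e > 0" using e0 by (simp add: e_def)
  have "e * (4 * V + W) + e = e * Z" by (simp add: algebra_simps Z_def)
  also have "\<dots> = e0 / 2" using Z by (simp add: e_def)
  finally have e_e0: "e * (4 * V + W) + e < e0" using e0 by simp
  obtain d where d: "0 < d" "\<And>x y. x \<in> {a..b} \<Longrightarrow> y \<in> {a..b} \<Longrightarrow> \<bar>x - y\<bar> < 2 * d \<Longrightarrow> norm (g x - g y) \<le> e"
    using continuous_on_Icc_modulus[OF g e] by blast
  obtain m where m: "0 < m" "(b - a) / real m < d"
    using eventually_upart_mesh[OF d(1), of b a] by (auto simp: eventually_sequentially)
  note P = RS_partition_upart[OF \<open>a \<le> b\<close> m]
  let ?p = "upart a b m"
  have mem: "?p i \<in> {a..b}" if "i \<le> m" for i by (rule upart_mem[OF \<open>a \<le> b\<close> that])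
  have "(\<lambda>N. RS_sum g (CN N) m ?p ?p) \<longlonglongrightarrow> RS_sum g C m ?p ?p"
    unfolding RS_sum_def by (intro tendsto_sum blinfun.tendsto tendsto_intros C mem) auto
  then have ev1: "\<forall>\<^sub>F N in sequentially. \<bar>RS_sum g (CN N) m ?p ?p - RS_sum g C m ?p ?p\<bar> < e"
    using e by (auto dest!: tendstoD simp: dist_real_def)
  have ev2: "\<forall>\<^sub>F N in sequentially. \<forall>x\<in>{a..b}. norm (gN N x - g x) < e"
    using uniform_limitD[OF unif e] by (simp add: dist_norm)
  have "\<forall>\<^sub>F N in sequentially. dist (KN N) K < e0"
    using ev1 ev2
  proof eventually_elim
    case (elim N)
    have "norm (gN N x - gN N y) \<le> 3 * e" if "x \<in> {a..b}" "y \<in> {a..b}" "\<bar>x - y\<bar> < 2 * d" for x y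
    proof -
      have "gN N x - gN N y = (gN N x - g x) + (g x - g y) - (gN N y - g y)" by simp
      then have "norm (gN N x - gN N y) \<le> norm (gN N x - g x) + norm (g x - g y) + norm (gN N y - g y)"
        by (metis (no_types, opaque_lifting) add_right_mono norm_triangle_ineq norm_triangle_ineq4 order_trans)
      moreover have "norm (gN N x - g x) < e" "norm (gN N y - g y) < e" using elim(2) that by auto
      ultimately show ?thesis using d(2)[OF that] by linarith
    qed
    then have "\<bar>RS_sum (gN N) (CN N) m ?p ?p - KN N\<bar> \<le> 3 * e * (vN N b - vN N a)"
      using has_stieltjes_integral_estimate[OF K(1) P d(1) \<open>a \<le> b\<close> domN] e by simp
    also have "\<dots> \<le> 3 * e * V" using VN e by (intro mult_left_mono) auto
    finally have 1: "\<bar>RS_sum (gN N) (CN N) m ?p ?p - KN N\<bar> \<le> 3 * e * V" .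
    have "\<bar>RS_sum (gN N) (CN N) m ?p ?p - RS_sum g (CN N) m ?p ?p\<bar>
        = \<bar>\<Sum>i<m. (gN N (?p i) - g (?p i)) (CN N (?p (Suc i)) - CN N (?p i))\<bar>"
      by (simp add: RS_sum_def blinfun.diff_left flip: sum_subtractf)
    also have "\<dots> \<le> (\<Sum>i<m. e * (vN N (?p (Suc i)) - vN N (?p i)))"
    proof (intro order_trans[OF sum_abs] sum_mono)
      fix i assume i: "i \<in> {..<m}"
      have "\<bar>(gN N (?p i) - g (?p i)) (CN N (?p (Suc i)) - CN N (?p i))\<bar> \<le>
        norm (gN N (?p i) - g (?p i)) * norm (CN N (?p (Suc i)) - CN N (?p i))"
        using norm_blinfun[of "gN N (?p i) - g (?p i)"] by simp
      also have "\<dots> \<le> e * (vN N (?p (Suc i)) - vN N (?p i))"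
        using elim(2) mem[of i] mem[of "Suc i"] i e RS_partition_mono[OF P, of i "Suc i"]
        by (intro mult_mono dominated_onD[OF domN]) (auto intro: less_imp_le)
      finally show "\<bar>(gN N (?p i) - g (?p i)) (CN N (?p (Suc i)) - CN N (?p i))\<bar> \<le>
         e * (vN N (?p (Suc i)) - vN N (?p i))" .
    qed
    also have "\<dots> = e * (vN N b - vN N a)"
      using P by (simp add: RS_partition_def sum_lessThan_telescope[of "\<lambda>i. vN N (?p i)"] flip: sum_distrib_left)
    also have "\<dots> \<le> e * V" using VN e by (intro mult_left_mono) auto
    finally have 2: "\<bar>RS_sum (gN N) (CN N) m ?p ?p - RS_sum g (CN N) m ?p ?p\<bar> \<le> e * V" .
    have 3: "\<bar>RS_sum g C m ?p ?p - K\<bar> \<le> e * W"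
      unfolding W_def by (rule has_stieltjes_integral_estimate[OF K(2) P d(1) \<open>a \<le> b\<close> dom less_imp_le[OF e] d(2)])
    have "\<bar>KN N - K\<bar> < 3 * e * V + e * V + e * W + e"
      using 1 2 3 elim(1) by linarith
    also have "\<dots> = e * (4 * V + W) + e" by (simp add: algebra_simps)
    also have "\<dots> < e0" by (rule e_e0)
    finally show ?case by (simp add: dist_real_def)
  qed
  then show "\<exists>N. \<forall>n\<ge>N. dist (KN n) K < e0" by (simp add: eventually_sequentially)
qed

text \<open>A fine partition of \<open>[s, x]\<close>, prolonged by the single cell
  \<open>[x, y]\<close> tagged at \<open>y\<close>, is a fine partition of \<open>[s, y]\<close>;
  the two sums differ exactly by \<open>g y (C y - C x)\<close>. The bound is uniform in
  \<open>x\<close> and \<open>y\<close>, hence it captures jumps of the integral as well as its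
  right continuity.\<close>

lemma has_stieltjes_integral_increment:
  assumes K: "\<And>t. t \<in> {s..T} \<Longrightarrow> has_stieltjes_integral g C s t (K t)"
    and g: "continuous_on {s..T} g" and dom: "dominated_on s T v C" and e0: "0 < e0"
  obtains d where "0 < d" "\<And>x y. s \<le> x \<Longrightarrow> x \<le> y \<Longrightarrow> y \<le> T \<Longrightarrow> y - x < d \<Longrightarrow> \<bar>K y - K x - g y (C y - C x)\<bar> \<le> e0"
proof (cases "s \<le> T")
  case True
  define V where "V = v T - v s"
  have V: "V \<ge> 0" using dominated_on_mono[OF dom, of s T] True by (simp add: V_def)
  define e where "e = e0 / (2 * V + 1)"
  have e: "e > 0" "2 * e * V \<le> e0" using e0 V by (auto simp: e_def field_simps)
  obtain d where d: "0 < d" "\<And>x y. x \<in> {s..T} \<Longrightarrow> y \<in> {s..T} \<Longrightarrow> \<bar>x - y\<bar> < 2 * d \<Longrightarrow> norm (g x - g y) \<le> e"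
    using continuous_on_Icc_modulus[OF g e(1)] by blast
  have "\<bar>K y - K x - g y (C y - C x)\<bar> \<le> e0" if xy: "s \<le> x" "x \<le> y" "y \<le> T" "y - x < d" for x y
  proof -
    obtain m where m: "0 < m" "(x - s) / real m < d"
      using eventually_upart_mesh[OF d(1), of x s] by (auto simp: eventually_sequentially)
    note P = RS_partition_upart[OF xy(1) m]
    define p where "p i = (if i \<le> m then upart s x m i else y)" for i
    define q where "q i = (if i < m then upart s x m i else y)" for i
    have P': "RS_partition s y d (Suc m) p q"
      using P xy by (auto simp: RS_partition_def p_def q_def less_Suc_eq)
    have "RS_sum g C (Suc m) p q = (\<Sum>i<m. g (q i) (C (p (Suc i)) - C (p i))) + g y (C y - C x)"
      using P by (simp add: RS_sum_def p_def q_def RS_partition_def)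
    also have "(\<Sum>i<m. g (q i) (C (p (Suc i)) - C (p i))) = RS_sum g C m (upart s x m) (upart s x m)"
      unfolding RS_sum_def by (rule sum.cong) (auto simp: p_def q_def)
    finally have eq: "RS_sum g C (Suc m) p q = RS_sum g C m (upart s x m) (upart s x m) + g y (C y - C x)" .
    have "\<bar>RS_sum g C m (upart s x m) (upart s x m) - K x\<bar> \<le> e * (v x - v s)"
      using xy by (intro has_stieltjes_integral_estimate[OF K P d(1)] dominated_on_subset[OF dom] d(2))
        (use e in auto)
    also have "\<dots> \<le> e * V" using e dominated_on_mono[OF dom, of x T] xy by (simp add: V_def)
    finally have 1: "\<bar>RS_sum g C m (upart s x m) (upart s x m) - K x\<bar> \<le> e * V" .
    have "\<bar>RS_sum g C (Suc m) p q - K y\<bar> \<le> e * (v y - v s)"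
      using xy by (intro has_stieltjes_integral_estimate[OF K P' d(1)] dominated_on_subset[OF dom] d(2))
        (use e in auto)
    also have "\<dots> \<le> e * V" using e dominated_on_mono[OF dom, of y T] xy by (simp add: V_def)
    finally have "\<bar>RS_sum g C (Suc m) p q - K y\<bar> \<le> e * V" .
    with 1 eq e(2) show ?thesis by linarith
  qed
  then show ?thesis using that d(1) by blast
next
  case False
  then show ?thesis by (intro that[of 1]) auto
qed

section \<open>Maps on the projective tensor product\<close>

lemma bounded_linear_ptensor_lift:
  fixes B :: "'v::real_normed_vector \<Rightarrow> 'a::real_normed_vector \<Rightarrow> 'b::real_normed_vector \<Rightarrow> 'c::banach"
  assumes "\<And>v. bounded_bilinear (B v)"
    and "\<And>v w a b. B (v + w) a b = B v a b + B w a b" "\<And>r v a b. B (r *\<^sub>R v) a b = r *\<^sub>R B v a b"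
    and "\<And>v a b. norm (B v a b) \<le> norm v * (norm a * norm b)"
  shows "bounded_linear (\<lambda>v. ptensor_lift (B v))"
proof (rule bounded_linear_intro[where K = 1])
  show "ptensor_lift (B (v + w)) = ptensor_lift (B v) + ptensor_lift (B w)" for v w
    by (rule blinfun_ptensor_eqI) (simp add: ptensor_lift_elem assms blinfun.add_left)
  show "ptensor_lift (B (r *\<^sub>R v)) = r *\<^sub>R ptensor_lift (B v)" for r v
    by (rule blinfun_ptensor_eqI) (simp add: ptensor_lift_elem assms blinfun.scaleR_left)
  show "norm (ptensor_lift (B v)) \<le> norm v * 1" for v
    using norm_ptensor_lift_le[OF assms(1) assms(4)] by simp
qed

definition bilin_functional ::
  "('h::real_normed_vector \<Rightarrow>\<^sub>L 'h \<Rightarrow>\<^sub>L real) \<Rightarrow> ('h, 'h) ptensor \<Rightarrow>\<^sub>L real" where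
  "bilin_functional \<beta> = ptensor_lift (\<lambda>x y. \<beta> x y)"

lemma bounded_bilinear_blinfun2: "bounded_bilinear (\<lambda>x y. blinfun_apply (blinfun_apply \<beta> x) y)"
  by (rule bounded_bilinear.comp1[OF bounded_bilinear_blinfun_apply blinfun.bounded_linear_right])

lemma norm_blinfun2: "norm (blinfun_apply (blinfun_apply \<beta> x) y) \<le> norm \<beta> * (norm x * norm y)"
  using order_trans[OF norm_blinfun mult_right_mono[OF norm_blinfun norm_ge_zero]]
  by (metis mult.assoc)

lemma bilin_functional_elem [simp]: "bilin_functional \<beta> (x \<otimes> y) = \<beta> x y"
  by (simp add: bilin_functional_def ptensor_lift_elem bounded_bilinear_blinfun2)

lemma bounded_linear_bilin_functional: "bounded_linear bilin_functional"
  unfolding bilin_functional_def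
  by (rule bounded_linear_ptensor_lift[OF bounded_bilinear_blinfun2 _ _ norm_blinfun2])
    (auto simp: blinfun.add_left blinfun.scaleR_left)

text \<open>The operator \<open>Q \<otimes> Q\<close> on the projective tensor product: it carries
  the bracket of the process to that of its image under \<open>Q\<close>.\<close>

definition tensor_square :: "('h::real_normed_vector \<Rightarrow>\<^sub>L 'h) \<Rightarrow> ('h, 'h) ptensor \<Rightarrow>\<^sub>L ('h, 'h) ptensor" where
  "tensor_square Q = ptensor_lift (\<lambda>x y. Q x \<otimes> Q y)"

lemma norm_elem_tensor_le: "norm (a \<otimes> b) \<le> norm a * norm b"
  using proj_norm_le[of "alg_elem a b" "[(a, b)]"] by (simp add: elem_tensor_def norm_to_ptensor)

lemma bounded_bilinear_tensor_square: "bounded_bilinear (\<lambda>x y. blinfun_apply Q x \<otimes> blinfun_apply Q y)"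
  by (rule bounded_bilinear.comp[OF bounded_bilinear_elem_tensor blinfun.bounded_linear_right blinfun.bounded_linear_right])

lemma tensor_square_elem [simp]: "tensor_square Q (x \<otimes> y) = Q x \<otimes> Q y"
  by (simp add: tensor_square_def ptensor_lift_elem bounded_bilinear_tensor_square)

lemma norm_tensor_square_le:
  assumes "norm Q \<le> K"
  shows "norm (tensor_square Q) \<le> K\<^sup>2"
  unfolding tensor_square_def
proof (rule norm_ptensor_lift_le[OF bounded_bilinear_tensor_square])
  fix a b :: 'a
  have K: "0 \<le> K" using assms norm_ge_zero order_trans by blast
  have le: "norm (Q a) \<le> K * norm a" for a
    using norm_blinfun[of Q a] mult_right_mono[OF assms, of "norm a"] by simp
  have "norm (Q a \<otimes> Q b) \<le> norm (Q a) * norm (Q b)" by (rule norm_elem_tensor_le)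
  also have "\<dots> \<le> (K * norm a) * (K * norm b)" using le K by (intro mult_mono) auto
  finally show "norm (Q a \<otimes> Q b) \<le> K\<^sup>2 * (norm a * norm b)" by (simp add: power2_eq_square mult_ac)
qed simp

text \<open>Strong convergence is inherited by the dense algebraic tensor product and extends by boundedness.\<close>

lemma tensor_square_tendsto:
  fixes QN :: "nat \<Rightarrow> 'h::real_normed_vector \<Rightarrow>\<^sub>L 'h" and Q :: "'h \<Rightarrow>\<^sub>L 'h"
  assumes "\<And>N. norm (QN N) \<le> K" "\<And>x. (\<lambda>N. QN N x) \<longlonglongrightarrow> Q x"
  shows "(\<lambda>N. tensor_square (QN N) u) \<longlonglongrightarrow> tensor_square Q u"
proof -
  have elem: "(\<lambda>N. tensor_square (QN N) (to_ptensor (\<Sum>(a, b)\<leftarrow>xs. alg_elem a b)))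
     \<longlonglongrightarrow> tensor_square Q (to_ptensor (\<Sum>(a, b)\<leftarrow>xs. alg_elem a b))" for xs
  proof (induction xs)
    case Nil
    then show ?case by (simp add: linear_0[OF linear_to_ptensor] blinfun.zero_right)
  next
    case (Cons p xs)
    obtain a b where p: "p = (a, b)" by (cases p)
    have *: "to_ptensor (\<Sum>(a, b)\<leftarrow>p # xs. alg_elem a b) = a \<otimes> b + to_ptensor (\<Sum>(a, b)\<leftarrow>xs. alg_elem a b)"
      by (simp add: p linear_add[OF linear_to_ptensor] elem_tensor_def)
    show ?case
      unfolding * blinfun.add_right tensor_square_elem
      by (intro tendsto_add Cons bounded_bilinear.tendsto[OF bounded_bilinear_elem_tensor] assms)
  qed
  have alg: "(\<lambda>N. tensor_square (QN N) (to_ptensor v)) \<longlonglongrightarrow> tensor_square Q (to_ptensor v)" for v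
    by (rule alg_tensor_list_exhaust[of v]) (use elem in simp)
  define L where "L = max (K\<^sup>2) (norm (tensor_square Q))"
  have L: "norm (tensor_square (QN N)) \<le> L" "norm (tensor_square Q) \<le> L" "0 \<le> L" for N
    using norm_tensor_square_le[OF assms(1), of N] by (auto simp: L_def le_max_iff_disj)
  show ?thesis
  proof (rule metric_LIMSEQ_I)
    fix e :: real assume e: "e > 0"
    then have "e / (3 * (L + 1)) > 0" using L by simp
    then obtain v where v: "norm (u - to_ptensor v) < e / (3 * (L + 1))"
      using to_ptensor_dense[of _ u] unfolding dist_norm by blast
    have small: "norm (A (u - to_ptensor v)) < e / 3" if "norm A \<le> L" for A :: "('h, 'h) ptensor \<Rightarrow>\<^sub>L ('h, 'h) ptensor"
    proof -
      have "norm (A (u - to_ptensor v)) \<le> L * norm (u - to_ptensor v)"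
        using norm_blinfun[of A] mult_right_mono[OF that norm_ge_zero] order_trans by blast
      also have "\<dots> \<le> L * (e / (3 * (L + 1)))" using v L by (intro mult_left_mono) auto
      also have "\<dots> < e / 3" using e L by (simp add: field_simps)
      finally show ?thesis .
    qed
    obtain N0 where N0: "\<And>N. N \<ge> N0 \<Longrightarrow> norm (tensor_square (QN N) (to_ptensor v) - tensor_square Q (to_ptensor v)) < e / 3"
      using LIMSEQ_D[OF alg, of "e / 3" v] e by auto
    have "dist (tensor_square (QN N) u) (tensor_square Q u) < e" if "N \<ge> N0" for N
    proof -
      have "tensor_square (QN N) u - tensor_square Q u = tensor_square (QN N) (u - to_ptensor v)
          + (tensor_square (QN N) (to_ptensor v) - tensor_square Q (to_ptensor v)) - tensor_square Q (u - to_ptensor v)"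
        by (simp add: blinfun.diff_right)
      then have "dist (tensor_square (QN N) u) (tensor_square Q u) \<le> norm (tensor_square (QN N) (u - to_ptensor v))
          + norm (tensor_square (QN N) (to_ptensor v) - tensor_square Q (to_ptensor v)) + norm (tensor_square Q (u - to_ptensor v))"
        unfolding dist_norm
        by (metis (no_types, opaque_lifting) add_right_mono norm_triangle_ineq norm_triangle_ineq4 order_trans)
      then show ?thesis using small[OF L(1)[of N]] small[OF L(2)] N0[OF that] by linarith
    qed
    then show "\<exists>N0. \<forall>N\<ge>N0. dist (tensor_square (QN N) u) (tensor_square Q u) < e" by blast
  qed
qed

section \<open>Functions of class C12 and weak convergence\<close>

text \<open>A continuous function on an infinite-dimensional domain need not be uniformly continuous
  on balls. Near a compact set, such as the graph of a path, its continuity is uniform, also with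
  respect to points off that set.\<close>

lemma continuous_on_compact_tube:
  fixes G :: "'a::metric_space \<Rightarrow> 'b::metric_space"
  assumes "compact K" "K \<subseteq> D" "continuous_on D G" "0 < e"
  shows "\<exists>d>0. \<forall>k\<in>K. \<forall>y\<in>D. dist y k < d \<longrightarrow> dist (G y) (G k) < e"
proof (rule ccontr)
  assume "\<not> ?thesis"
  then have "\<exists>k y. k \<in> K \<and> y \<in> D \<and> dist y k < 1 / Suc n \<and> \<not> dist (G y) (G k) < e" for n
    by (metis zero_less_divide_1_iff of_nat_0_less_iff zero_less_Suc)
  then obtain k y where ky: "\<And>n. k n \<in> K" "\<And>n. y n \<in> D" "\<And>n. dist (y n) (k n) < 1 / Suc n"
    "\<And>n. \<not> dist (G (y n)) (G (k n)) < e" by metis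
  obtain l r where l: "l \<in> K" "strict_mono r" "(k \<circ> r) \<longlonglongrightarrow> l"
    using assms(1) ky(1) unfolding compact_def by metis
  have "(\<lambda>n. dist (y n) (k n)) \<longlonglongrightarrow> 0"
    by (rule tendsto_sandwich[OF _ _ tendsto_const LIMSEQ_Suc[OF lim_1_over_n]])
       (use less_imp_le[OF ky(3)] in \<open>auto intro!: always_eventually\<close>)
  then have d0: "(\<lambda>n. dist ((y \<circ> r) n) ((k \<circ> r) n)) \<longlonglongrightarrow> 0"
    using LIMSEQ_subseq_LIMSEQ[OF _ l(2)] by (simp add: o_def)
  have yl: "(y \<circ> r) \<longlonglongrightarrow> l"
  proof (subst tendsto_dist_iff, rule tendsto_sandwich[OF _ _ tendsto_const])
    show "(\<lambda>n. dist ((y \<circ> r) n) ((k \<circ> r) n) + dist ((k \<circ> r) n) l) \<longlonglongrightarrow> 0"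
      using tendsto_add[OF d0 tendsto_dist_iff[THEN iffD1, OF l(3)]] by simp
  qed (auto intro!: always_eventually dist_triangle)
  have "(\<lambda>n. G ((y \<circ> r) n)) \<longlonglongrightarrow> G l" "(\<lambda>n. G ((k \<circ> r) n)) \<longlonglongrightarrow> G l"
    using assms(2) l(1) ky(1,2)
    by (intro continuous_on_tendsto_compose[OF assms(3)] yl l(3) always_eventually; auto)+
  then have "(\<lambda>n. dist (G ((y \<circ> r) n)) (G ((k \<circ> r) n))) \<longlonglongrightarrow> dist (G l) (G l)" by (rule tendsto_dist)
  then have "\<forall>\<^sub>F n in sequentially. dist (G ((y \<circ> r) n)) (G ((k \<circ> r) n)) < e"
    using assms(4) by (intro order_tendstoD) auto
  then show False using ky(4) by (auto simp: eventually_sequentially)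
qed

lemma uniform_limit_continuous_compose:
  fixes G :: "'a::metric_space \<Rightarrow> 'b::metric_space"
  assumes "uniform_limit S fN f F" "compact (f ` S)" "f ` S \<subseteq> D" "\<And>N r. r \<in> S \<Longrightarrow> fN N r \<in> D" "continuous_on D G"
  shows "uniform_limit S (\<lambda>N r. G (fN N r)) (\<lambda>r. G (f r)) F"
proof (rule uniform_limitI)
  fix e :: real assume "e > 0"
  from continuous_on_compact_tube[OF assms(2,3,5) this] obtain d where d: "d > 0"
    "\<And>k y. k \<in> f ` S \<Longrightarrow> y \<in> D \<Longrightarrow> dist y k < d \<Longrightarrow> dist (G y) (G k) < e" by blast
  show "\<forall>\<^sub>F N in F. \<forall>r\<in>S. dist (G (fN N r)) (G (f r)) < e"
    using uniform_limitD[OF assms(1) d(1)] by eventually_elim (use d(2) assms(4) in auto)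
qed

text \<open>A finite net of the compact image reduces uniform to pointwise convergence; the common
  norm bound controls the distance to the net.\<close>

lemma uniform_limit_strong_operator:
  fixes L :: "nat \<Rightarrow> 'a::real_normed_vector \<Rightarrow>\<^sub>L 'b::real_normed_vector" and L0 :: "'a \<Rightarrow>\<^sub>L 'b"
  assumes "\<And>N. norm (L N) \<le> B" "\<And>x. (\<lambda>N. L N x) \<longlonglongrightarrow> L0 x" "compact (f ` S)"
  shows "uniform_limit S (\<lambda>N r. L N (f r)) (\<lambda>r. L0 (f r)) sequentially"
proof (rule uniform_limitI)
  fix e :: real assume e: "e > 0"
  define W where "W = max B (norm L0) + 1"
  have "0 \<le> B" using assms(1)[of 0] norm_ge_zero order_trans by blast
  then have W: "W > 0" "\<And>N. norm (L N) \<le> W" "norm L0 \<le> W"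
    using assms(1) by (auto simp: W_def le_max_iff_disj add_increasing2 intro!: order_trans[OF assms(1)])
  define d where "d = e / (3 * W)"
  have d: "d > 0" using e W by (simp add: d_def)
  obtain k where k: "finite k" "f ` S \<subseteq> (\<Union>x\<in>k. ball x d)"
    using assms(3) d unfolding compact_eq_totally_bounded by meson
  have "\<forall>\<^sub>F N in sequentially. \<forall>x\<in>k. dist (L N x) (L0 x) < e / 3"
    using k(1) e by (intro eventually_ball_finite ballI tendstoD[OF assms(2)]) auto
  then show "\<forall>\<^sub>F N in sequentially. \<forall>r\<in>S. dist (L N (f r)) (L0 (f r)) < e"
  proof eventually_elim
    case (elim N)
    show ?case
    proof
      fix r assume "r \<in> S"
      then obtain x where x: "x \<in> k" "dist x (f r) < d" using k(2) by auto
      have small: "norm (A (f r - x)) < e / 3" if "norm A \<le> W" for A :: "'a \<Rightarrow>\<^sub>L 'b"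
      proof -
        have "norm (A (f r - x)) \<le> W * norm (f r - x)"
          using norm_blinfun[of A "f r - x"] mult_right_mono[OF that norm_ge_zero[of "f r - x"]] by (rule order_trans)
        also have "\<dots> < W * d" using x(2) W by (intro mult_strict_left_mono) (simp_all add: dist_norm norm_minus_commute)
        also have "\<dots> = e / 3" using W by (simp add: d_def)
        finally show ?thesis .
      qed
      have "L N (f r) - L0 (f r) = (L N (f r - x) + (L N x - L0 x)) - L0 (f r - x)"
        by (simp add: blinfun.diff_right)
      then have "dist (L N (f r)) (L0 (f r)) \<le> norm (L N (f r - x)) + norm (L N x - L0 x) + norm (L0 (f r - x))"
        unfolding dist_norm using norm_triangle_ineq4[of "L N (f r - x) + (L N x - L0 x)" "L0 (f r - x)"]
          norm_triangle_ineq[of "L N (f r - x)" "L N x - L0 x"] by simp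
      moreover have "norm (L N x - L0 x) < e / 3" using elim x(1) by (simp add: dist_norm)
      ultimately show "dist (L N (f r)) (L0 (f r)) < e" using small[OF W(2)[of N]] small[OF W(3)] by linarith
    qed
  qed
qed

lemma integral_average_tendsto:
  fixes \<phi> :: "real \<Rightarrow> real"
  assumes "continuous_on UNIV \<phi>" "\<epsilon> \<longlonglongrightarrow> 0" "\<And>n. 0 < \<epsilon> n"
  shows "(\<lambda>n. integral {t..t + \<epsilon> n} \<phi> / \<epsilon> n) \<longlonglongrightarrow> \<phi> t"
proof (rule metric_LIMSEQ_I)
  fix e :: real assume e: "e > 0"
  then obtain d where d: "d > 0" "\<And>u. dist u t < d \<Longrightarrow> dist (\<phi> u) (\<phi> t) < e / 2"
    using assms(1) unfolding continuous_on_iff by (metis UNIV_I half_gt_zero)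
  obtain N where N: "\<And>n. n \<ge> N \<Longrightarrow> \<epsilon> n < d"
    using order_tendstoD(2)[OF assms(2) d(1)] by (auto simp: eventually_sequentially)
  have "dist (integral {t..t + \<epsilon> n} \<phi> / \<epsilon> n) (\<phi> t) < e" if "n \<ge> N" for n
  proof -
    note \<epsilon> = assms(3)[of n]
    have int: "\<phi> integrable_on {t..t + \<epsilon> n}"
      by (rule integrable_continuous_interval[OF continuous_on_subset[OF assms(1)]]) simp
    have "((\<lambda>u. \<phi> u - \<phi> t) has_integral (integral {t..t + \<epsilon> n} \<phi> - \<epsilon> n * \<phi> t)) {t..t + \<epsilon> n}"
      using has_integral_diff[OF integrable_integral[OF int] has_integral_const_real[of "\<phi> t" t "t + \<epsilon> n"]] \<epsilon> by simp
    then have "norm (integral {t..t + \<epsilon> n} \<phi> - \<epsilon> n * \<phi> t) \<le> e / 2 * measure lborel {t..t + \<epsilon> n}"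
      using N[OF that] d(2) e by (intro has_integral_bound_real[where S = "{}"]) (auto simp: dist_real_def intro: less_imp_le)
    then have "\<bar>integral {t..t + \<epsilon> n} \<phi> - \<epsilon> n * \<phi> t\<bar> / \<epsilon> n \<le> e / 2 * \<epsilon> n / \<epsilon> n"
      using \<epsilon> by (intro divide_right_mono) auto
    moreover have "integral {t..t + \<epsilon> n} \<phi> / \<epsilon> n - \<phi> t = (integral {t..t + \<epsilon> n} \<phi> - \<epsilon> n * \<phi> t) / \<epsilon> n"
      using \<epsilon> by (simp add: diff_divide_distrib)
    ultimately have "dist (integral {t..t + \<epsilon> n} \<phi> / \<epsilon> n) (\<phi> t) \<le> e / 2 * \<epsilon> n / \<epsilon> n"
      using \<epsilon> by (simp only: dist_real_def abs_divide abs_of_pos)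
    also have "\<dots> < e" using \<epsilon> e by simp
    finally show ?thesis .
  qed
  then show "\<exists>N. \<forall>n\<ge>N. dist (integral {t..t + \<epsilon> n} \<phi> / \<epsilon> n) (\<phi> t) < e" by blast
qed

text \<open>Shifting the variable cancels the bulk of the integral and leaves the averages of \<phi>
  over the windows of length \<open>\<epsilon> n\<close> that start at \<open>t\<close> and at
  \<open>s\<close>.\<close>

lemma integral_increment_tendsto:
  fixes \<phi> :: "real \<Rightarrow> real"
  assumes "continuous_on UNIV \<phi>" "\<epsilon> \<longlonglongrightarrow> 0" "\<And>n. 0 < \<epsilon> n" "s \<le> t"
  shows "(\<lambda>n. integral {s..t} (\<lambda>r. (\<phi> (r + \<epsilon> n) - \<phi> r) / \<epsilon> n)) \<longlonglongrightarrow> \<phi> t - \<phi> s"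
proof -
  have int: "\<phi> integrable_on {a..b}" for a b
    by (rule integrable_continuous_interval[OF continuous_on_subset[OF assms(1)]]) simp
  have "integral {s..t} (\<lambda>r. (\<phi> (r + \<epsilon> n) - \<phi> r) / \<epsilon> n)
      = integral {t..t + \<epsilon> n} \<phi> / \<epsilon> n - integral {s..s + \<epsilon> n} \<phi> / \<epsilon> n" for n
  proof -
    note \<epsilon> = assms(3)[of n]
    have intsh: "(\<lambda>r. \<phi> (r + \<epsilon> n)) integrable_on {s..t}"
      by (intro integrable_continuous_interval continuous_on_compose2[OF assms(1)] continuous_intros) auto
    have "integral {s..t} (\<lambda>r. \<phi> (r + \<epsilon> n)) = integral {s + \<epsilon> n..t + \<epsilon> n} \<phi>"
      using integral_shift_Icc_real[of s t \<phi> "\<epsilon> n"] by (simp add: o_def add.commute)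
    moreover have "integral {s..s + \<epsilon> n} \<phi> + integral {s + \<epsilon> n..t + \<epsilon> n} \<phi> = integral {s..t + \<epsilon> n} \<phi>"
      using \<epsilon> assms(4) by (intro Henstock_Kurzweil_Integration.integral_combine int) auto
    moreover have "integral {s..t} \<phi> + integral {t..t + \<epsilon> n} \<phi> = integral {s..t + \<epsilon> n} \<phi>"
      using \<epsilon> assms(4) by (intro Henstock_Kurzweil_Integration.integral_combine int) auto
    ultimately have "integral {s..t} (\<lambda>r. \<phi> (r + \<epsilon> n)) - integral {s..t} \<phi>
        = integral {t..t + \<epsilon> n} \<phi> - integral {s..s + \<epsilon> n} \<phi>" by linarith
    moreover have "integral {s..t} (\<lambda>r. (\<phi> (r + \<epsilon> n) - \<phi> r) / \<epsilon> n)
        = (integral {s..t} (\<lambda>r. \<phi> (r + \<epsilon> n)) - integral {s..t} \<phi>) / \<epsilon> n"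
      by (simp add: integral_diff[OF intsh int, symmetric])
    ultimately show ?thesis by (simp only: diff_divide_distrib)
  qed
  then show ?thesis using tendsto_diff[OF integral_average_tendsto[OF assms(1-3)] integral_average_tendsto[OF assms(1-3)]]
    by simp
qed

text \<open>Weak convergence of signed densities: bounded in \<open>L^1\<close>, with primitives
  converging at partition points, they may be integrated against a continuous function. The limit is
  expressed by sums over partitions (first \<open>n\<close>, then \<open>m\<close> tends to
  infinity), so that these sums can be recombined into Riemann-Stieltjes sums of a vector-valued
  integrator.\<close>

lemma weak_convergence_upart:
  fixes g :: "real \<Rightarrow> real" and h :: "nat \<Rightarrow> real \<Rightarrow> real"
  assumes "s \<le> t" and g: "continuous_on {s..t} g" and h: "\<And>n. continuous_on {s..t} (h n)"
    and B: "\<And>n. integral {s..t} (\<lambda>r. \<bar>h n r\<bar>) \<le> B"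
    and lim: "\<And>m i. 0 < m \<Longrightarrow> i \<le> m \<Longrightarrow>
      (\<lambda>n. integral {s..upart s t m i} (h n)) \<longlonglongrightarrow> c (upart s t m i)"
    and e: "0 < e"
  shows "\<forall>\<^sub>F m in sequentially. \<forall>\<^sub>F n in sequentially. \<bar>integral {s..t} (\<lambda>r. g r * h n r)
    - (\<Sum>l<m. g (upart s t m l) * (c (upart s t m (Suc l)) - c (upart s t m l)))\<bar> < e"
proof -
  have "0 \<le> integral {s..t} (\<lambda>r. \<bar>h 0 r\<bar>)"
    by (intro integral_nonneg integrable_continuous_interval continuous_intros h) auto
  then have B0: "0 \<le> B" using B[of 0] by simp
  \<comment> \<open>Half of \<open>e\<close> pays for freezing \<open>g\<close> on each cell, where
    \<open>B\<close> bounds the mass of \<open>h n\<close>; the other half pays for the convergence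
    of the primitives. The summand 1 covers \<open>B = 0\<close>.\<close>
  define e1 where "e1 = e / (2 * (B + 1))"
  have e1: "e1 > 0" using e B0 by (simp add: e1_def)
  have "e1 * (B + 1) = e / 2" using B0 by (simp add: e1_def field_simps)
  then have e1B: "e1 * B < e / 2 + e1 * 0" using e1 by (simp add: distrib_left)
  obtain d where d: "d > 0" "\<And>x y. x \<in> {s..t} \<Longrightarrow> y \<in> {s..t} \<Longrightarrow> \<bar>x - y\<bar> < 2 * d \<Longrightarrow> norm (g x - g y) \<le> e1"
    using continuous_on_Icc_modulus[OF g e1] by blast
  show ?thesis
    using eventually_upart_mesh[OF d(1), of t s]
  proof eventually_elim
    case (elim m)
    define u where "u = upart s t m"
    have P: "RS_partition s t d m u u" unfolding u_def using elim assms(1) by (intro RS_partition_upart) auto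
    note mem = RS_partition_mem[OF P]
    have step: "u l \<le> u (Suc l)" "u (Suc l) - u l < d" if "l < m" for l using P that by (auto simp: RS_partition_def)
    have cells: "integral {s..t} f = (\<Sum>l<m. integral {u l..u (Suc l)} f)" if "continuous_on {s..t} f" for f :: "real \<Rightarrow> real"
    proof -
      have "integral {u l..u (Suc l)} f = integral {s..u (Suc l)} f - integral {s..u l} f" if "l < m" for l
        using Henstock_Kurzweil_Integration.integral_combine[of s "u l" "u (Suc l)" f] mem(1)[of l] mem(2)[of "Suc l"] step[OF that] that
          integrable_continuous_interval[OF continuous_on_subset[OF \<open>continuous_on {s..t} f\<close>], of s "u (Suc l)"] by simp
      then have "(\<Sum>l<m. integral {u l..u (Suc l)} f) = (\<Sum>l<m. integral {s..u (Suc l)} f - integral {s..u l} f)"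
        by (intro sum.cong) auto
      also have "\<dots> = integral {s..t} f"
        using P by (simp add: sum_lessThan_telescope[of "\<lambda>l. integral {s..u l} f"] RS_partition_def)
      finally show ?thesis by simp
    qed
    let ?R = "\<lambda>n. \<Sum>l<m. g (u l) * (integral {s..u (Suc l)} (h n) - integral {s..u l} (h n))"
    have est: "\<bar>integral {s..t} (\<lambda>r. g r * h n r) - ?R n\<bar> \<le> e1 * B" for n
    proof -
      have cell: "integral {s..u (Suc l)} (h n) - integral {s..u l} (h n) = integral {u l..u (Suc l)} (h n)" if "l < m" for l
        using Henstock_Kurzweil_Integration.integral_combine[of s "u l" "u (Suc l)" "h n"] mem(1)[of l] mem(2)[of "Suc l"] step[OF that] that
          integrable_continuous_interval[OF continuous_on_subset[OF h], of s "u (Suc l)" n] by simp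
      have "?R n = (\<Sum>l<m. integral {u l..u (Suc l)} (\<lambda>r. g (u l) * h n r))"
        by (intro sum.cong) (auto simp: cell)
      then have "integral {s..t} (\<lambda>r. g r * h n r) - ?R n =
        (\<Sum>l<m. integral {u l..u (Suc l)} (\<lambda>r. g r * h n r) - integral {u l..u (Suc l)} (\<lambda>r. g (u l) * h n r))"
        by (subst cells) (auto intro!: continuous_intros g h simp: sum_subtractf)
      also have "\<bar>\<dots>\<bar> \<le> (\<Sum>l<m. integral {u l..u (Suc l)} (\<lambda>r. e1 * \<bar>h n r\<bar>))"
      proof (intro order_trans[OF sum_abs] sum_mono)
        fix l assume l: "l \<in> {..<m}"
        have sub: "{u l..u (Suc l)} \<subseteq> {s..t}" using mem(1)[of l] mem(2)[of "Suc l"] l by auto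
        note c = continuous_on_subset[OF g sub] continuous_on_subset[OF h sub]
        have "integral {u l..u (Suc l)} (\<lambda>r. g r * h n r) - integral {u l..u (Suc l)} (\<lambda>r. g (u l) * h n r)
            = integral {u l..u (Suc l)} (\<lambda>r. (g r - g (u l)) * h n r)"
          by (subst integral_diff[symmetric])
             (auto intro!: integrable_continuous_interval continuous_intros c simp: left_diff_distrib)
        also have "\<bar>\<dots>\<bar> \<le> integral {u l..u (Suc l)} (\<lambda>r. e1 * \<bar>h n r\<bar>)"
          unfolding real_norm_def[symmetric]
        proof (rule integral_norm_bound_integral)
          fix r assume r: "r \<in> {u l..u (Suc l)}"
          have "norm (g r - g (u l)) \<le> e1" using r l sub step[of l] mem(1,2)[of l] by (intro d(2)) auto
          then show "norm ((g r - g (u l)) * h n r) \<le> e1 * norm (h n r)"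
            by (simp add: abs_mult mult_right_mono)
        qed (auto intro!: integrable_continuous_interval continuous_intros c)
        finally show "\<bar>integral {u l..u (Suc l)} (\<lambda>r. g r * h n r) - integral {u l..u (Suc l)} (\<lambda>r. g (u l) * h n r)\<bar>
          \<le> integral {u l..u (Suc l)} (\<lambda>r. e1 * \<bar>h n r\<bar>)" .
      qed
      also have "\<dots> = integral {s..t} (\<lambda>r. e1 * \<bar>h n r\<bar>)"
        by (rule cells[symmetric]) (intro continuous_intros h)
      also have "\<dots> \<le> e1 * B" using B[of n] e1 by simp
      finally show ?thesis .
    qed
    have "?R \<longlonglongrightarrow> (\<Sum>l<m. g (u l) * (c (u (Suc l)) - c (u l)))"
      unfolding u_def using elim by (intro tendsto_intros lim) auto
    then have "\<forall>\<^sub>F n in sequentially. dist (?R n) (\<Sum>l<m. g (u l) * (c (u (Suc l)) - c (u l))) < e / 2"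
      using e by (intro tendstoD) auto
    then show ?case
      unfolding u_def[symmetric]
    proof eventually_elim
      case (elim n)
      then have "\<bar>?R n - (\<Sum>l<m. g (u l) * (c (u (Suc l)) - c (u l)))\<bar> < e / 2" by (simp only: dist_real_def)
      then show ?case using est[of n] e1B by linarith
    qed
  qed
qed

section \<open>Continuity and Taylor estimates for functions of class C12\<close>

locale C12_function =
  fixes s T :: real and F Fr :: "real \<Rightarrow> 'h::real_normed_vector \<Rightarrow> real"
    and Fx :: "real \<Rightarrow> 'h \<Rightarrow> 'h \<Rightarrow>\<^sub>L real" and Fxx :: "real \<Rightarrow> 'h \<Rightarrow> 'h \<Rightarrow>\<^sub>L 'h \<Rightarrow>\<^sub>L real"
  assumes C12: "C12_with s T F Fr Fx Fxx"
begin

lemma continuous_F: "continuous_on ({s..T} \<times> UNIV) (\<lambda>(t, x). F t x)"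
  unfolding continuous_on_eq_continuous_within
proof
  fix p assume "p \<in> {s..T} \<times> (UNIV :: 'h set)"
  then obtain t x where p: "p = (t, x)" "t \<in> {s..T}" by auto
  then have "((\<lambda>(r, y). F r y) has_derivative (\<lambda>(h, k). h * Fr t x + Fx t x k)) (at (t, x) within {s..T} \<times> UNIV)"
    using C12 by (simp add: C12_with_def)
  then show "continuous (at p within {s..T} \<times> UNIV) (\<lambda>(t, x). F t x)"
    unfolding p(1) by (rule has_derivative_continuous)
qed

lemma continuous_Fr: "continuous_on ({s..T} \<times> UNIV) (\<lambda>(t, x). Fr t x)"
  and continuous_Fx: "continuous_on ({s..T} \<times> UNIV) (\<lambda>(t, x). Fx t x)"
  and continuous_Fxx: "continuous_on ({s..T} \<times> UNIV) (\<lambda>(t, x). Fxx t x)"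
  using C12 by (auto simp: C12_with_def)

lemma has_derivative_F_space:
  assumes "t \<in> {s..T}"
  shows "(F t has_derivative Fx t x) (at x)"
proof -
  have "((\<lambda>(r, y). F r y) has_derivative (\<lambda>(h, k). h * Fr t x + Fx t x k)) (at (t, x) within {s..T} \<times> UNIV)"
    using C12 assms by (simp add: C12_with_def)
  then have "((\<lambda>(r, y). F r y) has_derivative (\<lambda>(h, k). h * Fr t x + Fx t x k)) (at (t, x) within range (Pair t))"
    by (rule has_derivative_subset) (use assms in auto)
  from has_derivative_in_compose[OF has_derivative_Pair[OF has_derivative_const has_derivative_ident] this]
  show ?thesis by simp
qed

lemma has_derivative_F_time:
  assumes "t \<in> {s..T}"
  shows "((\<lambda>r. F r x) has_derivative (\<lambda>h. h * Fr t x)) (at t within {s..T})"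
proof -
  have "((\<lambda>(r, y). F r y) has_derivative (\<lambda>(h, k). h * Fr t x + Fx t x k)) (at (t, x) within {s..T} \<times> UNIV)"
    using C12 assms by (simp add: C12_with_def)
  then have "((\<lambda>(r, y). F r y) has_derivative (\<lambda>(h, k). h * Fr t x + Fx t x k)) (at (t, x) within (\<lambda>r. (r, x)) ` {s..T})"
    by (rule has_derivative_subset) auto
  from has_derivative_in_compose[OF has_derivative_Pair[OF has_derivative_ident has_derivative_const] this]
  show ?thesis by (simp add: blinfun.zero_right)
qed

lemma F_time_mean_value:
  assumes "s \<le> a" "a \<le> b" "b \<le> T"
  shows "\<exists>\<xi>. a \<le> \<xi> \<and> \<xi> \<le> b \<and> F b x - F a x = (b - a) * Fr \<xi> x"
proof -
  have "\<exists>\<xi>\<in>{a..b}. F b x - F a x = (b - a) * Fr \<xi> x"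
    using assms by (intro mvt_very_simple has_derivative_subset[OF has_derivative_F_time]) auto
  then show ?thesis by auto
qed

text \<open>Lagrange's remainder on the segment from \<open>x\<close> to \<open>x + h\<close>
  evaluates the second derivative at an intermediate point; \<eta> bounds its distance to the value
  at \<open>x\<close>.\<close>

lemma F_space_Taylor:
  assumes t: "t \<in> {s..T}" and \<eta>: "\<And>a. 0 \<le> a \<Longrightarrow> a \<le> 1 \<Longrightarrow> norm (Fxx t (x + a *\<^sub>R h) - Fxx t x) \<le> \<eta>"
  shows "\<bar>F t (x + h) - F t x - Fx t x h - 1 / 2 * Fxx t x h h\<bar> \<le> \<eta> / 2 * (norm h)\<^sup>2"
proof -
  let ?diff = "\<lambda>(m::nat) a. if m = 0 then F t (x + a *\<^sub>R h) else if m = 1 then Fx t (x + a *\<^sub>R h) h else Fxx t (x + a *\<^sub>R h) h h"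
  have line: "((\<lambda>a. x + a *\<^sub>R h) has_derivative (\<lambda>b. b *\<^sub>R h)) (at a)" for a
    by (auto intro!: derivative_eq_intros)
  have d1: "((\<lambda>a. F t (x + a *\<^sub>R h)) has_field_derivative Fx t (x + a *\<^sub>R h) h) (at a)" for a
    unfolding has_field_derivative_def
    by (rule has_derivative_eq_rhs[OF has_derivative_compose[OF line has_derivative_F_space[OF t]]])
      (simp add: fun_eq_iff blinfun.scaleR_right mult.commute)
  have d2: "((\<lambda>a. Fx t (x + a *\<^sub>R h) h) has_field_derivative Fxx t (x + a *\<^sub>R h) h h) (at a)" for a
  proof -
    have "(Fx t has_derivative blinfun_apply (Fxx t y)) (at y)" for y using C12 t by (simp add: C12_with_def)
    from has_derivative_compose[OF line this]
    have "((\<lambda>a. Fx t (x + a *\<^sub>R h)) has_derivative (\<lambda>b. Fxx t (x + a *\<^sub>R h) (b *\<^sub>R h))) (at a)" .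
    from bounded_linear.has_derivative[OF blinfun.bounded_linear_left[of h] this]
    show ?thesis unfolding has_field_derivative_def
      by (rule has_derivative_eq_rhs) (simp add: fun_eq_iff blinfun.scaleR_right blinfun.scaleR_left mult.commute)
  qed
  have "\<exists>a>0. a < 1 \<and> F t (x + 1 *\<^sub>R h) =
    (\<Sum>m<2. (?diff m 0 / fact m) * (1 - 0) ^ m) + (?diff 2 a / fact 2) * (1 - 0)\<^sup>2"
    by (rule Taylor_up[of 2 ?diff "\<lambda>a. F t (x + a *\<^sub>R h)" 0 1 0])
       (use d1 d2 in \<open>auto simp: less_2_cases_iff\<close>)
  then obtain a where a: "0 < a" "a < 1" "F t (x + h) = F t x + Fx t x h + Fxx t (x + a *\<^sub>R h) h h / 2"
    by (auto simp: numeral_2_eq_2)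
  have eq: "F t (x + h) - F t x - Fx t x h - 1 / 2 * Fxx t x h h = (Fxx t (x + a *\<^sub>R h) - Fxx t x) h h / 2"
    unfolding a(3) by (simp add: blinfun.diff_left diff_divide_distrib)
  have "\<bar>F t (x + h) - F t x - Fx t x h - 1 / 2 * Fxx t x h h\<bar> = \<bar>(Fxx t (x + a *\<^sub>R h) - Fxx t x) h h\<bar> / 2"
    unfolding eq by simp
  also have "\<dots> \<le> norm (Fxx t (x + a *\<^sub>R h) - Fxx t x) * (norm h * norm h) / 2"
    using norm_blinfun2[of "Fxx t (x + a *\<^sub>R h) - Fxx t x" h h] by simp
  also have "\<dots> \<le> \<eta> * (norm h * norm h) / 2"
    using \<eta>[of a] a by (intro divide_right_mono mult_right_mono) auto
  finally show ?thesis by (simp add: power2_eq_square)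
qed

end

section \<open>The pathwise finite rank formula\<close>

locale C12_path = C12_function s T F Fr Fx Fxx for s T :: real and F Fr :: "real \<Rightarrow> 'h::real_normed_vector \<Rightarrow> real"
    and Fx :: "real \<Rightarrow> 'h \<Rightarrow> 'h \<Rightarrow>\<^sub>L real" and Fxx :: "real \<Rightarrow> 'h \<Rightarrow> 'h \<Rightarrow>\<^sub>L 'h \<Rightarrow>\<^sub>L real" +
  fixes y :: "real \<Rightarrow> 'h"
  assumes less: "s < T" and cont: "continuous_on UNIV y" and const: "\<And>u. T \<le> u \<Longrightarrow> y u = y T"
begin

lemma continuous_along_path:
  fixes G :: "real \<Rightarrow> 'h \<Rightarrow> 'c::topological_space"
  assumes G: "continuous_on ({s..T} \<times> UNIV) (\<lambda>(t, x). G t x)"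
    and f: "continuous_on S f" "f ` S \<subseteq> {s..T}" and g: "continuous_on S g"
  shows "continuous_on S (\<lambda>r. G (f r) (y (g r)))"
proof -
  have "continuous_on S (\<lambda>r. (f r, y (g r)))"
    by (intro continuous_on_Pair f(1) continuous_on_compose2[OF cont g]) auto
  from continuous_on_compose2[OF G this] show ?thesis using f(2) by auto
qed

lemma time_part_tendsto:
  assumes "\<epsilon> \<longlonglongrightarrow> 0" "\<And>n. 0 < \<epsilon> n" "s \<le> t" "t \<le> T"
  shows "(\<lambda>n. integral {s..t} (\<lambda>r. (F (max s (min T (r + \<epsilon> n))) (y (r + \<epsilon> n)) - F r (y (r + \<epsilon> n))) / \<epsilon> n))
    \<longlonglongrightarrow> integral {s..t} (\<lambda>r. Fr r (y r))"
proof -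
  define f where "f n r = (F (max s (min T (r + \<epsilon> n))) (y (r + \<epsilon> n)) - F r (y (r + \<epsilon> n))) / \<epsilon> n" for n r
  \<comment> \<open>At \<open>r = T\<close> the clamping makes the difference quotient 0 instead of
    an approximation of \<open>Fr\<close>. Changing it on this null set gives convergence at every
    point.\<close>
  define f' where "f' n r = (if r = T then Fr T (y T) else f n r)" for n r
  have "compact ((\<lambda>p. Fr (fst p) (y (snd p))) ` ({s..T} \<times> {s..T}))"
    by (intro compact_continuous_image compact_Times continuous_along_path[OF continuous_Fr] continuous_intros) auto
  then obtain B where B: "\<And>u v. u \<in> {s..T} \<Longrightarrow> v \<in> {s..T} \<Longrightarrow> \<bar>Fr u (y v)\<bar> \<le> B"
    by (fastforce dest!: compact_imp_bounded simp: bounded_iff)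
  have mv: "\<exists>\<xi>. r \<le> \<xi> \<and> \<xi> \<le> min T (r + \<epsilon> n) \<and> f n r = (min T (r + \<epsilon> n) - r) / \<epsilon> n * Fr \<xi> (y (r + \<epsilon> n))"
    if "r \<in> {s..t}" for n r
  proof -
    have cl: "max s (min T (r + \<epsilon> n)) = min T (r + \<epsilon> n)" using that assms(2)[of n] less by auto
    have "s \<le> r" "r \<le> min T (r + \<epsilon> n)" "min T (r + \<epsilon> n) \<le> T"
      using that assms(2)[of n] assms(4) by auto
    from F_time_mean_value[OF this, of "y (r + \<epsilon> n)"] show ?thesis by (auto simp: f_def cl)
  qed
  have f_cont: "continuous_on {s..t} (f n)" for n
    unfolding f_def using less assms(2)[of n] assms(4)
    by (intro continuous_intros continuous_along_path[OF continuous_F]) auto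
  have f'_f: "integral {s..t} (f' n) = integral {s..t} (f n)" for n
    by (rule integral_spike[of "{T}"]) (auto simp: f'_def)
  have "(\<lambda>n. integral {s..t} (f' n)) \<longlonglongrightarrow> integral {s..t} (\<lambda>r. Fr r (y r))"
  proof (rule dominated_convergence(2)[where h = "\<lambda>_. B"])
    show "f' n integrable_on {s..t}" for n
      by (rule integrable_spike[OF integrable_continuous_interval[OF f_cont[of n]], of "{T}"]) (auto simp: f'_def)
    fix r assume r: "r \<in> {s..t}"
    show "norm (f' n r) \<le> B" for n
    proof (cases "r = T")
      case True
      then show ?thesis using B[of T T] less by (simp add: f'_def)
    next
      case False
      obtain \<xi> where \<xi>: "r \<le> \<xi>" "\<xi> \<le> min T (r + \<epsilon> n)" "f n r = (min T (r + \<epsilon> n) - r) / \<epsilon> n * Fr \<xi> (y (r + \<epsilon> n))"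
        using mv[OF r] by blast
      \<comment> \<open>The path is constant after \<open>T\<close>, so a shifted value is always
        one taken in \<open>[s, T]\<close>, where the bound \<open>B\<close> applies.\<close>
      have "y (r + \<epsilon> n) = y (min T (r + \<epsilon> n))" using const[of "r + \<epsilon> n"] by (cases "r + \<epsilon> n \<le> T") auto
      then have "\<bar>Fr \<xi> (y (r + \<epsilon> n))\<bar> \<le> B" using B[of \<xi> "min T (r + \<epsilon> n)"] \<xi> r by auto
      moreover have "\<bar>(min T (r + \<epsilon> n) - r) / \<epsilon> n\<bar> \<le> 1" using assms(2)[of n] r assms(4) by auto
      ultimately have "\<bar>(min T (r + \<epsilon> n) - r) / \<epsilon> n\<bar> * \<bar>Fr \<xi> (y (r + \<epsilon> n))\<bar> \<le> 1 * B"
        by (intro mult_mono) auto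
      then show ?thesis using False by (simp add: f'_def \<xi>(3) abs_mult)
    qed
    show "(\<lambda>n. f' n r) \<longlonglongrightarrow> Fr r (y r)"
    proof (cases "r = T")
      case False
      then have rT: "r < T" using r assms(4) by simp
      obtain \<xi> where \<xi>: "\<And>n. r \<le> \<xi> n" "\<And>n. \<xi> n \<le> min T (r + \<epsilon> n)"
        "\<And>n. f n r = (min T (r + \<epsilon> n) - r) / \<epsilon> n * Fr (\<xi> n) (y (r + \<epsilon> n))"
        using mv[OF r] by metis
      have lim: "(\<lambda>n. r + \<epsilon> n) \<longlonglongrightarrow> r" using tendsto_add[OF tendsto_const assms(1), of r] by simp
      have "\<xi> \<longlonglongrightarrow> r"
        by (rule tendsto_sandwich[OF _ _ tendsto_const lim]) (use \<xi>(1,2) in auto)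
      moreover have "(\<lambda>n. y (r + \<epsilon> n)) \<longlonglongrightarrow> y r"
        using continuous_on_tendsto_compose[OF cont lim] by simp
      ultimately have "(\<lambda>n. (\<lambda>(t, x). Fr t x) (\<xi> n, y (r + \<epsilon> n))) \<longlonglongrightarrow> (\<lambda>(t, x). Fr t x) (r, y r)"
        using \<xi>(1,2) r assms(4)
        by (intro continuous_on_tendsto_compose[OF continuous_Fr] tendsto_Pair always_eventually)
          (auto intro: order_trans)
      moreover have "\<forall>\<^sub>F n in sequentially. Fr (\<xi> n) (y (r + \<epsilon> n)) = f' n r"
        using order_tendstoD(2)[OF lim rT]
        by eventually_elim (use False assms(2) in \<open>simp add: f'_def \<xi>(3) less_imp_neq[THEN not_sym]\<close>)
      ultimately show ?thesis using Lim_transform_eventually by fastforce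
    qed (simp add: f'_def)
  qed (rule integrable_const_ivl)
  then show ?thesis unfolding f'_f unfolding f_def .
qed

lemma Fxx_increments_small:
  assumes "0 < \<eta>"
  shows "\<exists>b>0. \<forall>r\<in>{s..T}. \<forall>e. 0 < e \<and> e < b \<longrightarrow> (\<forall>a. 0 \<le> a \<and> a \<le> 1 \<longrightarrow>
    norm (Fxx r (y r + a *\<^sub>R (y (r + e) - y r)) - Fxx r (y r)) \<le> \<eta>)"
proof -
  have comp: "compact ((\<lambda>r. (r, y r)) ` {s..T})"
    by (intro compact_continuous_image continuous_intros continuous_on_subset[OF cont]) auto
  have sub: "(\<lambda>r. (r, y r)) ` {s..T} \<subseteq> {s..T} \<times> UNIV" by auto
  from continuous_on_compact_tube[OF comp sub continuous_Fxx assms]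
  obtain d where d: "d > 0" "\<And>k z. k \<in> (\<lambda>r. (r, y r)) ` {s..T} \<Longrightarrow> z \<in> {s..T} \<times> UNIV \<Longrightarrow> dist z k < d \<Longrightarrow>
      dist ((\<lambda>(t, x). Fxx t x) z) ((\<lambda>(t, x). Fxx t x) k) < \<eta>"
    by blast
  \<comment> \<open>The extra unit of time makes room for \<open>r + e\<close> with
    \<open>e < 1\<close>.\<close>
  have "uniformly_continuous_on {s..T + 1} y"
    by (rule compact_uniformly_continuous[OF continuous_on_subset[OF cont]]) auto
  then obtain b where b: "b > 0" "\<And>u v. u \<in> {s..T + 1} \<Longrightarrow> v \<in> {s..T + 1} \<Longrightarrow> dist v u < b \<Longrightarrow> dist (y v) (y u) < d"
    using d(1) unfolding uniformly_continuous_on_def by metis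
  have "norm (Fxx r (y r + a *\<^sub>R (y (r + e) - y r)) - Fxx r (y r)) \<le> \<eta>"
    if r: "r \<in> {s..T}" and e: "0 < e" "e < min b 1" and a: "0 \<le> a" "a \<le> 1" for r e a
  proof -
    have "norm (y (r + e) - y r) < d" using b(2)[of r "r + e"] r e by (simp add: dist_norm)
    then have "\<bar>a\<bar> * norm (y (r + e) - y r) < d"
      using a mult_left_le_one_le[of "norm (y (r + e) - y r)" a] by simp
    then have "dist (r, y r + a *\<^sub>R (y (r + e) - y r)) (r, y r) < d"
      by (simp add: dist_Pair_Pair dist_norm)
    from d(2)[OF _ _ this] r show ?thesis by (auto simp: dist_norm intro: less_imp_le)
  qed
  then show ?thesis using b(1) by (intro exI[of _ "min b 1"]) auto
qed

end

lemma norm_sum_scaleR_square_le: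
  fixes f :: "'a \<Rightarrow> 'h::real_normed_vector"
  assumes "finite A"
  shows "(norm (\<Sum>a\<in>A. \<alpha> a *\<^sub>R f a))\<^sup>2 \<le> (\<Sum>a\<in>A. (norm (f a))\<^sup>2) * (\<Sum>a\<in>A. (\<alpha> a)\<^sup>2)"
proof -
  have "norm (\<Sum>a\<in>A. \<alpha> a *\<^sub>R f a) \<le> (\<Sum>a\<in>A. \<bar>\<alpha> a\<bar> * norm (f a))"
    by (rule order_trans[OF norm_sum]) simp
  then have "(norm (\<Sum>a\<in>A. \<alpha> a *\<^sub>R f a))\<^sup>2 \<le> (\<Sum>a\<in>A. \<bar>\<alpha> a\<bar> * norm (f a))\<^sup>2"
    by (rule power_mono) simp
  also have "\<dots> \<le> (\<Sum>a\<in>A. (\<bar>\<alpha> a\<bar>)\<^sup>2) * (\<Sum>a\<in>A. (norm (f a))\<^sup>2)" by (rule Cauchy_Schwarz_ineq_sum)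
  finally show ?thesis by (simp add: mult.commute)
qed

text \<open>Both sides are bounded and linear in \<open>u\<close>, so it is enough to compare them
  on elementary tensors. The formula reduces the second order term for \<open>Q X\<close> to the
  scalar components that \<chi>-bar can see.\<close>

lemma bilin_functional_tensor_square_finite:
  fixes \<beta> :: "'h::real_inner \<Rightarrow>\<^sub>L 'h \<Rightarrow>\<^sub>L real" and j :: "'d::real_normed_vector \<Rightarrow> 'h" and Q :: "'h \<Rightarrow>\<^sub>L 'h"
  assumes "bounded_linear j" "\<And>x. Q x = (\<Sum>a\<in>A. inner (j (d a)) x *\<^sub>R a)"
  shows "bilin_functional \<beta> (tensor_square Q u) = (\<Sum>a\<in>A. \<Sum>b\<in>A. \<beta> a b * chi_embed j (d a \<otimes> d b) u)"
proof -
  have "bilin_functional \<beta> o\<^sub>L tensor_square Q = (\<Sum>a\<in>A. \<Sum>b\<in>A. \<beta> a b *\<^sub>R chi_embed j (d a \<otimes> d b))"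
    by (rule blinfun_ptensor_eqI)
      (simp add: assms(2) chi_embed_elem[OF assms(1)] blinfun.sum_left blinfun.sum_right blinfun.scaleR_left
        blinfun.scaleR_right sum_distrib_left mult_ac, subst sum.swap, simp add: mult_ac)
  then have "blinfun_apply (bilin_functional \<beta> o\<^sub>L tensor_square Q) u = blinfun_apply (\<Sum>a\<in>A. \<Sum>b\<in>A. \<beta> a b *\<^sub>R chi_embed j (d a \<otimes> d b)) u"
    by simp
  then show ?thesis by (simp add: blinfun.sum_left blinfun.scaleR_left)
qed

lemma dominated_on_blinfun:
  assumes "dominated_on a b v C" "norm L \<le> K"
  shows "dominated_on a b (\<lambda>r. K * v r) (\<lambda>r. blinfun_apply L (C r))"
  unfolding dominated_on_def
proof (intro allI impI)
  fix x y assume xy: "a \<le> x \<and> x \<le> y \<and> y \<le> b"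
  have "norm (L (C y) - L (C x)) \<le> norm L * norm (C y - C x)"
    using norm_blinfun[of L "C y - C x"] by (simp add: blinfun.diff_right)
  also have "\<dots> \<le> K * (v y - v x)"
    using assms xy order_trans[OF norm_ge_zero assms(2)] by (intro mult_mono dominated_onD[OF assms(1)]) auto
  finally show "norm (L (C y) - L (C x)) \<le> K * v y - K * v x" by (simp add: right_diff_distrib)
qed

text \<open>A deterministic statement about one path. The scalar products of increments converge to
  components of \<open>C\<close>, which turns the second order Taylor term into the Stieltjes
  integral; their diagonal part also bounds the squared increments of \<open>Q x\<close>, which
  makes the remainder negligible. All other terms have known limits, so the value of the Stieltjes
  integral is forced.\<close>

lemma finite_rank_pathwise_Ito:
  fixes x :: "real \<Rightarrow> 'h::real_inner" and Q :: "'h \<Rightarrow>\<^sub>L 'h" and j :: "'d::real_normed_vector \<Rightarrow> 'h"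
  assumes "C12_with s T F Fr Fx Fxx" "s < T"
    and x: "continuous_on UNIV x" "\<And>u. T \<le> u \<Longrightarrow> x u = x T"
    and j: "bounded_linear j" and Q: "finite A" "\<And>z. Q z = (\<Sum>a\<in>A. inner (j (d a)) z *\<^sub>R a)"
    and \<epsilon>: "\<epsilon> \<longlonglongrightarrow> 0" "\<And>n. 0 < \<epsilon> n" and t: "s \<le> t" "t \<le> T"
    and dom: "dominated_on s T v C"
    and lim: "\<And>a b m i. a \<in> A \<Longrightarrow> b \<in> A \<Longrightarrow> 0 < m \<Longrightarrow> i \<le> m \<Longrightarrow>
      (\<lambda>n. integral {s..upart s t m i} (\<lambda>r. inner (j (d a)) (x (r + \<epsilon> n) - x r) * inner (j (d b)) (x (r + \<epsilon> n) - x r) / \<epsilon> n))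
        \<longlonglongrightarrow> chi_embed j (d a \<otimes> d b) (C (upart s t m i))"
    and fw: "(\<lambda>n. integral {s..t} (\<lambda>r. Fx r (Q (x r)) (Q (x (r + \<epsilon> n) - x r)) / \<epsilon> n)) \<longlonglongrightarrow> I"
  shows "has_stieltjes_integral (\<lambda>r. bilin_functional (Fxx r (Q (x r)))) (\<lambda>r. tensor_square Q (C r)) s t
    (2 * (F t (Q (x t)) - F s (Q (x s)) - I - integral {s..t} (\<lambda>r. Fr r (Q (x r)))))"
proof -
  define y where "y r = Q (x r)" for r
  interpret C12_path s T F Fr Fx Fxx y
  proof unfold_locales
    show "continuous_on UNIV y" unfolding y_def by (intro continuous_intros x)
    show "y u = y T" if "T \<le> u" for u using x(2)[OF that] by (simp add: y_def)
  qed fact+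
  define \<Delta> where "\<Delta> n r = y (r + \<epsilon> n) - y r" for n r
  have \<Delta>: "\<Delta> n r = Q (x (r + \<epsilon> n) - x r)" for n r by (simp add: \<Delta>_def y_def blinfun.diff_right)
  define \<alpha> where "\<alpha> a n r = inner (j (d a)) (x (r + \<epsilon> n) - x r)" for a n r
  define h where "h a b n r = \<alpha> a n r * \<alpha> b n r / \<epsilon> n" for a b n r
  have xc: "continuous_on S (\<lambda>r. x (f r))" if "continuous_on S f" for S f
    by (rule continuous_on_compose2[OF x(1) that]) auto
  have hc: "continuous_on S (h a b n)" for S a b n
    unfolding h_def \<alpha>_def by (intro continuous_intros xc) (use \<epsilon>(2)[of n] in auto)
  have yc: "continuous_on S (\<lambda>r. y (f r))" if "continuous_on S f" for S f
    by (rule continuous_on_compose2[OF cont that]) auto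
  have \<Delta>c: "continuous_on S (\<Delta> n)" for S n unfolding \<Delta>_def by (intro continuous_intros yc)
  have hint: "h a b n integrable_on {u..w}" for a b n u w by (rule integrable_continuous_interval[OF hc])
  \<comment> \<open>The end point belongs to the partition with one cell, so \<open>lim\<close> with
    \<open>m = i = 1\<close> makes the diagonal integrals over \<open>[s, t]\<close> convergent,
    hence bounded.\<close>
  have end_t: "upart s t 1 1 = t" by (simp add: upart_def)
  have "\<exists>B. \<forall>a\<in>A. \<forall>n. integral {s..t} (h a a n) \<le> B"
  proof -
    have "\<exists>B. \<forall>n. integral {s..t} (h a a n) \<le> B" if "a \<in> A" for a
    proof -
      have "Bseq (\<lambda>n. integral {s..t} (h a a n))"
        using lim[OF that that, of 1 1] unfolding end_t h_def \<alpha>_def by (intro convergent_imp_Bseq convergentI) auto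
      then obtain B where "\<And>n. norm (integral {s..t} (h a a n)) \<le> B" by (auto simp: Bseq_def)
      then show ?thesis by (intro exI[of _ B]) (auto intro: order_trans[OF abs_ge_self])
    qed
    then obtain B where B: "\<And>a n. a \<in> A \<Longrightarrow> integral {s..t} (h a a n) \<le> B a" by metis
    have "integral {s..t} (h a a n) \<le> (\<Sum>a\<in>A. \<bar>B a\<bar>)" if "a \<in> A" for a n
      using B[OF that, of n] member_le_sum[OF that, of "\<lambda>a. \<bar>B a\<bar>"] Q(1) by simp
    then show ?thesis by blast
  qed
  then obtain B where B: "\<And>a n. a \<in> A \<Longrightarrow> integral {s..t} (h a a n) \<le> B" by blast
  \<comment> \<open>The mixed products are bounded by the diagonal ones through
    \<open>2 \<bar>a b\<bar> \<le> a^2 + b^2\<close>.\<close>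
  have hB: "integral {s..t} (\<lambda>r. \<bar>h a b n r\<bar>) \<le> B" if "a \<in> A" "b \<in> A" for a b n
  proof -
    have "integral {s..t} (\<lambda>r. \<bar>h a b n r\<bar>) \<le> integral {s..t} (\<lambda>r. (h a a n r + h b b n r) / 2)"
    proof (rule integral_le)
      fix r
      have "\<bar>\<alpha> a n r * \<alpha> b n r\<bar> \<le> (\<alpha> a n r * \<alpha> a n r + \<alpha> b n r * \<alpha> b n r) / 2"
        using zero_le_square[of "\<bar>\<alpha> a n r\<bar> - \<bar>\<alpha> b n r\<bar>"] by (simp add: algebra_simps abs_mult)
      then have "\<bar>\<alpha> a n r * \<alpha> b n r\<bar> / \<epsilon> n \<le> (\<alpha> a n r * \<alpha> a n r + \<alpha> b n r * \<alpha> b n r) / 2 / \<epsilon> n"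
        using \<epsilon>(2)[of n] by (intro divide_right_mono) auto
      then show "\<bar>h a b n r\<bar> \<le> (h a a n r + h b b n r) / 2"
        using \<epsilon>(2)[of n] by (simp add: h_def add_divide_distrib)
    qed (auto intro!: integrable_continuous_interval continuous_intros hc)
    also have "\<dots> = (integral {s..t} (h a a n) + integral {s..t} (h b b n)) / 2"
      by (simp add: integral_add[OF hint hint])
    also have "\<dots> \<le> B" using B[OF that(1), of n] B[OF that(2), of n] by simp
    finally show ?thesis .
  qed
  obtain K where K: "has_stieltjes_integral (\<lambda>r. bilin_functional (Fxx r (y r))) (\<lambda>r. tensor_square Q (C r)) s t K"
  proof -
    have "continuous_on {s..t} (\<lambda>r. bilin_functional (Fxx r (y r)))"
      using t by (intro bounded_linear.continuous_on[OF bounded_linear_bilin_functional]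
          continuous_along_path[OF continuous_Fxx] continuous_intros) auto
    moreover have "dominated_on s t (\<lambda>r. norm (tensor_square Q) * v r) (\<lambda>r. tensor_square Q (C r))"
      using t by (intro dominated_on_blinfun dominated_on_subset[OF dom]) auto
    ultimately show ?thesis using has_stieltjes_integral_exists t(1) that by blast
  qed
  define J where "J n = integral {s..t} (\<lambda>r. Fxx r (y r) (\<Delta> n r) (\<Delta> n r) / \<epsilon> n)" for n
  define g where "g a b r = Fxx r (y r) a b" for a b r
  have gc: "continuous_on {s..t} (g a b)" for a b
    unfolding g_def using t
    by (intro continuous_intros continuous_along_path[OF continuous_Fxx]) auto
  have gh: "(\<lambda>r. g a b r * h a b n r) integrable_on {s..t}" for a b n
    by (intro integrable_continuous_interval continuous_on_mult gc hc)
  have J: "J n = (\<Sum>a\<in>A. \<Sum>b\<in>A. integral {s..t} (\<lambda>r. g a b r * h a b n r))" for n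
  proof -
    have "Fxx r (y r) (\<Delta> n r) (\<Delta> n r) / \<epsilon> n = (\<Sum>a\<in>A. \<Sum>b\<in>A. g a b r * h a b n r)" for r
      by (simp add: \<Delta> Q(2) blinfun.sum_left blinfun.sum_right blinfun.scaleR_left blinfun.scaleR_right
          g_def h_def \<alpha>_def sum_divide_distrib sum_distrib_left mult_ac, subst sum.swap, simp add: mult_ac)
    then have "J n = integral {s..t} (\<lambda>r. \<Sum>a\<in>A. \<Sum>b\<in>A. g a b r * h a b n r)" by (simp add: J_def)
    also have "\<dots> = (\<Sum>a\<in>A. integral {s..t} (\<lambda>r. \<Sum>b\<in>A. g a b r * h a b n r))"
      by (rule integral_sum[OF Q(1)]) (rule integrable_sum[OF Q(1)], rule gh)
    also have "\<dots> = (\<Sum>a\<in>A. \<Sum>b\<in>A. integral {s..t} (\<lambda>r. g a b r * h a b n r))"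
      by (intro sum.cong HOL.refl integral_sum Q(1) gh)
    finally show ?thesis .
  qed
  have JK: "J \<longlonglongrightarrow> K"
  proof (rule metric_LIMSEQ_I)
    fix e :: real assume e: "e > 0"
    define c where "c a b r = chi_embed j (d a \<otimes> d b) (C r)" for a b r
    define S where "S m a b = (\<Sum>l<m. g a b (upart s t m l) * (c a b (upart s t m (Suc l)) - c a b (upart s t m l)))" for m a b
    \<comment> \<open>One half of \<open>e\<close> is shared among the pairs of elements of
      \<open>A\<close>; the other half is the distance of the Stieltjes sum from its limit. The
      summand 1 covers an empty \<open>A\<close>.\<close>
    define e' where "e' = e / (2 * (real (card A * card A) + 1))"
    have e': "e' > 0" using e by (simp add: e'_def add_nonneg_pos)
    have sum_S: "RS_sum (\<lambda>r. bilin_functional (Fxx r (y r))) (\<lambda>r. tensor_square Q (C r)) m (upart s t m) (upart s t m)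
        = (\<Sum>a\<in>A. \<Sum>b\<in>A. S m a b)" for m
    proof -
      have "RS_sum (\<lambda>r. bilin_functional (Fxx r (y r))) (\<lambda>r. tensor_square Q (C r)) m (upart s t m) (upart s t m)
        = (\<Sum>l<m. \<Sum>a\<in>A. \<Sum>b\<in>A. g a b (upart s t m l) * (c a b (upart s t m (Suc l)) - c a b (upart s t m l)))"
        unfolding RS_sum_def blinfun.diff_right[symmetric]
        by (simp add: bilin_functional_tensor_square_finite[OF j Q(2)] g_def c_def blinfun.diff_right
            right_diff_distrib sum_subtractf)
      also have "\<dots> = (\<Sum>a\<in>A. \<Sum>l<m. \<Sum>b\<in>A. g a b (upart s t m l) * (c a b (upart s t m (Suc l)) - c a b (upart s t m l)))"
        by (rule sum.swap)
      also have "\<dots> = (\<Sum>a\<in>A. \<Sum>b\<in>A. S m a b)"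
        unfolding S_def by (intro sum.cong HOL.refl sum.swap)
      finally show ?thesis .
    qed
    have "\<forall>\<^sub>F m in sequentially. \<forall>\<^sub>F n in sequentially. \<bar>integral {s..t} (\<lambda>r. g a b r * h a b n r) - S m a b\<bar> < e'"
      if "a \<in> A" "b \<in> A" for a b
      unfolding S_def
      by (rule weak_convergence_upart[OF t(1) gc hc hB[OF that] _ e'])
        (use lim[OF that] in \<open>simp add: h_def \<alpha>_def c_def\<close>)
    then have "\<forall>\<^sub>F m in sequentially. \<forall>a\<in>A. \<forall>b\<in>A. \<forall>\<^sub>F n in sequentially. \<bar>integral {s..t} (\<lambda>r. g a b r * h a b n r) - S m a b\<bar> < e'"
      using Q(1) by (intro eventually_ball_finite ballI) auto
    moreover have "\<forall>\<^sub>F m in sequentially. dist (\<Sum>a\<in>A. \<Sum>b\<in>A. S m a b) K < e / 2"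
      using tendstoD[OF has_stieltjes_integral_upart[OF K t(1)], of "e / 2"] e unfolding sum_S by simp
    ultimately have "\<forall>\<^sub>F m in sequentially. (\<forall>a\<in>A. \<forall>b\<in>A. \<forall>\<^sub>F n in sequentially. \<bar>integral {s..t} (\<lambda>r. g a b r * h a b n r) - S m a b\<bar> < e')
        \<and> dist (\<Sum>a\<in>A. \<Sum>b\<in>A. S m a b) K < e / 2" by (rule eventually_conj)
    from eventually_happens'[OF sequentially_bot this] obtain m where m: "\<forall>a\<in>A. \<forall>b\<in>A. \<forall>\<^sub>F n in sequentially. \<bar>integral {s..t} (\<lambda>r. g a b r * h a b n r) - S m a b\<bar> < e'"
      "dist (\<Sum>a\<in>A. \<Sum>b\<in>A. S m a b) K < e / 2"
      by blast
    have "\<forall>\<^sub>F n in sequentially. \<forall>a\<in>A. \<forall>b\<in>A. \<bar>integral {s..t} (\<lambda>r. g a b r * h a b n r) - S m a b\<bar> < e'"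
      using m(1) Q(1) by (intro eventually_ball_finite ballI) auto
    then have "\<forall>\<^sub>F n in sequentially. dist (J n) K < e"
    proof eventually_elim
      case (elim n)
      have "\<bar>J n - (\<Sum>a\<in>A. \<Sum>b\<in>A. S m a b)\<bar> = \<bar>\<Sum>a\<in>A. \<Sum>b\<in>A. integral {s..t} (\<lambda>r. g a b r * h a b n r) - S m a b\<bar>"
        by (simp add: J sum_subtractf)
      also have "\<dots> \<le> (\<Sum>a\<in>A. \<Sum>b\<in>A. e')"
        using elim by (intro order_trans[OF sum_abs] sum_mono) (auto intro: less_imp_le)
      also have "\<dots> = real (card A * card A) * e'" by simp
      also have "\<dots> < e / 2"
      proof -
        have "(real (card A * card A) + 1) * e' = e / 2"
          unfolding e'_def by (simp add: field_simps add_nonneg_eq_0_iff)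
        then show ?thesis using e' by (simp add: distrib_right)
      qed
      finally show ?case using m(2) unfolding dist_real_def by linarith
    qed
    then show "\<exists>N. \<forall>n\<ge>N. dist (J n) K < e" by (simp add: eventually_sequentially)
  qed
  define R where "R n r = (F r (y (r + \<epsilon> n)) - F r (y r) - Fx r (y r) (\<Delta> n r) - 1 / 2 * Fxx r (y r) (\<Delta> n r) (\<Delta> n r)) / \<epsilon> n" for n r
  have Fc: "continuous_on {s..t} (\<lambda>r. F r (y (r + \<epsilon> n)))" "continuous_on {s..t} (\<lambda>r. F r (y r))"
    "continuous_on {s..t} (\<lambda>r. Fx r (y r) (\<Delta> n r))" "continuous_on {s..t} (\<lambda>r. Fxx r (y r) (\<Delta> n r) (\<Delta> n r))"
    "continuous_on {s..t} (\<lambda>r. F (max s (min T (r + \<epsilon> n))) (y (r + \<epsilon> n)))" for n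
    using t less
    by (intro continuous_intros continuous_along_path[OF continuous_F] continuous_along_path[OF continuous_Fx]
        continuous_along_path[OF continuous_Fxx] \<Delta>c; force)+
  have \<epsilon>0: "\<epsilon> n \<noteq> 0" for n using \<epsilon>(2)[of n] by simp
  have Rint: "R n integrable_on {s..t}" for n
    unfolding R_def using \<epsilon>0 by (intro integrable_continuous_interval continuous_intros Fc) auto
  have R0: "(\<lambda>n. integral {s..t} (R n)) \<longlonglongrightarrow> 0"
  proof (rule metric_LIMSEQ_I)
    fix e :: real assume e: "e > 0"
    \<comment> \<open>By Cauchy-Schwarz the squared norm of an increment of \<open>Q x\<close>,
      divided by \<open>\<epsilon> n\<close>, is at most the first factor times the sum of the
      diagonal products, and the integral of that sum is bounded by the second factor.\<close>
    define M where "M = (\<Sum>a\<in>A. (norm a)\<^sup>2) * (real (card A) * \<bar>B\<bar>)"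
    have M: "M \<ge> 0" unfolding M_def by (intro mult_nonneg_nonneg sum_nonneg) auto
    define \<eta> where "\<eta> = e / (M + 1)"
    have \<eta>: "\<eta> > 0" using e M by (simp add: \<eta>_def)
    obtain b where b: "b > 0" "\<And>r e a. r \<in> {s..T} \<Longrightarrow> 0 < e \<Longrightarrow> e < b \<Longrightarrow> 0 \<le> a \<Longrightarrow> a \<le> 1 \<Longrightarrow>
      norm (Fxx r (y r + a *\<^sub>R (y (r + e) - y r)) - Fxx r (y r)) \<le> \<eta>"
      using Fxx_increments_small[OF \<eta>] by blast
    obtain N where N: "\<And>n. n \<ge> N \<Longrightarrow> \<epsilon> n < b"
      using order_tendstoD(2)[OF \<epsilon>(1) b(1)] by (auto simp: eventually_sequentially)
    have "dist (integral {s..t} (R n)) 0 < e" if n: "n \<ge> N" for n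
    proof -
      let ?W = "\<lambda>r. \<eta> / 2 * ((\<Sum>a\<in>A. (norm a)\<^sup>2) * (\<Sum>a\<in>A. h a a n r))"
      have "norm (integral {s..t} (R n)) \<le> integral {s..t} ?W"
      proof (rule integral_norm_bound_integral[OF Rint])
        show "?W integrable_on {s..t}" by (intro integrable_continuous_interval continuous_intros hc)
        fix r assume r: "r \<in> {s..t}"
        have "\<bar>F r (y r + \<Delta> n r) - F r (y r) - Fx r (y r) (\<Delta> n r) - 1 / 2 * Fxx r (y r) (\<Delta> n r) (\<Delta> n r)\<bar> \<le> \<eta> / 2 * (norm (\<Delta> n r))\<^sup>2"
          using r t b(2)[OF _ \<epsilon>(2) N[OF n]] by (intro F_space_Taylor) (auto simp: \<Delta>_def)
        also have "\<dots> \<le> \<eta> / 2 * ((\<Sum>a\<in>A. (norm a)\<^sup>2) * (\<Sum>a\<in>A. (\<alpha> a n r)\<^sup>2))"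
          unfolding \<Delta> Q(2) \<alpha>_def using \<eta> by (intro mult_left_mono norm_sum_scaleR_square_le Q) auto
        finally have "\<bar>F r (y (r + \<epsilon> n)) - F r (y r) - Fx r (y r) (\<Delta> n r) - 1 / 2 * Fxx r (y r) (\<Delta> n r) (\<Delta> n r)\<bar> / \<epsilon> n
          \<le> \<eta> / 2 * ((\<Sum>a\<in>A. (norm a)\<^sup>2) * (\<Sum>a\<in>A. (\<alpha> a n r)\<^sup>2)) / \<epsilon> n"
          using \<epsilon>(2)[of n] by (intro divide_right_mono) (auto simp: \<Delta>_def)
        also have "\<dots> = ?W r"
          by (simp add: h_def power2_eq_square sum_divide_distrib[symmetric])
        finally show "norm (R n r) \<le> ?W r" unfolding R_def using \<epsilon>(2)[of n] by (simp only: real_norm_def abs_divide abs_of_pos)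
      qed
      also have "\<dots> = \<eta> / 2 * ((\<Sum>a\<in>A. (norm a)\<^sup>2) * (\<Sum>a\<in>A. integral {s..t} (h a a n)))"
        by (simp add: integral_sum[OF Q(1) hint])
      also have "\<dots> \<le> \<eta> / 2 * M"
      proof -
        have "(\<Sum>a\<in>A. integral {s..t} (h a a n)) \<le> (\<Sum>a\<in>A. \<bar>B\<bar>)"
          by (intro sum_mono order_trans[OF B abs_ge_self])
        then show ?thesis unfolding M_def using \<eta> by (intro mult_left_mono sum_nonneg) auto
      qed
      also have "\<dots> < e"
      proof -
        have "\<eta> * (M + 1) = e" using M by (simp add: \<eta>_def)
        then have "\<eta> * M + \<eta> = e" by (simp add: distrib_left)
        moreover have "\<eta> / 2 * M \<le> \<eta> * M" using \<eta> M by (intro mult_right_mono) auto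
        ultimately show ?thesis using \<eta> by linarith
      qed
      finally show ?thesis by simp
    qed
    then show "\<exists>N. \<forall>n\<ge>N. dist (integral {s..t} (R n)) 0 < e" by blast
  qed
  define \<phi> where "\<phi> u = F (max s (min T u)) (y u)" for u
  have \<phi>c: "continuous_on UNIV \<phi>"
    unfolding \<phi>_def using less by (intro continuous_along_path[OF continuous_F] continuous_intros) auto
  \<comment> \<open>The increment of \<phi> is split at the point
    \<open>(r, y (r + \<epsilon> n))\<close>: first time moves with the space variable already
    advanced, then space moves at frozen time and is expanded to second order.\<close>
  have split: "integral {s..t} (\<lambda>r. (\<phi> (r + \<epsilon> n) - \<phi> r) / \<epsilon> n)
    = integral {s..t} (\<lambda>r. (F (max s (min T (r + \<epsilon> n))) (y (r + \<epsilon> n)) - F r (y (r + \<epsilon> n))) / \<epsilon> n)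
      + integral {s..t} (\<lambda>r. Fx r (y r) (\<Delta> n r) / \<epsilon> n) + 1 / 2 * J n + integral {s..t} (R n)" for n
  proof -
    let ?a = "\<lambda>r. (F (max s (min T (r + \<epsilon> n))) (y (r + \<epsilon> n)) - F r (y (r + \<epsilon> n))) / \<epsilon> n"
    let ?b = "\<lambda>r. Fx r (y r) (\<Delta> n r) / \<epsilon> n"
    let ?c = "\<lambda>r. 1 / 2 * (Fxx r (y r) (\<Delta> n r) (\<Delta> n r) / \<epsilon> n)"
    have ints: "?a integrable_on {s..t}" "?b integrable_on {s..t}" "?c integrable_on {s..t}"
      using \<epsilon>0 by (intro integrable_continuous_interval continuous_intros Fc; simp)+
    have "(\<phi> (r + \<epsilon> n) - \<phi> r) / \<epsilon> n = ?a r + ?b r + ?c r + R n r" if "r \<in> {s..t}" for r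
    proof -
      have "max s (min T r) = r" using that t by auto
      then show ?thesis unfolding \<phi>_def R_def by (simp add: diff_divide_distrib add_divide_distrib)
    qed
    then have "integral {s..t} (\<lambda>r. (\<phi> (r + \<epsilon> n) - \<phi> r) / \<epsilon> n) = integral {s..t} (\<lambda>r. ?a r + ?b r + ?c r + R n r)"
      by (rule integral_cong)
    also have "\<dots> = integral {s..t} ?a + integral {s..t} ?b + integral {s..t} ?c + integral {s..t} (R n)"
      by (simp only: integral_add ints Rint integrable_add)
    also have "integral {s..t} ?c = 1 / 2 * J n" unfolding J_def by (rule integral_mult_right)
    finally show ?thesis .
  qed
  have "(\<lambda>n. integral {s..t} (\<lambda>r. Fx r (y r) (\<Delta> n r) / \<epsilon> n)) \<longlonglongrightarrow> I" using fw by (simp add: \<Delta> y_def)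
  then have "(\<lambda>n. integral {s..t} (\<lambda>r. (\<phi> (r + \<epsilon> n) - \<phi> r) / \<epsilon> n)) \<longlonglongrightarrow>
      integral {s..t} (\<lambda>r. Fr r (y r)) + I + 1 / 2 * K + 0"
    unfolding split by (intro tendsto_intros time_part_tendsto \<epsilon> t JK R0)
  moreover have "(\<lambda>n. integral {s..t} (\<lambda>r. (\<phi> (r + \<epsilon> n) - \<phi> r) / \<epsilon> n)) \<longlonglongrightarrow> \<phi> t - \<phi> s"
    by (rule integral_increment_tendsto[OF \<phi>c \<epsilon> t(1)])
  ultimately have "\<phi> t - \<phi> s = integral {s..t} (\<lambda>r. Fr r (y r)) + I + 1 / 2 * K + 0"
    by (rule LIMSEQ_unique[rotated])
  moreover have "\<phi> t = F t (y t)" "\<phi> s = F s (y s)" using t less by (auto simp: \<phi>_def)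
  ultimately have "K = 2 * (F t (y t) - F s (y s) - I - integral {s..t} (\<lambda>r. Fr r (y r)))" by simp
  with K show ?thesis by (simp add: y_def)
qed

section \<open>Convergence in measure and forward integrals\<close>

lemma min1_triangle: "min 1 \<bar>a + b\<bar> \<le> min 1 \<bar>a\<bar> + min 1 \<bar>b :: real\<bar>"
  by (auto simp: min_def)

text \<open>On a finite measure space, convergence of this size to 0 is convergence in measure. It
  is subadditive but not homogeneous.\<close>

definition L0_size :: "'a measure \<Rightarrow> ('a \<Rightarrow> real) \<Rightarrow> real" where
  "L0_size N Z = (\<integral>z. min 1 \<bar>Z z\<bar> \<partial>N)"

context finite_measure
begin

lemma integrable_min1 [simp, intro]: "Z \<in> borel_measurable M \<Longrightarrow> integrable M (\<lambda>z. min 1 \<bar>Z z :: real\<bar>)"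
  by (rule integrable_const_bound[of _ 1]) auto

lemma L0_size_nonneg: "0 \<le> L0_size M Z"
  unfolding L0_size_def by (intro integral_nonneg_AE) auto

lemma L0_size_triangle:
  assumes "A \<in> borel_measurable M" "B \<in> borel_measurable M" "Z \<in> borel_measurable M"
    and "\<And>z. z \<in> space M \<Longrightarrow> Z z = A z + B z"
  shows "L0_size M Z \<le> L0_size M A + L0_size M B"
proof -
  have "L0_size M Z \<le> (\<integral>z. min 1 \<bar>A z\<bar> + min 1 \<bar>B z\<bar> \<partial>M)"
    unfolding L0_size_def using assms
    by (intro integral_mono integrable_min1 Bochner_Integration.integrable_add) (simp_all add: min1_triangle)
  then show ?thesis using assms by (simp add: L0_size_def Bochner_Integration.integral_add)
qed

lemma L0_size_mono:
  assumes "A \<in> borel_measurable M" "Z \<in> borel_measurable M" "\<And>z. z \<in> space M \<Longrightarrow> \<bar>Z z\<bar> \<le> \<bar>A z\<bar>"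
  shows "L0_size M Z \<le> L0_size M A"
  unfolding L0_size_def by (intro integral_mono integrable_min1 min.mono order_refl assms)

lemma L0_size_tendsto:
  assumes "\<And>n. Z n \<in> borel_measurable M" "A \<in> borel_measurable M" "AE z in M. (\<lambda>n. Z n z) \<longlonglongrightarrow> A z"
  shows "(\<lambda>n. L0_size M (Z n)) \<longlonglongrightarrow> L0_size M A"
  unfolding L0_size_def
proof (rule integral_dominated_convergence[where w = "\<lambda>_. 1"])
  show "AE z in M. (\<lambda>n. min 1 \<bar>Z n z\<bar>) \<longlonglongrightarrow> min 1 \<bar>A z\<bar>"
    using assms(3) by eventually_elim (intro tendsto_intros)
qed (use assms in auto)

lemma L0_size_AE_subseq:
  assumes "\<And>n. Z n \<in> borel_measurable M" "(\<lambda>n. L0_size M (Z n)) \<longlonglongrightarrow> 0"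
  shows "\<exists>r. strict_mono (r :: nat \<Rightarrow> nat) \<and> (AE z in M. (\<lambda>n. Z (r n) z) \<longlonglongrightarrow> 0)"
proof -
  have "\<exists>r. strict_mono (r :: nat \<Rightarrow> nat) \<and> (AE z in M. (\<lambda>n. min 1 \<bar>Z (r n) z\<bar>) \<longlonglongrightarrow> 0)"
    by (rule tendsto_L1_AE_subseq) (use assms in \<open>simp_all add: L0_size_def\<close>)
  then obtain r :: "nat \<Rightarrow> nat" where r: "strict_mono r" "AE z in M. (\<lambda>n. min 1 \<bar>Z (r n) z\<bar>) \<longlonglongrightarrow> 0" by blast
  have "(\<lambda>n. a n) \<longlonglongrightarrow> 0" if "(\<lambda>n. min 1 \<bar>a n\<bar>) \<longlonglongrightarrow> 0" for a :: "nat \<Rightarrow> real"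
  proof (rule tendsto_rabs_zero_cancel, rule Lim_transform_eventually[OF that])
    show "\<forall>\<^sub>F n in sequentially. min 1 \<bar>a n\<bar> = \<bar>a n\<bar>"
      using order_tendstoD(2)[OF that, of 1] by (auto elim!: eventually_mono simp: min_def split: if_splits)
  qed
  then have "AE z in M. (\<lambda>n. Z (r n) z) \<longlonglongrightarrow> 0" using r(2) by (auto elim!: eventually_mono)
  then show ?thesis using r(1) by blast
qed

text \<open>Countably many sequences that converge in measure converge almost everywhere along one common
  subsequence: the weighted sums \<open>\<Sum>k<n. 2\<^sup>-\<^sup>k min 1 \<bar>Z k n\<bar>\<close> converge in \<open>L\<^sup>1\<close>.\<close>

lemma L0_size_AE_subseq_countable:
  fixes Z :: "nat \<Rightarrow> nat \<Rightarrow> 'a \<Rightarrow> real"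
  assumes Z: "\<And>k n. Z k n \<in> borel_measurable M" "\<And>k. (\<lambda>n. L0_size M (Z k n)) \<longlonglongrightarrow> 0"
  shows "\<exists>r. strict_mono (r :: nat \<Rightarrow> nat) \<and> (AE z in M. \<forall>k. (\<lambda>n. Z k (r n) z) \<longlonglongrightarrow> 0)"
proof -
  define W where "W n z = (\<Sum>k<n. (1/2) ^ k * min 1 \<bar>Z k n z\<bar>)" for n z
  have Wm: "W n \<in> borel_measurable M" for n unfolding W_def using Z(1) by measurable
  have W0: "0 \<le> W n z" for n z unfolding W_def by (intro sum_nonneg) auto
  define C where "C = measure M (space M)"
  have sz_le: "L0_size M A \<le> C" if "A \<in> borel_measurable M" for A
  proof -
    have "L0_size M A \<le> (\<integral>z. 1 \<partial>M)" unfolding L0_size_def using that by (intro integral_mono) auto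
    then show ?thesis by (simp add: C_def)
  qed
  have C: "C \<ge> 0" by (simp add: C_def)
  have WI: "(\<integral>z. norm (W n z) \<partial>M) = (\<Sum>k<n. (1/2) ^ k * L0_size M (Z k n))" for n
    using Z(1) W0 by (simp add: W_def L0_size_def)
  have lim: "(\<lambda>n. \<integral>z. norm (W n z) \<partial>M) \<longlonglongrightarrow> 0"
  proof (rule metric_LIMSEQ_I)
    fix e :: real assume e: "e > 0"
    have "(\<lambda>m. 2 * C * (1/2) ^ m) \<longlonglongrightarrow> 2 * C * 0" by (intro tendsto_intros LIMSEQ_power_zero) auto
    then have "\<forall>\<^sub>F m in sequentially. 2 * C * (1/2) ^ m < e / 2" using e by (intro order_tendstoD) auto
    then obtain m where m: "2 * C * (1/2) ^ m < e / 2" by (auto simp: eventually_sequentially)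
    have "(\<lambda>n. \<Sum>k<m. L0_size M (Z k n)) \<longlonglongrightarrow> (\<Sum>k<m. 0)" by (intro tendsto_sum Z)
    then have "\<forall>\<^sub>F n in sequentially. (\<Sum>k<m. L0_size M (Z k n)) < e / 2" using e by (intro order_tendstoD) auto
    then have "\<forall>\<^sub>F n in sequentially. dist (\<integral>z. norm (W n z) \<partial>M) 0 < e"
      using eventually_ge_at_top[of m]
    proof eventually_elim
      case (elim n)
      have split: "(\<Sum>k<n. (1/2) ^ k * L0_size M (Z k n)) = (\<Sum>k<m. (1/2) ^ k * L0_size M (Z k n)) + (\<Sum>k=m..<n. (1/2) ^ k * L0_size M (Z k n))"
        using sum.atLeastLessThan_concat[of 0 m n "\<lambda>k. (1/2) ^ k * L0_size M (Z k n)"] elim by (simp add: atLeast0LessThan)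
      have head: "(\<Sum>k<m. (1/2) ^ k * L0_size M (Z k n)) \<le> (\<Sum>k<m. L0_size M (Z k n))"
        by (intro sum_mono mult_left_le_one_le L0_size_nonneg) (auto simp: power_le_one)
      have "(\<Sum>k=m..<n. (1/2) ^ k * L0_size M (Z k n)) \<le> (\<Sum>k=m..<n. (1/2) ^ k * C)"
        by (intro sum_mono mult_left_mono sz_le Z) auto
      also have "\<dots> = (\<Sum>k=m..<n. (- 2 * C * (1/2) ^ Suc k) - (- 2 * C * (1/2) ^ k))"
        by (rule sum.cong) simp_all
      also have "\<dots> = - 2 * C * (1/2) ^ n - (- 2 * C * (1/2) ^ m)"
        by (rule sum_Suc_diff'[OF elim(2)])
      also have "\<dots> \<le> 2 * C * (1/2) ^ m" using C by simp
      finally have "(\<Sum>k<n. (1/2) ^ k * L0_size M (Z k n)) < e" using elim(1) m head split by linarith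
      moreover have "0 \<le> (\<Sum>k<n. (1/2) ^ k * L0_size M (Z k n))"
        by (intro sum_nonneg mult_nonneg_nonneg L0_size_nonneg) auto
      ultimately show ?case unfolding WI dist_real_def by simp
    qed
    then show "\<exists>N. \<forall>n\<ge>N. dist (\<integral>z. norm (W n z) \<partial>M) 0 < e" by (simp add: eventually_sequentially)
  qed
  have "integrable M (W n)" for n unfolding W_def using Z(1) by simp
  from tendsto_L1_AE_subseq[OF this lim] obtain r :: "nat \<Rightarrow> nat"
    where r: "strict_mono r" "AE z in M. (\<lambda>n. W (r n) z) \<longlonglongrightarrow> 0" by blast
  \<comment> \<open>The weighted sum dominates each of its terms, so
    \<open>min 1 \<bar>Z\<bar>\<close> is at most \<open>2 ^ k * W\<close>; as soon as this is below
    1 the minimum is \<open>\<bar>Z\<bar>\<close> itself.\<close>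
  have "(\<lambda>n. Z k (r n) z) \<longlonglongrightarrow> 0" if W: "(\<lambda>n. W (r n) z) \<longlonglongrightarrow> 0" for k z
  proof -
    have "(\<lambda>n. 2 ^ k * W (r n) z) \<longlonglongrightarrow> 2 ^ k * 0" by (intro tendsto_intros W)
    then have lim': "(\<lambda>n. 2 ^ k * W (r n) z) \<longlonglongrightarrow> 0" by simp
    have "\<forall>\<^sub>F n in sequentially. norm (Z k (r n) z) \<le> 2 ^ k * W (r n) z"
      using order_tendstoD(2)[OF lim' zero_less_one] eventually_gt_at_top[of k]
    proof eventually_elim
      case (elim n)
      have "(1/2) ^ k * min 1 \<bar>Z k (r n) z\<bar> \<le> W (r n) z"
        unfolding W_def using elim(2) seq_suble[OF r(1), of n]
        by (intro member_le_sum) auto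
      then have "2 ^ k * ((1/2) ^ k * min 1 \<bar>Z k (r n) z\<bar>) \<le> 2 ^ k * W (r n) z" by (intro mult_left_mono) auto
      then have "min 1 \<bar>Z k (r n) z\<bar> \<le> 2 ^ k * W (r n) z" by (simp add: power_one_over)
      then show ?case using elim(1) by (auto simp: min_def split: if_splits)
    qed
    then show ?thesis by (rule Lim_null_comparison[OF _ lim'])
  qed
  then have "AE z in M. \<forall>k. (\<lambda>n. Z k (r n) z) \<longlonglongrightarrow> 0" using r(2) by (auto elim!: eventually_mono)
  then show ?thesis using r(1) by blast
qed

lemma L0_size_le_measure:
  assumes "Z \<in> borel_measurable M" "0 \<le> d"
  shows "L0_size M Z \<le> d * measure M (space M) + measure M {z \<in> space M. d < \<bar>Z z\<bar>}"
proof -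
  have S: "{z \<in> space M. d < \<bar>Z z\<bar>} \<in> sets M" using assms(1) by measurable
  have "L0_size M Z \<le> (\<integral>z. d + indicator {z \<in> space M. d < \<bar>Z z\<bar>} z \<partial>M)"
    unfolding L0_size_def
    using assms S
    by (intro integral_mono integrable_min1 Bochner_Integration.integrable_add integrable_const integrable_real_indicator)
      (auto simp: indicator_def min_def emeasure_eq_measure)
  also have "\<dots> = d * measure M (space M) + measure M {z \<in> space M. d < \<bar>Z z\<bar>}"
    by (subst Bochner_Integration.integral_add) (use S in \<open>auto simp: mult.commute emeasure_eq_measure\<close>)
  finally show ?thesis .
qed

end

lemma (in prob_space) L0_size_tendsto_0_if_in_prob:
  assumes Z: "\<And>n. Z n \<in> borel_measurable M"
    and lim: "\<And>d. 0 < d \<Longrightarrow> (\<lambda>n. measure M {z \<in> space M. d < \<bar>Z n z\<bar>}) \<longlonglongrightarrow> 0"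
  shows "(\<lambda>n. L0_size M (Z n)) \<longlonglongrightarrow> 0"
proof (rule metric_LIMSEQ_I)
  fix e :: real assume e: "e > 0"
  have "\<forall>\<^sub>F n in sequentially. measure M {z \<in> space M. e / 2 < \<bar>Z n z\<bar>} < e / 2"
    using e by (intro order_tendstoD(2)[OF lim]) auto
  then have "\<forall>\<^sub>F n in sequentially. dist (L0_size M (Z n)) 0 < e"
  proof eventually_elim
    case (elim n)
    then show ?case using L0_size_le_measure[OF Z, of "e / 2" n] e L0_size_nonneg[of "Z n"]
      by (simp add: prob_space dist_real_def)
  qed
  then show "\<exists>N. \<forall>n\<ge>N. dist (L0_size M (Z n)) 0 < e" by (simp add: eventually_sequentially)
qed

text \<open>The radial retraction onto the ball of radius \<eta>. It is continuous, so a truncated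
  integrand is again admissible, now with a global bound.\<close>

definition radial_truncation :: "real \<Rightarrow> 'd::real_normed_vector \<Rightarrow> 'd" where
  "radial_truncation \<eta> v = (\<eta> / max \<eta> (norm v)) *\<^sub>R v"

lemma radial_truncation:
  assumes "0 < \<eta>"
  shows "continuous_on UNIV (radial_truncation \<eta>)" "norm (radial_truncation \<eta> v) \<le> \<eta>"
    and "norm v \<le> \<eta> \<Longrightarrow> radial_truncation \<eta> v = v"
proof -
  show "continuous_on UNIV (radial_truncation \<eta> :: 'a \<Rightarrow> 'a)"
    unfolding radial_truncation_def[abs_def] using assms by (intro continuous_intros) auto
  have m: "0 < max \<eta> (norm v)" using assms by simp
  have "norm (radial_truncation \<eta> v) = \<eta> * (norm v / max \<eta> (norm v))"
    using assms m by (simp add: radial_truncation_def abs_of_pos)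
  also have "\<dots> \<le> \<eta> * 1" using assms m by (intro mult_left_mono) (auto simp: divide_le_eq)
  finally show "norm (radial_truncation \<eta> v) \<le> \<eta>" by simp
  show "norm v \<le> \<eta> \<Longrightarrow> radial_truncation \<eta> v = v" using assms by (simp add: radial_truncation_def max_def)
qed

section \<open>Regularised forward integrals on the product of time and sample space\<close>

locale path_process = prob_space M for M :: "'w measure" +
  fixes s T :: real and X :: "real \<Rightarrow> 'w \<Rightarrow> 'h::{real_inner, complete_space, second_countable_topology}"
    and j :: "'d::banach \<Rightarrow> 'h"
  assumes less: "s < T"
    and X_measurable: "(\<lambda>(t, \<omega>). X t \<omega>) \<in> borel_measurable (borel \<Otimes>\<^sub>M M)"
    and X_cont: "\<And>\<omega>. \<omega> \<in> space M \<Longrightarrow> continuous_on UNIV (\<lambda>t. X t \<omega>)"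
    and j: "bounded_linear j"
begin

text \<open>The finite product measure \<open>TM\<close> absorbs the exceptional times: convergence
  in probability at almost every time becomes convergence in measure of one function of
  \<open>(t, \<omega>)\<close>.\<close>

definition "Time = restrict_space lborel {s..T}"
definition "TM = Time \<Otimes>\<^sub>M M"

lemma finite_Time: "finite_measure Time"
  unfolding Time_def using less by (intro finite_measureI) (simp add: space_restrict_space emeasure_restrict_space)

sublocale Time: finite_measure Time by (rule finite_Time)
sublocale TM: pair_sigma_finite Time M ..

lemma finite_TM: "finite_measure TM"
  unfolding TM_def by (rule finite_measure_pair_measure) unfold_locales

sublocale prd: finite_measure TM by (rule finite_TM)

lemma space_Time: "space Time = {s..T}" and space_TM: "space TM = {s..T} \<times> space M"
  by (simp_all add: Time_def TM_def space_pair_measure space_restrict_space)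

lemma measurable_fst_TM [measurable]: "fst \<in> borel_measurable TM"
proof -
  have "(\<lambda>x. x) \<in> measurable Time borel" unfolding Time_def by (simp add: measurable_restrict_space1)
  then show ?thesis unfolding TM_def by (intro measurable_compose[OF measurable_fst]) 
qed

lemma measurable_snd_TM [measurable]: "snd \<in> measurable TM M"
  unfolding TM_def by (rule measurable_snd)

lemma X_compose [measurable]:
  assumes [measurable]: "f \<in> borel_measurable N" "g \<in> measurable N M"
  shows "(\<lambda>z. X (f z) (g z)) \<in> borel_measurable N"
proof -
  have "(\<lambda>z. (f z, g z)) \<in> measurable N (borel \<Otimes>\<^sub>M M)" by measurable
  from measurable_compose[OF this X_measurable] show ?thesis by simp
qed

definition "integrand \<Gamma> e r \<omega> = inner (j (\<Gamma> (r, X r \<omega>))) (X (r + e) \<omega> - X r \<omega>) / e"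
  for \<Gamma> :: "real \<times> 'h \<Rightarrow> 'd" and e r :: real and \<omega> :: 'w

definition "fwd \<Gamma> e z = (LINT r:{s..fst z}|lborel. integrand \<Gamma> e r (snd z))"
  for \<Gamma> :: "real \<times> 'h \<Rightarrow> 'd" and e :: real and z :: "real \<times> 'w"

lemma integrand_compose [measurable]:
  assumes \<Gamma>: "continuous_on UNIV \<Gamma>" and [measurable]: "f \<in> borel_measurable N" "g \<in> measurable N M"
  shows "(\<lambda>z. integrand \<Gamma> e (f z) (g z)) \<in> borel_measurable N"
proof -
  have "continuous_on UNIV (\<lambda>p. j (\<Gamma> p))" by (intro bounded_linear.continuous_on[OF j] \<Gamma>)
  then have "(\<lambda>p. j (\<Gamma> p)) \<in> borel_measurable borel" by (rule borel_measurable_continuous_onI)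
  then have [measurable]: "(\<lambda>p. j (\<Gamma> p)) \<in> borel_measurable (borel \<Otimes>\<^sub>M borel)" by (simp add: borel_prod)
  have "(\<lambda>z. (f z, X (f z) (g z))) \<in> measurable N (borel \<Otimes>\<^sub>M borel)" by measurable
  from measurable_compose[OF this \<open>(\<lambda>p. j (\<Gamma> p)) \<in> borel_measurable (borel \<Otimes>\<^sub>M borel)\<close>]
  have [measurable]: "(\<lambda>z. j (\<Gamma> (f z, X (f z) (g z)))) \<in> borel_measurable N" by simp
  show ?thesis unfolding integrand_def by measurable
qed

lemma integral_up_to_measurable:
  assumes "(\<lambda>(z, r). f r z) \<in> borel_measurable (N \<Otimes>\<^sub>M lborel)" "u \<in> borel_measurable N"
  shows "(\<lambda>z. LINT r:{s..u z}|lborel. (f r z :: real)) \<in> borel_measurable N"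
  unfolding set_lebesgue_integral_def
proof (rule lborel.borel_measurable_lebesgue_integral)
  note [measurable] = assms
  have "(\<lambda>(z, r). (if s \<le> r \<and> r \<le> u z then f r z else 0)) \<in> borel_measurable (N \<Otimes>\<^sub>M lborel)"
    using assms(1) by (simp add: case_prod_beta) measurable
  then show "(\<lambda>(z, r). indicat_real {s..u z} r *\<^sub>R f r z) \<in> borel_measurable (N \<Otimes>\<^sub>M lborel)"
    by (rule measurable_cong[THEN iffD1, rotated]) (auto simp: indicator_def)
qed

lemma fwd_measurable [measurable]:
  assumes "continuous_on UNIV \<Gamma>"
  shows "fwd \<Gamma> e \<in> borel_measurable TM"
  unfolding fwd_def[abs_def]
proof (rule integral_up_to_measurable)
  have [measurable]: "snd \<in> borel_measurable (TM \<Otimes>\<^sub>M lborel)"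
    using measurable_snd[of TM lborel] by simp
  have "(\<lambda>z. integrand \<Gamma> e (snd z) (snd (fst z))) \<in> borel_measurable (TM \<Otimes>\<^sub>M lborel)"
    by (rule integrand_compose[OF assms]) measurable
  then show "(\<lambda>(z, r). integrand \<Gamma> e r (snd z)) \<in> borel_measurable (TM \<Otimes>\<^sub>M lborel)"
    by (simp add: case_prod_beta)
qed measurable

lemma integrand_cont:
  assumes \<Gamma>: "continuous_on UNIV \<Gamma>" and \<omega>: "\<omega> \<in> space M"
  shows "continuous_on S (\<lambda>r. integrand \<Gamma> e r \<omega>)"
proof (cases "e = 0")
  case False
  have X: "continuous_on S (\<lambda>r. X (f r) \<omega>)" if "continuous_on S f" for f
    by (rule continuous_on_compose2[OF X_cont[OF \<omega>] that]) auto
  have "continuous_on S (\<lambda>r. \<Gamma> (r, X r \<omega>))"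
    by (rule continuous_on_compose2[OF \<Gamma>]) (intro continuous_intros X, auto)
  then show ?thesis unfolding integrand_def
    using False by (intro continuous_intros X bounded_linear.continuous_on[OF j]) auto
qed (simp add: integrand_def)

lemma LINT_cont_eq_integral:
  assumes "continuous_on {s..t} (f :: real \<Rightarrow> real)"
  shows "(LINT r:{s..t}|lborel. f r) = integral {s..t} f"
  by (rule set_borel_integral_eq_integral(2)) (rule borel_integrable_compact[OF compact_Icc assms, folded set_integrable_def])

lemma fwd_eq_integral:
  assumes "continuous_on UNIV \<Gamma>" "z \<in> space TM"
  shows "fwd \<Gamma> e z = integral {s..fst z} (\<lambda>r. integrand \<Gamma> e r (snd z))"
  unfolding fwd_def using assms by (intro LINT_cont_eq_integral integrand_cont) (auto simp: space_TM)

lemma fwd_diff: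
  assumes "continuous_on UNIV \<Gamma>" "continuous_on UNIV \<Gamma>'" "z \<in> space TM"
  shows "fwd (\<lambda>p. \<Gamma> p - \<Gamma>' p) e z = fwd \<Gamma> e z - fwd \<Gamma>' e z"
proof -
  interpret j: bounded_linear j by (rule j)
  have \<omega>: "snd z \<in> space M" using assms(3) by (auto simp: space_TM)
  have "integral {s..fst z} (\<lambda>r. integrand (\<lambda>p. \<Gamma> p - \<Gamma>' p) e r (snd z)) =
    integral {s..fst z} (\<lambda>r. integrand \<Gamma> e r (snd z) - integrand \<Gamma>' e r (snd z))"
    by (simp add: integrand_def j.diff inner_diff_left diff_divide_distrib)
  also have "\<dots> = integral {s..fst z} (\<lambda>r. integrand \<Gamma> e r (snd z)) - integral {s..fst z} (\<lambda>r. integrand \<Gamma>' e r (snd z))"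
    by (intro integral_diff integrable_continuous_interval integrand_cont assms \<omega>)
  finally show ?thesis using assms by (simp add: fwd_eq_integral continuous_on_diff)
qed

lemma fwd_scaleR: "fwd (\<lambda>p. c *\<^sub>R \<Gamma> p) e z = c * fwd \<Gamma> e z"
proof -
  interpret j: bounded_linear j by (rule j)
  have "integrand (\<lambda>p. c *\<^sub>R \<Gamma> p) e r \<omega> = c * integrand \<Gamma> e r \<omega>" for r \<omega> by (simp add: integrand_def j.scaleR)
  then show ?thesis unfolding fwd_def by (simp add: set_lebesgue_integral_def mult.left_commute)
qed

lemma fwd_cong:
  assumes "\<And>r. s \<le> r \<Longrightarrow> r \<le> fst z \<Longrightarrow> \<Gamma> (r, X r (snd z)) = \<Gamma>' (r, X r (snd z))"
  shows "fwd \<Gamma> e z = fwd \<Gamma>' e z"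
  unfolding fwd_def by (rule set_lebesgue_integral_cong) (auto simp: integrand_def assms)

text \<open>For fixed \<open>e\<close> and \<open>z\<close> the regularised integral is a bounded
  functional of the integrand in the supremum norm. The constant depends on \<open>e\<close> and
  \<open>z\<close>; it yields closedness of the sets in the Baire argument, whereas uniformity in
  \<open>e\<close> is the outcome of that argument.\<close>

lemma fwd_bound:
  assumes z: "z \<in> space TM" and e: "0 < e"
  shows "\<exists>K\<ge>0. \<forall>\<Gamma> \<eta>. continuous_on UNIV \<Gamma> \<longrightarrow> (\<forall>p. norm (\<Gamma> p) \<le> \<eta>) \<longrightarrow> \<bar>fwd \<Gamma> e z\<bar> \<le> \<eta> * K"
proof -
  obtain Kj where Kj: "Kj > 0" "\<And>v. norm (j v) \<le> norm v * Kj" using bounded_linear.pos_bounded[OF j] by blast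
  have \<omega>: "snd z \<in> space M" and t: "s \<le> fst z" using z by (auto simp: space_TM)
  have "continuous_on {s..fst z} (\<lambda>r. X (r + e) (snd z) - X r (snd z))"
    by (intro continuous_intros continuous_on_compose2[OF X_cont[OF \<omega>]]) auto
  then have "bounded ((\<lambda>r. X (r + e) (snd z) - X r (snd z)) ` {s..fst z})"
    by (intro compact_imp_bounded compact_continuous_image) auto
  then obtain B where "\<forall>v\<in>(\<lambda>r. X (r + e) (snd z) - X r (snd z)) ` {s..fst z}. norm v \<le> B"
    unfolding bounded_iff by blast
  then have B: "norm (X (r + e) (snd z) - X r (snd z)) \<le> B" if "r \<in> {s..fst z}" for r using that by blast
  have B0: "0 \<le> B" using B[of s] t norm_ge_zero order_trans by (metis atLeastAtMost_iff order_refl)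
  have "\<bar>fwd \<Gamma> e z\<bar> \<le> \<eta> * (Kj * B / e * (fst z - s))" if \<Gamma>: "continuous_on UNIV \<Gamma>" "\<forall>p. norm (\<Gamma> p) \<le> \<eta>" for \<Gamma> \<eta>
  proof -
    have \<eta>: "0 \<le> \<eta>" using \<Gamma>(2) norm_ge_zero order_trans by blast
    have "norm (integral {s..fst z} (\<lambda>r. integrand \<Gamma> e r (snd z))) \<le> (\<eta> * Kj * B / e) * measure lborel {s..fst z}"
    proof (rule has_integral_bound_real[where S = "{}"])
      show "((\<lambda>r. integrand \<Gamma> e r (snd z)) has_integral integral {s..fst z} (\<lambda>r. integrand \<Gamma> e r (snd z))) {s..fst z}"
        by (intro integrable_integral integrable_continuous_interval integrand_cont \<Gamma> \<omega>)
      fix r assume r: "r \<in> {s..fst z} - {}"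
      have "\<bar>inner (j (\<Gamma> (r, X r (snd z)))) (X (r + e) (snd z) - X r (snd z))\<bar>
          \<le> norm (j (\<Gamma> (r, X r (snd z)))) * norm (X (r + e) (snd z) - X r (snd z))"
        by (rule Cauchy_Schwarz_ineq2)
      also have "\<dots> \<le> (\<eta> * Kj) * B"
      proof (rule mult_mono)
        show "norm (j (\<Gamma> (r, X r (snd z)))) \<le> \<eta> * Kj"
          using Kj(2)[of "\<Gamma> (r, X r (snd z))"] mult_right_mono[OF \<Gamma>(2)[rule_format, of "(r, X r (snd z))"], of Kj] Kj(1) by linarith
      qed (use B r \<eta> Kj in auto)
      finally show "norm (integrand \<Gamma> e r (snd z)) \<le> \<eta> * Kj * B / e"
        using e by (simp add: integrand_def divide_right_mono)
    qed (use \<eta> Kj B0 e in auto)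
    then show ?thesis using fwd_eq_integral[OF \<Gamma>(1) z] t by (simp add: mult_ac)
  qed
  then show ?thesis using Kj B0 e t by (intro exI[of _ "Kj * B / e * (fst z - s)"]) auto
qed

text \<open>The Banach--Steinhaus argument: the sets \<open>E m\<close> are closed and cover the Banach space of bounded continuous
  functions, since a sequence that converges in measure is bounded in measure.\<close>

lemma fwd_equicontinuous:
  assumes \<epsilon>: "\<And>n. 0 < \<epsilon> n"
    and conv: "\<And>\<Gamma> :: real \<times> 'h \<Rightarrow> 'd. continuous_on UNIV \<Gamma> \<Longrightarrow>
      \<exists>I\<in>borel_measurable TM. (\<lambda>n. L0_size TM (\<lambda>z. fwd \<Gamma> (\<epsilon> n) z - I z)) \<longlonglongrightarrow> 0"
    and \<delta>: "0 < \<delta>"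
  shows "\<exists>\<eta>>0. \<forall>\<Gamma>. continuous_on UNIV \<Gamma> \<and> (\<forall>p. norm (\<Gamma> p) \<le> \<eta>) \<longrightarrow> (\<forall>n. L0_size TM (fwd \<Gamma> (\<epsilon> n)) \<le> \<delta>)"
proof -
  \<comment> \<open>By linearity, division by \<open>Suc m\<close> is a scaling of the integrand. It
    is kept explicit because \<open>L0_size\<close> is not homogeneous.\<close>
  define T' where "T' n m \<Gamma> z = fwd (apply_bcontfun \<Gamma>) (\<epsilon> n) z / real (Suc m)" for n m :: nat and \<Gamma> z
  have meas: "T' n m \<Gamma> \<in> borel_measurable TM" for n m \<Gamma>
    unfolding T'_def[abs_def] by (intro borel_measurable_divide fwd_measurable) auto
  define E where "E m = {\<Gamma>. \<forall>n. L0_size TM (T' n m \<Gamma>) \<le> \<delta> / 2}" for m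
  have closedE: "closed (E m)" for m
    unfolding closed_sequential_limits
  proof (intro allI impI, elim conjE)
    fix g :: "nat \<Rightarrow> (real \<times> 'h) \<Rightarrow>\<^sub>C 'd" and l assume g: "\<forall>i. g i \<in> E m" "g \<longlonglongrightarrow> l"
    have "L0_size TM (T' n m l) \<le> \<delta> / 2" for n
    proof (rule LIMSEQ_le_const2)
      show "(\<lambda>i. L0_size TM (T' n m (g i))) \<longlonglongrightarrow> L0_size TM (T' n m l)"
      proof (rule prd.L0_size_tendsto[OF meas meas], rule AE_I2)
        fix z assume z: "z \<in> space TM"
        obtain K where K: "K \<ge> 0" "\<And>\<Gamma> \<eta>. continuous_on UNIV \<Gamma> \<Longrightarrow> (\<forall>p. norm (\<Gamma> p) \<le> \<eta>) \<Longrightarrow> \<bar>fwd \<Gamma> (\<epsilon> n) z\<bar> \<le> \<eta> * K"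
          using fwd_bound[OF z \<epsilon>[of n]] by blast
        have null: "(\<lambda>i. dist (g i) l * K) \<longlonglongrightarrow> 0"
          using tendsto_mult[OF tendsto_dist_iff[THEN iffD1, OF g(2)] tendsto_const[of K]] by simp
        have "(\<lambda>i. fwd (g i) (\<epsilon> n) z - fwd l (\<epsilon> n) z) \<longlonglongrightarrow> 0"
        proof (rule Lim_null_comparison[OF _ null], intro always_eventually allI)
          fix i
          have "norm (g i p - l p) \<le> dist (g i) l" for p using dist_bounded[of "g i" p l] by (simp add: dist_norm)
          then have "\<bar>fwd (\<lambda>p. g i p - l p) (\<epsilon> n) z\<bar> \<le> dist (g i) l * K"
            by (intro K(2)) (auto intro!: continuous_intros)
          then show "norm (fwd (g i) (\<epsilon> n) z - fwd l (\<epsilon> n) z) \<le> dist (g i) l * K"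
            using z by (subst (asm) fwd_diff) auto
        qed
        then have "(\<lambda>i. fwd (g i) (\<epsilon> n) z) \<longlonglongrightarrow> fwd l (\<epsilon> n) z" by (simp add: LIM_zero_iff)
        then show "(\<lambda>i. T' n m (g i) z) \<longlonglongrightarrow> T' n m l z" unfolding T'_def by (intro tendsto_intros) auto
      qed
      show "\<exists>N. \<forall>i\<ge>N. L0_size TM (T' n m (g i)) \<le> \<delta> / 2" using g(1) by (auto simp: E_def)
    qed
    then show "l \<in> E m" by (simp add: E_def)
  qed
  have "\<Gamma> \<in> (\<Union>m. E m)" for \<Gamma>
  proof -
    obtain I where I: "I \<in> borel_measurable TM" "(\<lambda>n. L0_size TM (\<lambda>z. fwd \<Gamma> (\<epsilon> n) z - I z)) \<longlonglongrightarrow> 0"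
      using conv[of \<Gamma>] by auto
    have scale0: "(\<lambda>m. L0_size TM (\<lambda>z. A z / real (Suc m))) \<longlonglongrightarrow> 0" if A: "A \<in> borel_measurable TM" for A
    proof -
      have "(\<lambda>m. A z / real (Suc m)) \<longlonglongrightarrow> 0" for z
        using LIMSEQ_Suc[OF lim_const_over_n[of "A z"]] by simp
      then have "(\<lambda>m. L0_size TM (\<lambda>z. A z / real (Suc m))) \<longlonglongrightarrow> L0_size TM (\<lambda>_. 0)"
        using A by (intro prd.L0_size_tendsto) auto
      then show ?thesis by (simp add: L0_size_def)
    qed
    have mono: "L0_size TM (\<lambda>z. A z / real (Suc m)) \<le> L0_size TM (\<lambda>z. A z / real (Suc k))"
      if "A \<in> borel_measurable TM" "k \<le> m" for A k m
      using that by (intro prd.L0_size_mono) (auto simp: abs_divide intro!: divide_left_mono)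
    \<comment> \<open>From \<open>N\<close> on the functionals are close to their limit
      \<open>I\<close>, so that scaling down \<open>I\<close> handles them all; the finitely many
      earlier ones are scaled down individually.\<close>
    obtain N where N: "\<And>n. n \<ge> N \<Longrightarrow> L0_size TM (\<lambda>z. fwd \<Gamma> (\<epsilon> n) z - I z) < \<delta> / 4"
      using order_tendstoD(2)[OF I(2), of "\<delta> / 4"] \<delta> by (auto simp: eventually_sequentially)
    have fm: "fwd \<Gamma> (\<epsilon> n) \<in> borel_measurable TM" for n by (rule fwd_measurable) simp
    have "\<forall>\<^sub>F m in sequentially. L0_size TM (\<lambda>z. I z / real (Suc m)) < \<delta> / 4"
      using \<delta> by (intro order_tendstoD(2)[OF scale0[OF I(1)]]) auto
    moreover have "\<forall>\<^sub>F m in sequentially. \<forall>n\<in>{..<N}. L0_size TM (\<lambda>z. fwd \<Gamma> (\<epsilon> n) z / real (Suc m)) < \<delta> / 2"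
      using \<delta> by (intro eventually_ball_finite ballI order_tendstoD(2)[OF scale0[OF fm]]) auto
    ultimately have "\<forall>\<^sub>F m in sequentially. L0_size TM (\<lambda>z. I z / real (Suc m)) < \<delta> / 4 \<and>
       (\<forall>n\<in>{..<N}. L0_size TM (\<lambda>z. fwd \<Gamma> (\<epsilon> n) z / real (Suc m)) < \<delta> / 2)" by (rule eventually_conj)
    from eventually_happens'[OF sequentially_bot this] obtain m where m: "L0_size TM (\<lambda>z. I z / real (Suc m)) < \<delta> / 4"
       "\<And>n. n < N \<Longrightarrow> L0_size TM (\<lambda>z. fwd \<Gamma> (\<epsilon> n) z / real (Suc m)) < \<delta> / 2" by auto
    have "L0_size TM (T' n m \<Gamma>) \<le> \<delta> / 2" for n
    proof (cases "n < N")
      case True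
      then show ?thesis using m(2)[OF True] by (simp add: T'_def[abs_def])
    next
      case False
      have "L0_size TM (T' n m \<Gamma>) \<le> L0_size TM (\<lambda>z. (fwd \<Gamma> (\<epsilon> n) z - I z) / real (Suc m)) + L0_size TM (\<lambda>z. I z / real (Suc m))"
        using fm[of n] I(1) meas by (intro prd.L0_size_triangle) (auto simp: T'_def diff_divide_distrib)
      also have "L0_size TM (\<lambda>z. (fwd \<Gamma> (\<epsilon> n) z - I z) / real (Suc m)) \<le> L0_size TM (\<lambda>z. fwd \<Gamma> (\<epsilon> n) z - I z)"
        using mono[of "\<lambda>z. fwd \<Gamma> (\<epsilon> n) z - I z" 0 m] fm[of n] I(1) by simp
      finally show ?thesis using N[of n] False m(1) by simp
    qed
    then have "\<Gamma> \<in> E m" by (simp add: E_def)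
    then show ?thesis by blast
  qed
  then have cover: "(\<Union>m. E m) = UNIV" by blast
  obtain m \<Gamma>0 r where r: "0 < r" "ball \<Gamma>0 r \<subseteq> E m"
    by (rule Baire_closed_cover[OF closedE cover])
  \<comment> \<open>A small \<Gamma>, multiplied by \<open>Suc m\<close>, is a difference of two
    elements of the ball around \<open>\<Gamma>0\<close>; half the radius stays inside the open
    ball. The two elements contribute \<open>\<delta> / 2\<close> each.\<close>
  define \<eta> where "\<eta> = r / 2 / real (Suc m)"
  have \<eta>: "\<eta> > 0" using r by (simp add: \<eta>_def)
  have "L0_size TM (fwd \<Gamma> (\<epsilon> n)) \<le> \<delta>" if \<Gamma>: "continuous_on UNIV \<Gamma>" "\<forall>p. norm (\<Gamma> p) \<le> \<eta>" for \<Gamma> n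
  proof -
    have nb: "norm (real (Suc m) *\<^sub>R \<Gamma> p) \<le> r / 2" for p
    proof -
      have "norm (real (Suc m) *\<^sub>R \<Gamma> p) = real (Suc m) * norm (\<Gamma> p)" by (simp only: norm_scaleR abs_of_nat)
      also have "\<dots> \<le> real (Suc m) * \<eta>" by (rule mult_left_mono[OF \<Gamma>(2)[rule_format]]) simp
      also have "\<dots> = r / 2" by (simp add: \<eta>_def del: of_nat_Suc)
      finally show ?thesis .
    qed
    have "(\<lambda>p. real (Suc m) *\<^sub>R \<Gamma> p) \<in> bcontfun"
      by (rule bcontfun_normI[OF _ nb]) (intro continuous_intros \<Gamma>)
    then obtain g :: "(real \<times> 'h) \<Rightarrow>\<^sub>C 'd" where g: "apply_bcontfun g = (\<lambda>p. real (Suc m) *\<^sub>R \<Gamma> p)"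
      using apply_bcontfun_cases by metis
    have "norm g \<le> r / 2" by (rule norm_bound) (simp only: g nb)
    then have "\<Gamma>0 + g \<in> E m" "\<Gamma>0 \<in> E m" using r by (auto simp: dist_norm intro!: subsetD[OF r(2)])
    then have le: "L0_size TM (T' n m (\<Gamma>0 + g)) \<le> \<delta> / 2" "L0_size TM (T' n m \<Gamma>0) \<le> \<delta> / 2" by (auto simp: E_def)
    have "L0_size TM (fwd \<Gamma> (\<epsilon> n)) \<le> L0_size TM (T' n m (\<Gamma>0 + g)) + L0_size TM (\<lambda>z. - T' n m \<Gamma>0 z)"
    proof (rule prd.L0_size_triangle)
      fix z assume z: "z \<in> space TM"
      have "fwd (\<lambda>p. real (Suc m) *\<^sub>R \<Gamma> p) (\<epsilon> n) z = fwd (\<lambda>p. (\<Gamma>0 + g) p - \<Gamma>0 p) (\<epsilon> n) z" by (simp add: g)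
      also have "\<dots> = fwd (\<Gamma>0 + g) (\<epsilon> n) z - fwd \<Gamma>0 (\<epsilon> n) z" by (rule fwd_diff[OF continuous_on_apply_bcontfun continuous_on_apply_bcontfun z])
      finally have "real (Suc m) * fwd \<Gamma> (\<epsilon> n) z = fwd (\<Gamma>0 + g) (\<epsilon> n) z - fwd \<Gamma>0 (\<epsilon> n) z" by (simp only: fwd_scaleR)
      then have "fwd \<Gamma> (\<epsilon> n) z = (fwd (\<Gamma>0 + g) (\<epsilon> n) z - fwd \<Gamma>0 (\<epsilon> n) z) / real (Suc m)"
        by (metis nonzero_mult_div_cancel_left of_nat_Suc of_nat_neq_0)
      then show "fwd \<Gamma> (\<epsilon> n) z = T' n m (\<Gamma>0 + g) z + - T' n m \<Gamma>0 z" by (simp add: T'_def diff_divide_distrib)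
    qed (use meas fwd_measurable[OF \<Gamma>(1)] in auto)
    also have "L0_size TM (\<lambda>z. - T' n m \<Gamma>0 z) = L0_size TM (T' n m \<Gamma>0)" by (simp add: L0_size_def)
    finally show ?thesis using le by simp
  qed
  then show ?thesis using \<eta> by blast
qed

end

text \<open>Lets countable unions over rational times replace suprema over all times, which makes
  the corresponding events measurable.\<close>

lemma exceeds_at_rational:
  fixes f :: "real \<Rightarrow> real"
  assumes "continuous_on {s..T} f" "s < T" "r0 \<in> {s..T}" "c < f r0"
  shows "\<exists>r\<in>{s..T} \<inter> \<rat>. c < f r"
proof -
  have "0 < f r0 - c" using assms(4) by simp
  then obtain d where d: "d > 0" "\<And>r. r \<in> {s..T} \<Longrightarrow> dist r r0 < d \<Longrightarrow> dist (f r) (f r0) < f r0 - c"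
    using assms(1,3) unfolding continuous_on_iff by blast
  have "max s (r0 - d) < min T (r0 + d)" using assms(2,3) d(1) by auto
  then obtain q where q: "q \<in> \<rat>" "max s (r0 - d) < q" "q < min T (r0 + d)" using Rats_dense_in_real by blast
  then have "dist (f q) (f r0) < f r0 - c" by (intro d(2)) (auto simp: dist_real_def)
  then have "c < f q" by (simp add: dist_real_def)
  then show ?thesis using q by auto
qed

lemma AE_eventually_indicator_tendsto_0:
  assumes "\<And>N. B N \<in> sets M" "finite_measure M" "\<And>z. z \<in> space M \<Longrightarrow> \<forall>\<^sub>F N in sequentially. z \<notin> B N"
  shows "(\<lambda>N. \<integral>z. indicator (B N) z \<partial>M) \<longlonglongrightarrow> (0::real)"
proof -
  interpret finite_measure M by fact
  have "(\<lambda>N. \<integral>z. indicator (B N) z \<partial>M) \<longlonglongrightarrow> (\<integral>z. 0 \<partial>M :: real)"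
  proof (rule integral_dominated_convergence[where w = "\<lambda>_. 1"])
    show "AE z in M. (\<lambda>N. indicat_real (B N) z) \<longlonglongrightarrow> 0"
    proof (rule AE_I2)
      fix z assume "z \<in> space M"
      from assms(3)[OF this] have "\<forall>\<^sub>F N in sequentially. 0 = indicat_real (B N) z" by eventually_elim simp
      then show "(\<lambda>N. indicat_real (B N) z) \<longlonglongrightarrow> 0" by (rule Lim_transform_eventually[OF tendsto_const])
    qed
  qed (use assms(1) in \<open>auto simp: indicator_def\<close>)
  then show ?thesis by simp
qed

context path_process
begin

text \<open>By Fubini the size on the product is the time integral of the sizes at fixed times;
  these tend to 0 at almost every time and are bounded by 1.\<close>

lemma L0_size_TM_tendsto_0:
  assumes Z: "\<And>n. Z n \<in> borel_measurable TM"
    and lim: "AE t in Time. \<forall>d>0. (\<lambda>n. measure M {\<omega> \<in> space M. d < \<bar>Z n (t, \<omega>)\<bar>}) \<longlonglongrightarrow> 0"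
  shows "(\<lambda>n. L0_size TM (Z n)) \<longlonglongrightarrow> 0"
proof -
  have Zt: "(\<lambda>\<omega>. Z n (t, \<omega>)) \<in> borel_measurable M" if "t \<in> space Time" for n t
    using measurable_Pair2[OF Z[unfolded TM_def] that] by simp
  have int: "integrable (Time \<Otimes>\<^sub>M M) (\<lambda>z. min 1 \<bar>Z n z\<bar>)" for n
    using prd.integrable_min1[OF Z] by (simp add: TM_def)
  have "(\<lambda>n. \<integral>t. (\<integral>\<omega>. min 1 \<bar>Z n (t, \<omega>)\<bar> \<partial>M) \<partial>Time) \<longlonglongrightarrow> (\<integral>t. 0 \<partial>Time)"
  proof (rule integral_dominated_convergence[where w = "\<lambda>_. 1"])
    show "AE t in Time. (\<lambda>n. \<integral>\<omega>. min 1 \<bar>Z n (t, \<omega>)\<bar> \<partial>M) \<longlonglongrightarrow> 0"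
      using lim AE_space
    proof eventually_elim
      case (elim t)
      from L0_size_tendsto_0_if_in_prob[OF Zt[OF elim(2)]] elim(1) show ?case by (simp add: L0_size_def)
    qed
    show "(\<lambda>t. \<integral>\<omega>. min 1 \<bar>Z n (t, \<omega>)\<bar> \<partial>M) \<in> borel_measurable Time" for n
      using TM.integrable_fst'[OF int] by auto
    show "AE t in Time. norm (\<integral>\<omega>. min 1 \<bar>Z n (t, \<omega>)\<bar> \<partial>M) \<le> 1" for n
      using AE_space
    proof eventually_elim
      case (elim t)
      have "(\<integral>\<omega>. min 1 \<bar>Z n (t, \<omega>)\<bar> \<partial>M) \<le> (\<integral>\<omega>. 1 \<partial>M)"
        using Zt[OF elim] by (intro integral_mono integrable_min1) auto
      moreover have "0 \<le> (\<integral>\<omega>. min 1 \<bar>Z n (t, \<omega>)\<bar> \<partial>M)" by (intro integral_nonneg_AE) auto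
      ultimately show ?case by (simp add: prob_space)
    qed
  qed auto
  then show ?thesis by (simp add: L0_size_def TM_def TM.integral_fst'[OF int])
qed

lemma L0_size_TM_AE_subseq:
  assumes "\<And>n. Z n \<in> borel_measurable TM" "(\<lambda>n. L0_size TM (Z n)) \<longlonglongrightarrow> 0"
  shows "\<exists>r. strict_mono (r :: nat \<Rightarrow> nat) \<and> (AE t in Time. AE \<omega> in M. (\<lambda>n. Z (r n) (t, \<omega>)) \<longlonglongrightarrow> 0)"
proof -
  obtain r :: "nat \<Rightarrow> nat" where r: "strict_mono r" "AE z in TM. (\<lambda>n. Z (r n) z) \<longlonglongrightarrow> 0"
    using prd.L0_size_AE_subseq[of Z] assms by blast
  show ?thesis using r(1) TM.AE_pair[OF r(2)[unfolded TM_def]] by blast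
qed

text \<open>Outside an event of small probability the difference of the integrands is at most \<open>\<eta>\<close> along the path
  and may be replaced by its radial truncation, to which equicontinuity applies.\<close>

lemma forward_limits_converge:
  assumes \<epsilon>: "\<And>n. 0 < \<epsilon> n"
    and conv: "\<And>\<Gamma> :: real \<times> 'h \<Rightarrow> 'd. continuous_on UNIV \<Gamma> \<Longrightarrow>
      \<exists>I\<in>borel_measurable TM. (\<lambda>n. L0_size TM (\<lambda>z. fwd \<Gamma> (\<epsilon> n) z - I z)) \<longlonglongrightarrow> 0"
    and \<Gamma>N: "\<And>N. continuous_on UNIV (\<Gamma>N N)" and \<Gamma>: "continuous_on UNIV \<Gamma>"
    and unif: "\<And>\<omega>. \<omega> \<in> space M \<Longrightarrow> uniform_limit {s..T} (\<lambda>N r. \<Gamma>N N (r, X r \<omega>)) (\<lambda>r. \<Gamma> (r, X r \<omega>)) sequentially"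
    and IN: "\<And>N. IN N \<in> borel_measurable TM" "\<And>N. (\<lambda>n. L0_size TM (\<lambda>z. fwd (\<Gamma>N N) (\<epsilon> n) z - IN N z)) \<longlonglongrightarrow> 0"
    and I: "I \<in> borel_measurable TM" "(\<lambda>n. L0_size TM (\<lambda>z. fwd \<Gamma> (\<epsilon> n) z - I z)) \<longlonglongrightarrow> 0"
  shows "(\<lambda>N. L0_size TM (\<lambda>z. IN N z - I z)) \<longlonglongrightarrow> 0"
proof (rule metric_LIMSEQ_I)
  fix \<delta> :: real assume \<delta>: "\<delta> > 0"
  then have \<delta>4: "\<delta> / 4 > 0" by simp
  obtain \<eta> where \<eta>: "\<eta> > 0" "\<And>\<Gamma> n. continuous_on UNIV \<Gamma> \<Longrightarrow> (\<forall>p. norm (\<Gamma> p) \<le> \<eta>) \<Longrightarrow> L0_size TM (fwd \<Gamma> (\<epsilon> n)) \<le> \<delta> / 4"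
    using fwd_equicontinuous[OF \<epsilon> conv \<delta>4] by blast
  define D where "D N p = \<Gamma>N N p - \<Gamma> p" for N p
  have Dc: "continuous_on UNIV (D N)" for N unfolding D_def by (intro continuous_intros \<Gamma>N \<Gamma>)
  define D' where "D' N p = radial_truncation \<eta> (D N p)" for N p
  have D'c: "continuous_on UNIV (D' N)" for N
    unfolding D'_def by (rule continuous_on_compose2[OF radial_truncation(1)[OF \<eta>(1)] Dc]) auto
  define Bad where "Bad N = {z \<in> space TM. \<exists>r\<in>{s..T}. \<eta> < norm (D N (r, X r (snd z)))}" for N
  have path: "continuous_on S (\<lambda>r. D N (r, X r \<omega>))" if "\<omega> \<in> space M" for S N \<omega>
    by (rule continuous_on_compose2[OF Dc]) (auto intro!: continuous_intros continuous_on_subset[OF X_cont[OF that]])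
  have BadM: "Bad N \<in> sets TM" for N
  proof -
    have "Bad N = (\<Union>r\<in>{s..T} \<inter> \<rat>. {z \<in> space TM. \<eta> < norm (D N (r, X r (snd z)))})"
      unfolding Bad_def
      using exceeds_at_rational[OF continuous_on_norm[OF path] less] by (fastforce simp: space_TM)
    moreover have "{z \<in> space TM. \<eta> < norm (D N (r, X r (snd z)))} \<in> sets TM" for r
    proof -
      have "continuous_on UNIV (\<lambda>x. norm (D N (r, x)))"
        by (intro continuous_intros continuous_on_compose2[OF Dc]) auto
      then have [measurable]: "(\<lambda>x. norm (D N (r, x))) \<in> borel_measurable borel" by (rule borel_measurable_continuous_onI)
      have [measurable]: "(\<lambda>z. X r (snd z)) \<in> borel_measurable TM" by (rule X_compose) measurable
      show ?thesis by measurable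
    qed
    ultimately show ?thesis by (auto intro!: sets.countable_UN' countable_Int2 countable_rat)
  qed
  have "\<forall>\<^sub>F N in sequentially. z \<notin> Bad N" if "z \<in> space TM" for z
  proof -
    have "snd z \<in> space M" using that by (auto simp: space_TM)
    from uniform_limitD[OF unif[OF this] \<eta>(1)] show ?thesis
    proof eventually_elim
      case (elim N)
      show ?case
      proof
        assume "z \<in> Bad N"
        then obtain r where r: "r \<in> {s..T}" "\<eta> < norm (D N (r, X r (snd z)))" by (auto simp: Bad_def)
        then show False using bspec[OF elim r(1)] by (simp add: D_def dist_norm)
      qed
    qed
  qed
  from AE_eventually_indicator_tendsto_0[OF BadM finite_TM this]
  have Bad0: "(\<lambda>N. \<integral>z. indicator (Bad N) z \<partial>TM) \<longlonglongrightarrow> (0::real)" .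
  have est: "L0_size TM (fwd (D N) (\<epsilon> n)) \<le> \<delta> / 4 + (\<integral>z. indicator (Bad N) z \<partial>TM)" for N n
  proof -
    have "L0_size TM (fwd (D N) (\<epsilon> n)) \<le> (\<integral>z. min 1 \<bar>fwd (D' N) (\<epsilon> n) z\<bar> + indicator (Bad N) z \<partial>TM)"
      unfolding L0_size_def
    proof (rule integral_mono)
      show "integrable TM (\<lambda>z. min 1 \<bar>fwd (D N) (\<epsilon> n) z\<bar>)" by (intro prd.integrable_min1 fwd_measurable Dc)
      show "integrable TM (\<lambda>z. min 1 \<bar>fwd (D' N) (\<epsilon> n) z\<bar> + indicator (Bad N) z)"
        using BadM[of N]
        by (intro Bochner_Integration.integrable_add prd.integrable_min1 fwd_measurable D'c integrable_real_indicator)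
          (auto simp: prd.emeasure_eq_measure)
      fix z assume z: "z \<in> space TM"
      show "min 1 \<bar>fwd (D N) (\<epsilon> n) z\<bar> \<le> min 1 \<bar>fwd (D' N) (\<epsilon> n) z\<bar> + indicator (Bad N) z"
      proof (cases "z \<in> Bad N")
        case False
        have "fwd (D N) (\<epsilon> n) z = fwd (D' N) (\<epsilon> n) z"
        proof (rule fwd_cong)
          fix r assume "s \<le> r" "r \<le> fst z"
          then have "norm (D N (r, X r (snd z))) \<le> \<eta>" using False z by (fastforce simp: Bad_def space_TM not_less)
          then show "D N (r, X r (snd z)) = D' N (r, X r (snd z))" by (simp add: D'_def radial_truncation(3)[OF \<eta>(1)])
        qed
        then show ?thesis by simp
      qed simp
    qed
    also have "\<dots> = L0_size TM (fwd (D' N) (\<epsilon> n)) + (\<integral>z. indicator (Bad N) z \<partial>TM)"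
      unfolding L0_size_def using BadM[of N]
      by (intro Bochner_Integration.integral_add prd.integrable_min1 fwd_measurable D'c integrable_real_indicator)
          (auto simp: prd.emeasure_eq_measure)
    also have "L0_size TM (fwd (D' N) (\<epsilon> n)) \<le> \<delta> / 4"
      by (intro \<eta>(2) D'c) (simp add: D'_def radial_truncation(2)[OF \<eta>(1)])
    finally show ?thesis by simp
  qed
  have fm: "fwd (\<Gamma>N N) (\<epsilon> n) \<in> borel_measurable TM" "fwd \<Gamma> (\<epsilon> n) \<in> borel_measurable TM" "fwd (D N) (\<epsilon> n) \<in> borel_measurable TM" for N n
    by (intro fwd_measurable \<Gamma>N \<Gamma> Dc)+
  \<comment> \<open>The bound \<open>est\<close> is uniform in \<open>n\<close>. For fixed
    \<open>N\<close> the regularisation errors of both integrands therefore vanish as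
    \<open>n\<close> grows, and the bound survives for the limits.\<close>
  have main: "L0_size TM (\<lambda>z. IN N z - I z) \<le> \<delta> / 4 + (\<integral>z. indicator (Bad N) z \<partial>TM)" for N
  proof (rule LIMSEQ_le_const)
    show "(\<lambda>n. L0_size TM (\<lambda>z. fwd (\<Gamma>N N) (\<epsilon> n) z - IN N z) + (\<delta> / 4 + (\<integral>z. indicator (Bad N) z \<partial>TM))
        + L0_size TM (\<lambda>z. fwd \<Gamma> (\<epsilon> n) z - I z)) \<longlonglongrightarrow> \<delta> / 4 + (\<integral>z. indicator (Bad N) z \<partial>TM)"
      using tendsto_add[OF tendsto_add[OF IN(2)[of N] tendsto_const] I(2)] by simp
    have "L0_size TM (\<lambda>z. IN N z - I z) \<le> L0_size TM (\<lambda>z. fwd (\<Gamma>N N) (\<epsilon> n) z - IN N z) + (\<delta> / 4 + (\<integral>z. indicator (Bad N) z \<partial>TM))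
        + L0_size TM (\<lambda>z. fwd \<Gamma> (\<epsilon> n) z - I z)" for n
    proof -
      have "L0_size TM (\<lambda>z. IN N z - I z) \<le> L0_size TM (\<lambda>z. - (fwd (\<Gamma>N N) (\<epsilon> n) z - IN N z))
          + L0_size TM (\<lambda>z. fwd (D N) (\<epsilon> n) z + (fwd \<Gamma> (\<epsilon> n) z - I z))"
        using fm IN(1) I(1) unfolding D_def
        by (intro prd.L0_size_triangle) (auto simp: fwd_diff \<Gamma>N \<Gamma>)
      moreover have "L0_size TM (\<lambda>z. - (fwd (\<Gamma>N N) (\<epsilon> n) z - IN N z)) = L0_size TM (\<lambda>z. fwd (\<Gamma>N N) (\<epsilon> n) z - IN N z)"
        by (simp add: L0_size_def abs_minus_commute)
      moreover have "L0_size TM (\<lambda>z. fwd (D N) (\<epsilon> n) z + (fwd \<Gamma> (\<epsilon> n) z - I z)) \<le> L0_size TM (fwd (D N) (\<epsilon> n)) + L0_size TM (\<lambda>z. fwd \<Gamma> (\<epsilon> n) z - I z)"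
        using fm IN(1) I(1) by (intro prd.L0_size_triangle) auto
      ultimately show ?thesis using est[of N n] by linarith
    qed
    then show "\<exists>n0. \<forall>n\<ge>n0. L0_size TM (\<lambda>z. IN N z - I z) \<le> L0_size TM (\<lambda>z. fwd (\<Gamma>N N) (\<epsilon> n) z - IN N z) + (\<delta> / 4 + (\<integral>z. indicator (Bad N) z \<partial>TM))
        + L0_size TM (\<lambda>z. fwd \<Gamma> (\<epsilon> n) z - I z)" by blast
  qed
  have "\<forall>\<^sub>F N in sequentially. (\<integral>z. indicator (Bad N) z \<partial>TM) < \<delta> / 4" by (rule order_tendstoD(2)[OF Bad0 \<delta>4])
  then have "\<forall>\<^sub>F N in sequentially. dist (L0_size TM (\<lambda>z. IN N z - I z)) 0 < \<delta>"
  proof eventually_elim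
    case (elim N)
    then show ?case using main[of N] \<delta> prd.L0_size_nonneg[of "\<lambda>z. IN N z - I z"] by (simp add: dist_real_def)
  qed
  then show "\<exists>no. \<forall>N\<ge>no. dist (L0_size TM (\<lambda>z. IN N z - I z)) 0 < \<delta>" by (simp add: eventually_sequentially)
qed

end

text \<open>A direction annihilated by all space gradients is one along which \<open>F\<close> is
  constant; the remaining claims follow by differentiating this invariance. It is applied to
  \<open>P x - x\<close>, which is orthogonal to the range of \<open>j\<close>.\<close>

lemma (in C12_function) gradient_range_invariance:
  fixes w :: 'h
  assumes grad: "\<And>t x. t \<in> {s..T} \<Longrightarrow> Fx t x w = 0" and less: "s < T" and t: "t \<in> {s..T}"
  shows "F t (x + w) = F t x" "Fr t (x + w) = Fr t x" "Fx t (x + w) = Fx t x" "Fxx t (x + w) = Fxx t x"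
    and "Fxx t x u w = 0" "Fxx t x w = 0"
proof -
  have F_shift: "F t (x + a *\<^sub>R w) = F t x" if t: "t \<in> {s..T}" for t x a
  proof -
    have "((\<lambda>a. F t (x + a *\<^sub>R w)) has_real_derivative 0) (at b)" for b
    proof -
      have "((\<lambda>a. x + a *\<^sub>R w) has_derivative (\<lambda>b. b *\<^sub>R w)) (at b)" by (auto intro!: derivative_eq_intros)
      from has_derivative_compose[OF this has_derivative_F_space[OF t]]
      show ?thesis unfolding has_field_derivative_def
        by (rule has_derivative_eq_rhs) (simp add: fun_eq_iff blinfun.scaleR_right grad[OF t])
    qed
    then have "F t (x + a *\<^sub>R w) = F t (x + 0 *\<^sub>R w)" by (intro DERIV_isconst_all) auto
    then show ?thesis by simp
  qed
  show "F t (x + w) = F t x" using F_shift[OF t, of x 1] by simp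
  have Fx_shift: "Fx t (x + a *\<^sub>R w) = Fx t x" for x a
  proof -
    have "((\<lambda>y. F t (y + a *\<^sub>R w)) has_derivative Fx t (x + a *\<^sub>R w)) (at x)"
      using has_derivative_compose[OF has_derivative_add[OF has_derivative_ident has_derivative_const] has_derivative_F_space[OF t]] by simp
    then have "(F t has_derivative Fx t (x + a *\<^sub>R w)) (at x)" by (simp add: F_shift[OF t])
    from has_derivative_unique[OF this has_derivative_F_space[OF t]] show ?thesis by (simp add: blinfun_apply_inject)
  qed
  show "Fx t (x + w) = Fx t x" using Fx_shift[of x 1] by simp
  have Fxd: "(Fx t has_derivative blinfun_apply (Fxx t y)) (at y)" for y using C12 t by (simp add: C12_with_def)
  have "((\<lambda>y. Fx t (y + w)) has_derivative blinfun_apply (Fxx t (x + w))) (at x)"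
    using has_derivative_compose[OF has_derivative_add[OF has_derivative_ident has_derivative_const] Fxd] by simp
  moreover have "Fx t (y + w) = Fx t y" for y using Fx_shift[of y 1] by simp
  ultimately have "(Fx t has_derivative blinfun_apply (Fxx t (x + w))) (at x)" by simp
  from has_derivative_unique[OF this Fxd] show "Fxx t (x + w) = Fxx t x" by (simp add: blinfun_apply_inject)
  have line: "((\<lambda>a. x + a *\<^sub>R u) has_derivative (\<lambda>b. b *\<^sub>R u)) (at 0)" for u by (auto intro!: derivative_eq_intros)
  have Fx_line: "((\<lambda>a. Fx t (x + a *\<^sub>R u)) has_derivative (\<lambda>b. b *\<^sub>R Fxx t x u)) (at 0)" for u
    using has_derivative_compose[OF line, of "Fx t" "blinfun_apply (Fxx t (x + 0 *\<^sub>R u))" u] Fxd[of x]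
    by (simp add: blinfun.scaleR_right)
  have "((\<lambda>a. Fx t (x + a *\<^sub>R u) w) has_derivative (\<lambda>b. (b *\<^sub>R Fxx t x u) w)) (at 0)"
    by (rule bounded_linear.has_derivative[OF blinfun.bounded_linear_left[of w] Fx_line])
  then have "((\<lambda>a. 0) has_derivative (\<lambda>b. (b *\<^sub>R Fxx t x u) w)) (at (0::real))" by (simp add: grad[OF t])
  from has_derivative_unique[OF this has_derivative_const]
  have "(1 *\<^sub>R Fxx t x u) w = 0" by (rule fun_cong)
  then show "Fxx t x u w = 0" by simp
  have "((\<lambda>a. Fx t x) has_derivative (\<lambda>b. b *\<^sub>R Fxx t x w)) (at (0::real))" using Fx_line[of w] by (simp add: Fx_shift)
  from has_derivative_unique[OF this has_derivative_const]
  have "1 *\<^sub>R Fxx t x w = 0" by (rule fun_cong)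
  then show "Fxx t x w = 0" by simp
  \<comment> \<open>The same function of time has both values as derivative. At the end points the
    derivative is one-sided, and \<open>s < T\<close> ensures that it is still unique.\<close>
  have "((\<lambda>r. F r x) has_vector_derivative Fr t (x + w)) (at t within {s..T})"
  proof -
    have "((\<lambda>r. F r (x + w)) has_derivative (\<lambda>h. h * Fr t (x + w))) (at t within {s..T})" by (rule has_derivative_F_time[OF t])
    then have "((\<lambda>r. F r x) has_derivative (\<lambda>h. h * Fr t (x + w))) (at t within {s..T})"
      by (rule has_derivative_transform[OF t, rotated]) (use F_shift[of _ x 1] in simp)
    then show ?thesis by (simp add: has_vector_derivative_def)
  qed
  moreover have "((\<lambda>r. F r x) has_vector_derivative Fr t x) (at t within {s..T})"
    using has_derivative_F_time[OF t, of x] by (simp add: has_vector_derivative_def)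
  moreover have "at t within {s..T} \<noteq> bot"
    using islimpt_Icc[OF less, of t] t by (simp add: trivial_limit_within)
  ultimately show "Fr t (x + w) = Fr t x" by (rule vector_derivative_unique_within[rotated])
qed

section \<open>Passage to the limit in the integrands\<close>

text \<open>The stochastic hypotheses in the form in which they are used: along one sequence
  \<epsilon>, in measure, and for a process with continuous paths, constant after \<open>T\<close>.
  The bracket enters only through elementary tensors and at fixed times.\<close>

locale ito_setting =
  path_process M s T X j + C12_function s T F Fr Fx Fxx
  for M :: "'w measure" and s T :: real
    and X :: "real \<Rightarrow> 'w \<Rightarrow> 'h::{real_inner, complete_space, second_countable_topology}" and j :: "'d::banach \<Rightarrow> 'h"
    and F Fr :: "real \<Rightarrow> 'h \<Rightarrow> real" and Fx :: "real \<Rightarrow> 'h \<Rightarrow> 'h \<Rightarrow>\<^sub>L real"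
    and Fxx :: "real \<Rightarrow> 'h \<Rightarrow> 'h \<Rightarrow>\<^sub>L 'h \<Rightarrow>\<^sub>L real" +
  fixes G :: "real \<times> 'h \<Rightarrow> 'd" and C :: "real \<Rightarrow> 'w \<Rightarrow> ('h, 'h) ptensor" and \<epsilon> :: "nat \<Rightarrow> real"
  assumes \<epsilon>: "\<And>n. 0 < \<epsilon> n" "\<epsilon> \<longlonglongrightarrow> 0"
    and const: "\<And>\<omega> t. \<omega> \<in> space M \<Longrightarrow> T \<le> t \<Longrightarrow> X t \<omega> = X T \<omega>"
    and G: "continuous_on ({s..T} \<times> UNIV) G"
    and Fx_G: "\<And>t x. t \<in> {s..T} \<Longrightarrow> Fx t x = blinfun_inner_right (j (G (t, x)))"
    and dominated: "AE \<omega> in M. \<exists>v. dominated_on s T v (\<lambda>t. C t \<omega>)"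
    and C_measurable: "\<And>t \<phi>. t \<in> {s..T} \<Longrightarrow> (\<lambda>\<omega>. chi_embed j \<phi> (C t \<omega>)) \<in> borel_measurable M"
    and qv: "\<And>a b t d. t \<in> {s..T} \<Longrightarrow> 0 < d \<Longrightarrow>
      (\<lambda>n. measure M {\<omega> \<in> space M. d < \<bar>(LINT r:{s..t}|lborel. inner (j a) (X (r + \<epsilon> n) \<omega> - X r \<omega>) *
        inner (j b) (X (r + \<epsilon> n) \<omega> - X r \<omega>) / \<epsilon> n) - chi_embed j (a \<otimes> b) (C t \<omega>)\<bar>}) \<longlonglongrightarrow> 0"
    and forward: "\<And>\<Gamma>. continuous_on UNIV \<Gamma> \<Longrightarrow>
      \<exists>I\<in>borel_measurable TM. (\<lambda>n. L0_size TM (\<lambda>z. fwd \<Gamma> (\<epsilon> n) z - I z)) \<longlonglongrightarrow> 0"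
begin

text \<open>Clamping the time variable makes the integrand continuous on the whole space.
  \<open>Q'\<close> stands in front of \<open>G\<close> because pairing with \<open>Q\<close> of an
  increment is pairing of \<open>Q' G\<close> with the increment.\<close>

definition "gradient_integrand Q Q' p = blinfun_apply Q' (G (max s (min T (fst p)), blinfun_apply Q (snd p)))"
  for Q :: "'h \<Rightarrow>\<^sub>L 'h" and Q' :: "'d \<Rightarrow>\<^sub>L 'd" and p :: "real \<times> 'h"

text \<open>Every limit \<open>I\<close> in measure is allowed, not a chosen one, so that the
  statement at the end applies to whichever version of the forward integral is given.\<close>

definition "ito_formula Q Q' \<longleftrightarrow> (\<forall>I\<in>borel_measurable TM.
    (\<lambda>n. L0_size TM (\<lambda>z. fwd (gradient_integrand Q Q') (\<epsilon> n) z - I z)) \<longlonglongrightarrow> 0 \<longrightarrow>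
    (AE t in Time. AE \<omega> in M. has_stieltjes_integral
      (\<lambda>r. bilin_functional (Fxx r (Q (X r \<omega>)))) (\<lambda>r. tensor_square Q (C r \<omega>)) s t
      (2 * (F t (Q (X t \<omega>)) - F s (Q (X s \<omega>)) - I (t, \<omega>) - integral {s..t} (\<lambda>r. Fr r (Q (X r \<omega>)))))))"
  for Q :: "'h \<Rightarrow>\<^sub>L 'h" and Q' :: "'d \<Rightarrow>\<^sub>L 'd"

lemma gradient_integrand_cont: "continuous_on UNIV (gradient_integrand Q Q')"
  unfolding gradient_integrand_def[abs_def] using less
  by (intro continuous_intros continuous_on_compose2[OF G]) auto

text \<open>Two subsequences make the pathwise formula applicable. The one for the forward term
  works for almost all times at once, since convergence is in measure on \<open>TM\<close>. The one
  for the quadratic variation may depend on \<open>t\<close>: only countably many errors matter,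
  those at the points of the equidistant partitions of \<open>[s, t]\<close>.\<close>

lemma ito_formula_finite_rank:
  assumes Q: "finite_rank_through j Q" and pair: "dual_pair j Q Q'"
  shows "ito_formula Q Q'"
  unfolding ito_formula_def
proof (intro ballI impI)
  let ?\<Gamma> = "gradient_integrand Q Q'"
  fix I assume I: "I \<in> borel_measurable TM" "(\<lambda>n. L0_size TM (\<lambda>z. fwd ?\<Gamma> (\<epsilon> n) z - I z)) \<longlonglongrightarrow> 0"
  obtain A d where A: "finite A" "\<And>x. Q x = (\<Sum>a\<in>A. inner (j (d a)) x *\<^sub>R a)"
    using Q by (auto simp: finite_rank_through_def)
  have fm: "fwd ?\<Gamma> e \<in> borel_measurable TM" for e by (rule fwd_measurable[OF gradient_integrand_cont])
  obtain r where r: "strict_mono (r :: nat \<Rightarrow> nat)" "AE t in Time. AE \<omega> in M. (\<lambda>n. fwd ?\<Gamma> (\<epsilon> (r n)) (t, \<omega>) - I (t, \<omega>)) \<longlonglongrightarrow> 0"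
    using L0_size_TM_AE_subseq[of "\<lambda>n z. fwd ?\<Gamma> (\<epsilon> n) z - I z"] I fm by auto
  show "AE t in Time. AE \<omega> in M. has_stieltjes_integral
      (\<lambda>r. bilin_functional (Fxx r (Q (X r \<omega>)))) (\<lambda>r. tensor_square Q (C r \<omega>)) s t
      (2 * (F t (Q (X t \<omega>)) - F s (Q (X s \<omega>)) - I (t, \<omega>) - integral {s..t} (\<lambda>r. Fr r (Q (X r \<omega>)))))"
    using r(2) AE_space
  proof eventually_elim
    case (elim t)
    then have t: "s \<le> t" "t \<le> T" by (auto simp: space_Time)
    define h where "h a b n r \<omega> = inner (j (d a)) (X (r + \<epsilon> n) \<omega> - X r \<omega>) * inner (j (d b)) (X (r + \<epsilon> n) \<omega> - X r \<omega>) / \<epsilon> n" for a b n r \<omega>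
    \<comment> \<open>All the errors form one family over a countable index set, so that a single
      subsequence serves them. Irrelevant indices get the value 0, which keeps each member
      measurable and null in the limit.\<close>
    define err where "err p n \<omega> = (case p of (a, b, m, i) \<Rightarrow> if a \<in> A \<and> b \<in> A \<and> i \<le> m then
        (LINT r:{s..upart s t m i}|lborel. h a b n r \<omega>) - chi_embed j (d a \<otimes> d b) (C (upart s t m i) \<omega>) else 0)"
      for p :: "'h \<times> 'h \<times> nat \<times> nat" and n \<omega>
    define U where "U = insert (0, 0, 0, 0) (A \<times> A \<times> (UNIV :: nat set) \<times> (UNIV :: nat set))"
    have "countable U" unfolding U_def using A(1) by (intro countable_insert countable_SIGMA) (auto intro: countable_finite)
    have mem: "upart s t m i \<in> {s..T}" if "i \<le> m" for m i using upart_mem[OF t(1) that] t by auto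
    have hm: "(\<lambda>\<omega>. LINT r:{s..u}|lborel. h a b n r \<omega>) \<in> borel_measurable M" for a b n u
    proof (rule integral_up_to_measurable[of _ M "\<lambda>_. u"])
      have [measurable]: "(\<lambda>x. inner (j v) x) \<in> borel_measurable borel" for v
        by (intro borel_measurable_continuous_onI continuous_intros)
      have [measurable]: "(\<lambda>z. X (snd z + c) (fst z)) \<in> borel_measurable (M \<Otimes>\<^sub>M lborel)" for c
        by (rule X_compose) measurable
      have [measurable]: "(\<lambda>z. X (snd z) (fst z)) \<in> borel_measurable (M \<Otimes>\<^sub>M lborel)"
        by (rule X_compose) measurable
      show "(\<lambda>(\<omega>, r). h a b n r \<omega>) \<in> borel_measurable (M \<Otimes>\<^sub>M lborel)"
        unfolding h_def case_prod_beta by measurable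
    qed measurable
    have errm: "err p n \<in> borel_measurable M" for p n
    proof -
      obtain a b m i where p: "p = (a, b, m, i)" by (cases p)
      show ?thesis
      proof (cases "a \<in> A \<and> b \<in> A \<and> i \<le> m")
        case True
        then have "err p n = (\<lambda>\<omega>. (LINT r:{s..upart s t m i}|lborel. h a b n r \<omega>) - chi_embed j (d a \<otimes> d b) (C (upart s t m i) \<omega>))"
          by (simp add: err_def p fun_eq_iff)
        then show ?thesis using hm C_measurable[OF mem, of i m] True by (auto intro!: borel_measurable_diff)
      next
        case False
        then have "err p n = (\<lambda>_. 0)" by (auto simp: err_def p fun_eq_iff)
        then show ?thesis by simp
      qed
    qed
    have err0: "(\<lambda>n. L0_size M (err p (r n))) \<longlonglongrightarrow> 0" for p
    proof -
      obtain a b m i where p: "p = (a, b, m, i)" by (cases p)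
      show ?thesis
      proof (cases "a \<in> A \<and> b \<in> A \<and> i \<le> m")
        case True
        have "(\<lambda>n. L0_size M (err p n)) \<longlonglongrightarrow> 0"
        proof (rule L0_size_tendsto_0_if_in_prob[OF errm])
          fix e :: real assume "e > 0"
          from qv[OF mem this, of i m "d a" "d b"] True
          show "(\<lambda>n. measure M {\<omega> \<in> space M. e < \<bar>err p n \<omega>\<bar>}) \<longlonglongrightarrow> 0" by (simp add: err_def p h_def)
        qed
        from LIMSEQ_subseq_LIMSEQ[OF this r(1)] show ?thesis by (simp add: o_def)
      next
        case False
        then have "err p n = (\<lambda>_. 0)" for n by (auto simp: err_def p fun_eq_iff)
        then show ?thesis by (simp add: L0_size_def)
      qed
    qed
    obtain r' where r': "strict_mono (r' :: nat \<Rightarrow> nat)" "AE \<omega> in M. \<forall>k. (\<lambda>n. err (from_nat_into U k) (r (r' n)) \<omega>) \<longlonglongrightarrow> 0"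
      using L0_size_AE_subseq_countable[of "\<lambda>k n. err (from_nat_into U k) (r n)"] errm err0 by auto
    define q where "q = r \<circ> r'"
    have q: "strict_mono q" unfolding q_def using r(1) r'(1) by (rule strict_mono_o)
    show ?case
      using elim(1) r'(2) dominated AE_space
    proof eventually_elim
      case (elim \<omega>)
      note \<omega> = elim(4)
      obtain v where v: "dominated_on s T v (\<lambda>t. C t \<omega>)" using elim(3) by blast
      have xc: "continuous_on S (\<lambda>r. X (f r) \<omega>)" if "continuous_on S f" for S f
        by (rule continuous_on_compose2[OF X_cont[OF \<omega>] that]) auto
      show ?case
      proof (rule finite_rank_pathwise_Ito[where x = "\<lambda>t. X t \<omega>" and \<epsilon> = "\<lambda>n. \<epsilon> (q n)" and A = A and d = d, OF C12 less X_cont[OF \<omega>] const[OF \<omega>] j A])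
        show "(\<lambda>n. \<epsilon> (q n)) \<longlonglongrightarrow> 0" using LIMSEQ_subseq_LIMSEQ[OF \<epsilon>(2) q] by (simp add: o_def)
        show "dominated_on s T v (\<lambda>t. C t \<omega>)" by (rule v)
        fix a b and m i :: nat assume ab: "a \<in> A" "b \<in> A" "0 < m" "i \<le> m"
        then have "(a, b, m, i) \<in> U" by (auto simp: U_def)
        then obtain k where k: "from_nat_into U k = (a, b, m, i)" using from_nat_into_surj[OF \<open>countable U\<close>] by blast
        have err_lim: "(\<lambda>n. (LINT r:{s..upart s t m i}|lborel. h a b (q n) r \<omega>) - chi_embed j (d a \<otimes> d b) (C (upart s t m i) \<omega>)) \<longlonglongrightarrow> 0"
          using spec[OF elim(2), of k] ab unfolding k by (simp add: err_def q_def)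
        have eq: "(LINT r:{s..upart s t m i}|lborel. h a b (q n) r \<omega>) = integral {s..upart s t m i} (\<lambda>r. h a b (q n) r \<omega>)" for n
        proof (rule LINT_cont_eq_integral)
          show "continuous_on {s..upart s t m i} (\<lambda>r. h a b (q n) r \<omega>)"
            unfolding h_def using \<epsilon>(1)[of "q n"] by (intro continuous_intros xc) auto
        qed
        show "(\<lambda>n. integral {s..upart s t m i} (\<lambda>r. inner (j (d a)) (X (r + \<epsilon> (q n)) \<omega> - X r \<omega>) *
            inner (j (d b)) (X (r + \<epsilon> (q n)) \<omega> - X r \<omega>) / \<epsilon> (q n))) \<longlonglongrightarrow> chi_embed j (d a \<otimes> d b) (C (upart s t m i) \<omega>)"
          using err_lim[unfolded eq LIM_zero_iff] unfolding h_def .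
      next
        have z: "(t, \<omega>) \<in> space TM" using t \<omega> by (simp add: space_TM)
        have "(\<lambda>n. fwd ?\<Gamma> (\<epsilon> (r n)) (t, \<omega>)) \<longlonglongrightarrow> I (t, \<omega>)" using elim(1) by (simp add: LIM_zero_iff)
        from LIMSEQ_subseq_LIMSEQ[OF this r'(1)]
        have "(\<lambda>n. fwd ?\<Gamma> (\<epsilon> (q n)) (t, \<omega>)) \<longlonglongrightarrow> I (t, \<omega>)" by (simp add: o_def q_def)
        moreover have "fwd ?\<Gamma> (\<epsilon> (q n)) (t, \<omega>) =
            integral {s..t} (\<lambda>r. Fx r (Q (X r \<omega>)) (Q (X (r + \<epsilon> (q n)) \<omega> - X r \<omega>)) / \<epsilon> (q n))" for n
          unfolding fwd_eq_integral[OF gradient_integrand_cont z] fst_conv snd_conv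
        proof (rule integral_cong)
          fix r assume r: "r \<in> {s..t}"
          then have "max s (min T r) = r" "r \<in> {s..T}" using t by auto
          then show "integrand ?\<Gamma> (\<epsilon> (q n)) r \<omega> = Fx r (Q (X r \<omega>)) (Q (X (r + \<epsilon> (q n)) \<omega> - X r \<omega>)) / \<epsilon> (q n)"
            using pair by (simp add: integrand_def gradient_integrand_def Fx_G dual_pair_def)
        qed
        ultimately show "(\<lambda>n. integral {s..t} (\<lambda>r. Fx r (Q (X r \<omega>)) (Q (X (r + \<epsilon> (q n)) \<omega> - X r \<omega>)) / \<epsilon> (q n))) \<longlonglongrightarrow> I (t, \<omega>)" by simp
      qed (use t \<epsilon>(1) in auto)
    qed
  qed
qed

text \<open>Strong convergence is uniform along the compact path, which settles \<open>F\<close>,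
  \<open>Fr\<close>, \<open>Fxx\<close> and the forward integrands. The Stieltjes integrals converge
  because the integrators share a majorant with factor \<open>K\<close> squared. The forward
  integrals converge in measure only, so the two sides are compared along a subsequence, and the
  value of the limiting Stieltjes integral is identified there.\<close>

lemma ito_formula_closure:
  fixes QN :: "nat \<Rightarrow> 'h \<Rightarrow>\<^sub>L 'h" and QN' :: "nat \<Rightarrow> 'd \<Rightarrow>\<^sub>L 'd" and Q :: "'h \<Rightarrow>\<^sub>L 'h" and Q' :: "'d \<Rightarrow>\<^sub>L 'd"
  assumes formula: "\<And>N. ito_formula (QN N) (QN' N)"
    and Q: "\<And>N. norm (QN N) \<le> K" "\<And>x. (\<lambda>N. QN N x) \<longlonglongrightarrow> Q x"
    and Q': "\<And>N. norm (QN' N) \<le> K" "\<And>z. (\<lambda>N. QN' N z) \<longlonglongrightarrow> Q' z"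
  shows "ito_formula Q Q'"
  unfolding ito_formula_def
proof (intro ballI impI)
  fix I assume I: "I \<in> borel_measurable TM" "(\<lambda>n. L0_size TM (\<lambda>z. fwd (gradient_integrand Q Q') (\<epsilon> n) z - I z)) \<longlonglongrightarrow> 0"
  have "\<forall>N. \<exists>I. I \<in> borel_measurable TM \<and> (\<lambda>n. L0_size TM (\<lambda>z. fwd (gradient_integrand (QN N) (QN' N)) (\<epsilon> n) z - I z)) \<longlonglongrightarrow> 0"
    using forward[OF gradient_integrand_cont] by blast
  from choice[OF this] obtain IN where IN_all: "\<forall>N. IN N \<in> borel_measurable TM \<and>
    (\<lambda>n. L0_size TM (\<lambda>z. fwd (gradient_integrand (QN N) (QN' N)) (\<epsilon> n) z - IN N z)) \<longlonglongrightarrow> 0" ..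
  then have IN: "\<And>N. IN N \<in> borel_measurable TM"
    "\<And>N. (\<lambda>n. L0_size TM (\<lambda>z. fwd (gradient_integrand (QN N) (QN' N)) (\<epsilon> n) z - IN N z)) \<longlonglongrightarrow> 0" by simp_all
  have xcompact: "compact ((\<lambda>r. L (X r \<omega>)) ` {s..T})" if "\<omega> \<in> space M" "continuous_on UNIV L"
    for \<omega> and L :: "'h \<Rightarrow> 'h"
    by (intro compact_continuous_image continuous_on_compose2[OF that(2)] continuous_on_subset[OF X_cont[OF that(1)]]) auto
  have unifQ: "uniform_limit {s..T} (\<lambda>N r. QN N (X r \<omega>)) (\<lambda>r. Q (X r \<omega>)) sequentially" if "\<omega> \<in> space M" for \<omega>
    using xcompact[OF that continuous_on_id] by (intro uniform_limit_strong_operator[OF Q]) auto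
  have unif_comp: "uniform_limit {s..T} (\<lambda>N r. H (r, QN N (X r \<omega>))) (\<lambda>r. H (r, Q (X r \<omega>))) sequentially"
    if "continuous_on ({s..T} \<times> UNIV) H" "\<omega> \<in> space M" for H :: "real \<times> 'h \<Rightarrow> 'c::metric_space" and \<omega>
  proof (rule uniform_limit_continuous_compose[OF _ _ _ _ that(1)])
    show "uniform_limit {s..T} (\<lambda>N r. (r, QN N (X r \<omega>))) (\<lambda>r. (r, Q (X r \<omega>))) sequentially"
      using uniform_limitD[OF unifQ[OF that(2)]] by (intro uniform_limitI) (simp add: dist_Pair_Pair)
    show "compact ((\<lambda>r. (r, Q (X r \<omega>))) ` {s..T})"
      by (intro compact_continuous_image continuous_intros continuous_on_subset[OF X_cont[OF that(2)]]) auto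
  qed auto
  have unifG: "uniform_limit {s..T} (\<lambda>N r. gradient_integrand (QN N) (QN' N) (r, X r \<omega>))
      (\<lambda>r. gradient_integrand Q Q' (r, X r \<omega>)) sequentially" if \<omega>: "\<omega> \<in> space M" for \<omega>
  proof (rule uniform_limitI)
    fix e :: real assume e: "e > 0"
    \<comment> \<open>Two errors of \<open>e / 2\<close>: changing the argument of \<open>G\<close>,
      amplified by at most \<open>K\<close>, and replacing \<open>QN' N\<close> by \<open>Q'\<close>
      on the compact image of the path under \<open>G\<close>. Using \<open>K + 1\<close> covers
      \<open>K = 0\<close>.\<close>
    have "0 \<le> K" using Q'(1)[of 0] norm_ge_zero order_trans by blast
    then have e1: "e / 2 / (K + 1) > 0" using e by simp
    have "compact ((\<lambda>r. G (r, Q (X r \<omega>))) ` {s..T})"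
      by (intro compact_continuous_image continuous_on_compose2[OF G] continuous_intros continuous_on_subset[OF X_cont[OF \<omega>]]) auto
    from uniform_limitD[OF uniform_limit_strong_operator[OF Q' this] half_gt_zero[OF e]]
      uniform_limitD[OF unif_comp[OF G \<omega>] e1]
    show "\<forall>\<^sub>F N in sequentially. \<forall>r\<in>{s..T}. dist (gradient_integrand (QN N) (QN' N) (r, X r \<omega>)) (gradient_integrand Q Q' (r, X r \<omega>)) < e"
    proof eventually_elim
      case (elim N)
      show ?case
      proof
        fix r assume r: "r \<in> {s..T}"
        then have mm: "max s (min T r) = r" by auto
        let ?g = "G (r, Q (X r \<omega>))" and ?gN = "G (r, QN N (X r \<omega>))"
        have "norm (QN' N ?gN - QN' N ?g) \<le> norm (QN' N) * norm (?gN - ?g)"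
          using norm_blinfun[of "QN' N" "?gN - ?g"] by (simp add: blinfun.diff_right)
        also have "\<dots> \<le> (K + 1) * norm (?gN - ?g)" using Q'(1)[of N] by (intro mult_right_mono) auto
        also have "\<dots> < (K + 1) * (e / 2 / (K + 1))"
          using bspec[OF elim(2) r] \<open>0 \<le> K\<close> by (intro mult_strict_left_mono) (auto simp: dist_norm)
        also have "\<dots> = e / 2"
          using nonzero_mult_div_cancel_left[of "K + 1" "e / 2"] \<open>0 \<le> K\<close> by (simp only: times_divide_eq_right[of "K + 1" "e / 2"])
        finally have "dist (QN' N ?gN) (QN' N ?g) < e / 2" by (simp add: dist_norm)
        moreover have "dist (QN' N ?g) (Q' ?g) < e / 2" using bspec[OF elim(1) r] .
        ultimately have "dist (QN' N ?gN) (Q' ?g) < e" using dist_triangle[of "QN' N ?gN" "Q' ?g" "QN' N ?g"] by linarith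
        then show "dist (gradient_integrand (QN N) (QN' N) (r, X r \<omega>)) (gradient_integrand Q Q' (r, X r \<omega>)) < e"
          by (simp add: gradient_integrand_def mm)
      qed
    qed
  qed
  have "(\<lambda>N. L0_size TM (\<lambda>z. IN N z - I z)) \<longlonglongrightarrow> 0"
    by (rule forward_limits_converge[OF \<epsilon>(1) forward gradient_integrand_cont gradient_integrand_cont unifG IN I])
  then obtain q where q: "strict_mono (q :: nat \<Rightarrow> nat)" "AE t in Time. AE \<omega> in M. (\<lambda>n. IN (q n) (t, \<omega>) - I (t, \<omega>)) \<longlonglongrightarrow> 0"
    using L0_size_TM_AE_subseq[of "\<lambda>N z. IN N z - I z"] IN(1) I(1) by auto
  define val where "val P I t \<omega> = 2 * (F t (blinfun_apply P (X t \<omega>)) - F s (P (X s \<omega>)) - I (t, \<omega>) - integral {s..t} (\<lambda>r. Fr r (P (X r \<omega>))))"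
    for P I t \<omega>
  have ito: "AE t in Time. AE \<omega> in M. \<forall>N. has_stieltjes_integral
      (\<lambda>r. bilin_functional (Fxx r (QN N (X r \<omega>)))) (\<lambda>r. tensor_square (QN N) (C r \<omega>)) s t (val (QN N) (IN N) t \<omega>)"
    using formula IN unfolding ito_formula_def val_def by (auto simp: AE_all_countable)
  show "AE t in Time. AE \<omega> in M. has_stieltjes_integral
      (\<lambda>r. bilin_functional (Fxx r (Q (X r \<omega>)))) (\<lambda>r. tensor_square Q (C r \<omega>)) s t
      (2 * (F t (Q (X t \<omega>)) - F s (Q (X s \<omega>)) - I (t, \<omega>) - integral {s..t} (\<lambda>r. Fr r (Q (X r \<omega>)))))"
    using ito q(2) AE_space
  proof eventually_elim
    case (elim t)
    then have t: "s \<le> t" "t \<le> T" by (auto simp: space_Time)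
    from elim(1,2) dominated AE_space show ?case
    proof eventually_elim
      case (elim \<omega>)
      note \<omega> = elim(4)
      obtain v where v: "dominated_on s T v (\<lambda>t. C t \<omega>)" using elim(3) by blast
      have dom: "dominated_on s t (\<lambda>r. K\<^sup>2 * v r) (\<lambda>r. tensor_square (QN N) (C r \<omega>))" for N
        using t by (intro dominated_on_blinfun[OF dominated_on_subset[OF v]] norm_tensor_square_le Q) auto
      have domQ: "dominated_on s t (\<lambda>r. norm (tensor_square Q) * v r) (\<lambda>r. tensor_square Q (C r \<omega>))"
        using t by (intro dominated_on_blinfun[OF dominated_on_subset[OF v]]) auto
      have Fxxc: "continuous_on {s..t} (\<lambda>r. bilin_functional (Fxx r (Q (X r \<omega>))))"
      proof (intro bounded_linear.continuous_on[OF bounded_linear_bilin_functional])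
        have "continuous_on {s..t} (\<lambda>r. (r, Q (X r \<omega>)))" by (intro continuous_intros continuous_on_subset[OF X_cont[OF \<omega>]]) auto
        from continuous_on_compose2[OF continuous_Fxx this]
        show "continuous_on {s..t} (\<lambda>r. Fxx r (Q (X r \<omega>)))" using t by (simp add: image_subset_iff)
      qed
      obtain k where k: "has_stieltjes_integral (\<lambda>r. bilin_functional (Fxx r (Q (X r \<omega>)))) (\<lambda>r. tensor_square Q (C r \<omega>)) s t k"
        using has_stieltjes_integral_exists[OF Fxxc domQ t(1)] by blast
      have "uniform_limit {s..T} (\<lambda>N r. Fxx r (QN N (X r \<omega>))) (\<lambda>r. Fxx r (Q (X r \<omega>))) sequentially"
        using unif_comp[OF continuous_Fxx \<omega>] by simp
      from bounded_linear.uniform_limit[OF bounded_linear_bilin_functional this]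
      have unifFxx: "uniform_limit {s..t} (\<lambda>N r. bilin_functional (Fxx r (QN N (X r \<omega>)))) (\<lambda>r. bilin_functional (Fxx r (Q (X r \<omega>)))) sequentially"
        by (rule uniform_limit_on_subset) (use t in auto)
      have "(\<lambda>N. val (QN N) (IN N) t \<omega>) \<longlonglongrightarrow> k"
        by (rule has_stieltjes_integral_converges[OF spec[OF elim(1)] k t(1) Fxxc unifFxx dom order_refl domQ])
          (intro tensor_square_tendsto[OF Q])
      from LIMSEQ_subseq_LIMSEQ[OF this q(1)]
      have lim_k: "(\<lambda>n. val (QN (q n)) (IN (q n)) t \<omega>) \<longlonglongrightarrow> k" by (simp add: o_def)
      have "continuous_on {s..t} (\<lambda>r. Fr r (QN N (X r \<omega>)))" for N
      proof -
        have "continuous_on {s..t} (\<lambda>r. (r, QN N (X r \<omega>)))" by (intro continuous_intros continuous_on_subset[OF X_cont[OF \<omega>]]) auto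
        from continuous_on_compose2[OF continuous_Fr this] show ?thesis using t by (simp add: image_subset_iff)
      qed
      note Frc = this
      have unifFr: "uniform_limit {s..t} (\<lambda>N r. Fr r (QN N (X r \<omega>))) (\<lambda>r. Fr r (Q (X r \<omega>))) sequentially"
        using uniform_limit_on_subset[OF unif_comp[OF continuous_Fr \<omega>], of "{s..t}"] t by simp
      obtain i i' where i: "\<And>N. ((\<lambda>r. Fr r (QN N (X r \<omega>))) has_integral i N) {s..t}"
        "((\<lambda>r. Fr r (Q (X r \<omega>))) has_integral i') {s..t}" "i \<longlonglongrightarrow> i'"
        using uniform_limit_integral[OF unifFr Frc sequentially_bot] by metis
      have Fr_lim: "(\<lambda>N. integral {s..t} (\<lambda>r. Fr r (QN N (X r \<omega>)))) \<longlonglongrightarrow> integral {s..t} (\<lambda>r. Fr r (Q (X r \<omega>)))"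
        using i(3) by (simp add: integral_unique[OF i(1)] integral_unique[OF i(2)])
      have F_lim: "(\<lambda>N. F u (QN N (X u \<omega>))) \<longlonglongrightarrow> F u (Q (X u \<omega>))" if "u \<in> {s..T}" for u
        using tendsto_uniform_limitI[OF unif_comp[OF continuous_F \<omega>] that] by simp
      have I_lim: "(\<lambda>n. IN (q n) (t, \<omega>)) \<longlonglongrightarrow> I (t, \<omega>)" using elim(2) by (simp add: LIM_zero_iff)
      note sub = LIMSEQ_subseq_LIMSEQ[OF _ q(1), unfolded o_def]
      have "t \<in> {s..T}" "s \<in> {s..T}" using t by auto
      then have "(\<lambda>n. val (QN (q n)) (IN (q n)) t \<omega>) \<longlonglongrightarrow> val Q I t \<omega>"
        unfolding val_def by (intro tendsto_mult tendsto_const tendsto_diff sub[OF F_lim] I_lim sub[OF Fr_lim])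
      with lim_k have "k = val Q I t \<omega>" by (rule LIMSEQ_unique)
      with k show ?case by (simp add: val_def)
    qed
  qed
qed

end

section \<open>From almost every time to all times\<close>

lemma has_stieltjes_integral_cong:
  fixes g :: "real \<Rightarrow> 'b::real_normed_vector \<Rightarrow>\<^sub>L real" and g' :: "real \<Rightarrow> 'c::real_normed_vector \<Rightarrow>\<^sub>L real"
  assumes "\<And>q u v. q \<in> {a..b} \<Longrightarrow> u \<in> {a..b} \<Longrightarrow> v \<in> {a..b} \<Longrightarrow> g q (C v - C u) = g' q (C' v - C' u)"
  shows "has_stieltjes_integral g C a b I \<longleftrightarrow> has_stieltjes_integral g' C' a b I"
proof -
  have "RS_sum g C n p q = RS_sum g' C' n p q" if P: "RS_partition a b d n p q" for d n p q
    unfolding RS_sum_def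
  proof (rule sum.cong)
    fix i assume "i \<in> {..<n}"
    then show "g (q i) (C (p (Suc i)) - C (p i)) = g' (q i) (C' (p (Suc i)) - C' (p i))"
      using RS_partition_mem[OF P] by (intro assms) auto
  qed simp
  then show ?thesis unfolding has_stieltjes_integral_iff by metis
qed

text \<open>The Stieltjes integral inherits right continuity from \<open>C\<close>, so at
  \<open>t < T\<close> points of \<open>E\<close> from the right decide. At \<open>T\<close> they
  exist only on the left, where the integral may jump by \<open>g T\<close> applied to the jump of
  \<open>C\<close>; the assumption \<open>jump\<close> rules this out, in accordance with the
  continuity of \<open>V\<close>.\<close>

lemma stieltjes_identity_extends:
  fixes V :: "real \<Rightarrow> real" and g :: "real \<Rightarrow> 'b::real_normed_vector \<Rightarrow>\<^sub>L real"
  assumes less: "s < T" and g: "continuous_on {s..T} g" and dom: "dominated_on s T v C" and cadlag: "cadlag_on s T C"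
    and V: "continuous_on {s..T} V"
    and E: "E \<subseteq> {s..T}" "\<And>a b. s \<le> a \<Longrightarrow> a < b \<Longrightarrow> b \<le> T \<Longrightarrow> \<exists>t\<in>E. a < t \<and> t < b"
    and KV: "\<And>t. t \<in> E \<Longrightarrow> has_stieltjes_integral g C s t (V t)"
    and jump: "\<And>l t. (\<And>n. t n \<in> E) \<Longrightarrow> t \<longlonglongrightarrow> T \<Longrightarrow> (\<lambda>n. C (t n)) \<longlonglongrightarrow> l \<Longrightarrow> g T (C T - l) = 0"
    and t: "t \<in> {s..T}"
  shows "has_stieltjes_integral g C s t (V t)"
proof -
  have "\<exists>K. has_stieltjes_integral g C s t K" if "t \<in> {s..T}" for t
    by (rule has_stieltjes_integral_exists[OF continuous_on_subset[OF g, of "{s..t}"] dominated_on_subset[OF dom order_refl, of t]])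
      (use that in auto)
  then obtain K where K: "\<And>t. t \<in> {s..T} \<Longrightarrow> has_stieltjes_integral g C s t (K t)" by metis
  have KE: "K t = V t" if "t \<in> E" for t
    using has_stieltjes_integral_unique[OF K KV[OF that]] E(1) that by auto
  have Vlim: "(\<lambda>n. V (u n)) \<longlonglongrightarrow> V t" if "u \<longlonglongrightarrow> t" "\<And>n. u n \<in> E" "t \<in> {s..T}" for u t
  proof (rule continuous_on_tendsto_compose[OF V that(1) that(3)])
    show "\<forall>\<^sub>F n in sequentially. u n \<in> {s..T}" using that(2) E(1) by (intro always_eventually) blast
  qed
  have incr: "(\<lambda>n. K (y n) - K (x n) - g (y n) (C (y n) - C (x n))) \<longlonglongrightarrow> 0"
    if "\<And>n. s \<le> x n" "\<And>n. x n \<le> y n" "\<And>n. y n \<le> T" "(\<lambda>n. y n - x n) \<longlonglongrightarrow> 0" for x y :: "nat \<Rightarrow> real"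
  proof (rule metric_LIMSEQ_I)
    fix e :: real assume "e > 0"
    then have e2: "e / 2 > 0" by simp
    obtain d where d: "0 < d" "\<And>x y. s \<le> x \<Longrightarrow> x \<le> y \<Longrightarrow> y \<le> T \<Longrightarrow> y - x < d \<Longrightarrow> \<bar>K y - K x - g y (C y - C x)\<bar> \<le> e / 2"
      using has_stieltjes_integral_increment[OF K g dom e2] by metis
    have "\<forall>\<^sub>F n in sequentially. y n - x n < d" by (rule order_tendstoD(2)[OF that(4) d(1)])
    then have "\<forall>\<^sub>F n in sequentially. dist (K (y n) - K (x n) - g (y n) (C (y n) - C (x n))) 0 < e"
    proof eventually_elim
      case (elim n)
      then show ?case using d(2)[OF that(1-3)] \<open>e > 0\<close> by (fastforce simp: dist_real_def)
    qed
    then show "\<exists>N. \<forall>n\<ge>N. dist (K (y n) - K (x n) - g (y n) (C (y n) - C (x n))) 0 < e"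
      by (simp add: eventually_sequentially)
  qed
  have "K t = V t"
  proof (cases "t < T")
    case True
    have "\<exists>u\<in>E. t < u \<and> u < min T (t + 1 / Suc n)" for n using t True by (intro E(2)) auto
    then obtain u where u: "\<And>n. u n \<in> E" "\<And>n. t < u n" "\<And>n. u n < min T (t + 1 / Suc n)" by metis
    have "(\<lambda>n. t + 1 / real (Suc n)) \<longlonglongrightarrow> t + 0" by (intro tendsto_intros LIMSEQ_Suc[OF lim_1_over_n])
    then have ut: "u \<longlonglongrightarrow> t"
      by (intro tendsto_sandwich[OF _ _ tendsto_const, of t u _ "\<lambda>n. t + 1 / real (Suc n)"])
        (use u in \<open>auto intro!: always_eventually less_imp_le simp: min_less_iff_conj\<close>)
    have "filterlim u (at_right t) sequentially"
      unfolding filterlim_at using ut u(2) by (auto intro!: always_eventually simp: less_imp_neq)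
    moreover have "(C \<longlongrightarrow> C t) (at_right t)" using cadlag t True by (auto simp: cadlag_on_def)
    ultimately have Cu: "(\<lambda>n. C (u n)) \<longlonglongrightarrow> C t" by (rule filterlim_compose[rotated])
    have gu: "(\<lambda>n. g (u n)) \<longlonglongrightarrow> g t"
    proof (rule continuous_on_tendsto_compose[OF g ut t])
      show "\<forall>\<^sub>F n in sequentially. u n \<in> {s..T}" using u(1) E(1) by (intro always_eventually) blast
    qed
    have "(\<lambda>n. g (u n) (C (u n) - C t)) \<longlonglongrightarrow> g t (C t - C t)"
      by (intro blinfun.tendsto gu tendsto_intros Cu)
    then have g0: "(\<lambda>n. g (u n) (C (u n) - C t)) \<longlonglongrightarrow> 0" by (simp add: blinfun.zero_right)
    have "(\<lambda>n. K (u n) - K t - g (u n) (C (u n) - C t)) \<longlonglongrightarrow> 0"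
    proof (rule incr)
      show "s \<le> t" "t \<le> u n" "u n \<le> T" for n using t u(2)[of n] subsetD[OF E(1) u(1)[of n]] by auto
      show "(\<lambda>n. u n - t) \<longlonglongrightarrow> 0" using ut by (simp add: LIM_zero_iff)
    qed
    from tendsto_add[OF this g0] have "(\<lambda>n. V (u n) - K t) \<longlonglongrightarrow> 0" by (simp add: KE u(1))
    then have "(\<lambda>n. V (u n)) \<longlonglongrightarrow> K t" by (simp add: LIM_zero_iff)
    then show ?thesis using Vlim[OF ut u(1) t] by (rule LIMSEQ_unique)
  next
    case False
    then have tT: "t = T" using t by simp
    have "\<exists>u\<in>E. max s (T - 1 / Suc n) < u \<and> u < T" for n using less by (intro E(2)) auto
    then obtain u where u: "\<And>n. u n \<in> E" "\<And>n. max s (T - 1 / Suc n) < u n" "\<And>n. u n < T" by metis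
    have "(\<lambda>n. T - 1 / real (Suc n)) \<longlonglongrightarrow> T - 0" by (intro tendsto_intros LIMSEQ_Suc[OF lim_1_over_n])
    then have uT: "u \<longlonglongrightarrow> T"
      by (intro tendsto_sandwich[OF _ _ _ tendsto_const, of "\<lambda>n. T - 1 / real (Suc n)" u _ T])
        (use u in \<open>auto intro!: always_eventually less_imp_le simp: max_less_iff_conj\<close>)
    obtain l where l: "(C \<longlongrightarrow> l) (at_left T)" using cadlag less unfolding cadlag_on_def
      by (meson greaterThanAtMost_iff order_refl)
    have "filterlim u (at_left T) sequentially"
      unfolding filterlim_at using uT u(3) by (auto intro!: always_eventually simp: less_imp_neq)
    with l have Cu: "(\<lambda>n. C (u n)) \<longlonglongrightarrow> l" by (rule filterlim_compose)
    have "(\<lambda>n. g T (C T - C (u n))) \<longlonglongrightarrow> g T (C T - l)" by (intro blinfun.tendsto tendsto_intros Cu)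
    then have g0: "(\<lambda>n. g T (C T - C (u n))) \<longlonglongrightarrow> 0" using jump[OF u(1) uT Cu] by simp
    have "(\<lambda>n. K T - K (u n) - g T (C T - C (u n))) \<longlonglongrightarrow> 0"
    proof (rule incr)
      show "s \<le> u n" "u n \<le> T" "T \<le> T" for n using subsetD[OF E(1) u(1)[of n]] by auto
      show "(\<lambda>n. T - u n) \<longlonglongrightarrow> 0" using tendsto_diff[OF tendsto_const uT, of T] by simp
    qed
    from tendsto_add[OF this g0] have "(\<lambda>n. K T - V (u n)) \<longlonglongrightarrow> 0" by (simp add: KE u(1))
    from tendsto_diff[OF tendsto_const this, of "K T"] have "(\<lambda>n. V (u n)) \<longlonglongrightarrow> K T" by simp
    then show ?thesis unfolding tT using Vlim[OF uT u(1)] less by (intro LIMSEQ_unique) auto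
  qed
  then show ?thesis using K[OF t] by simp
qed

text \<open>Completeness transfers measurability and probability from events of a modified process
  to the same events of the original one, whose irregular paths lie in a null set.\<close>

lemma complete_null_set_cong:
  assumes "complete_measure M" "B \<in> sets M" "N \<in> null_sets M" "A \<subseteq> space M"
    and "\<And>\<omega>. \<omega> \<in> space M \<Longrightarrow> \<omega> \<notin> N \<Longrightarrow> \<omega> \<in> A \<longleftrightarrow> \<omega> \<in> B"
  shows "A \<in> sets M" "measure M A = measure M B"
proof -
  interpret complete_measure M by fact
  have "A = (B - N) \<union> (A \<inter> N)" using assms(2,4,5) sets.sets_into_space by blast
  moreover have "A \<inter> N \<in> sets M" by (rule complete[OF _ assms(3)]) auto
  ultimately show A: "A \<in> sets M" using assms(2,3) by (metis null_setsD2 sets.Diff sets.Un)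
  have "AE \<omega> in M. \<omega> \<in> A \<longleftrightarrow> \<omega> \<in> B"
    using AE_not_in[OF assms(3)] AE_space by eventually_elim (use assms(5) in auto)
  then show "measure M A = measure M B" by (intro measure_eq_AE A assms)
qed

text \<open>One good time is picked in each rational interval. Countability of the resulting set
  lets the exceptional events of its times be united into one null set.\<close>

lemma countable_dense_subset_of_AE:
  fixes s T :: real
  assumes "AE t in lborel. t \<in> {s..T} \<longrightarrow> P t"
  shows "\<exists>E. countable E \<and> E \<subseteq> {t\<in>{s..T}. P t} \<and> (\<forall>a b. s \<le> a \<and> a < b \<and> b \<le> T \<longrightarrow> (\<exists>t\<in>E. a < t \<and> t < b))"
proof -
  have ex: "\<exists>t. a < t \<and> t < b \<and> P t" if "s \<le> a" "a < b" "b \<le> T" for a b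
  proof (rule ccontr)
    assume no: "\<not> ?thesis"
    have "AE t in lborel. t \<notin> {a<..<b}"
      using assms
    proof eventually_elim
      case (elim t)
      have "t \<in> {s..T}" if "t \<in> {a<..<b}" using that \<open>s \<le> a\<close> \<open>b \<le> T\<close> by simp
      then show ?case using elim no by auto
    qed
    then have "{a<..<b} \<in> null_sets lborel" by (simp add: AE_iff_null_sets)
    then show False using that(2) by (simp add: null_sets_def)
  qed
  define I where "I = {(p, q). p \<in> \<rat> \<and> q \<in> \<rat> \<and> s \<le> p \<and> p < q \<and> q \<le> T}"
  have "countable I"
    by (rule countable_subset[of _ "\<rat> \<times> \<rat>"]) (auto simp: I_def countable_rat)
  have "\<forall>i\<in>I. \<exists>t. fst i < t \<and> t < snd i \<and> P t" using ex by (auto simp: I_def)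
  then obtain e where e: "\<And>i. i \<in> I \<Longrightarrow> fst i < e i \<and> e i < snd i \<and> P (e i)" by metis
  have "\<exists>t\<in>e ` I. a < t \<and> t < b" if ab: "s \<le> a" "a < b" "b \<le> T" for a b
  proof -
    obtain p where p: "p \<in> \<rat>" "a < p" "p < b" using Rats_dense_in_real[OF ab(2)] by blast
    obtain q where q: "q \<in> \<rat>" "p < q" "q < b" using Rats_dense_in_real[OF p(3)] by blast
    have "(p, q) \<in> I" using p q ab by (auto simp: I_def)
    then show ?thesis using e[of "(p, q)"] p q by (intro bexI[of _ "e (p, q)"]) auto
  qed
  moreover have "e ` I \<subseteq> {t\<in>{s..T}. P t}" using e by (fastforce simp: I_def)
  ultimately show ?thesis using \<open>countable I\<close> by (intro exI[of _ "e ` I"]) auto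
qed

lemma process_clamp_measurable:
  fixes X :: "real \<Rightarrow> 'w \<Rightarrow> 'b::real_normed_vector"
  assumes "process M s T X" "s \<le> T" "N \<in> sets M"
  shows "(\<lambda>(t, \<omega>). if \<omega> \<in> N then 0 else X (max s (min T t)) \<omega>) \<in> borel_measurable (borel \<Otimes>\<^sub>M M)"
proof -
  have "(\<lambda>t. max s (min T t)) \<in> measurable borel (restrict_space borel {s..T})"
    using assms(2) by (intro measurable_restrict_space2) auto
  then have "(\<lambda>z. (max s (min T (fst z)), snd z)) \<in> measurable (borel \<Otimes>\<^sub>M M) (restrict_space borel {s..T} \<Otimes>\<^sub>M M)"
    by (rule measurable_Pair[OF measurable_compose[OF measurable_fst] measurable_snd])
  from measurable_compose[OF this assms(1)[unfolded process_def]]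
  have "(\<lambda>z. X (max s (min T (fst z))) (snd z)) \<in> borel_measurable (borel \<Otimes>\<^sub>M M)" by simp
  moreover have "{z \<in> space (borel \<Otimes>\<^sub>M M). snd z \<in> N} \<in> sets (borel \<Otimes>\<^sub>M M)"
    using measurable_sets[OF measurable_snd assms(3), of borel] by (simp add: vimage_def Int_def conj_commute)
  ultimately have "(\<lambda>z. if snd z \<in> N then 0 else X (max s (min T (fst z))) (snd z)) \<in> borel_measurable (borel \<Otimes>\<^sub>M M)"
    by (intro measurable_If) auto
  then show ?thesis by (simp add: case_prod_beta)
qed

lemma process_section_measurable:
  assumes "process M s T Z" "t \<in> {s..T}"
  shows "Z t \<in> borel_measurable M"
  using measurable_Pair2[OF assms(1)[unfolded process_def], of t] assms(2) by (simp add: space_restrict_space)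

lemma filterlim_at_right_0:
  assumes "\<And>n. 0 < \<epsilon> n" "\<epsilon> \<longlonglongrightarrow> 0"
  shows "filterlim \<epsilon> (at_right (0::real)) sequentially"
  unfolding filterlim_at using assms(2)
  by (simp add: assms(1) less_imp_neq[OF assms(1), symmetric])

lemma UC_imp_continuous_on:
  assumes "G \<in> UC s T"
  shows "continuous_on ({s..T} \<times> UNIV) G"
  unfolding continuous_on_eq_continuous_within
proof
  fix p :: "real \<times> 'a" assume p: "p \<in> {s..T} \<times> UNIV"
  then have "uniformly_continuous_on (({s..T} \<times> UNIV) \<inter> cball p 1) G" using assms unfolding UC_def by blast
  then have "continuous_on (({s..T} \<times> UNIV) \<inter> cball p 1) G" by (rule uniformly_continuous_imp_continuous)
  then have "continuous (at p within ({s..T} \<times> UNIV) \<inter> cball p 1) G"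
    using p by (simp add: continuous_on_eq_continuous_within)
  moreover have "at p within ({s..T} \<times> UNIV) \<inter> cball p 1 = at p within {s..T} \<times> UNIV"
    by (rule at_within_nhd[of _ "ball p 1"]) auto
  ultimately show "continuous (at p within {s..T} \<times> UNIV) G" by simp
qed

text \<open>Completeness of the space makes the event in the definition of ucp convergence measurable.\<close>

lemma ucp_limit_pointwise:
  assumes M: "finite_measure M" "complete_measure M" and less: "s < T" and N: "N \<in> null_sets M"
    and Zm: "\<And>e t. t \<in> {s..T} \<Longrightarrow> Z' e t \<in> borel_measurable M"
    and Zc: "\<And>e \<omega>. 0 < e \<Longrightarrow> \<omega> \<in> space M \<Longrightarrow> \<omega> \<notin> N \<Longrightarrow> continuous_on {s..T} (\<lambda>t. Z' e t \<omega>)"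
    and ZZ: "\<And>e t \<omega>. t \<in> {s..T} \<Longrightarrow> \<omega> \<in> space M \<Longrightarrow> \<omega> \<notin> N \<Longrightarrow> Z' e t \<omega> = Z e t \<omega>"
    and Lm: "\<And>t. t \<in> {s..T} \<Longrightarrow> L t \<in> borel_measurable M"
    and Lc: "\<And>\<omega>. \<omega> \<in> space M \<Longrightarrow> \<omega> \<notin> N \<Longrightarrow> continuous_on {s..T} (\<lambda>t. L t \<omega>)"
    and ucp: "tendsto_ucp M s T Z L (at_right 0)" and t: "t \<in> {s..T}" and d: "0 < d"
  shows "((\<lambda>e. measure M {\<omega> \<in> space M. d < \<bar>Z' e t \<omega> - L t \<omega>\<bar>}) \<longlongrightarrow> 0) (at_right 0)"
proof (rule tendsto_sandwich[OF _ _ tendsto_const])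
  interpret finite_measure M by fact
  define S where "S e = {\<omega> \<in> space M. \<exists>t\<in>{s..T}. d < \<bar>Z e t \<omega> - L t \<omega>\<bar>}" for e
  show "((\<lambda>e. measure M (S e)) \<longlongrightarrow> 0) (at_right 0)" using ucp d by (simp add: tendsto_ucp_def S_def)
  have "measure M {\<omega> \<in> space M. d < \<bar>Z' e t \<omega> - L t \<omega>\<bar>} \<le> measure M (S e)" if e: "0 < e" for e
  proof -
    define B where "B = (\<Union>t\<in>{s..T} \<inter> \<rat>. {\<omega> \<in> space M. d < \<bar>Z' e t \<omega> - L t \<omega>\<bar>})"
    have BM: "B \<in> sets M"
      unfolding B_def using Zm Lm
      by (intro sets.countable_UN' countable_Int2 countable_rat) (auto intro!: borel_measurable_less borel_measurable_abs borel_measurable_diff)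
    have SB: "\<omega> \<in> S e \<longleftrightarrow> \<omega> \<in> B" if \<omega>: "\<omega> \<in> space M" "\<omega> \<notin> N" for \<omega>
    proof
      assume "\<omega> \<in> S e"
      then obtain r where r: "r \<in> {s..T}" "d < \<bar>Z' e r \<omega> - L r \<omega>\<bar>" using ZZ \<omega> by (auto simp: S_def)
      have "continuous_on {s..T} (\<lambda>t. \<bar>Z' e t \<omega> - L t \<omega>\<bar>)" by (intro continuous_intros Zc Lc \<omega> e)
      from exceeds_at_rational[OF this less r] show "\<omega> \<in> B" using \<omega> by (auto simp: B_def)
    next
      assume "\<omega> \<in> B" then show "\<omega> \<in> S e" using ZZ \<omega> by (auto simp: B_def S_def)
    qed
    have "S e \<subseteq> space M" by (auto simp: S_def)
    then have SM: "S e \<in> sets M" using SB by (rule complete_null_set_cong(1)[OF M(2) BM N])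
    have "measure M {\<omega> \<in> space M. d < \<bar>Z' e t \<omega> - L t \<omega>\<bar>} \<le> measure M (S e \<union> N)"
    proof (rule finite_measure_mono)
      show "{\<omega> \<in> space M. d < \<bar>Z' e t \<omega> - L t \<omega>\<bar>} \<subseteq> S e \<union> N" using ZZ[OF t] t by (force simp: S_def)
      show "S e \<union> N \<in> sets M" using SM N by auto
    qed
    also have "\<dots> = measure M (S e)" using SM N by (rule measure_Un_null_set)
    finally show ?thesis .
  qed
  then show "\<forall>\<^sub>F e in at_right 0. measure M {\<omega> \<in> space M. d < \<bar>Z' e t \<omega> - L t \<omega>\<bar>} \<le> measure M (S e)"
    by (rule eventually_mono[OF eventually_at_right_less])
qed simp

section \<open>The hypotheses on the original process, rewritten for its continuous
  modification\<close>

context path_process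
begin

context
  fixes XX :: "real \<Rightarrow> 'w \<Rightarrow> 'h" and N0 :: "'w set"
  assumes complete: "complete_measure M" and N0: "N0 \<in> null_sets M"
    and XX: "\<And>\<omega> t. \<omega> \<in> space M \<Longrightarrow> \<omega> \<notin> N0 \<Longrightarrow> X t \<omega> = XX (max s (min T t)) \<omega>"
begin

lemma increment_eq:
  assumes "\<omega> \<in> space M" "\<omega> \<notin> N0"
  shows "increment s T XX e r \<omega> = X (r + e) \<omega> - X r \<omega>"
  using XX[OF assms] by (simp add: increment_def extend_def)

text \<open>Off \<open>N0\<close> the regularisations of the original process and of its
  modification coincide, so by completeness the events in the definition of the forward integral
  keep their probabilities. Convergence at almost every time then becomes convergence in measure on
  \<open>TM\<close>.\<close>

lemma forward_integral_L0:
  fixes \<epsilon> :: "nat \<Rightarrow> real"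
  assumes \<Gamma>: "continuous_on ({s..T} \<times> UNIV) \<Gamma>"
    and I: "has_forward_integral M s T (\<lambda>r \<omega>. blinfun_inner_right (j (\<Gamma> (r, XX r \<omega>)))) XX I"
    and \<epsilon>: "\<And>n. 0 < \<epsilon> n" "\<epsilon> \<longlonglongrightarrow> 0"
  shows "(\<lambda>z. I (fst z) (snd z)) \<in> borel_measurable TM"
    and "(\<lambda>n. L0_size TM (\<lambda>z. fwd (\<lambda>p. \<Gamma> (max s (min T (fst p)), snd p)) (\<epsilon> n) z - I (fst z) (snd z))) \<longlonglongrightarrow> 0"
proof -
  define \<Gamma>' where "\<Gamma>' p = \<Gamma> (max s (min T (fst p)), snd p)" for p
  have \<Gamma>': "continuous_on UNIV \<Gamma>'"
    unfolding \<Gamma>'_def using less by (intro continuous_on_compose2[OF \<Gamma>] continuous_intros) auto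
  have Iproc: "process M s T I" using I by (auto simp: has_forward_integral_def continuous_process_def)
  have "sets TM = sets (restrict_space borel {s..T} \<Otimes>\<^sub>M M)"
    unfolding TM_def Time_def by (intro sets_pair_measure_cong sets_restrict_space_cong) auto
  then show Im: "(\<lambda>z. I (fst z) (snd z)) \<in> borel_measurable TM"
    using Iproc by (simp add: process_def case_prod_beta cong: measurable_cong_sets)
  have "(\<lambda>n. L0_size TM (\<lambda>z. fwd \<Gamma>' (\<epsilon> n) z - I (fst z) (snd z))) \<longlonglongrightarrow> 0"
  proof (rule L0_size_TM_tendsto_0)
    show "(\<lambda>z. fwd \<Gamma>' (\<epsilon> n) z - I (fst z) (snd z)) \<in> borel_measurable TM" for n
      using fwd_measurable[OF \<Gamma>'] Im by simp
    have "AE t in lborel. t \<in> {s..T} \<longrightarrow> tendsto_in_prob M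
        (\<lambda>e. forward_approx s T (\<lambda>r \<omega>. blinfun_inner_right (j (\<Gamma> (r, XX r \<omega>)))) XX e t) (I t) (at_right 0)"
      using I by (simp add: has_forward_integral_def)
    then have "AE t in Time. tendsto_in_prob M
        (\<lambda>e. forward_approx s T (\<lambda>r \<omega>. blinfun_inner_right (j (\<Gamma> (r, XX r \<omega>)))) XX e t) (I t) (at_right 0)"
      unfolding Time_def by (subst AE_restrict_space_iff) auto
    then show "AE t in Time. \<forall>d>0. (\<lambda>n. measure M {\<omega> \<in> space M. d < \<bar>fwd \<Gamma>' (\<epsilon> n) (t, \<omega>) - I (fst (t, \<omega>)) (snd (t, \<omega>))\<bar>}) \<longlonglongrightarrow> 0"
      using AE_space
    proof eventually_elim
      case (elim t)
      then have t: "t \<in> {s..T}" by (simp add: space_Time)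
      have \<epsilon>r: "filterlim \<epsilon> (at_right 0) sequentially"
        by (rule filterlim_at_right_0[OF \<epsilon>])
      show ?case
      proof (intro allI impI)
        fix d :: real assume d: "0 < d"
        have "measure M {\<omega> \<in> space M. d < \<bar>forward_approx s T (\<lambda>r \<omega>. blinfun_inner_right (j (\<Gamma> (r, XX r \<omega>)))) XX (\<epsilon> n) t \<omega> - I t \<omega>\<bar>}
          = measure M {\<omega> \<in> space M. d < \<bar>fwd \<Gamma>' (\<epsilon> n) (t, \<omega>) - I t \<omega>\<bar>}" for n
        proof (rule complete_null_set_cong(2)[OF complete _ N0])
          have "(\<lambda>\<omega>. fwd \<Gamma>' (\<epsilon> n) (t, \<omega>)) \<in> borel_measurable M"
            using measurable_Pair2[OF fwd_measurable[OF \<Gamma>', unfolded TM_def], of t] t by (simp add: space_Time)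
          then show "{\<omega> \<in> space M. d < \<bar>fwd \<Gamma>' (\<epsilon> n) (t, \<omega>) - I t \<omega>\<bar>} \<in> sets M"
            using process_section_measurable[OF Iproc t] by measurable
          fix \<omega> assume \<omega>: "\<omega> \<in> space M" "\<omega> \<notin> N0"
          have "forward_approx s T (\<lambda>r \<omega>. blinfun_inner_right (j (\<Gamma> (r, XX r \<omega>)))) XX (\<epsilon> n) t \<omega> = fwd \<Gamma>' (\<epsilon> n) (t, \<omega>)"
            unfolding forward_approx_def fwd_def fst_conv snd_conv
          proof (rule set_lebesgue_integral_cong)
            show "\<forall>r. r \<in> {s..t} \<longrightarrow> blinfun_inner_right (j (\<Gamma> (r, XX r \<omega>))) (increment s T XX (\<epsilon> n) r \<omega> /\<^sub>R \<epsilon> n) = integrand \<Gamma>' (\<epsilon> n) r \<omega>"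
            proof (intro allI impI)
              fix r assume r: "r \<in> {s..t}"
              then have "max s (min T r) = r" using t by auto
              then show "blinfun_inner_right (j (\<Gamma> (r, XX r \<omega>))) (increment s T XX (\<epsilon> n) r \<omega> /\<^sub>R \<epsilon> n) = integrand \<Gamma>' (\<epsilon> n) r \<omega>"
                using XX[OF \<omega>, of r] by (simp add: increment_eq[OF \<omega>] integrand_def \<Gamma>'_def blinfun.scaleR_right divide_inverse mult.commute)
            qed
          qed simp
          then show "(\<omega> \<in> {\<omega> \<in> space M. d < \<bar>forward_approx s T (\<lambda>r \<omega>. blinfun_inner_right (j (\<Gamma> (r, XX r \<omega>)))) XX (\<epsilon> n) t \<omega> - I t \<omega>\<bar>})
            \<longleftrightarrow> \<omega> \<in> {\<omega> \<in> space M. d < \<bar>fwd \<Gamma>' (\<epsilon> n) (t, \<omega>) - I t \<omega>\<bar>}" by simp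
        qed auto
        moreover have "(\<lambda>n. measure M {\<omega> \<in> space M. d < \<bar>forward_approx s T (\<lambda>r \<omega>. blinfun_inner_right (j (\<Gamma> (r, XX r \<omega>)))) XX (\<epsilon> n) t \<omega> - I t \<omega>\<bar>}) \<longlonglongrightarrow> 0"
          using elim(1) d unfolding tendsto_in_prob_def by (intro filterlim_compose[OF _ \<epsilon>r]) blast
        ultimately show "(\<lambda>n. measure M {\<omega> \<in> space M. d < \<bar>fwd \<Gamma>' (\<epsilon> n) (t, \<omega>) - I (fst (t, \<omega>)) (snd (t, \<omega>))\<bar>}) \<longlonglongrightarrow> 0" by simp
      qed
    qed
  qed
  then show "(\<lambda>n. L0_size TM (\<lambda>z. fwd (\<lambda>p. \<Gamma> (max s (min T (fst p)), snd p)) (\<epsilon> n) z - I (fst z) (snd z))) \<longlonglongrightarrow> 0"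
    by (simp add: \<Gamma>'_def[abs_def])
qed

text \<open>On an elementary tensor the approximate bracket is the integral of a product of two
  scalar increments. The ucp limit is used at one time only, and there its value may be replaced by
  the almost surely equal \<open>c\<close>.\<close>

lemma quadratic_variation_L0:
  fixes \<epsilon> :: "nat \<Rightarrow> real"
  assumes QV: "has_chi_quadratic_variation M s T j XX QV" and \<epsilon>: "\<And>n. 0 < \<epsilon> n" "\<epsilon> \<longlonglongrightarrow> 0"
    and C: "AE \<omega> in M. c \<omega> = QV (a \<otimes> b) t \<omega>" "c \<in> borel_measurable M" and t: "t \<in> {s..T}" and d: "0 < d"
  shows "(\<lambda>n. measure M {\<omega> \<in> space M. d < \<bar>(LINT r:{s..t}|lborel. inner (j a) (X (r + \<epsilon> n) \<omega> - X r \<omega>) *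
        inner (j b) (X (r + \<epsilon> n) \<omega> - X r \<omega>) / \<epsilon> n) - c \<omega>\<bar>}) \<longlonglongrightarrow> 0"
proof -
  define h where "h e r \<omega> = inner (j a) (X (r + e) \<omega> - X r \<omega>) * inner (j b) (X (r + e) \<omega> - X r \<omega>) / e" for e r \<omega>
  define Z' where "Z' e u \<omega> = (LINT r:{s..u}|lborel. h e r \<omega>)" for e u \<omega>
  have Lproc: "continuous_process M s T (QV (a \<otimes> b))" using QV by (simp add: has_chi_quadratic_variation_def)
  then obtain N1 where N1: "N1 \<in> null_sets M" "{\<omega> \<in> space M. \<not> continuous_on {s..T} (\<lambda>t. QV (a \<otimes> b) t \<omega>)} \<subseteq> N1"
    unfolding continuous_process_def by (auto elim!: AE_E simp: null_sets_def)
  have Lm: "QV (a \<otimes> b) u \<in> borel_measurable M" if "u \<in> {s..T}" for u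
    using process_section_measurable[OF conjunct1[OF Lproc[unfolded continuous_process_def]] that] .
  have Zm: "Z' e u \<in> borel_measurable M" for e u
    unfolding Z'_def
  proof (rule integral_up_to_measurable[of _ M "\<lambda>_. u"])
    have [measurable]: "(\<lambda>x. inner (j v) x) \<in> borel_measurable borel" for v
      by (intro borel_measurable_continuous_onI continuous_intros)
    have [measurable]: "(\<lambda>z. X (snd z + c) (fst z)) \<in> borel_measurable (M \<Otimes>\<^sub>M lborel)" for c
      by (rule X_compose) measurable
    have [measurable]: "(\<lambda>z. X (snd z) (fst z)) \<in> borel_measurable (M \<Otimes>\<^sub>M lborel)"
      by (rule X_compose) measurable
    show "(\<lambda>(\<omega>, r). h e r \<omega>) \<in> borel_measurable (M \<Otimes>\<^sub>M lborel)"
      unfolding h_def case_prod_beta by measurable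
  qed measurable
  have hc: "continuous_on S (\<lambda>r. h e r \<omega>)" if "\<omega> \<in> space M" "0 < e" for S e \<omega>
    unfolding h_def using that by (intro continuous_intros continuous_on_compose2[OF X_cont[OF that(1)]]) auto
  have lim: "((\<lambda>e. measure M {\<omega> \<in> space M. d < \<bar>Z' e t \<omega> - QV (a \<otimes> b) t \<omega>\<bar>}) \<longlongrightarrow> 0) (at_right 0)"
  proof (rule ucp_limit_pointwise[where N = "N0 \<union> N1" and Z = "\<lambda>e. chi_qv_approx s T j XX e (a \<otimes> b)", OF _ _ _ _ Zm])
    show "finite_measure M" by unfold_locales
    show "complete_measure M" by (rule complete)
    show "s < T" by (rule less)
    show "N0 \<union> N1 \<in> null_sets M" using N0 N1(1) by (rule null_sets.Un)
    show "tendsto_ucp M s T (\<lambda>e. chi_qv_approx s T j XX e (a \<otimes> b)) (QV (a \<otimes> b)) (at_right 0)"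
      using QV by (simp add: has_chi_quadratic_variation_def)
    show "continuous_on {s..T} (\<lambda>u. Z' e u \<omega>)" if "0 < e" "\<omega> \<in> space M" for e \<omega>
    proof -
      have "Z' e u \<omega> = integral {s..u} (\<lambda>r. h e r \<omega>)" for u
        unfolding Z'_def by (intro LINT_cont_eq_integral hc that)
      moreover have "continuous_on {s..T} (\<lambda>u. integral {s..u} (\<lambda>r. h e r \<omega>))"
        by (intro indefinite_integral_continuous_1 integrable_continuous_interval hc that)
      ultimately show ?thesis by simp
    qed
    show "Z' e u \<omega> = chi_qv_approx s T j XX e (a \<otimes> b) u \<omega>" if "\<omega> \<in> space M" "\<omega> \<notin> N0 \<union> N1" for e u \<omega>
      unfolding Z'_def chi_qv_approx_def using that
      by (intro set_lebesgue_integral_cong) (auto simp: h_def chi_dual_apply chi_embed_elem[OF j] increment_eq)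
  qed (use Lm N1(2) t d in auto)
  have \<epsilon>r: "filterlim \<epsilon> (at_right 0) sequentially"
    by (rule filterlim_at_right_0[OF \<epsilon>])
  have "measure M {\<omega> \<in> space M. d < \<bar>Z' e t \<omega> - QV (a \<otimes> b) t \<omega>\<bar>} = measure M {\<omega> \<in> space M. d < \<bar>Z' e t \<omega> - c \<omega>\<bar>}" for e
    using C Lm[OF t] Zm by (intro measure_eq_AE) (auto elim!: eventually_mono)
  then have "(\<lambda>n. measure M {\<omega> \<in> space M. d < \<bar>Z' (\<epsilon> n) t \<omega> - c \<omega>\<bar>}) \<longlonglongrightarrow> 0"
    using filterlim_compose[OF lim \<epsilon>r] by simp
  then show ?thesis by (simp add: Z'_def h_def)
qed

end

end

text \<open>A tensor annihilated by the products of the coefficient functionals is annihilated by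
  the form composed with each \<open>Q n N\<close>, and the vanishing passes through both strong
  limits. It is applied to the jump of \<open>C\<close> at \<open>T\<close>, for which this tests
  only countably many elements of \<chi>-bar.\<close>

lemma bilin_functional_tensor_square_limit_eq_0:
  fixes j :: "'d::real_normed_vector \<Rightarrow> 'h::real_inner" and P :: "'h \<Rightarrow>\<^sub>L 'h" and S :: "nat \<Rightarrow> 'h \<Rightarrow>\<^sub>L 'h"
    and Q :: "nat \<Rightarrow> nat \<Rightarrow> 'h \<Rightarrow>\<^sub>L 'h"
  assumes j: "bounded_linear j"
    and S: "\<And>n. norm (S n) \<le> K'" "\<And>x. (\<lambda>n. S n x) \<longlonglongrightarrow> P x"
    and Q: "\<And>n N. norm (Q n N) \<le> K n" "\<And>n x. (\<lambda>N. Q n N x) \<longlonglongrightarrow> S n x"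
    and A: "\<And>n N x. Q n N x = (\<Sum>a\<in>A n N. inner (j (d n N a)) x *\<^sub>R a)"
    and J: "\<And>n N a b. a \<in> A n N \<Longrightarrow> b \<in> A n N \<Longrightarrow> chi_embed j (d n N a \<otimes> d n N b) J = 0"
  shows "bilin_functional \<beta> (tensor_square P J) = 0"
proof (rule LIMSEQ_unique)
  have Q0: "bilin_functional \<beta> (tensor_square (Q n N) J) = 0" for n N
    by (simp add: bilin_functional_tensor_square_finite[OF j A] J)
  have S0: "bilin_functional \<beta> (tensor_square (S n) J) = 0" for n
  proof (rule LIMSEQ_unique)
    show "(\<lambda>N. bilin_functional \<beta> (tensor_square (Q n N) J)) \<longlonglongrightarrow> bilin_functional \<beta> (tensor_square (S n) J)"
      by (intro blinfun.tendsto tendsto_const tensor_square_tendsto[OF Q])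
  qed (simp add: Q0)
  show "(\<lambda>n. bilin_functional \<beta> (tensor_square (S n) J)) \<longlonglongrightarrow> bilin_functional \<beta> (tensor_square P J)"
    by (intro blinfun.tendsto tendsto_const tensor_square_tendsto[OF S])
  show "(\<lambda>n. bilin_functional \<beta> (tensor_square (S n) J)) \<longlonglongrightarrow> 0" by (simp add: S0)
qed

context ito_setting
begin

text \<open>The gradient takes values in the range of \<open>j\<close>, to which
  \<open>P x - x\<close> is orthogonal, so \<open>F\<close> cannot distinguish \<open>P x\<close>
  from \<open>x\<close>. For \<open>G\<close> the Riesz identification and injectivity of
  \<open>j\<close> are used in addition.\<close>

lemma projection_invariance:
  fixes P :: "'h \<Rightarrow>\<^sub>L 'h"
  assumes P: "\<And>z x. inner (j z) (P x) = inner (j z) x" and inj: "inj j" and t: "t \<in> {s..T}"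
  shows "F t (P x) = F t x" "Fr t (P x) = Fr t x" "G (t, P x) = G (t, x)"
    and "bilin_functional (Fxx t (P x)) (tensor_square P c) = bilin_functional (Fxx t x) c"
proof -
  have grad: "Fx r y (P x - x) = 0" if "r \<in> {s..T}" for r x y
    using that by (simp add: Fx_G inner_diff_right P)
  have Px: "P x = x + (P x - x)" for x by simp
  show "F t (P x) = F t x" "Fr t (P x) = Fr t x"
    using gradient_range_invariance(1,2)[OF grad less t, of x x] by simp_all
  have "Fx t (P x) = Fx t x" using gradient_range_invariance(3)[OF grad less t, of x x] by simp
  then have "\<forall>y. inner (j (G (t, P x))) y = inner (j (G (t, x))) y"
    using t by (metis Fx_G blinfun_inner_right.rep_eq)
  then have "j (G (t, P x)) = j (G (t, x))" using vector_eq_rdot by blast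
  then show "G (t, P x) = G (t, x)" using inj by (rule injD[rotated])
  have "Fxx t (P x) (P u) (P v) = Fxx t x u v" for u v
  proof -
    have "Fxx t (P x) = Fxx t x" using gradient_range_invariance(4)[OF grad less t, of x x] by simp
    moreover have "Fxx t x (P u - u) = 0" by (rule gradient_range_invariance(6)[OF grad less t])
    moreover have "Fxx t x u (P v - v) = 0" by (rule gradient_range_invariance(5)[OF grad less t])
    ultimately show ?thesis by (simp add: blinfun.diff_right)
  qed
  then have "bilin_functional (Fxx t (P x)) o\<^sub>L tensor_square P = bilin_functional (Fxx t x)"
    by (intro blinfun_ptensor_eqI) simp
  then show "bilin_functional (Fxx t (P x)) (tensor_square P c) = bilin_functional (Fxx t x) c"
    by (metis blinfun_apply_blinfun_compose)
qed

text \<open>Two closures lead from finite rank to \<open>P\<close> paired with the identity, and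
  invariance then removes \<open>P\<close>. What remains is the order of quantifiers: the formula at
  almost every time is fixed on a countable dense set of times, off one null set, and extended
  pathwise.\<close>

lemma Ito_formula_all_times:
  fixes P :: "'h \<Rightarrow>\<^sub>L 'h" and R :: "nat \<Rightarrow> 'h \<Rightarrow>\<^sub>L 'h" and R' :: "nat \<Rightarrow> 'd \<Rightarrow>\<^sub>L 'd"
    and Q :: "nat \<Rightarrow> nat \<Rightarrow> 'h \<Rightarrow>\<^sub>L 'h" and Q' :: "nat \<Rightarrow> nat \<Rightarrow> 'd \<Rightarrow>\<^sub>L 'd"
  assumes inj: "inj j" and P: "\<And>z x. inner (j z) (P x) = inner (j z) x"
    and R: "\<And>n. norm (R n) \<le> K'" "\<And>x. (\<lambda>n. R n x) \<longlonglongrightarrow> P x"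
    and R': "\<And>n. norm (R' n) \<le> K'" "\<And>z. (\<lambda>n. R' n z) \<longlonglongrightarrow> z"
    and Q: "\<And>n N. norm (Q n N) \<le> K n" "\<And>n x. (\<lambda>N. Q n N x) \<longlonglongrightarrow> R n x"
    and Q': "\<And>n N. norm (Q' n N) \<le> K n" "\<And>n z. (\<lambda>N. Q' n N z) \<longlonglongrightarrow> R' n z"
    and pair: "\<And>n N. dual_pair j (Q n N) (Q' n N)" and rank: "\<And>n N. finite_rank_through j (Q n N)"
    and cadlag: "AE \<omega> in M. cadlag_on s T (\<lambda>t. C t \<omega>)"
    and QV_cont: "\<And>\<phi>. AE \<omega> in M. continuous_on {s..T} (\<lambda>t. QV \<phi> t \<omega>)"
    and QV_C: "\<And>\<phi> t. t \<in> {s..T} \<Longrightarrow> AE \<omega> in M. chi_embed j \<phi> (C t \<omega>) = QV \<phi> t \<omega>"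
    and I: "(\<lambda>z. I (fst z) (snd z)) \<in> borel_measurable TM"
      "(\<lambda>n. L0_size TM (\<lambda>z. fwd (\<lambda>p. G (max s (min T (fst p)), snd p)) (\<epsilon> n) z - I (fst z) (snd z))) \<longlonglongrightarrow> 0"
      "AE \<omega> in M. continuous_on {s..T} (\<lambda>t. I t \<omega>)"
  shows "AE \<omega> in M. \<forall>t\<in>{s..T}. has_stieltjes_integral (\<lambda>r. bilin_functional (Fxx r (X r \<omega>))) (\<lambda>r. C r \<omega>) s t
    (2 * (F t (X t \<omega>) - F s (X s \<omega>) - I t \<omega> - integral {s..t} (\<lambda>r. Fr r (X r \<omega>))))"
proof -
  note inv = projection_invariance[OF P inj]
  define V where "V t \<omega> = 2 * (F t (X t \<omega>) - F s (X s \<omega>) - I t \<omega> - integral {s..t} (\<lambda>r. Fr r (X r \<omega>)))" for t \<omega>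
  define holds where "holds t \<omega> \<longleftrightarrow>
    has_stieltjes_integral (\<lambda>r. bilin_functional (Fxx r (X r \<omega>))) (\<lambda>r. C r \<omega>) s t (V t \<omega>)" for t \<omega>
  have R_formula: "ito_formula (R n) (R' n)" for n
    by (rule ito_formula_closure[OF ito_formula_finite_rank[OF rank pair] Q Q'])
  have formula: "ito_formula P id_blinfun"
    by (rule ito_formula_closure[OF R_formula R R'(1)]) (simp add: R'(2))
  have "gradient_integrand P id_blinfun = (\<lambda>p. G (max s (min T (fst p)), snd p))"
    unfolding fun_eq_iff gradient_integrand_def using less by (auto intro!: inv(3))
  then have "AE t in Time. AE \<omega> in M. has_stieltjes_integral
      (\<lambda>r. bilin_functional (Fxx r (P (X r \<omega>)))) (\<lambda>r. tensor_square P (C r \<omega>)) s t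
      (2 * (F t (P (X t \<omega>)) - F s (P (X s \<omega>)) - I (fst (t, \<omega>)) (snd (t, \<omega>)) - integral {s..t} (\<lambda>r. Fr r (P (X r \<omega>)))))"
    using bspec[OF formula[unfolded ito_formula_def] I(1)] I(2) by simp
  then have "AE t in Time. AE \<omega> in M. holds t \<omega>"
    using AE_space
  proof eventually_elim
    case (elim t)
    then have t: "t \<in> {s..T}" by (simp add: space_Time)
    show ?case
      using elim(1)
    proof eventually_elim
      case (elim \<omega>)
      have "integral {s..t} (\<lambda>r. Fr r (P (X r \<omega>))) = integral {s..t} (\<lambda>r. Fr r (X r \<omega>))"
        using t by (intro integral_cong inv(2)) auto
      then have val: "2 * (F t (P (X t \<omega>)) - F s (P (X s \<omega>)) - I (fst (t, \<omega>)) (snd (t, \<omega>))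
          - integral {s..t} (\<lambda>r. Fr r (P (X r \<omega>)))) = V t \<omega>"
        using t less by (simp add: V_def inv(1))
      have "has_stieltjes_integral (\<lambda>r. bilin_functional (Fxx r (P (X r \<omega>)))) (\<lambda>r. tensor_square P (C r \<omega>)) s t v
        \<longleftrightarrow> has_stieltjes_integral (\<lambda>r. bilin_functional (Fxx r (X r \<omega>))) (\<lambda>r. C r \<omega>) s t v" for v
        using t by (intro has_stieltjes_integral_cong) (simp add: inv(4) blinfun.diff_right[symmetric])
      with elim show ?case unfolding holds_def val by blast
    qed
  qed
  then have "AE t in lborel. t \<in> {s..T} \<longrightarrow> (AE \<omega> in M. holds t \<omega>)"
    unfolding Time_def by (subst (asm) AE_restrict_space_iff) auto
  from countable_dense_subset_of_AE[OF this]
  obtain E where E: "countable E" "E \<subseteq> {t\<in>{s..T}. AE \<omega> in M. holds t \<omega>}"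
    "\<And>a b. s \<le> a \<Longrightarrow> a < b \<Longrightarrow> b \<le> T \<Longrightarrow> \<exists>t\<in>E. a < t \<and> t < b" by blast
  have "\<exists>A d. finite A \<and> (\<forall>x. Q n N x = (\<Sum>a\<in>A. inner (j (d a)) x *\<^sub>R a))" for n N
    using rank unfolding finite_rank_through_def .
  then have "\<forall>p. \<exists>Ad. finite (fst Ad) \<and> (\<forall>x. Q (fst p) (snd p) x = (\<Sum>a\<in>fst Ad. inner (j (snd Ad a)) x *\<^sub>R a))" by auto
  from choice[OF this] obtain Ad where
    Ad: "\<forall>p. finite (fst (Ad p)) \<and> (\<forall>x. Q (fst p) (snd p) x = (\<Sum>a\<in>fst (Ad p). inner (j (snd (Ad p) a)) x *\<^sub>R a))" ..
  define A where "A n N = fst (Ad (n, N))" for n N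
  define d where "d n N = snd (Ad (n, N))" for n N
  have A: "finite (A n N)" "Q n N x = (\<Sum>a\<in>A n N. inner (j (d n N a)) x *\<^sub>R a)" for n N x
    using spec[OF Ad, of "(n, N)"] by (simp_all add: A_def d_def)
  \<comment> \<open>The identity between \<open>C\<close> and the bracket holds almost surely for
    each tensor separately. The vanishing of the jump at \<open>T\<close> needs only these countably
    many tensors, so one exceptional null set suffices.\<close>
  define \<Phi> where "\<Phi> = (\<Union>n. \<Union>N. \<Union>a\<in>A n N. \<Union>b\<in>A n N. {d n N a \<otimes> d n N b})"
  have \<Phi>: "countable \<Phi>" unfolding \<Phi>_def using A(1)
    by (intro countable_UN countableI_type countable_finite finite_UN_I finite.intros)
  have "AE \<omega> in M. \<forall>t\<in>E. holds t \<omega>"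
    using E(2) by (subst AE_ball_countable[OF E(1)]) blast
  moreover have "AE \<omega> in M. \<forall>\<phi>\<in>\<Phi>. continuous_on {s..T} (\<lambda>t. QV \<phi> t \<omega>)"
    by (subst AE_ball_countable[OF \<Phi>]) (use QV_cont in blast)
  moreover have "AE \<omega> in M. \<forall>\<phi>\<in>\<Phi>. \<forall>t\<in>insert T E. chi_embed j \<phi> (C t \<omega>) = QV \<phi> t \<omega>"
  proof (subst AE_ball_countable[OF \<Phi>], rule ballI)
    fix \<phi> show "AE \<omega> in M. \<forall>t\<in>insert T E. chi_embed j \<phi> (C t \<omega>) = QV \<phi> t \<omega>"
      using E(1,2) less by (subst AE_ball_countable) (auto intro!: QV_C)
  qed
  ultimately have "AE \<omega> in M. \<forall>t\<in>{s..T}. holds t \<omega>"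
    using cadlag dominated I(3) AE_space
  proof eventually_elim
    case (elim \<omega>)
    obtain v where v: "dominated_on s T v (\<lambda>t. C t \<omega>)" using elim(5) by blast
    have path: "continuous_on {s..T} (\<lambda>r. (r, X r \<omega>))"
      by (intro continuous_intros continuous_on_subset[OF X_cont[OF elim(7)]]) auto
    have cont: "continuous_on {s..T} (\<lambda>r. f r (X r \<omega>))" if "continuous_on ({s..T} \<times> UNIV) (\<lambda>(t, x). f t x)"
      for f :: "real \<Rightarrow> 'h \<Rightarrow> 'x::topological_space"
      using continuous_on_compose2[OF that path] by (simp add: image_subset_iff)
    have Fr_int: "continuous_on {s..T} (\<lambda>t. integral {s..t} (\<lambda>r. Fr r (X r \<omega>)))"
      by (intro indefinite_integral_continuous_1 integrable_continuous_interval cont continuous_Fr)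
    show ?case
    proof
      fix t assume t: "t \<in> {s..T}"
      show "holds t \<omega>"
        unfolding holds_def
      proof (rule stieltjes_identity_extends[where V = "\<lambda>t. V t \<omega>", OF less _ v elim(4) _ _ E(3) _ _ t])
        show "continuous_on {s..T} (\<lambda>r. bilin_functional (Fxx r (X r \<omega>)))"
          by (intro bounded_linear.continuous_on[OF bounded_linear_bilin_functional] cont continuous_Fxx)
        show "continuous_on {s..T} (\<lambda>t. V t \<omega>)"
          unfolding V_def by (intro continuous_intros cont continuous_F elim(6) Fr_int)
        show "E \<subseteq> {s..T}" using E(2) by blast
        show "has_stieltjes_integral (\<lambda>r. bilin_functional (Fxx r (X r \<omega>))) (\<lambda>r. C r \<omega>) s u (V u \<omega>)" if "u \<in> E" for u
          using elim(1) that by (simp add: holds_def)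
        fix l u assume u: "\<And>n. u n \<in> E" "u \<longlonglongrightarrow> T" "(\<lambda>n. C (u n) \<omega>) \<longlonglongrightarrow> l"
        \<comment> \<open>Along points of \<open>E\<close> the bracket tends to its value at
          \<open>T\<close> by continuity and also to the tested left limit of \<open>C\<close>; at
          \<open>T\<close> itself it equals the tested value of \<open>C\<close>. The jump is
          therefore invisible to these tensors.\<close>
        have chi: "chi_embed j \<phi> (C T \<omega> - l) = 0" if \<phi>: "\<phi> \<in> \<Phi>" for \<phi>
        proof -
          have "(\<lambda>n. chi_embed j \<phi> (C (u n) \<omega>)) \<longlonglongrightarrow> chi_embed j \<phi> l"
            by (intro blinfun.tendsto tendsto_const u)
          then have "(\<lambda>n. QV \<phi> (u n) \<omega>) \<longlonglongrightarrow> chi_embed j \<phi> l" using elim(3) \<phi> u(1) by simp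
          moreover have "(\<lambda>n. QV \<phi> (u n) \<omega>) \<longlonglongrightarrow> QV \<phi> T \<omega>"
          proof (rule continuous_on_tendsto_compose[OF bspec[OF elim(2) \<phi>] u(2)])
            show "\<forall>\<^sub>F n in sequentially. u n \<in> {s..T}" using u(1) E(2) by (intro always_eventually) blast
          qed (use less in simp)
          ultimately have "chi_embed j \<phi> l = QV \<phi> T \<omega>" by (rule LIMSEQ_unique)
          then show ?thesis using elim(3) \<phi> by (simp add: blinfun.diff_right)
        qed
        have "bilin_functional (Fxx T (P (X T \<omega>))) (tensor_square P (C T \<omega> - l)) = 0"
        proof (rule bilin_functional_tensor_square_limit_eq_0[OF j R Q A(2)])
          show "chi_embed j (d n N a \<otimes> d n N b) (C T \<omega> - l) = 0" if "a \<in> A n N" "b \<in> A n N" for n N a b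
            by (rule chi) (use that in \<open>unfold \<Phi>_def, blast\<close>)
        qed
        then show "bilin_functional (Fxx T (X T \<omega>)) (C T \<omega> - l) = 0" using less by (simp add: inv(4))
      qed
    qed
  qed
  then show ?thesis by (simp add: holds_def V_def)
qed

end

section \<open>The Ito formula\<close>

lemma has_forward_integral_cong:
  assumes I: "has_forward_integral M s T Y X I" and eq: "\<And>r \<omega>. r \<in> {s..T} \<Longrightarrow> Y' r \<omega> = Y r \<omega>"
  shows "has_forward_integral M s T Y' X I"
proof -
  have "process M s T Y' \<longleftrightarrow> process M s T Y"
    unfolding process_def
    by (rule measurable_cong) (auto simp: space_pair_measure space_restrict_space eq)
  moreover have "set_integrable lborel {s..T} (\<lambda>r. norm (Y' r \<omega>)) \<longleftrightarrow> set_integrable lborel {s..T} (\<lambda>r. norm (Y r \<omega>))" for \<omega>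
    by (rule set_integrable_cong) (simp_all add: eq)
  moreover have "forward_approx s T Y' X e t = forward_approx s T Y X e t" if "t \<in> {s..T}" for e t
    unfolding forward_approx_def fun_eq_iff using that
    by (auto intro!: set_lebesgue_integral_cong simp: eq)
  then have "(t \<in> {s..T} \<longrightarrow> tendsto_in_prob M (\<lambda>e. forward_approx s T Y' X e t) (I t) (at_right 0)) \<longleftrightarrow>
      (t \<in> {s..T} \<longrightarrow> tendsto_in_prob M (\<lambda>e. forward_approx s T Y X e t) (I t) (at_right 0))" for t by auto
  ultimately show ?thesis using I by (simp add: has_forward_integral_def)
qed

theorem theorem5p5:
  fixes M :: "'w measure"
    and s T :: real
    and S :: "real \<Rightarrow> 'h::{real_inner, complete_space, second_countable_topology} \<Rightarrow>\<^sub>L 'h"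
    and DA :: "'h set"
    and A :: "'h \<Rightarrow> 'h"
    and j :: "'d::banach \<Rightarrow> 'h"
    and F Fr :: "real \<Rightarrow> 'h \<Rightarrow> real"
    and Fx :: "real \<Rightarrow> 'h \<Rightarrow> 'h \<Rightarrow>\<^sub>L real"
    and Fxx :: "real \<Rightarrow> 'h \<Rightarrow> 'h \<Rightarrow>\<^sub>L 'h \<Rightarrow>\<^sub>L real"
    and G :: "real \<times> 'h \<Rightarrow> 'd"
    and X :: "real \<Rightarrow> 'w \<Rightarrow> 'h"
    and QV :: "('d, 'd) ptensor \<Rightarrow> real \<Rightarrow> 'w \<Rightarrow> real"
    and C :: "real \<Rightarrow> 'w \<Rightarrow> ('h, 'h) ptensor"
  assumes "prob_space M" "complete_measure M"
    and "0 < T" "0 \<le> s" "s < T"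
    and "C0_semigroup S" "semigroup_generator S DA A"
    and "adjoint_domain_space DA A j"
    and "C12_with s T F Fr Fx Fxx"
    and "G \<in> UC s T"
    and "\<And>t x. t \<in> {s..T} \<Longrightarrow> Fx t x = blinfun_inner_right (j (G (t, x)))"
    and "continuous_process M s T X"
    and "has_chi_quadratic_variation M s T j X QV"
    and "process M s T C"
    and "AE \<omega> in M. cadlag_on s T (\<lambda>t. C t \<omega>) \<and> bounded_variation_on s T (\<lambda>t. C t \<omega>)"
    and "\<And>t \<phi>. t \<in> {s..T} \<Longrightarrow> AE \<omega> in M. chi_embed j \<phi> (C t \<omega>) = QV \<phi> t \<omega>"
    and "\<And>\<Gamma> :: real \<times> 'h \<Rightarrow> 'd. continuous_on ({s..T} \<times> UNIV) \<Gamma> \<Longrightarrow>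
      \<exists>I. has_forward_integral M s T
        (\<lambda>r \<omega>. blinfun_inner_right (j (\<Gamma> (r, X r \<omega>)))) X I"
  shows "\<exists>I. has_forward_integral M s T (\<lambda>r \<omega>. Fx r (X r \<omega>)) X I \<and>
    (AE \<omega> in M. \<forall>t\<in>{s..T}. \<exists>K.
      has_stieltjes_integral (\<lambda>r. ptensor_lift (\<lambda>x y. Fxx r (X r \<omega>) x y)) (\<lambda>r. C r \<omega>) s t K \<and>
      F t (X t \<omega>) = F s (X s \<omega>) + I t \<omega> + 1 / 2 * K + (LINT r:{s..t}|lborel. Fr r (X r \<omega>)))"
proof -
  note less = \<open>s < T\<close> and Fx_G = assms(11) and C_QV = assms(16) and forward = assms(17)
  interpret prob_space M by fact
  interpret C12_function s T F Fr Fx Fxx by unfold_locales fact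
  define \<iota> where "\<iota> v = (j v, adjoint_op DA A (j v))" for v
  have "closure DA = UNIV" by (rule semigroup_generator_domain_dense) fact+
  note embedding = adjoint_domain_space_embedding[OF this assms(8), folded \<iota>_def]
  interpret j: bounded_linear j
    by (rule bounded_linear_intro[where K = 1])
      (simp_all add: linear_add[OF embedding(1)] linear_cmul[OF embedding(1)] embedding(3))
  have G: "continuous_on ({s..T} \<times> UNIV) G" by (rule UC_imp_continuous_on) fact
  have X: "process M s T X" "AE \<omega> in M. continuous_on {s..T} (\<lambda>t. X t \<omega>)"
    using assms(12) by (simp_all add: continuous_process_def)
  obtain N where N: "{\<omega> \<in> space M. \<not> continuous_on {s..T} (\<lambda>t. X t \<omega>)} \<subseteq> N" "N \<in> null_sets M"
    using X(2) by (auto elim!: AE_E simp: null_sets_def)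
  \<comment> \<open>Zero on the exceptional null set and frozen outside \<open>[s, T]\<close>: every
    path of the modification is continuous on the whole line, and the increments of the extended
    process become plain differences.\<close>
  define X' where "X' t \<omega> = (if \<omega> \<in> N then 0 else X (max s (min T t)) \<omega>)" for t \<omega>
  have X'_clamp: "X' t \<omega> = X (max s (min T t)) \<omega>" if "\<omega> \<in> space M" "\<omega> \<notin> N" for t \<omega>
    using that by (simp add: X'_def)
  have X'_eq: "X' t \<omega> = X t \<omega>" if "\<omega> \<notin> N" "t \<in> {s..T}" for t \<omega>
  proof -
    have "max s (min T t) = t" using that(2) by auto
    then show ?thesis using that(1) by (simp add: X'_def)
  qed
  interpret path: path_process M s T X' j
  proof
    show "s < T" by (rule less)
    show "(\<lambda>(t, \<omega>). X' t \<omega>) \<in> borel_measurable (borel \<Otimes>\<^sub>M M)"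
      unfolding X'_def using X(1) less N(2) by (intro process_clamp_measurable) auto
    show "continuous_on UNIV (\<lambda>t. X' t \<omega>)" if "\<omega> \<in> space M" for \<omega>
    proof (cases "\<omega> \<in> N")
      case False
      then have "continuous_on {s..T} (\<lambda>t. X t \<omega>)" using N(1) that by blast
      then have "continuous_on UNIV (\<lambda>t. X (max s (min T t)) \<omega>)"
        by (rule continuous_on_compose2) (use less in \<open>auto intro!: continuous_intros\<close>)
      then show ?thesis using False by (simp add: X'_def)
    qed (simp add: X'_def)
  qed
  \<comment> \<open>A single sequence is enough, because the forward integrals and the bracket are
    already given as limits over all positive \<epsilon>; the sequence only has to recover
    them.\<close>
  define \<epsilon> :: "nat \<Rightarrow> real" where "\<epsilon> n = 1 / real (Suc n)" for n
  have \<epsilon>: "0 < \<epsilon> n" "\<epsilon> \<longlonglongrightarrow> 0" for n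
    unfolding \<epsilon>_def by (simp, rule LIMSEQ_Suc[OF lim_1_over_n])
  have forward_L0: "(\<lambda>z. I (fst z) (snd z)) \<in> borel_measurable path.TM"
    "(\<lambda>n. L0_size path.TM (\<lambda>z. path.fwd (\<lambda>p. \<Gamma> (max s (min T (fst p)), snd p)) (\<epsilon> n) z - I (fst z) (snd z))) \<longlonglongrightarrow> 0"
    if "continuous_on ({s..T} \<times> UNIV) \<Gamma>"
      "has_forward_integral M s T (\<lambda>r \<omega>. blinfun_inner_right (j (\<Gamma> (r, X r \<omega>)))) X I" for \<Gamma> I
    by (rule path.forward_integral_L0[OF assms(2) N(2) X'_clamp that \<epsilon>]; assumption)+
  have QV: "continuous_process M s T (QV \<phi>)" for \<phi> using assms(13) by (simp add: has_chi_quadratic_variation_def)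
  have C_measurable: "(\<lambda>\<omega>. chi_embed j \<phi> (C t \<omega>)) \<in> borel_measurable M" if "t \<in> {s..T}" for t \<phi>
  proof (rule measurable_compose[OF process_section_measurable[OF assms(14) that]])
    show "(\<lambda>u. chi_embed j \<phi> u) \<in> borel_measurable borel"
      by (intro borel_measurable_continuous_onI continuous_intros)
  qed
  interpret Ito: ito_setting M s T X' j F Fr Fx Fxx G C \<epsilon>
  proof
    show "0 < \<epsilon> n" "\<epsilon> \<longlonglongrightarrow> 0" for n by (rule \<epsilon>)+
    show "X' t \<omega> = X' T \<omega>" if "T \<le> t" for t \<omega> using that less by (simp add: X'_def)
    show "continuous_on ({s..T} \<times> UNIV) G" by (rule G)
    show "Fx t x = blinfun_inner_right (j (G (t, x)))" if "t \<in> {s..T}" for t x by (rule Fx_G[OF that])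
    show "AE \<omega> in M. \<exists>v. dominated_on s T v (\<lambda>t. C t \<omega>)"
      using assms(15)
    proof eventually_elim
      case (elim \<omega>)
      then have "bounded_variation_on s T (\<lambda>t. C t \<omega>)" by simp
      then show ?case by (rule bounded_variation_on_dominated) blast
    qed
    show "(\<lambda>\<omega>. chi_embed j \<phi> (C t \<omega>)) \<in> borel_measurable M" if "t \<in> {s..T}" for t \<phi> by (rule C_measurable[OF that])
    show "(\<lambda>n. measure M {\<omega> \<in> space M. d < \<bar>(LINT r:{s..t}|lborel. inner (j a) (X' (r + \<epsilon> n) \<omega> - X' r \<omega>) *
        inner (j b) (X' (r + \<epsilon> n) \<omega> - X' r \<omega>) / \<epsilon> n) - chi_embed j (a \<otimes> b) (C t \<omega>)\<bar>}) \<longlonglongrightarrow> 0"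
      if "t \<in> {s..T}" "0 < d" for a b t d
      by (rule path.quadratic_variation_L0[OF assms(2) N(2) X'_clamp assms(13) \<epsilon> C_QV[OF that(1)] C_measurable[OF that(1)] that])
    fix \<Gamma> :: "real \<times> 'h \<Rightarrow> 'd" assume \<Gamma>: "continuous_on UNIV \<Gamma>"
    then have \<Gamma>': "continuous_on ({s..T} \<times> UNIV) \<Gamma>" by (rule continuous_on_subset) simp
    obtain I where I: "has_forward_integral M s T (\<lambda>r \<omega>. blinfun_inner_right (j (\<Gamma> (r, X r \<omega>)))) X I"
      using forward[OF \<Gamma>'] by blast
    \<comment> \<open>The regularised integral evaluates the integrand only at times in
      \<open>[s, T]\<close>, where clamping the time variable changes nothing.\<close>
    have "L0_size path.TM (\<lambda>z. path.fwd (\<lambda>p. \<Gamma> (max s (min T (fst p)), snd p)) (\<epsilon> n) z - I (fst z) (snd z))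
        = L0_size path.TM (\<lambda>z. path.fwd \<Gamma> (\<epsilon> n) z - I (fst z) (snd z))" for n
      unfolding L0_size_def
    proof (rule Bochner_Integration.integral_cong[OF HOL.refl])
      fix z assume "z \<in> space path.TM"
      then have "path.fwd (\<lambda>p. \<Gamma> (max s (min T (fst p)), snd p)) (\<epsilon> n) z = path.fwd \<Gamma> (\<epsilon> n) z"
        by (intro path.fwd_cong) (auto simp: path.space_TM max_absorb2 min_absorb2)
      then show "min 1 \<bar>path.fwd (\<lambda>p. \<Gamma> (max s (min T (fst p)), snd p)) (\<epsilon> n) z - I (fst z) (snd z)\<bar>
          = min 1 \<bar>path.fwd \<Gamma> (\<epsilon> n) z - I (fst z) (snd z)\<bar>" by simp
    qed
    with forward_L0[OF \<Gamma>' I] show "\<exists>I\<in>borel_measurable path.TM. (\<lambda>n. L0_size path.TM (\<lambda>z. path.fwd \<Gamma> (\<epsilon> n) z - I z)) \<longlonglongrightarrow> 0"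
      by (intro bexI[of _ "\<lambda>z. I (fst z) (snd z)"]) simp_all
  qed
  obtain I where I: "has_forward_integral M s T (\<lambda>r \<omega>. blinfun_inner_right (j (G (r, X r \<omega>)))) X I"
    using forward[OF G] by blast
  have I_cont: "AE \<omega> in M. continuous_on {s..T} (\<lambda>t. I t \<omega>)"
    using I by (simp add: has_forward_integral_def continuous_process_def)
  have cadlag: "AE \<omega> in M. cadlag_on s T (\<lambda>t. C t \<omega>)" using assms(15) by (auto elim: eventually_mono)
  have QV_cont: "AE \<omega> in M. continuous_on {s..T} (\<lambda>t. QV \<phi> t \<omega>)" for \<phi> using QV by (simp add: continuous_process_def)
  obtain P :: "'h \<Rightarrow>\<^sub>L 'h" and R R' Q Q' and K :: "nat \<Rightarrow> real" where approx:
    "\<And>z x. inner (j z) (P x) = inner (j z) x"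
    "\<And>n. dual_pair j (R n) (R' n)" "\<And>n. norm (R n) \<le> 2" "\<And>n. norm (R' n) \<le> 2"
    "\<And>x. (\<lambda>n. R n x) \<longlonglongrightarrow> P x" "\<And>z. (\<lambda>n. R' n z) \<longlonglongrightarrow> z"
    "\<And>n N. dual_pair j (Q n N) (Q' n N)" "\<And>n N. norm (Q n N) \<le> K n" "\<And>n N. norm (Q' n N) \<le> K n"
    "\<And>n x. (\<lambda>N. Q n N x) \<longlonglongrightarrow> R n x" "\<And>n z. (\<lambda>N. Q' n N z) \<longlonglongrightarrow> R' n z"
    "\<And>n N. finite_rank_through j (Q n N)"
    by (rule finite_rank_approximation[OF embedding]) blast
  have formula: "AE \<omega> in M. \<forall>t\<in>{s..T}. has_stieltjes_integral (\<lambda>r. bilin_functional (Fxx r (X' r \<omega>))) (\<lambda>r. C r \<omega>) s t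
      (2 * (F t (X' t \<omega>) - F s (X' s \<omega>) - I t \<omega> - integral {s..t} (\<lambda>r. Fr r (X' r \<omega>))))"
    by (rule Ito.Ito_formula_all_times[OF embedding(2) approx(1,3,5,4,6,8,10,9,11,7,12) cadlag QV_cont C_QV
      forward_L0[OF G I] I_cont])
  have "AE \<omega> in M. \<forall>t\<in>{s..T}. \<exists>K.
      has_stieltjes_integral (\<lambda>r. ptensor_lift (\<lambda>x y. Fxx r (X r \<omega>) x y)) (\<lambda>r. C r \<omega>) s t K \<and>
      F t (X t \<omega>) = F s (X s \<omega>) + I t \<omega> + 1 / 2 * K + (LINT r:{s..t}|lborel. Fr r (X r \<omega>))"
    using formula AE_not_in[OF N(2)] AE_space
  proof eventually_elim
    case (elim \<omega>)
    show ?case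
    proof
      fix t assume t: "t \<in> {s..T}"
      have X_eq: "X r \<omega> = X' r \<omega>" if "r \<in> {s..t}" for r using X'_eq[OF elim(2), of r] that t by simp
      define k where "k = 2 * (F t (X' t \<omega>) - F s (X' s \<omega>) - I t \<omega> - integral {s..t} (\<lambda>r. Fr r (X' r \<omega>)))"
      have "continuous_on {s..t} (\<lambda>r. (r, X' r \<omega>))"
        by (intro continuous_intros continuous_on_subset[OF path.X_cont[OF elim(3)]]) auto
      from continuous_on_compose2[OF continuous_Fr this]
      have "continuous_on {s..t} (\<lambda>r. Fr r (X' r \<omega>))" using t by (simp add: image_subset_iff)
      then have "(LINT r:{s..t}|lborel. Fr r (X' r \<omega>)) = integral {s..t} (\<lambda>r. Fr r (X' r \<omega>))"
        by (rule path.LINT_cont_eq_integral)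
      moreover have "(LINT r:{s..t}|lborel. Fr r (X r \<omega>)) = (LINT r:{s..t}|lborel. Fr r (X' r \<omega>))"
        by (rule set_lebesgue_integral_cong) (auto simp: X_eq)
      ultimately have "F t (X t \<omega>) = F s (X s \<omega>) + I t \<omega> + 1 / 2 * k + (LINT r:{s..t}|lborel. Fr r (X r \<omega>))"
        using t by (simp add: k_def X_eq field_simps)
      moreover have "has_stieltjes_integral (\<lambda>r. bilin_functional (Fxx r (X r \<omega>))) (\<lambda>r. C r \<omega>) s t k
        \<longleftrightarrow> has_stieltjes_integral (\<lambda>r. bilin_functional (Fxx r (X' r \<omega>))) (\<lambda>r. C r \<omega>) s t k"
        by (rule has_stieltjes_integral_cong) (simp add: X_eq)
      then have "has_stieltjes_integral (\<lambda>r. ptensor_lift (\<lambda>x y. Fxx r (X r \<omega>) x y)) (\<lambda>r. C r \<omega>) s t k"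
        using elim(1) t by (simp add: k_def bilin_functional_def)
      ultimately show "\<exists>K. has_stieltjes_integral (\<lambda>r. ptensor_lift (\<lambda>x y. Fxx r (X r \<omega>) x y)) (\<lambda>r. C r \<omega>) s t K \<and>
          F t (X t \<omega>) = F s (X s \<omega>) + I t \<omega> + 1 / 2 * K + (LINT r:{s..t}|lborel. Fr r (X r \<omega>))" by blast
    qed
  qed
  moreover have "has_forward_integral M s T (\<lambda>r \<omega>. Fx r (X r \<omega>)) X I"
    by (rule has_forward_integral_cong[OF I]) (simp add: Fx_G)
  ultimately show ?thesis by blast
qed

end
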